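(* For each $i,j\in I$ and $k,l\in\mathbb Z_{>0}$, there are isomorphisms of graded $\Bbbk$-vector spaces $$\mathrm{ext}^1_{\widetilde\Pi}(K^{(i)}_k,K^{(j)}_l)\cong\mathrm{ext}^1_{\widetilde\Pi}(K^{(j)}_l,K^{(i)}_k)\cong q^{-kd_i-ld_j}\,e_i\frac{\widetilde\Pi}{\varepsilon_i^k\widetilde\Pi+\widetilde\Pi\varepsilon_j^l}e_j.$$
   Context: Lie data: $\mathfrak g$ is a complex finite-dimensional simple Lie algebra with Cartan matrix $C=(c_{ij})_{i,j\in I}$. Write $i\sim j$ if $i\neq j$ and $c_{ij}<0$. $(d_i)_{i\in I}$ is the unique tuple of mutually coprime positive integers with $d_ic_{ij}=d_jc_{ji}$ (so $c_{ij}=-\lceil d_j/d_i\rceil$ if $i\sim j$). Algebra: $\Bbbk$ is an arbitrary field. $\widetilde Q$ is the quiver with vertex set $I$, arrows $\alpha_{ij}\colon j\to i$ for each $(i,j)$ with $i\sim j$, and loops $\varepsilon_i\colon i\to i$; $e_i$ is the idempotent at $i$, and $\alpha=e_{t(\alpha)}\alpha e_{s(\alpha)}$ for an arrow $\alpha$ with source $s(\alpha)$ and target $t(\alpha)$. It is graded by $\deg\alpha_{ij}=-\max(d_i,d_j)$, $\deg\varepsilon_i=2d_i$. Fix signs $\omega_{ij}=-\omega_{ji}\in\{\pm1\}$ for $i\sim j$. $\widetilde\Pi$ is the graded quotient of $\Bbbk\widetilde Q$ by (R1) $\varepsilon_i^{-c_{ij}}\alpha_{ij}=\alpha_{ij}\varepsilon_j^{-c_{ji}}$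 for $i\sim j$, and (R2) $\sum_{j\sim i}\sum_{k=0}^{-c_{ij}-1}\omega_{ij}\varepsilon_i^k\alpha_{ij}\alpha_{ji}\varepsilon_i^{-c_{ij}-1-k}=0$ for each $i$. Modules: left graded modules. Shift: $(qV)_u=V_{u-1}$. Restricted dual: $\mathbb D(V)_u=\mathrm{Hom}_\Bbbk(V_{-u},\Bbbk)$; duals of left $\widetilde\Pi$-modules are left modules via the anti-involution $e_i\mapsto e_i$, $\alpha_{ij}\mapsto\alpha_{ji}$, $\varepsilon_i\mapsto\varepsilon_i$. $\mathrm{Ext}^1_{\widetilde\Pi}$ denotes the first extension group in the category of all graded $\widetilde\Pi$-modules with degree-preserving morphisms, and $\mathrm{ext}^1_{\widetilde\Pi}(M,N)$ is the graded vector space with $\mathrm{ext}^1_{\widetilde\Pi}(M,N)_u=\mathrm{Ext}^1_{\widetilde\Pi}(q^uM,N)$. Generic kernels: for $i\in I$ and $k\in\mathbb Z_{>0}$, $K^{(i)}_k=q^{kd_i}\,\mathbb D((\widetilde\Pi/\widetilde\Pi\varepsilon_i^k)e_i)$. *)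

theory Defs
  imports Complex_Main "HOL-Algebra.Module" "HOL-Algebra.QuotRing"
begin

section \<open>Simple Lie algebras and their Cartan matrices\<close>

locale complex_lie_algebra = vector_space scale
  for scale :: "complex \<Rightarrow> 'g::ab_group_add \<Rightarrow> 'g" +
  fixes br :: "'g \<Rightarrow> 'g \<Rightarrow> 'g"
  assumes br_add_left: "br (x + y) z = br x z + br y z"
    and br_add_right: "br x (y + z) = br x y + br x z"
    and br_scale_left: "br (scale c x) y = scale c (br x y)"
    and br_scale_right: "br x (scale c y) = scale c (br x y)"
    and br_self: "br x x = 0"
    and jacobi: "br x (br y z) + br y (br z x) + br z (br x y) = 0"
begin

definition lie_ideal :: "'g set \<Rightarrow> bool" where
  "lie_ideal J \<longleftrightarrow> subspace J \<and> (\<forall>x. \<forall>y\<in>J. br x y \<in> J)"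

text \<open>Cartan subalgebras of a semisimple Lie algebra: commutative, self-centralizing, and
  consisting of elements with diagonalizable adjoint action.\<close>

definition cartan_subalgebra :: "'g set \<Rightarrow> bool" where
  "cartan_subalgebra H \<longleftrightarrow> subspace H
     \<and> (\<forall>h\<in>H. \<forall>h'\<in>H. br h h' = 0)
     \<and> (\<forall>x. (\<forall>h\<in>H. br h x = 0) \<longrightarrow> x \<in> H)
     \<and> (\<forall>h\<in>H. span {x. \<exists>c. br h x = scale c x} = UNIV)"

text \<open>An element of the dual of \<open>H\<close> is represented by any function on \<open>'g\<close> restricting to
  it; only the values on \<open>H\<close> are ever used.\<close>

definition root_space :: "'g set \<Rightarrow> ('g \<Rightarrow> complex) \<Rightarrow> 'g set" where
  "root_space H \<beta> = {x. \<forall>h\<in>H. br h x = scale (\<beta> h) x}"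

definition is_root :: "'g set \<Rightarrow> ('g \<Rightarrow> complex) \<Rightarrow> bool" where
  "is_root H \<beta> \<longleftrightarrow> (\<exists>h\<in>H. \<beta> h \<noteq> 0) \<and> root_space H \<beta> \<noteq> {0}"

definition simple_roots :: "'g set \<Rightarrow> ('i::finite \<Rightarrow> 'g \<Rightarrow> complex) \<Rightarrow> bool" where
  "simple_roots H \<alpha> \<longleftrightarrow> (\<forall>i. is_root H (\<alpha> i))
     \<and> (\<forall>a. (\<forall>h\<in>H. (\<Sum>i\<in>UNIV. a i * \<alpha> i h) = 0) \<longrightarrow> (\<forall>i. a i = 0))
     \<and> (\<forall>\<beta>. is_root H \<beta> \<longrightarrow> (\<exists>n :: 'i \<Rightarrow> nat.
           (\<forall>h\<in>H. \<beta> h = (\<Sum>i\<in>UNIV. of_nat (n i) * \<alpha> i h))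
         \<or> (\<forall>h\<in>H. \<beta> h = - (\<Sum>i\<in>UNIV. of_nat (n i) * \<alpha> i h))))"

definition is_coroot :: "'g set \<Rightarrow> ('g \<Rightarrow> complex) \<Rightarrow> 'g \<Rightarrow> bool" where
  "is_coroot H \<beta> t \<longleftrightarrow> \<beta> t = 2
     \<and> (\<exists>x\<in>root_space H \<beta>. \<exists>y\<in>root_space H (\<lambda>h. - \<beta> h). t = br x y)"

definition has_cartan_matrix :: "('i::finite \<Rightarrow> 'i \<Rightarrow> int) \<Rightarrow> bool" where
  "has_cartan_matrix C \<longleftrightarrow> (\<exists>H \<alpha> t. cartan_subalgebra H \<and> simple_roots H \<alpha>
     \<and> (\<forall>i. is_coroot H (\<alpha> i) (t i)) \<and> (\<forall>i j. of_int (C i j) = \<alpha> j (t i)))"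

end

locale simple_lie_algebra = complex_lie_algebra +
  assumes fin_dim: "\<exists>B. finite B \<and> span B = UNIV"
    and non_abelian: "\<exists>x y. br x y \<noteq> 0"
    and no_proper_ideals: "lie_ideal J \<Longrightarrow> J = {0} \<or> J = UNIV"

text \<open>The entries of \<open>d\<close> are coprime as a family; they need not be pairwise coprime.\<close>

definition symmetrizer :: "('i::finite \<Rightarrow> 'i \<Rightarrow> int) \<Rightarrow> ('i \<Rightarrow> int) \<Rightarrow> bool" where
  "symmetrizer C d \<longleftrightarrow> (\<forall>i. d i > 0) \<and> Gcd (range d) = 1 \<and> (\<forall>i j. d i * C i j = d j * C j i)"

definition adj :: "('i \<Rightarrow> 'i \<Rightarrow> int) \<Rightarrow> 'i \<Rightarrow> 'i \<Rightarrow> bool" where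
  "adj C i j \<longleftrightarrow> i \<noteq> j \<and> C i j < 0"

definition sign_choice :: "('i \<Rightarrow> 'i \<Rightarrow> int) \<Rightarrow> ('i \<Rightarrow> 'i \<Rightarrow> int) \<Rightarrow> bool" where
  "sign_choice C \<omega> \<longleftrightarrow> (\<forall>i j. adj C i j \<longrightarrow> \<omega> i j \<in> {1, -1} \<and> \<omega> i j = - \<omega> j i)"


section \<open>Graded vector spaces over a field\<close>

text \<open>Vector spaces over the field \<open>'k\<close> are records of type \<open>('k, 'v) module\<close>, whose
  multiplicative fields are irrelevant. A graded vector space is the family of its homogeneous
  components.\<close>

type_synonym ('k, 'v) gvec = "int \<Rightarrow> ('k, 'v) module"

definition ground :: "('k::field, 'k) module" where
  "ground = \<lparr>carrier = UNIV, monoid.mult = (*), one = 1, zero = 0, add = (+), smult = (*)\<rparr>"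

definition lin_maps :: "('k, 'v) module \<Rightarrow> ('k, 'w) module \<Rightarrow> ('v \<Rightarrow> 'w) set" where
  "lin_maps V W = {f \<in> carrier V \<rightarrow>\<^sub>E carrier W.
     (\<forall>x\<in>carrier V. \<forall>y\<in>carrier V. f (x \<oplus>\<^bsub>V\<^esub> y) = f x \<oplus>\<^bsub>W\<^esub> f y) \<and>
     (\<forall>c. \<forall>x\<in>carrier V. f (c \<odot>\<^bsub>V\<^esub> x) = c \<odot>\<^bsub>W\<^esub> f x)}"

definition hom_space :: "('k, 'v) module \<Rightarrow> ('k, 'w) module \<Rightarrow> ('k, 'v \<Rightarrow> 'w) module" where
  "hom_space V W = \<lparr>carrier = lin_maps V W, monoid.mult = undefined, one = undefined,
     zero = (\<lambda>x\<in>carrier V. \<zero>\<^bsub>W\<^esub>), add = (\<lambda>f g. \<lambda>x\<in>carrier V. f x \<oplus>\<^bsub>W\<^esub> g x),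
     smult = (\<lambda>c f. \<lambda>x\<in>carrier V. c \<odot>\<^bsub>W\<^esub> f x)\<rparr>"

text \<open>The image of a subspace \<open>S\<close> of \<open>V\<close> in the quotient of \<open>V\<close> by the subspace \<open>W\<close>.\<close>

definition coset_space :: "('k, 'v, 'z) module_scheme \<Rightarrow> 'v set \<Rightarrow> 'v set \<Rightarrow> ('k, 'v set) module"
  where
  "coset_space V W S = \<lparr>carrier = (\<lambda>x. W +>\<^bsub>V\<^esub> x) ` S, monoid.mult = undefined,
     one = undefined, zero = W, add = (<+>\<^bsub>V\<^esub>),
     smult = (\<lambda>c X. \<Union>x\<in>X. W +>\<^bsub>V\<^esub> (c \<odot>\<^bsub>V\<^esub> x))\<rparr>"

definition gvec_shift :: "int \<Rightarrow> ('k, 'v) gvec \<Rightarrow> ('k, 'v) gvec" where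
  "gvec_shift s V = (\<lambda>u. V (u - s))"

definition gvec_iso :: "('k, 'v) gvec \<Rightarrow> ('k, 'w) gvec \<Rightarrow> bool" where
  "gvec_iso V W \<longleftrightarrow>
     (\<forall>u. \<exists>f \<in> lin_maps (V u) (W u). bij_betw f (carrier (V u)) (carrier (W u)))"


section \<open>Graded algebras, graded left modules and extension groups\<close>

record ('k, 'a) galgebra = "('k, 'a) module" +
  hcomp :: "int \<Rightarrow> 'a set"

text \<open>In a graded left module \<open>M\<close> over \<open>A\<close>, the map \<open>act M v u\<close> sends
  \<open>hcomp A v\<close> times \<open>gr M u\<close> to \<open>gr M (v + u)\<close>.\<close>

record ('k, 'a, 'm) gmodule =
  gr :: "('k, 'm) gvec"
  act :: "int \<Rightarrow> int \<Rightarrow> 'a \<Rightarrow> 'm \<Rightarrow> 'm"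

definition shift :: "int \<Rightarrow> ('k, 'a, 'm) gmodule \<Rightarrow> ('k, 'a, 'm) gmodule" where
  "shift s M = \<lparr>gr = gvec_shift s (gr M), act = (\<lambda>v u. act M v (u - s))\<rparr>"

definition restricted_dual ::
    "('a \<Rightarrow> 'a) \<Rightarrow> ('k::field, 'a, 'm) gmodule \<Rightarrow> ('k, 'a, 'm \<Rightarrow> 'k) gmodule" where
  "restricted_dual \<tau> M = \<lparr>gr = (\<lambda>u. hom_space (gr M (- u)) ground),
     act = (\<lambda>v u a \<phi>. \<lambda>x\<in>carrier (gr M (- (v + u))). \<phi> (act M v (- (v + u)) (\<tau> a) x))\<rparr>"

definition ghom :: "('k, 'a) galgebra \<Rightarrow> ('k, 'a, 'm) gmodule \<Rightarrow> ('k, 'a, 'n) gmodule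
    \<Rightarrow> ('k, int \<Rightarrow> 'm \<Rightarrow> 'n) module" where
  "ghom A M N = \<lparr>carrier = {\<phi>. (\<forall>u. \<phi> u \<in> lin_maps (gr M u) (gr N u)) \<and>
       (\<forall>v u. \<forall>a\<in>hcomp A v. \<forall>x\<in>carrier (gr M u). \<phi> (v + u) (act M v u a x) = act N v u a (\<phi> u x))},
     monoid.mult = undefined, one = undefined,
     zero = (\<lambda>u. \<zero>\<^bsub>hom_space (gr M u) (gr N u)\<^esub>),
     add = (\<lambda>\<phi> \<psi> u. \<phi> u \<oplus>\<^bsub>hom_space (gr M u) (gr N u)\<^esub> \<psi> u),
     smult = (\<lambda>c \<phi> u. c \<odot>\<^bsub>hom_space (gr M u) (gr N u)\<^esub> \<phi> u)\<rparr>"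

text \<open>The free graded module with one generator of degree \<open>w\<close> for each element of \<open>gr M w\<close>,
  \<open>w\<close> ranging over the integers, and its canonical projection onto \<open>M\<close>.\<close>

definition free_cover :: "('k, 'a) galgebra \<Rightarrow> ('k, 'a, 'm) gmodule
    \<Rightarrow> ('k, 'a, int \<times> 'm \<Rightarrow> 'a) gmodule" where
  "free_cover A M = \<lparr>gr = (\<lambda>u. \<lparr>carrier = {f. finite {x. f x \<noteq> \<zero>\<^bsub>A\<^esub>} \<and>
         (\<forall>w m. if m \<in> carrier (gr M w) then f (w, m) \<in> hcomp A (u - w) else f (w, m) = \<zero>\<^bsub>A\<^esub>)},
       monoid.mult = undefined, one = undefined, zero = (\<lambda>x. \<zero>\<^bsub>A\<^esub>),
       add = (\<lambda>f g x. f x \<oplus>\<^bsub>A\<^esub> g x), smult = (\<lambda>c f x. c \<odot>\<^bsub>A\<^esub> f x)\<rparr>),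
     act = (\<lambda>v u a f x. a \<otimes>\<^bsub>A\<^esub> f x)\<rparr>"

definition cover_map :: "('k, 'a) galgebra \<Rightarrow> ('k, 'a, 'm) gmodule
    \<Rightarrow> int \<Rightarrow> (int \<times> 'm \<Rightarrow> 'a) \<Rightarrow> 'm" where
  "cover_map A M u f =
     finsum (gr M u) (\<lambda>(w, m). act M (u - w) w (f (w, m)) m) {x. f x \<noteq> \<zero>\<^bsub>A\<^esub>}"

definition syzygy :: "('k, 'a) galgebra \<Rightarrow> ('k, 'a, 'm) gmodule
    \<Rightarrow> ('k, 'a, int \<times> 'm \<Rightarrow> 'a) gmodule" where
  "syzygy A M = (free_cover A M)\<lparr>gr := (\<lambda>u. (gr (free_cover A M) u)\<lparr>carrier :=
     {f \<in> carrier (gr (free_cover A M) u). cover_map A M u f = \<zero>\<^bsub>gr M u\<^esub>}\<rparr>)\<rparr>"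

text \<open>The first extension group of \<open>M\<close> by \<open>N\<close> in the category of graded modules and
  degree-preserving morphisms: the cokernel of the restriction map from \<open>Hom(P, N)\<close> to
  \<open>Hom(R, N)\<close>, for the projective presentation \<open>0 \<rightarrow> R \<rightarrow> P \<rightarrow> M \<rightarrow> 0\<close> given by
  the free cover. Any other projective presentation gives a canonically isomorphic space.\<close>

definition Ext1 :: "('k, 'a) galgebra \<Rightarrow> ('k, 'a, 'm) gmodule \<Rightarrow> ('k, 'a, 'n) gmodule
    \<Rightarrow> ('k, (int \<Rightarrow> (int \<times> 'm \<Rightarrow> 'a) \<Rightarrow> 'n) set) module" where
  "Ext1 A M N = coset_space (ghom A (syzygy A M) N)
     ((\<lambda>\<phi> u. restrict (\<phi> u) (carrier (gr (syzygy A M) u))) ` carrier (ghom A (free_cover A M) N))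
     (carrier (ghom A (syzygy A M) N))"

definition graded_ext1 :: "('k, 'a) galgebra \<Rightarrow> ('k, 'a, 'm) gmodule \<Rightarrow> ('k, 'a, 'n) gmodule
    \<Rightarrow> ('k, (int \<Rightarrow> (int \<times> 'm \<Rightarrow> 'a) \<Rightarrow> 'n) set) gvec" where
  "graded_ext1 A M N = (\<lambda>u. Ext1 A (shift u M) N)"


section \<open>The path algebra\<close>

text \<open>\<open>Alpha i j\<close> is the arrow from \<open>j\<close> to \<open>i\<close>.\<close>

datatype 'i arrow = Alpha 'i 'i | Eps 'i

fun tgt :: "'i arrow \<Rightarrow> 'i" where
  "tgt (Alpha i j) = i"
| "tgt (Eps i) = i"

fun src :: "'i arrow \<Rightarrow> 'i" where
  "src (Alpha i j) = j"
| "src (Eps i) = i"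

fun opp :: "'i arrow \<Rightarrow> 'i arrow" where
  "opp (Alpha i j) = Alpha j i"
| "opp (Eps i) = Eps i"

fun is_arrow :: "('i \<Rightarrow> 'i \<Rightarrow> int) \<Rightarrow> 'i arrow \<Rightarrow> bool" where
  "is_arrow C (Alpha i j) = adj C i j"
| "is_arrow C (Eps i) = True"

text \<open>The pair \<open>(i, [a1, ..., an])\<close> stands for the path \<open>a1 ... an\<close> with target \<open>i\<close>,
  composed from right to left; \<open>(i, [])\<close> is the idempotent at \<open>i\<close>.\<close>

type_synonym 'i path = "'i \<times> 'i arrow list"

fun psrc :: "'i \<Rightarrow> 'i arrow list \<Rightarrow> 'i" where
  "psrc i [] = i"
| "psrc i (a # p) = psrc (src a) p"

fun is_path :: "('i \<Rightarrow> 'i \<Rightarrow> int) \<Rightarrow> 'i \<Rightarrow> 'i arrow list \<Rightarrow> bool" where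
  "is_path C i [] = True"
| "is_path C i (a # p) = (is_arrow C a \<and> tgt a = i \<and> is_path C (src a) p)"

type_synonym ('i, 'k) pelem = "'i path \<Rightarrow> 'k"

definition path_mult :: "('i, 'k::field) pelem \<Rightarrow> ('i, 'k) pelem \<Rightarrow> ('i, 'k) pelem" where
  "path_mult f g = (\<lambda>(i, p). \<Sum>n\<le>length p. f (i, take n p) * g (psrc i (take n p), drop n p))"

definition path_algebra :: "('i \<Rightarrow> 'i \<Rightarrow> int) \<Rightarrow> ('k::field, ('i::finite, 'k) pelem) module" where
  "path_algebra C = \<lparr>
     carrier = {f. finite {x. f x \<noteq> 0} \<and> (\<forall>i p. f (i, p) \<noteq> 0 \<longrightarrow> is_path C i p)},
     monoid.mult = path_mult, one = (\<lambda>(i, p). if p = [] then 1 else 0),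
     zero = (\<lambda>x. 0), add = (\<lambda>f g x. f x + g x), smult = (\<lambda>c f x. c * f x)\<rparr>"

definition path_basis :: "'i path \<Rightarrow> ('i, 'k::field) pelem" where
  "path_basis x = (\<lambda>y. if y = x then 1 else 0)"

abbreviation idem :: "'i \<Rightarrow> ('i, 'k::field) pelem" where
  "idem i \<equiv> path_basis (i, [])"

abbreviation arr :: "'i arrow \<Rightarrow> ('i, 'k::field) pelem" where
  "arr a \<equiv> path_basis (tgt a, [a])"

fun arrow_deg :: "('i \<Rightarrow> int) \<Rightarrow> 'i arrow \<Rightarrow> int" where
  "arrow_deg d (Alpha i j) = - max (d i) (d j)"
| "arrow_deg d (Eps i) = 2 * d i"

definition path_comp :: "('i \<Rightarrow> 'i \<Rightarrow> int) \<Rightarrow> ('i \<Rightarrow> int) \<Rightarrow> int \<Rightarrow> ('i::finite, 'k::field) pelem set"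
  where
  "path_comp C d v =
     {f \<in> carrier (path_algebra C). \<forall>i p. f (i, p) \<noteq> 0 \<longrightarrow> sum_list (map (arrow_deg d) p) = v}"

definition path_anti :: "('i \<Rightarrow> 'i \<Rightarrow> int) \<Rightarrow> ('i, 'k::field) pelem \<Rightarrow> ('i, 'k) pelem" where
  "path_anti C f = (\<lambda>(i, p). if is_path C i p then f (psrc i p, rev (map opp p)) else 0)"


section \<open>The algebra \<open>\<Pi>\<close> and its generic kernels\<close>

definition rel_commute :: "('i \<Rightarrow> 'i \<Rightarrow> int) \<Rightarrow> 'i \<Rightarrow> 'i \<Rightarrow> ('i::finite, 'k::field) pelem" where
  "rel_commute C i j = (let R = path_algebra C in
     (arr (Eps i) [^]\<^bsub>R\<^esub> nat (- C i j)) \<otimes>\<^bsub>R\<^esub> arr (Alpha i j)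
       \<ominus>\<^bsub>R\<^esub> arr (Alpha i j) \<otimes>\<^bsub>R\<^esub> (arr (Eps j) [^]\<^bsub>R\<^esub> nat (- C j i)))"

definition rel_mesh :: "('i \<Rightarrow> 'i \<Rightarrow> int) \<Rightarrow> ('i \<Rightarrow> 'i \<Rightarrow> int) \<Rightarrow> 'i \<Rightarrow> ('i::finite, 'k::field) pelem"
  where
  "rel_mesh C \<omega> i = (let R = path_algebra C in
     \<Oplus>\<^bsub>R\<^esub> j \<in> {j. adj C j i}. \<Oplus>\<^bsub>R\<^esub> k \<in> {..<nat (- C i j)}.
       of_int (\<omega> i j) \<odot>\<^bsub>R\<^esub> ((arr (Eps i) [^]\<^bsub>R\<^esub> k) \<otimes>\<^bsub>R\<^esub> arr (Alpha i j) \<otimes>\<^bsub>R\<^esub> arr (Alpha j i)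
         \<otimes>\<^bsub>R\<^esub> (arr (Eps i) [^]\<^bsub>R\<^esub> (nat (- C i j) - 1 - k))))"

definition rel_ideal :: "('i \<Rightarrow> 'i \<Rightarrow> int) \<Rightarrow> ('i \<Rightarrow> 'i \<Rightarrow> int) \<Rightarrow> ('i::finite, 'k::field) pelem set"
  where
  "rel_ideal C \<omega> = Idl\<^bsub>path_algebra C\<^esub>
     ({rel_commute C i j | i j. adj C i j} \<union> range (rel_mesh C \<omega>))"

definition Pi_proj :: "('i \<Rightarrow> 'i \<Rightarrow> int) \<Rightarrow> ('i \<Rightarrow> 'i \<Rightarrow> int)
    \<Rightarrow> ('i::finite, 'k::field) pelem \<Rightarrow> ('i, 'k) pelem set" where
  "Pi_proj C \<omega> f = rel_ideal C \<omega> +>\<^bsub>path_algebra C\<^esub> f"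

definition Pi_alg :: "('i \<Rightarrow> 'i \<Rightarrow> int) \<Rightarrow> ('i \<Rightarrow> int) \<Rightarrow> ('i \<Rightarrow> 'i \<Rightarrow> int)
    \<Rightarrow> ('k::field, ('i::finite, 'k) pelem set) galgebra" where
  "Pi_alg C d \<omega> = (let R = path_algebra C; Q = R Quot rel_ideal C \<omega> in
     \<lparr>carrier = carrier Q, monoid.mult = monoid.mult Q, one = one Q, zero = zero Q, add = add Q,
      smult = (\<lambda>c X. \<Union>f\<in>X. Pi_proj C \<omega> (c \<odot>\<^bsub>R\<^esub> f)),
      hcomp = (\<lambda>v. Pi_proj C \<omega> ` path_comp C d v)\<rparr>)"

abbreviation Pi_idem :: "('i \<Rightarrow> 'i \<Rightarrow> int) \<Rightarrow> ('i \<Rightarrow> 'i \<Rightarrow> int)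
    \<Rightarrow> 'i \<Rightarrow> ('i::finite, 'k::field) pelem set" where
  "Pi_idem C \<omega> i \<equiv> Pi_proj C \<omega> (idem i)"

abbreviation Pi_eps :: "('i \<Rightarrow> 'i \<Rightarrow> int) \<Rightarrow> ('i \<Rightarrow> 'i \<Rightarrow> int)
    \<Rightarrow> 'i \<Rightarrow> ('i::finite, 'k::field) pelem set" where
  "Pi_eps C \<omega> i \<equiv> Pi_proj C \<omega> (arr (Eps i))"

definition left_gen :: "('k, 'a) galgebra \<Rightarrow> 'a \<Rightarrow> 'a set" where
  "left_gen A a = (\<lambda>x. x \<otimes>\<^bsub>A\<^esub> a) ` carrier A"

definition right_gen :: "('k, 'a) galgebra \<Rightarrow> 'a \<Rightarrow> 'a set" where
  "right_gen A a = (\<lambda>x. a \<otimes>\<^bsub>A\<^esub> x) ` carrier A"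

text \<open>The left module \<open>(\<Pi>/\<Pi>\<epsilon>\<^sub>i\<^sup>k)e\<^sub>i\<close>, the image of right multiplication by \<open>e\<^sub>i\<close>
  on \<open>\<Pi>/\<Pi>\<epsilon>\<^sub>i\<^sup>k\<close>.\<close>

definition eps_quotient :: "('i \<Rightarrow> 'i \<Rightarrow> int) \<Rightarrow> ('i \<Rightarrow> int) \<Rightarrow> ('i \<Rightarrow> 'i \<Rightarrow> int) \<Rightarrow> 'i \<Rightarrow> nat
    \<Rightarrow> ('k::field, ('i::finite, 'k) pelem set, ('i, 'k) pelem set set) gmodule" where
  "eps_quotient C d \<omega> i k =
    (let A = Pi_alg C d \<omega>; L = left_gen A (Pi_eps C \<omega> i [^]\<^bsub>A\<^esub> k) in
     \<lparr>gr = (\<lambda>u. coset_space A L ((\<lambda>x. x \<otimes>\<^bsub>A\<^esub> Pi_idem C \<omega> i) ` hcomp A u)),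
      act = (\<lambda>v u a X. \<Union>x\<in>X. L +>\<^bsub>A\<^esub> (a \<otimes>\<^bsub>A\<^esub> x))\<rparr>)"

definition generic_kernel :: "('i \<Rightarrow> 'i \<Rightarrow> int) \<Rightarrow> ('i \<Rightarrow> int) \<Rightarrow> ('i \<Rightarrow> 'i \<Rightarrow> int) \<Rightarrow> 'i \<Rightarrow> nat
    \<Rightarrow> ('k::field, ('i::finite, 'k) pelem set, ('i, 'k) pelem set set \<Rightarrow> 'k) gmodule" where
  "generic_kernel C d \<omega> i k =
     shift (int k * d i) (restricted_dual (image (path_anti C)) (eps_quotient C d \<omega> i k))"

text \<open>The graded vector space \<open>e\<^sub>i(\<Pi>/(\<epsilon>\<^sub>i\<^sup>k\<Pi> + \<Pi>\<epsilon>\<^sub>j\<^sup>l))e\<^sub>j\<close>.\<close>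

definition eps_biquotient :: "('i \<Rightarrow> 'i \<Rightarrow> int) \<Rightarrow> ('i \<Rightarrow> int) \<Rightarrow> ('i \<Rightarrow> 'i \<Rightarrow> int)
    \<Rightarrow> 'i \<Rightarrow> nat \<Rightarrow> 'i \<Rightarrow> nat \<Rightarrow> ('k::field, ('i::finite, 'k) pelem set set) gvec" where
  "eps_biquotient C d \<omega> i k j l =
    (let A = Pi_alg C d \<omega>;
         W = right_gen A (Pi_eps C \<omega> i [^]\<^bsub>A\<^esub> k) <+>\<^bsub>A\<^esub> left_gen A (Pi_eps C \<omega> j [^]\<^bsub>A\<^esub> l) in
     (\<lambda>u. coset_space A W ((\<lambda>x. Pi_idem C \<omega> i \<otimes>\<^bsub>A\<^esub> x \<otimes>\<^bsub>A\<^esub> Pi_idem C \<omega> j) ` hcomp A u)))"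

end

theory Submission
  imports Defs "HOL-Library.Function_Algebras"
begin

text \<open>Let \<open>A\<close> be the algebra and \<open>K\<close> a generic kernel at \<open>i\<close> with parameter \<open>k\<close>. By duality, homomorphisms
 from a graded module \<open>F\<close> to \<open>K\<close> are functionals on a component of \<open>e\<^sub>i F / \<epsilon>\<^sub>i\<^sup>k F\<close>. Applied to the free cover
 of \<open>X\<close> and its syzygies, this identifies the extensions of \<open>X\<close> by \<open>K\<close> with the dual of the kernel of
 \<open>\<epsilon>\<^sub>i\<^sup>k\<close> on a component of \<open>e\<^sub>i X\<close>, provided that \<open>\<epsilon>\<^sub>i\<close> acts injectively on \<open>e\<^sub>i A\<close>. If \<open>X\<close> is a generic kernel
 too, this kernel is the dual of a component of the asserted quotient of \<open>e\<^sub>j A e\<^sub>i\<close>. It is finite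
 dimensional when long paths with many arrows \<open>\<alpha>\<close> vanish, and the anti-involution exchanges \<open>i\<close> and \<open>j\<close>.

 Torsion-freeness and this nilpotency are shown by knitting. Order \<open>I\<close> and split \<open>A e\<^sub>i\<close> by target and by
 the number of arrows \<open>\<alpha>\<close> that increase the order. By the mesh relation, each piece is the cokernel of a map of
 free modules between earlier pieces, and replacing the oldest piece in a window of \<open>card I\<close>
 consecutive pieces by the next one acts on the vector of ranks as a simple reflection on roots. The
 vanishing of self-extensions of the window is preserved and forces the new piece to be either free of
 the expected rank or zero, in which case all later pieces vanish. Because root systems
 are finite, no orbit stays positive, so the second alternative occurs.\<close>

text \<open>A cokernel of free modules over the polynomial ring in \<open>E j\<close> may have
  torsion; it is free if the map stays injective modulo \<open>E j\<close>, and rigidity is there to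
  secure this. If injectivity modulo \<open>E j\<close> failed, a cocycle supported on a single
  arrow out of the oldest piece could be chosen so that its being a coboundary, fed into the mesh
  relation, puts an arbitrary generator of the new piece \<open>Y\<close> into \<open>E j Y\<close>.
  So \<open>Y = E j Y\<close>, and as \<open>E j\<close> raises degrees that are bounded below,
  \<open>Y = 0\<close>. But then the mesh map is onto, and comparing ranks restores injectivity
  unless the reflected rank is negative. A negative reflected rank means that the current root is
  supported at \<open>j\<close>, so that all other pieces of the window are zero. The degree shift
  of the statement comes from the loops: the \<open>k\<close>-th power of the loop at
  \<open>i\<close> has degree \<open>2 k d i\<close>, and the shift by \<open>k d i\<close> in the
  generic kernel makes its extensions see this power as a map from degree \<open>- k d i\<close> to
  degree \<open>k d i\<close>. The other kernel contributes its own shift.\<close>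

abbreviation "nbs C j \<equiv> {k. adj C j k}"

abbreviation vlin :: "('k::field => 'b::ab_group_add => 'b) => ('k => 'c::ab_group_add => 'c) => ('b => 'c) => bool" where
 "vlin \<equiv> Vector_Spaces.linear"

abbreviation vend :: "('k::field => 'b::ab_group_add => 'b) => ('b => 'b) => bool" where
 "vend s \<equiv> vlin s s"

text \<open>The path algebra and all coordinate maps live in types of functions to the field, where
  the typed theory of bases and complements applies.\<close>

definition fsc :: "'k::field => ('x => 'k) => 'x => 'k" where
 "fsc c f = (%x. c * f x)"

lemma fscale_apply [simp]: "fsc c f x = c * f x"
 by (simp add: fsc_def)

lemma sum_apply: "(\<Sum>a\<in>A. f a) x = (\<Sum>a\<in>A. f a x)"
 for f :: "'a => 'b => 'c::comm_monoid_add"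
 by (induction A rule: infinite_finite_induct) auto

section \<open>Free modules of finite rank over a polynomial ring, as spaces with an
  operator\<close>

locale vspace = vector_space scale
 for scale :: "'k::field => 'v::ab_group_add => 'v" (infixr "*s" 75)
begin

lemma linear_funpow: "vend scale e ==> vend scale (e ^^ n)"
proof (induction n)
 case 0
 thus ?case using linear_id by (simp add: id_def[symmetric] del: id_apply)
next
 case (Suc n)
 thus ?case using Vector_Spaces.linear_compose by (metis funpow.simps(2))
qed

lemma funpow_mem: "e ` S \<subseteq> S ==> x\<in>S ==> (e ^^ n) x\<in>S"
 by (induction n) auto

text \<open>The range of \<open>p\<close> serves as a model of the quotient by \<open>W\<close>.\<close>

lemma projection_along:
 assumes "subspace W"
 obtains p where "vend scale p" "!!x. p x = 0 \<longleftrightarrow> x\<in>W" "!!x. p x - x\<in>W"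
proof -
 obtain B where B: "B \<subseteq> W" "independent B" "W \<subseteq> span B"
  using maximal_independent_subset by blast
 hence WB: "W = span B" using assms span_minimal by blast
 let ?E = "extend_basis B"
 have E: "B \<subseteq> ?E" "independent ?E" "span ?E = UNIV"
  using B(2) extend_basis_superset independent_extend_basis by auto
 interpret vp: vector_space_pair scale scale ..
 define p where "p = vp.construct ?E (%b. if b\<in>B then 0 else b)"
 have lp: "vend scale p" unfolding p_def by (rule vp.linear_construct[OF E(2)])
 interpret p: Vector_Spaces.linear scale scale p by (rule lp)
 have pb: "p b = (if b\<in>B then 0 else b)" if "b\<in>?E" for b
  unfolding p_def by (rule vp.construct_basis[OF E(2) that])
 have diff: "p x - x\<in>W" for x
 proof -
  have "x\<in>span ?E" using E(3) by simp
  thus ?thesis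
  proof (induction rule: span_induct_alt)
  case base thus ?case using assms by (simp add: subspace_0)
  next
  case (step c x y)
  have "p x - x\<in>W" using pb[OF step(1)] WB by (auto intro: span_base span_neg subspace_0 assms)
  hence "c *s (p x - x) + (p y - y)\<in>W" using step assms by (simp add: subspace_add subspace_scale)
  moreover have "p (c *s x + y) - (c *s x + y) = c *s (p x - x) + (p y - y)"
  by (simp add: p.add p.scale algebra_simps)
  ultimately show ?case by (simp only:)
  qed
 qed
 have "p x = 0" if "x\<in>W" for x
 proof -
  have "x\<in>span B" using that WB by simp
  thus ?thesis
  proof (induction rule: span_induct_alt)
  case base thus ?case by (simp add: p.zero)
  next
  case (step c x y) thus ?case using pb E(1) by (auto simp: p.add p.scale)
  qed
 qed
 moreover have "x\<in>W" if "p x = 0" for x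
 proof -
  have "p x - x\<in>W" by (rule diff)
  hence "- (p x - x)\<in>W" using assms subspace_neg by blast
  thus ?thesis using that by simp
 qed
 ultimately show ?thesis using lp diff that by blast
qed

text \<open>\<open>hbasis e B S\<close>: the space \<open>S\<close>, on which a polynomial ring acts through the operator \<open>e\<close>,
 is free with the finite basis \<open>B\<close>.\<close>

definition hbasis :: "('v => 'v) => 'v set => 'v set => bool" where
 "hbasis e B S \<longleftrightarrow> finite B
  & (\<forall>m kp. (\<Sum>a\<le>m::nat. \<Sum>b\<in>B. kp a b *s (e ^^ a) b) = 0 --> (\<forall>a\<le>m. \<forall>b\<in>B. kp a b = 0))
  & S = span {(e ^^ a) b | a b. b\<in>B}"

lemma hb_finite: "hbasis e B S ==> finite B"
 by (simp add: hbasis_def)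

lemma hb_subspace: "hbasis e B S ==> subspace S"
 by (simp add: hbasis_def)

lemma hb_span: "hbasis e B S ==> S = span {(e ^^ a) b | a b. b\<in>B}"
 by (simp add: hbasis_def)

lemma hb_pow: "hbasis e B S ==> b\<in>B ==> (e ^^ a) b\<in>S"
 by (auto simp: hbasis_def intro!: span_base)

lemma hbasis_mem: "hbasis e B S ==> b\<in>B ==> b\<in>S"
 using hb_pow[of e B S b 0] by simp

lemma hbasis_empty: "hbasis e {} S ==> S = {0}"
 by (simp add: hbasis_def)

lemma span_funpow_closed:
 assumes "vend scale e" "x\<in>span {(e ^^ a) b | a b. b\<in>B}"
 shows "e x\<in>span {(e ^^ a) b | a b. b\<in>B}"
proof -
 interpret e: Vector_Spaces.linear scale scale e by fact
 show ?thesis using assms(2)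
 proof (induction rule: span_induct_alt)
  case base thus ?case by (simp add: span_zero)
 next
  case (step c x y)
  from step(1) obtain a b where "x = (e ^^ a) b" "b\<in>B" by blast
  hence "e x = (e ^^ Suc a) b" by simp
  hence "e x\<in>span {(e ^^ a) b | a b. b\<in>B}" using \<open>b\<in>B\<close> by (intro span_base) blast
  thus ?case using step by (simp add: e.add e.scale span_add span_scale)
 qed
qed

lemma hbasis_closed:
 assumes "hbasis e B S" "vend scale e" shows "e ` S \<subseteq> S"
 using span_funpow_closed[OF assms(2)] hb_span[OF assms(1)] by blast

text \<open>\<open>hbasis\<close> states independence through double sums. For the typed theory of
  bases it is turned into independence of a set, which requires the elements
  \<open>(e ^^ a) b\<close> to be pairwise distinct.\<close>

lemma hb_indep:
 assumes "hbasis e B S"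
 shows "inj_on (%(a, b). (e ^^ a) b) (UNIV \<times> B)"
  and "independent ((%(a, b). (e ^^ a) b) ` (UNIV \<times> B))"
proof -
 let ?p = "%(a, b). (e ^^ a) b"
 have fin: "finite B" using assms by (simp add: hbasis_def)
 have ind: "kp a b = 0" if "(\<Sum>a\<le>m. \<Sum>b\<in>B. kp a b *s (e ^^ a) b) = 0" "a <= m" "b\<in>B" for m kp a b
  using assms that unfolding hbasis_def by blast
 show inj: "inj_on ?p (UNIV \<times> B)"
 proof (rule inj_onI, clarify)
  fix a b a' b'
  assume b: "b\<in>B" "b'\<in>B" and eq: "(e ^^ a) b = (e ^^ a') b'"
  show "a = a' & b = b'"
  proof (rule ccontr)
  assume ne: "\<not> ?thesis"
  \<comment> \<open>Two equal elements would satisfy the relation with coefficients 1 and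
    -1.\<close>
  define kp where "kp x y = (if (x, y) = (a, b) then 1 else if (x, y) = (a', b') then - 1 else (0::'k))" for x y
  let ?m = "max a a'"
  have k1: "kp x y *s (e ^^ x) y = (if (x,y) = (a,b) then (e ^^ a) b else 0) - (if (x,y) = (a',b') then (e ^^ a') b' else 0)" for x y
  using ne by (auto simp: kp_def)
  have "(\<Sum>x\<le>?m. \<Sum>y\<in>B. kp x y *s (e ^^ x) y) = (\<Sum>p\<in>{..?m}\<times>B. (if p = (a,b) then (e ^^ a) b else 0) - (if p = (a',b') then (e ^^ a') b' else 0))"
  by (auto simp: k1 sum.cartesian_product intro!: sum.cong)
  also have "\<dots> = 0"
  using fin b eq by (simp add: sum_subtractf)
  finally have "kp a b = 0" using b by (intro ind[of kp ?m]) auto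
  thus False by (simp add: kp_def)
  qed
 qed
 show "independent (?p ` (UNIV \<times> B))"
  unfolding independent_explicit_finite_subsets
 proof (intro allI impI ballI)
  fix T u v assume T: "T \<subseteq> ?p ` (UNIV \<times> B)" "finite T" and s: "(\<Sum>v\<in>T. u v *s v) = 0" and v: "v\<in>T"
  obtain D where D: "D \<subseteq> UNIV \<times> B" "finite D" "T = ?p ` D"
  using finite_subset_image[OF T(2,1)] by blast
  have "finite (fst ` D)" using D by simp
  then obtain m where m: "\<forall>x\<in>fst ` D. x <= m" using finite_nat_set_iff_bounded_le by blast
  define kp where "kp a b = (if (a,b)\<in>D then u (?p (a, b)) else 0)" for a b
  have "(\<Sum>a\<le>m. \<Sum>b\<in>B. kp a b *s (e ^^ a) b) = (\<Sum>q\<in>{..m}\<times>B. (if q\<in>D then u (?p q) *s ?p q else 0))"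
  by (auto simp: sum.cartesian_product kp_def intro!: sum.cong)
  also have "\<dots> = (\<Sum>q\<in>D. u (?p q) *s ?p q)"
  using D m fin by (intro sum.mono_neutral_cong_right) force+
  also have "\<dots> = (\<Sum>v\<in>T. u v *s v)"
  unfolding D(3) by (subst sum.reindex) (auto intro: inj_on_subset[OF inj D(1)])
  finally have 0: "(\<Sum>a\<le>m. \<Sum>b\<in>B. kp a b *s (e ^^ a) b) = 0" using s by simp
  obtain a b where ab: "(a,b)\<in>D" "v = (e ^^ a) b" using v D by auto
  hence "kp a b = 0" using m D(1) by (intro ind[OF 0]) force+
  thus "u v = 0" using ab by (simp add: kp_def)
 qed
qed

text \<open>Lowering the exponent of \<open>e\<close> by one on basis elements is a left inverse of
  \<open>e\<close>.\<close>

lemma hbasis_inj: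
 assumes "hbasis e B S" "vend scale e" "x\<in>S" "e x = 0"
 shows "x = 0"
proof -
 interpret e: Vector_Spaces.linear scale scale e by fact
 let ?p = "%(a, b). (e ^^ a) b"
 let ?I = "?p ` (UNIV \<times> B)"
 note ind = hb_indep[OF assms(1)]
 have S: "S = span ?I" using hb_span[OF assms(1)] by (auto intro!: arg_cong[of _ _ span])
 interpret vp: vector_space_pair scale scale ..
 \<comment> \<open>The value at exponent 0 is a mere default: \<open>e x\<close> involves only
   positive exponents.\<close>
 define g where "g y = (case inv_into (UNIV \<times> B) ?p y of (a, b) => if a = 0 then 0 else (e ^^ (a - 1)) b)" for y
 let ?f = "vp.construct ?I g"
 have lf: "vend scale ?f" by (rule vp.linear_construct[OF ind(2)])
 interpret f: Vector_Spaces.linear scale scale ?f by (rule lf)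
 have "?f (e x) = x" if "x\<in>span ?I" for x using that
 proof (induction rule: span_induct_alt)
  case base thus ?case by (simp add: f.zero)
 next
  case (step c x y)
  then obtain a b where ab: "b\<in>B" "x = (e ^^ a) b" by auto
  have ex: "e x = ?p (Suc a, b)" using ab by simp
  have "?f (e x) = g (e x)" using ab(1) by (intro vp.construct_basis ind) (auto simp: ex simp del: funpow.simps intro!: image_eqI[of _ _ "(Suc a, b)"])
  also have "\<dots> = x" unfolding ex g_def using ab by (subst inv_into_f_f[OF ind(1)]) auto
  finally show ?case using step by (simp add: e.add e.scale f.add f.scale)
 qed
 hence "?f (e x) = x" using assms(3) S by blast
 thus ?thesis using assms(4) by (simp add: f.zero)
qed

text \<open>A relation is peeled off one power at a time: modulo \<open>e\<close> its constant
  coefficients vanish, what remains is \<open>e\<close> times a shorter relation, and injectivity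
  cancels \<open>e\<close>.\<close>

lemma hbasis_criterion:
 assumes e: "vend scale e" and S: "subspace S" "e ` S \<subseteq> S"
  and inj: "!!x. x\<in>S ==> e x = 0 ==> x = 0"
  and B: "finite B" "B \<subseteq> S"
  and ind: "!!kp b. (\<Sum>b\<in>B. kp b *s b)\<in>e ` S ==> b\<in>B ==> kp b = 0"
  and sp: "S \<subseteq> span {(e ^^ a) b | a b. b\<in>B}"
 shows "hbasis e B S"
proof -
 interpret e: Vector_Spaces.linear scale scale e by fact
 have pS: "(e ^^ a) b\<in>S" if "b\<in>B" for a b
  using funpow_mem[OF S(2)] that B(2) by blast
 have main: "\<forall>a\<le>m. \<forall>b\<in>B. kp a b = 0" if "(\<Sum>a\<le>m. \<Sum>b\<in>B. kp a b *s (e ^^ a) b) = 0" for m :: nat and kp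
  using that
 proof (induction m arbitrary: kp)
  case 0
  have "e 0\<in>e ` S" using S(1) subspace_0 by blast
  hence "0\<in>e ` S" by (simp add: e.zero)
  thus ?case using 0 ind[of "kp 0"] by auto
 next
  case (Suc m)
  let ?y = "\<Sum>a\<le>m. \<Sum>b\<in>B. kp (Suc a) b *s (e ^^ a) b"
  have y: "?y\<in>S" by (intro subspace_sum subspace_scale S(1) pS)
  have "(\<Sum>a\<le>Suc m. \<Sum>b\<in>B. kp a b *s (e ^^ a) b) = (\<Sum>b\<in>B. kp 0 b *s b) + e ?y"
  by (subst sum.atMost_Suc_shift) (simp add: e.sum e.scale)
  hence eq: "(\<Sum>b\<in>B. kp 0 b *s b) = e (- ?y)" using Suc.prems
  by (simp add: e.neg eq_neg_iff_add_eq_0)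
  hence "(\<Sum>b\<in>B. kp 0 b *s b)\<in>e ` S" using y S(1) subspace_neg by blast
  hence k0: "kp 0 b = 0" if "b\<in>B" for b using that ind by blast
  hence "e (- ?y) = 0" using eq by simp
  hence "?y = 0" using inj y S(1) subspace_neg by force
  from Suc.IH[OF this] show ?case using k0 by (metis not0_implies_Suc Suc_le_mono)
 qed
 have "span {(e ^^ a) b | a b. b\<in>B} \<subseteq> S"
  using pS by (intro span_minimal S(1)) auto
 thus ?thesis unfolding hbasis_def using B(1) main sp by blast
qed

end

locale vspace_pair = vs1: vspace s1 + vs2: vspace s2
 for s1 :: "'k::field => 'v::ab_group_add => 'v" and s2 :: "'k => 'w::ab_group_add => 'w"
begin

sublocale vector_space_pair s1 s2 ..

text \<open>Maps out of a free module that are semilinear along \<open>e ^ c \<mapsto> e'\<close> can be prescribed on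
 the elements \<open>e ^ r b\<close> with \<open>r < c\<close>.\<close>

lemma hbasis_extend:
 assumes h: "vs1.hbasis e B S" and e: "vlin s1 s1 e" and e': "vlin s2 s2 e'"
  and T: "vs2.subspace T" "e' ` T \<subseteq> T" and c: "c > 0"
  and g: "!!r b. r < c ==> b\<in>B ==> g r b\<in>T"
 obtains f where "vlin s1 s2 f" "f ` S \<subseteq> T" "!!r b. r < c ==> b\<in>B ==> f ((e ^^ r) b) = g r b"
  "!!x. x\<in>S ==> f ((e ^^ c) x) = e' (f x)"
proof -
 let ?p = "%(a, b). (e ^^ a) b"
 let ?I = "?p ` (UNIV \<times> B)"
 note ind = vs1.hb_indep[OF h]
 have S: "S = vs1.span ?I" using vs1.hb_span[OF h] by (auto intro!: arg_cong[of _ _ vs1.span])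
 \<comment> \<open>With \<open>a = c q + r\<close> and \<open>r < c\<close>, semilinearity forces
   the value \<open>e' ^^ q\<close> applied to the one prescribed at \<open>r\<close>.\<close>
 define G where "G y = (case inv_into (UNIV \<times> B) ?p y of (a, b) => (e' ^^ (a div c)) (g (a mod c) b))" for y
 define f where "f = construct ?I G"
 have lf: "vlin s1 s2 f" unfolding f_def by (rule linear_construct[OF ind(2)])
 have fb: "f ((e ^^ a) b) = (e' ^^ (a div c)) (g (a mod c) b)" if "b\<in>B" for a b
 proof -
  have "f (?p (a, b)) = G (?p (a, b))" unfolding f_def
  using that by (intro construct_basis ind) (auto simp: image_iff)
  also have "\<dots> = (e' ^^ (a div c)) (g (a mod c) b)"
  unfolding G_def using that by (subst inv_into_f_f[OF ind(1)]) auto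
  finally show ?thesis by simp
 qed
 interpret f: Vector_Spaces.linear s1 s2 f by (rule lf)
 interpret e: Vector_Spaces.linear s1 s1 "e ^^ c" by (rule vs1.linear_funpow[OF e])
 interpret e': Vector_Spaces.linear s2 s2 e' by fact
 have 1: "f x\<in>T" if "x\<in>S" for x using that unfolding S
 proof (induction rule: vs1.span_induct_alt)
  case base thus ?case using T(1) by (simp add: vs2.subspace_0)
 next
  case (step c' x y)
  from step(1) obtain a b where ab: "x = (e ^^ a) b" "b\<in>B" by auto
  have "f x\<in>T" unfolding ab fb[OF ab(2)] using T g ab c by (intro vs2.funpow_mem) auto
  thus ?case using step T(1) by (simp add: f.add f.scale vs2.subspace_add vs2.subspace_scale)
 qed
 have 2: "f ((e ^^ c) x) = e' (f x)" if "x\<in>S" for x using that unfolding S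
 proof (induction rule: vs1.span_induct_alt)
  case base thus ?case by (simp add: e'.zero)
 next
  case (step c' x y)
  from step(1) obtain a b where ab: "x = (e ^^ a) b" "b\<in>B" by auto
  have "(e ^^ c) x = (e ^^ (c + a)) b" using ab by (simp add: funpow_add)
  hence "f ((e ^^ c) x) = e' (f x)" using c by (simp add: fb[OF ab(2)] ab(1))
  thus ?case using step by (simp add: e.add e.scale f.add f.scale e'.add e'.scale)
 qed
 have 3: "f ((e ^^ r) b) = g r b" if "r < c" "b\<in>B" for r b using fb[OF that(2)] that(1) by simp
 show ?thesis using that[OF lf _ 3 2] 1 by blast
qed

text \<open>Compose \<open>h\<close> with a linear section of \<open>Ph\<close> on the image of
  \<open>S\<close>. Going through \<open>Ph\<close> and back changes \<open>x\<close> by an element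
  of \<open>S\<close> killed by \<open>Ph\<close>, hence by \<open>h\<close>.\<close>

lemma factor_through:
 assumes Ph: "vlin s1 s2 Ph" and h: "vlin s1 s2 h" and S: "vs1.subspace S"
  and ker: "!!x. x\<in>S ==> Ph x = 0 ==> h x = 0"
 obtains g where "vlin s2 s2 g" "!!x. x\<in>S ==> g (Ph x) = h x"
proof -
 obtain s where s: "s ` (Ph ` S) \<subseteq> S" "vlin s2 s1 s" "\<forall>x\<in>Ph ` S. Ph (s x) = x"
  using linear_exists_right_inverse_on[OF Ph S] by auto
 interpret Ph: Vector_Spaces.linear s1 s2 Ph by fact
 interpret h: Vector_Spaces.linear s1 s2 h by fact
 have "h (s (Ph x)) = h x" if "x\<in>S" for x
 proof -
  have "s (Ph x) - x\<in>S" using that s(1) S by (intro vs1.subspace_diff) auto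
  moreover have "Ph (s (Ph x) - x) = 0" using that s(3) by (simp add: Ph.diff)
  ultimately have "h (s (Ph x) - x) = 0" by (rule ker)
  thus ?thesis by (simp add: h.diff)
 qed
 moreover have "vlin s2 s2 (h \<circ> s)" by (rule Vector_Spaces.linear_compose[OF s(2) h])
 ultimately show ?thesis using that[of "h \<circ> s"] by simp
qed

end

lemma vspace_fscale: "vspace fsc"
 by unfold_locales (auto simp: fun_eq_iff algebra_simps)

context vspace
begin

text \<open>Coordinates on \<open>S / e S\<close>, as a linear map on the whole type: the extension
  lemma with exponent 1 and the zero operator on the target sends \<open>B\<close> to unit vectors
  and kills \<open>e S\<close>.\<close>

lemma hbasis_coord:
 assumes h: "hbasis e B S" and e: "vend scale e"
 obtains co :: "'v => 'v => 'k" where "vlin scale fsc co"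
  "!!b. b\<in>B ==> co b = (%y. if y = b then 1 else 0)"
  "!!x. x\<in>S ==> co (e x) = 0"
  "!!x. x\<in>S ==> x - (\<Sum>b\<in>B. co x b *s b)\<in>e ` S"
  "!!x y. x\<in>S ==> y \<notin> B ==> co x y = 0"
proof -
 interpret f: vspace "fsc :: 'k => ('v => 'k) => _" by (rule vspace_fscale)
 interpret vp: vspace_pair scale "fsc :: 'k => ('v => 'k) => _" ..
 let ?T = "{f :: 'v => 'k. \<forall>y. y \<notin> B --> f y = 0}"
 have T: "f.subspace ?T" by (auto simp: f.subspace_def)
 have l0: "vlin fsc fsc (%x :: 'v => 'k. 0 :: 'v => 'k)" by (simp add: Vector_Spaces.linear_iff f.vector_space_axioms)
 let ?g = "%(r :: nat) b y. if y = b then 1 else (0 :: 'k)"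
 have T': "(%x. 0) ` ?T \<subseteq> ?T" by auto
 have g: "?g r b\<in>?T" if "r < 1" "b\<in>B" for r b using that by auto
 obtain co where co: "vlin scale fsc co" "co ` S \<subseteq> ?T"
  "!!r b. r < 1 ==> b\<in>B ==> co ((e ^^ r) b) = ?g r b"
  "!!x. x\<in>S ==> co ((e ^^ 1) x) = 0"
  by (rule vp.hbasis_extend[OF h e l0 T T' zero_less_one, of ?g, OF g]) (assumption | rule that)+
 interpret co: Vector_Spaces.linear scale fsc co by fact
 interpret e: Vector_Spaces.linear scale scale e by fact
 have eS: "subspace (e ` S)" using hb_subspace[OF h] by (rule e.subspace_image)
 have "x - (\<Sum>b\<in>B. co x b *s b)\<in>e ` S" if "x\<in>S" for x
  using that unfolding hb_span[OF h]
 proof (induction rule: span_induct_alt)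
  case base thus ?case using eS by (simp add: co.zero subspace_0 hb_span[OF h, symmetric])
 next
  case (step c x y)
  from step(1) obtain a b where ab: "x = (e ^^ a) b" "b\<in>B" by auto
  have "x - (\<Sum>b\<in>B. co x b *s b)\<in>e ` S"
  proof (cases a)
  case 0
  have "co b = (%y. if y = b then 1 else 0)" using co(3)[of 0] ab by simp
  hence "(\<Sum>y\<in>B. co b y *s y) = (\<Sum>y\<in>B. if y = b then y else 0)" by (intro sum.cong) auto
  thus ?thesis using 0 ab hb_finite[OF h] eS by (simp add: subspace_0)
  next
  case (Suc a')
  hence "x = e ((e ^^ a') b)" using ab by simp
  moreover have "(e ^^ a') b\<in>S" using hb_pow[OF h ab(2)] .
  ultimately show ?thesis using co(4)[of "(e ^^ a') b"] by simp
  qed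
  hence "c *s (x - (\<Sum>b\<in>B. co x b *s b)) + (y - (\<Sum>b\<in>B. co y b *s b))\<in>e ` S"
  using step(2) eS by (simp add: hb_span[OF h, symmetric] subspace_add subspace_scale)
  moreover have "c *s (x - (\<Sum>b\<in>B. co x b *s b)) + (y - (\<Sum>b\<in>B. co y b *s b))
  = (c *s x + y) - (\<Sum>b\<in>B. co (c *s x + y) b *s b)"
  by (simp add: co.add co.scale algebra_simps sum.distrib scale_sum_right)
  ultimately show ?case by (simp only: hb_span[OF h, symmetric])
 qed
 moreover have "co x y = 0" if "x\<in>S" "y \<notin> B" for x y using co(2) that by blast
 ultimately show ?thesis using that[of co] co(1) co(3)[of 0] co(4) by simp
qed

lemma hb_comb:
 assumes "hbasis e B S" "vend scale e" "x\<in>S"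
 obtains mu where "x - (\<Sum>b\<in>B. mu b *s b)\<in>e ` S"
proof (rule hbasis_coord[OF assms(1,2)])
 fix co :: "'v => 'v => 'k"
 assume "!!x. x\<in>S ==> x - (\<Sum>b\<in>B. co x b *s b)\<in>e ` S"
 thus thesis using that assms(3) by blast
qed

text \<open>The coordinates modulo \<open>e\<close> annihilate everything but the constant
  coefficients, which therefore vanish; injectivity of \<open>e\<close> then cancels one power and
  the induction goes on.\<close>

lemma hbasis_mod:
 assumes h: "hbasis e B S" and e: "vend scale e"
 shows "(\<Sum>r<c. \<Sum>b\<in>B. kp r b *s (e ^^ r) b)\<in>(e ^^ c) ` S ==> r < c ==> b\<in>B ==> kp r b = 0"
proof (induction c arbitrary: kp r)
 case 0 thus ?case by simp
next
 case (Suc c)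
 interpret e: Vector_Spaces.linear scale scale e by fact
 obtain co :: "'v => 'v => 'k" where co: "vlin scale fsc co"
  "!!b. b\<in>B ==> co b = (%y. if y = b then 1 else 0)" "!!x. x\<in>S ==> co (e x) = 0"
  by (rule hbasis_coord[OF h e]) (rule that; assumption)
 interpret co: Vector_Spaces.linear scale fsc co by fact
 note cl = hbasis_closed[OF h e] and sub = hb_subspace[OF h]
 let ?y = "\<Sum>r<c. \<Sum>b\<in>B. kp (Suc r) b *s (e ^^ r) b"
 have y: "?y\<in>S" by (intro subspace_sum subspace_scale sub hb_pow[OF h])
 obtain s where s: "s\<in>S" "(\<Sum>r<Suc c. \<Sum>b\<in>B. kp r b *s (e ^^ r) b) = (e ^^ Suc c) s" using Suc.prems(1) by auto
 have "(\<Sum>r<Suc c. \<Sum>b\<in>B. kp r b *s (e ^^ r) b) = (\<Sum>b\<in>B. kp 0 b *s b) + e ?y"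
  by (subst sum.lessThan_Suc_shift) (simp add: e.sum e.scale)
 hence eq: "(\<Sum>b\<in>B. kp 0 b *s b) + e ?y = e ((e ^^ c) s)" using s(2) by simp
 have "co ((\<Sum>b\<in>B. kp 0 b *s b) + e ?y) = 0" unfolding eq by (intro co(3) funpow_mem cl s)
 hence "co (\<Sum>b\<in>B. kp 0 b *s b) = 0" by (simp add: co.add co(3)[OF y])
 hence "(\<Sum>b\<in>B. kp 0 b * co b y) = 0" for y by (simp add: co.sum co.scale fun_eq_iff sum_apply)
 moreover have "(\<Sum>b\<in>B. kp 0 b * co b y) = kp 0 y" if "y\<in>B" for y
 proof -
  have "(\<Sum>b\<in>B. kp 0 b * co b y) = (\<Sum>b\<in>B. if b = y then kp 0 b else 0)"
  by (intro sum.cong) (auto simp: co(2))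
  thus ?thesis using that hb_finite[OF h] by simp
 qed
 ultimately have k0: "kp 0 y = 0" if "y\<in>B" for y using that by simp
 hence "e (?y - (e ^^ c) s) = 0" using eq by (simp add: e.diff)
 hence "?y = (e ^^ c) s" using hbasis_inj[OF h e, of "?y - (e ^^ c) s"] y s(1) sub cl
  by (simp add: subspace_diff funpow_mem)
 hence "?y\<in>(e ^^ c) ` S" using s(1) by blast
 from Suc.IH[OF this] have "kp (Suc r) b = 0" if "r < c" for r using that Suc.prems(3) by blast
 thus ?case using k0 Suc.prems by (cases r) auto
qed

text \<open>Both parts are about the space \<open>S / e S\<close> of dimension
  \<open>card B\<close>: a generating set has at least that many elements, and one of exactly that
  size is independent.\<close>

lemma card_le_spanning:
 assumes h: "hbasis e B S" and e: "vend scale e"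
  and G: "finite G" "G \<subseteq> S" and sp: "!!x. x\<in>S ==> \<exists>y\<in>span G. x - y\<in>e ` S"
 shows "card B <= card G"
  and "card B = card G ==> (\<Sum>g\<in>G. kp g *s g)\<in>e ` S ==> g\<in>G ==> kp g = 0"
proof -
 obtain co :: "'v => 'v => 'k" where co: "vlin scale fsc co"
  "!!b. b\<in>B ==> co b = (%y. if y = b then 1 else 0)" "!!x. x\<in>S ==> co (e x) = 0"
  by (rule hbasis_coord[OF h e]) (rule that; assumption)
 interpret f: vspace "fsc :: 'k => ('v => 'k) => _" by (rule vspace_fscale)
 interpret co: Vector_Spaces.linear scale fsc co by fact
 have cs: "co x\<in>f.span (co ` G)" if "x\<in>S" for x
 proof -
  from sp[OF that] obtain y where y: "y\<in>span G" "x - y\<in>e ` S" by blast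
  hence "co (x - y) = 0" using co(3) by auto
  hence "co x = co y" by (simp add: co.diff)
  also have "co y\<in>f.span (co ` G)" using y(1) co.span_image by blast
  finally show ?thesis .
 qed
 have inj: "inj_on co B"
 proof (rule inj_onI)
  fix x y assume "x\<in>B" "y\<in>B" "co x = co y"
  hence "co x x = co y x" by simp
  thus "x = y" using co(2) \<open>x\<in>B\<close> \<open>y\<in>B\<close> by (simp split: if_splits)
 qed
 have "finite B" using h by (rule hb_finite)
 have ind: "f.independent (co ` B)"
 proof (rule f.independent_if_scalars_zero)
  show "finite (co ` B)" using \<open>finite B\<close> by simp
  fix u x assume s: "(\<Sum>x\<in>co ` B. fsc (u x) x) = 0" and x: "x\<in>co ` B"
  then obtain b where b: "b\<in>B" "x = co b" by blast
  have "(\<Sum>x\<in>co ` B. fsc (u x) x) b = (\<Sum>y\<in>B. if y = b then u (co b) else 0)"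
  unfolding sum_apply by (subst sum.reindex[OF inj]) (auto simp: co(2) intro!: sum.cong)
  thus "u x = 0" using s b \<open>finite B\<close> by simp
 qed
 have sub: "co ` B \<subseteq> f.span (co ` G)" using cs hbasis_mem[OF h] by blast
 have "card (co ` B) <= card (co ` G)"
  using f.independent_span_bound[OF _ ind sub] G(1) by simp
 hence le: "card B <= card (co ` G)" by (simp add: card_image[OF inj])
 thus "card B <= card G" using card_image_le[OF G(1), of co] by simp
 assume eq: "card B = card G" and k: "(\<Sum>g\<in>G. kp g *s g)\<in>e ` S" and g: "g\<in>G"
 have cG: "card (co ` G) = card G" using le eq card_image_le[OF G(1), of co] by simp
 hence injG: "inj_on co G" using G(1) by (simp add: eq_card_imp_inj_on)
 have indG: "f.independent (co ` G)"
 proof (rule ccontr)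
  assume "\<not> f.independent (co ` G)"
  then obtain a where a: "a\<in>co ` G" "a\<in>f.span (co ` G - {a})" by (auto simp: f.dependent_def)
  hence "f.span (co ` G) = f.span (co ` G - {a})" using f.span_redundant[of a "co ` G - {a}"] by (simp add: insert_absorb)
  hence "card (co ` B) <= card (co ` G - {a})"
  using f.independent_span_bound[OF _ ind, of "co ` G - {a}"] sub G(1) by simp
  also have "\<dots> < card (co ` G)" using a(1) G(1) by (intro card_Diff1_less) auto
  finally show False using cG eq card_image[OF inj] by simp
 qed
 have "co (\<Sum>g\<in>G. kp g *s g) = 0" using k co(3) by auto
 hence "(\<Sum>x\<in>co ` G. fsc (kp (inv_into G co x)) x) = 0"
  by (simp add: sum.reindex[OF injG] co.sum co.scale injG cong: sum.cong)
 hence "kp (inv_into G co (co g)) = 0"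
  using indG g G(1) unfolding f.independent_explicit_finite_subsets
  by (elim allE[of _ "co ` G"]) auto
 thus "kp g = 0" using injG g by simp
qed

text \<open>The dimension bound for \<open>S / e S\<close> again. The elements come as an indexed
  family so that the bound applies directly to a disjoint sum of bases.\<close>

lemma card_le_indep:
 assumes h: "hbasis e B S" and e: "vend scale e"
  and J: "finite J" "g ` J \<subseteq> S"
  and ind: "!!kp j. (\<Sum>j\<in>J. kp j *s g j)\<in>e ` S ==> j\<in>J ==> kp j = 0"
 shows "card J <= card B"
proof -
 obtain co :: "'v => 'v => 'k" where co: "vlin scale fsc co"
  "!!b. b\<in>B ==> co b = (%y. if y = b then 1 else 0)"
  "!!x. x\<in>S ==> x - (\<Sum>b\<in>B. co x b *s b)\<in>e ` S"
  "!!x y. x\<in>S ==> y \<notin> B ==> co x y = 0"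
  by (rule hbasis_coord[OF h e]) (rule that; assumption)
 interpret f: vspace "fsc :: 'k => ('v => 'k) => _" by (rule vspace_fscale)
 interpret co: Vector_Spaces.linear scale fsc co by fact
 have finB: "finite B" using h by (rule hb_finite)
 have co0: "x\<in>e ` S" if "x\<in>S" "co x = 0" for x using co(3)[OF that(1)] that(2) by simp
 have kS: "(\<Sum>j\<in>J. kp j *s g j)\<in>S" for kp
  using J(2) by (intro subspace_sum subspace_scale hb_subspace[OF h]) auto
 have ind': "kp j = 0" if "(\<Sum>j\<in>J. fsc (kp j) (co (g j))) = 0" "j\<in>J" for kp j
 proof -
  have "co (\<Sum>j\<in>J. kp j *s g j) = 0" using that(1) by (simp add: co.sum co.scale)
  thus ?thesis using ind co0 kS that(2) by blast
 qed
 have inj: "inj_on (%j. co (g j)) J"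
 proof (rule inj_onI, rule ccontr)
  fix i j assume ij: "i\<in>J" "j\<in>J" "co (g i) = co (g j)" "i ~= j"
  define kp where "kp x = (if x = i then 1 else if x = j then - 1 else (0::'k))" for x
  have "(\<Sum>x\<in>J. fsc (kp x) (co (g x))) = (\<Sum>x\<in>J. (if x = i then co (g x) else 0) - (if x = j then co (g x) else 0))"
  using ij(4) by (intro sum.cong) (auto simp: kp_def fun_eq_iff)
  also have "\<dots> = 0" using ij J(1) by (simp add: sum_subtractf)
  finally have "kp i = 0" using ij by (intro ind')
  thus False by (simp add: kp_def)
 qed
 have "f.independent ((%j. co (g j)) ` J)"
 proof (rule f.independent_if_scalars_zero)
  fix u x assume s: "(\<Sum>x\<in>(%j. co (g j)) ` J. fsc (u x) x) = 0" and x: "x\<in>(%j. co (g j)) ` J"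
  thus "u x = 0" using ind'[of "%j. u (co (g j))"] by (auto simp: sum.reindex[OF inj])
 qed (use J in simp)
 moreover have "(%j. co (g j)) ` J \<subseteq> f.span (co ` B)"
 proof clarify
  fix j assume "j\<in>J"
  hence "g j\<in>S" using J(2) by blast
  hence "co (g j) = (\<Sum>b\<in>B. fsc (co (g j) b) (co b))"
  using finB co(4)[OF \<open>g j\<in>S\<close>] by (auto simp: fun_eq_iff sum_apply co(2) if_distrib sum.delta cong: if_cong sum.cong)
  thus "co (g j)\<in>f.span (co ` B)" by (metis (no_types, lifting) f.span_base f.span_scale f.span_sum image_eqI)
 qed
 ultimately have "card ((%j. co (g j)) ` J) <= card (co ` B)"
  using f.independent_span_bound finB by blast
 thus ?thesis using card_image[OF inj] card_image_le[OF finB, of co] by simp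
qed

text \<open>The graded Nakayama lemma: \<open>pr u\<close> is the projection to degree
  \<open>u\<close>, degrees are bounded below by \<open>L\<close>, and \<open>e\<close> raises them
  by \<open>p\<close>. Generators that form a basis modulo \<open>e\<close> then generate, and
  injectivity of \<open>e\<close> makes them free. Homogeneity keeps the components of the
  generators inside the span.\<close>

lemma graded_nakayama:
 assumes e: "vend scale e" and G: "finite G" and S: "S = span {(e ^^ a) b | a b. b\<in>G}"
  and inj: "!!x. x\<in>S ==> e x = 0 ==> x = 0"
  and pr: "!!u. vend scale (pr u)" "!!u x. x\<in>S ==> pr u x\<in>S"
  "!!u x. x\<in>S ==> pr u (e x) = e (pr (u - p) x)" "!!u x. x\<in>S ==> pr u (pr u x) = pr u x"
  "!!u x. x\<in>S ==> u < L ==> pr u x = 0"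
  and p: "p > (0::int)"
  and hom: "!!g. g\<in>G ==> \<exists>u. pr u g = g & (\<forall>u'. u' ~= u --> pr u' g = 0)"
 obtains B where "B \<subseteq> G" "hbasis e B S"
proof -
 interpret e: Vector_Spaces.linear scale scale e by fact
 have sub: "subspace S" unfolding S by (rule subspace_span)
 have cl: "e ` S \<subseteq> S" using span_funpow_closed[OF e] S by blast
 have GS: "G \<subseteq> S" unfolding S by (fastforce intro!: span_base intro: exI[of _ 0])
 have eS: "subspace (e ` S)" using sub by (rule e.subspace_image)
 obtain kp where k: "vend scale kp" "!!x. kp x = 0 \<longleftrightarrow> x\<in>e ` S" "!!x. kp x - x\<in>e ` S"
  using projection_along[OF eS] by blast
 interpret kp: Vector_Spaces.linear scale scale kp by fact
 obtain D where D: "D \<subseteq> kp ` G" "independent D" "kp ` G \<subseteq> span D"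
  using maximal_independent_subset by blast
 obtain B where B: "B \<subseteq> G" "inj_on kp B" "D = kp ` B"
  using D(1) subset_image_inj by metis
 have finB: "finite B" using B(1) G finite_subset by blast
 have ind: "mu b = 0" if s: "(\<Sum>b\<in>B. mu b *s b)\<in>e ` S" and b: "b\<in>B" for mu b
 proof -
  have "kp (\<Sum>b\<in>B. mu b *s b) = 0" using s k(2) by blast
  hence "(\<Sum>x\<in>D. mu (inv_into B kp x) *s x) = 0" unfolding B(3)
  by (simp add: sum.reindex[OF B(2)] kp.sum kp.scale B(2) cong: sum.cong)
  hence "mu (inv_into B kp (kp b)) = 0"
  using D(2) b finB unfolding independent_explicit_finite_subsets B(3)
  by (elim allE[of _ "kp ` B"]) auto
  thus ?thesis using B(2) b by simp
 qed
 let ?T = "span {(e ^^ a) b | a b. b\<in>B}"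
 have BT: "B \<subseteq> ?T" by (fastforce intro!: span_base intro: exI[of _ 0])
 have eT: "e x\<in>?T" if "x\<in>?T" for x using span_funpow_closed[OF e that] .
 have dec: "\<exists>mu y. x = (\<Sum>b\<in>B. mu b *s b) + e y & y\<in>S" if "x\<in>S" for x
 proof -
  have "kp x\<in>span D" using that unfolding S
  proof (induction rule: span_induct_alt)
  case base thus ?case by (simp add: span_zero)
  next
  case (step c x y)
  from step(1) obtain a b where ab: "x = (e ^^ a) b" "b\<in>G" by auto
  have "kp x\<in>span D"
  proof (cases a)
  case 0 thus ?thesis using ab D(3) by auto
  next
  case (Suc a')
  hence "x = e ((e ^^ a') b)" using ab by simp
  moreover have "(e ^^ a') b\<in>S" using funpow_mem[OF cl] GS ab(2) by blast
  ultimately have "kp x = 0" using k(2) by blast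
  thus ?thesis by (simp add: span_zero)
  qed
  thus ?case using step by (simp add: kp.add kp.scale span_add span_scale)
  qed
  then obtain v where v: "v\<in>span B" "kp x = kp v" using B(3) kp.span_image by blast
  hence "kp (x - v) = 0" by (simp add: kp.diff)
  then obtain y where "x - v = e y" "y\<in>S" using k(2) by blast
  moreover obtain mu where "v = (\<Sum>b\<in>B. mu b *s b)" using v(1) finB by (auto simp: span_finite)
  ultimately show ?thesis by (intro exI[of _ mu] exI[of _ y]) (simp add: algebra_simps)
 qed
 \<comment> \<open>Induction on the degree above the bound: modulo the chosen generators
   \<open>x\<close> is some \<open>e y\<close>, and the component of \<open>e y\<close> in degree
   \<open>u\<close> comes from degree \<open>u - p\<close> of \<open>y\<close>.\<close>
 have T: "pr u x\<in>?T" if "x\<in>S" for u x using that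
 proof (induction "nat (u - L + 1)" arbitrary: u x rule: less_induct)
  case less
  show ?case
  proof (cases "u < L")
  case True thus ?thesis using pr(5) less.prems by (simp add: span_zero)
  next
  case False
  interpret pr: Vector_Spaces.linear scale scale "pr u" by (rule pr(1))
  obtain mu y where y: "x = (\<Sum>b\<in>B. mu b *s b) + e y" "y\<in>S" using dec[OF less.prems] by blast
  have "pr u b\<in>?T" if "b\<in>B" for b
  proof -
  have "b\<in>G" "b\<in>?T" using B(1) BT that by auto
  then obtain w where w: "pr w b = b" "!!u'. u' ~= w ==> pr u' b = 0" using hom by blast
  thus ?thesis using \<open>b\<in>?T\<close> by (cases "u = w") (simp_all add: span_zero)
  qed
  moreover have "pr (u - p) y\<in>?T" using False p less.hyps[of "u - p" y] y(2) by simp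
  ultimately show ?thesis unfolding y(1)
  by (simp add: pr.add pr.sum pr.scale pr(3)[OF y(2)]) (intro span_add span_sum span_scale eT)
  qed
 qed
 have "g\<in>?T" if g: "g\<in>G" for g
 proof -
  have "g\<in>S" using GS g by blast
  obtain u where "pr u g = g" using hom[OF g] by blast
  thus ?thesis using T[OF \<open>g\<in>S\<close>, of u] by simp
 qed
 hence "(e ^^ a) g\<in>?T" if "g\<in>G" for a g using that by (induction a) (auto intro: eT)
 hence "S \<subseteq> ?T" unfolding S by (intro span_minimal) auto
 moreover have BS: "B \<subseteq> S" using B(1) GS by blast
 ultimately have "hbasis e B S"
  by (intro hbasis_criterion[OF e sub cl _ finB BS]) (assumption | rule inj ind)+
 thus ?thesis using that B(1) by blast
qed

end

context vspace_pair
begin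

text \<open>Additivity of ranks along the sequence from \<open>U\<close> through \<open>W\<close> to
  \<open>Y\<close>. As \<open>out\<close> is injective modulo the operators, the sequence stays
  exact on the left after reduction; the images of \<open>B\<close> and lifts of \<open>F\<close>
  then generate \<open>W\<close> modulo \<open>e'\<close> and are independent there, which gives the
  two inequalities.\<close>

lemma hbasis_exact:
 assumes hU: "vs1.hbasis e B U" and e: "vlin s1 s1 e"
  and hW: "vs2.hbasis e' D W" and e': "vlin s2 s2 e'"
  and hY: "vs1.hbasis e F Y"
  and out: "vlin s1 s2 out" "out ` U \<subseteq> W" "!!x. x\<in>U ==> out (e x) = e' (out x)"
  and Ph: "vlin s2 s1 Ph" "Ph ` W = Y" "!!w. w\<in>W ==> Ph (e' w) = e (Ph w)"
  and ker: "!!w. w\<in>W ==> Ph w = 0 ==> w\<in>out ` U" "!!x. x\<in>U ==> Ph (out x) = 0"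
  and inj: "!!x. x\<in>U ==> out x\<in>e' ` W ==> x\<in>e ` U"
 shows "card D = card B + card F"
proof -
 interpret o: Vector_Spaces.linear s1 s2 out by fact
 interpret Ph: Vector_Spaces.linear s2 s1 Ph by fact
 have subW: "vs2.subspace W" and clW: "e' ` W \<subseteq> W" and subU: "vs1.subspace U"
  using vs2.hb_subspace[OF hW] vs2.hbasis_closed[OF hW e'] vs1.hb_subspace[OF hU] by auto
 note fin = vs1.hb_finite[OF hU] vs1.hb_finite[OF hY]
 have "\<forall>f\<in>F. \<exists>w\<in>W. Ph w = f" using vs1.hbasis_mem[OF hY] Ph(2) by fastforce
 then obtain l where l: "!!f. f\<in>F ==> l f\<in>W" "!!f. f\<in>F ==> Ph (l f) = f" by metis
 have outB: "out b\<in>W" if "b\<in>B" for b using that vs1.hbasis_mem[OF hU] out(2) by blast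
 have "card D <= card (out ` B \<union> l ` F)"
 proof (rule vs2.card_le_spanning(1)[OF hW e'])
  show "finite (out ` B \<union> l ` F)" using fin by simp
  show "out ` B \<union> l ` F \<subseteq> W" using outB l by auto
  fix w assume w: "w\<in>W"
  have "Ph w\<in>Y" using Ph(2) w by blast
  then obtain nu where nu: "Ph w - (\<Sum>f\<in>F. s1 (nu f) f)\<in>e ` Y"
  by (rule vs1.hb_comb[OF hY e])
  then obtain y where "y\<in>Y" "Ph w - (\<Sum>f\<in>F. s1 (nu f) f) = e y" by blast
  then obtain w' where w': "w'\<in>W" "Ph w - (\<Sum>f\<in>F. s1 (nu f) f) = Ph (e' w')" using Ph(2,3) by auto
  let ?v = "w - (\<Sum>f\<in>F. s2 (nu f) (l f)) - e' w'"
  have "?v\<in>W" using w w' clW l(1) by (intro vs2.subspace_diff vs2.subspace_sum vs2.subspace_scale subW) auto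
  moreover have "Ph ?v = 0" using w'(2) l(2) by (simp add: Ph.diff Ph.sum Ph.scale)
  ultimately obtain u where u: "u\<in>U" "?v = out u" using ker(1) by blast
  obtain mu where mu: "u - (\<Sum>b\<in>B. s1 (mu b) b)\<in>e ` U"
  by (rule vs1.hb_comb[OF hU e u(1)])
  then obtain u' where u': "u'\<in>U" "u - (\<Sum>b\<in>B. s1 (mu b) b) = e u'" by blast
  let ?y = "(\<Sum>f\<in>F. s2 (nu f) (l f)) + (\<Sum>b\<in>B. s2 (mu b) (out b))"
  have "out u = (\<Sum>b\<in>B. s2 (mu b) (out b)) + e' (out u')"
  using arg_cong[OF u'(2), of out] out(3)[OF u'(1)] by (simp add: o.diff o.sum o.scale algebra_simps)
  hence "w - ?y = e' (out u') + e' w'" using u(2) by (simp add: algebra_simps)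
  also have "\<dots> = e' (out u' + w')" using e' by (simp add: Vector_Spaces.linear_iff)
  finally have "w - ?y\<in>e' ` W" using u'(1) w'(1) out(2) subW vs2.subspace_add by blast
  moreover have "?y\<in>vs2.span (out ` B \<union> l ` F)"
  by (intro vs2.span_add vs2.span_sum vs2.span_scale vs2.span_base) auto
  ultimately show "\<exists>y\<in>vs2.span (out ` B \<union> l ` F). w - y\<in>e' ` W" by blast
 qed
 also have "\<dots> <= card (out ` B) + card (l ` F)" by (rule card_Un_le)
 also have "\<dots> <= card B + card F" using fin by (intro add_mono card_image_le)
 finally have 1: "card D <= card B + card F" .
 have "card (B <+> F) <= card D"
 proof (rule vs2.card_le_indep[OF hW e'])
  show "finite (B <+> F)" using fin by simp
  show "case_sum out l ` (B <+> F) \<subseteq> W" using outB l by auto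
  fix kp :: "'v + 'v => 'k" and j
  assume s: "(\<Sum>j\<in>B <+> F. s2 (kp j) (case_sum out l j))\<in>e' ` W" and j: "j\<in>B <+> F"
  let ?b = "\<Sum>b\<in>B. s1 (kp (Inl b)) b"
  have eq: "(\<Sum>j\<in>B <+> F. s2 (kp j) (case_sum out l j)) = out ?b + (\<Sum>f\<in>F. s2 (kp (Inr f)) (l f))"
  using fin by (simp add: sum.Plus o.sum o.scale)
  have bU: "?b\<in>U" by (intro vs1.subspace_sum vs1.subspace_scale subU vs1.hbasis_mem[OF hU])
  obtain w where w: "w\<in>W" "out ?b + (\<Sum>f\<in>F. s2 (kp (Inr f)) (l f)) = e' w" using s eq by auto
  have "Ph (out ?b + (\<Sum>f\<in>F. s2 (kp (Inr f)) (l f))) = (\<Sum>f\<in>F. s1 (kp (Inr f)) f)"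
  using ker(2)[OF bU] l(2) by (simp add: Ph.add Ph.sum Ph.scale)
  hence "(\<Sum>f\<in>F. s1 (kp (Inr f)) f) = e (Ph w)" using w Ph(3) by simp
  hence "(\<Sum>f\<in>F. s1 (kp (Inr f)) f)\<in>e ` Y" using w(1) Ph(2) by blast
  hence F0: "kp (Inr f) = 0" if "f\<in>F" for f
  using vs1.hbasis_mod[OF hY e, of "%_ f. kp (Inr f)" 1 0 f] that by simp
  hence "out ?b = e' w" using w(2) by simp
  hence "?b\<in>e ` U" using inj[OF bU] w(1) by blast
  hence "kp (Inl b) = 0" if "b\<in>B" for b
  using vs1.hbasis_mod[OF hU e, of "%_ b. kp (Inl b)" 1 0 b] that by simp
  thus "kp j = 0" using F0 j by auto
 qed
 thus ?thesis using 1 fin by (simp add: card_Plus)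
qed

end

definition cc :: "('i => 'i => int) => 'i => 'i => nat" where
 "cc C i j = nat (- C i j)"

lemma cc_pos: "adj C i j ==> cc C i j > 0"
 by (simp add: cc_def adj_def)

section \<open>Reflections of rigid representations\<close>

lemma sum_Sigma:
 "finite A ==> (!!x. x\<in>A ==> finite (B x)) ==> sum f (Sigma A B) = (\<Sum>x\<in>A. \<Sum>y\<in>B x. f (x, y))"
 by (subst sum.Sigma) (auto simp: case_prod_unfold)

text \<open>The vanishing of the first extension group of \<open>V\<close> by itself, for representations of the
 quiver with the arrows \<open>k \<rightarrow> l\<close> such that \<open>R k l\<close>.\<close>

definition (in vspace) rigid ::
  "('i => 'i => int) => ('i => 'v => 'v) => ('i => 'i => 'v => 'v) => ('i => 'i => bool) => ('i => 'v set) => bool"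
 where
 "rigid C E Al R V \<longleftrightarrow> (\<forall>xi.
  (\<forall>k l. adj C l k & R k l --> vend scale (xi l k) & xi l k ` V k \<subseteq> V l
  & (\<forall>x\<in>V k. xi l k ((E k ^^ cc C k l) x) = (E l ^^ cc C l k) (xi l k x)))
  --> (\<exists>f. (\<forall>k. vend scale (f k) & f k ` V k \<subseteq> V k
  & (\<forall>x\<in>V k. f k (E k x) = E k (f k x)))
  & (\<forall>k l. adj C l k & R k l --> (\<forall>x\<in>V k. xi l k x = f l (Al l k x) - Al l k (f k x)))))"

text \<open>The setting of one step: \<open>V\<close> is the current window, \<open>V j\<close> its
  oldest piece and \<open>Y\<close> the piece that will replace it. For neighbours,
  \<open>R k l\<close> says that the arrow points from \<open>V k\<close> to \<open>V l\<close>; by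
  \<open>R_source\<close> the vertex \<open>j\<close> is a source. After the step it is a
  sink.\<close>

locale reflection = vspace scale
 for scale :: "'k::field => 'v::ab_group_add => 'v" (infixr "*s" 75) +
 fixes C :: "'i::finite => 'i => int" and E :: "'i => 'v => 'v" and Al :: "'i => 'i => 'v => 'v"
  and om :: "'i => 'k" and V :: "'i => 'v set" and B :: "'i => 'v set" and j :: 'i and Y :: "'v set"
  and R :: "'i => 'i => bool"
 assumes lin_E: "vend scale (E k)"
  and lin_Al: "vend scale (Al k l)"
  and adj_sym: "adj C k l ==> adj C l k"
  and om: "adj C j k ==> om k ~= 0"
  and R_source: "k ~= j ==> R j k"
  and basis: "hbasis (E k) (B k) (V k)"
  and Y: "subspace Y" "E j ` Y \<subseteq> Y"
  and Al_out: "adj C j k ==> x\<in>V j ==> Al k j x\<in>V k"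
  and Al_in: "adj C j k ==> x\<in>V k ==> Al j k x\<in>Y"
  and rel_out: "adj C j k ==> x\<in>V j ==> Al k j ((E j ^^ cc C j k) x) = (E k ^^ cc C k j) (Al k j x)"
  and rel_in: "adj C j k ==> x\<in>V k ==> Al j k ((E k ^^ cc C k j) x) = (E j ^^ cc C j k) (Al j k x)"
begin

definition Ix :: "('i \<times> nat) set" where
 "Ix = (SIGMA k : nbs C j. {..<cc C j k})"

text \<open>The direct sum over the neighbours \<open>k\<close> of \<open>j\<close> of the modules
  induced from \<open>V k\<close> along the identification of \<open>E k ^^ cc C k j\<close> with
  \<open>E j ^^ cc C j k\<close>; the entry at \<open>(k, a)\<close> is the coefficient of the
  \<open>a\<close>-th power of the variable at \<open>j\<close>.\<close>

definition W :: "('i \<times> nat => 'v) set" where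
 "W = {w. \<forall>p. if p\<in>Ix then w p\<in>V (fst p) else w p = 0}"

definition Ph :: "('i \<times> nat => 'v) => 'v" where
 "Ph w = (\<Sum>p\<in>Ix. (E j ^^ snd p) (Al j (fst p) (w p)))"

text \<open>The mesh relation (R2) read as a map: \<open>Ph\<close> composed with it is the action
  of the mesh element. The exponents run backwards as in the relation, which is what makes the map
  commute with the variable.\<close>

definition out :: "'v => 'i \<times> nat => 'v" where
 "out u = (%p. if p\<in>Ix then om (fst p) *s Al (fst p) j ((E j ^^ (cc C j (fst p) - 1 - snd p)) u) else 0)"

text \<open>The variable at \<open>j\<close> on the induced module: exponents go up by one, and the
  top one wraps around to 0 at the price of \<open>E k ^^ cc C k j\<close>.\<close>

definition ep :: "('i \<times> nat => 'v) => 'i \<times> nat => 'v" where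
 "ep w = (%p. if p\<in>Ix then
  (if snd p = 0 then (E (fst p) ^^ cc C (fst p) j) (w (fst p, cc C j (fst p) - 1)) else w (fst p, snd p - 1)) else 0)"

definition sW :: "'k => ('i \<times> nat => 'v) => 'i \<times> nat => 'v" where
 "sW c w = (%p. c *s w p)"

definition dl :: "'i => 'v => 'i \<times> nat => 'v" where
 "dl k y = (%p. if p = (k, 0) then y else 0)"

sublocale W: vspace sW
 by unfold_locales (auto simp: sW_def fun_eq_iff scale_right_distrib scale_left_distrib)

sublocale VW: vspace_pair scale sW ..

sublocale WV: vspace_pair sW scale ..

lemma sW_apply [simp]: "sW c w p = c *s w p"
 by (simp add: sW_def)

lemma ep_apply: "ep w p = (if p\<in>Ix then
  (if snd p = 0 then (E (fst p) ^^ cc C (fst p) j) (w (fst p, cc C j (fst p) - 1)) else w (fst p, snd p - 1)) else 0)"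
 by (simp add: ep_def)

lemma E_pow_linear: "vend scale (E k ^^ n)"
 by (rule linear_funpow[OF lin_E])

lemma E_pows: "(E k ^^ n) (x + y) = (E k ^^ n) x + (E k ^^ n) y"
 "(E k ^^ n) (x - y) = (E k ^^ n) x - (E k ^^ n) y" "(E k ^^ n) (c *s x) = c *s (E k ^^ n) x"
 "(E k ^^ n) 0 = 0" "(E k ^^ n) (sum h I) = (\<Sum>i\<in>I. (E k ^^ n) (h i))"
proof -
 interpret e: Vector_Spaces.linear scale scale "E k ^^ n" by (rule E_pow_linear)
 show "(E k ^^ n) (x + y) = (E k ^^ n) x + (E k ^^ n) y"
  "(E k ^^ n) (x - y) = (E k ^^ n) x - (E k ^^ n) y" "(E k ^^ n) (c *s x) = c *s (E k ^^ n) x"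
  "(E k ^^ n) 0 = 0" "(E k ^^ n) (sum h I) = (\<Sum>i\<in>I. (E k ^^ n) (h i))"
  by (rule e.add e.diff e.scale e.zero e.sum)+
qed

lemmas E_simps = E_pows[where n = 1, simplified]

lemma Al_simps: "Al k l (x + y) = Al k l x + Al k l y"
 "Al k l (x - y) = Al k l x - Al k l y" "Al k l (c *s x) = c *s Al k l x"
 "Al k l 0 = 0" "Al k l (sum h I) = (\<Sum>i\<in>I. Al k l (h i))"
proof -
 interpret e: Vector_Spaces.linear scale scale "Al k l" by (rule lin_Al)
 show "Al k l (x + y) = Al k l x + Al k l y"
  "Al k l (x - y) = Al k l x - Al k l y" "Al k l (c *s x) = c *s Al k l x"
  "Al k l 0 = 0" "Al k l (sum h I) = (\<Sum>i\<in>I. Al k l (h i))"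
  by (rule e.add e.diff e.scale e.zero e.sum)+
qed

lemma linearI_vs:
 "vector_space s1 ==> vector_space s2 ==> (!!x y. f (x + y) = f x + f y) ==> (!!c x. f (s1 c x) = s2 c (f x))
  ==> vlin s1 s2 f"
 by (simp add: Vector_Spaces.linear_iff)

lemma finite_Ix: "finite Ix"
 by (simp add: Ix_def)

lemma V_sub: "subspace (V k)" and V_E: "E k ` V k \<subseteq> V k"
 using hb_subspace[OF basis] hbasis_closed[OF basis lin_E] by auto

lemma V_E_pow: "x\<in>V k ==> (E k ^^ n) x\<in>V k"
 by (rule funpow_mem[OF V_E])

lemma sub_W: "W.subspace W"
 using subspace_0[OF V_sub] subspace_add[OF V_sub] subspace_scale[OF V_sub]
 by (auto simp: W.subspace_def W_def)

lemma Ph_linear: "vlin sW scale Ph"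
 by (intro linearI_vs W.vector_space_axioms vector_space_axioms)
  (simp_all add: Ph_def Al_simps E_pows sum.distrib scale_sum_right)

lemma out_linear: "vlin scale sW out"
 by (intro linearI_vs W.vector_space_axioms vector_space_axioms)
  (auto simp: out_def Al_simps E_pows fun_eq_iff scale_right_distrib mult.commute)

lemma ep_linear: "vlin sW sW ep"
 by (intro linearI_vs W.vector_space_axioms vector_space_axioms)
  (auto simp: ep_apply E_pows fun_eq_iff)

lemma IxD: "p\<in>Ix ==> adj C j (fst p)" "p\<in>Ix ==> snd p < cc C j (fst p)"
 by (auto simp: Ix_def)

lemma Ix_iff: "(k, a)\<in>Ix \<longleftrightarrow> adj C j k & a < cc C j k"
 by (auto simp: Ix_def)

lemma WD: "w\<in>W ==> p\<in>Ix ==> w p\<in>V (fst p)" "w\<in>W ==> p \<notin> Ix ==> w p = 0"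
 unfolding W_def mem_Collect_eq by (metis)+

lemma out_W: "u\<in>V j ==> out u\<in>W"
 using IxD by (auto simp: W_def out_def intro!: subspace_scale V_sub Al_out V_E_pow)

lemma ep_W: "w\<in>W ==> ep w\<in>W"
 unfolding W_def mem_Collect_eq
proof (rule allI)
 fix p :: "'i \<times> nat" assume w: "\<forall>p. if p\<in>Ix then w p\<in>V (fst p) else w p = 0"
 obtain k a where p: "p = (k, a)" by (cases p)
 show "if p\<in>Ix then ep w p\<in>V (fst p) else ep w p = 0"
 proof (cases "p\<in>Ix")
  case True
  hence "(k, cc C j k - 1)\<in>Ix" "a > 0 --> (k, a - 1)\<in>Ix" by (auto simp: p Ix_iff)
  thus ?thesis using w[rule_format, of "(k, cc C j k - 1)"] w[rule_format, of "(k, a - 1)"]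
  by (auto simp: ep_apply p intro!: V_E_pow)
 qed (simp add: ep_apply)
qed

lemma dl_W: "adj C j k ==> y\<in>V k ==> dl k y\<in>W"
 using cc_pos[of C j k] by (auto simp: W_def dl_def Ix_iff subspace_0[OF V_sub])

lemma Ph_dl: "adj C j k ==> Ph (dl k y) = Al j k y"
proof -
 assume a: "adj C j k"
 have "Ph (dl k y) = (\<Sum>p\<in>Ix. if p = (k, 0) then Al j k y else 0)"
  unfolding Ph_def by (intro sum.cong) (auto simp: dl_def Al_simps E_pows)
 thus ?thesis using a cc_pos[OF a] finite_Ix by (simp add: Ix_iff)
qed

lemma Ph_Y: "w\<in>W ==> Ph w\<in>Y"
 unfolding Ph_def by (intro subspace_sum Y funpow_mem[OF Y(2)] Al_in) (auto dest: IxD WD)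

lemma Ph_ep: assumes w: "w\<in>W" shows "Ph (ep w) = E j (Ph w)"
proof -
 have "Ph (ep w) = (\<Sum>k\<in>nbs C j. \<Sum>a<cc C j k. (E j ^^ a) (Al j k (ep w (k, a))))"
  unfolding Ph_def Ix_def by (subst sum.Sigma) (auto simp: case_prod_unfold)
 also have "\<dots> = (\<Sum>k\<in>nbs C j. \<Sum>a<cc C j k. (E j ^^ Suc a) (Al j k (w (k, a))))"
 proof (rule sum.cong[OF refl])
  fix k assume "k\<in>nbs C j"
  hence k: "adj C j k" by simp
  obtain c where c: "cc C j k = Suc c" using cc_pos[OF k] gr0_conv_Suc by auto
  have wk: "w (k, c)\<in>V k" using WD(1)[OF w, of "(k, c)"] k c by (simp add: Ix_iff)
  have 0: "Al j k (ep w (k, 0)) = (E j ^^ Suc c) (Al j k (w (k, c)))"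
  using rel_in[OF k wk] k c by (simp add: ep_apply Ix_iff del: funpow.simps)
  have S: "(E j ^^ Suc a) (Al j k (ep w (k, Suc a))) = (E j ^^ Suc a) (Al j k (w (k, a)))" if "a < c" for a
  using that k c by (simp add: ep_apply Ix_iff)
  have "(\<Sum>a<cc C j k. (E j ^^ a) (Al j k (ep w (k, a))))
  = Al j k (ep w (k, 0)) + (\<Sum>a<c. (E j ^^ Suc a) (Al j k (ep w (k, Suc a))))"
  unfolding c by (subst sum.lessThan_Suc_shift) simp
  also have "\<dots> = (E j ^^ Suc c) (Al j k (w (k, c))) + (\<Sum>a<c. (E j ^^ Suc a) (Al j k (w (k, a))))"
  using 0 S by (metis (no_types, lifting) lessThan_iff sum.cong)
  finally show "(\<Sum>a<cc C j k. (E j ^^ a) (Al j k (ep w (k, a)))) = (\<Sum>a<cc C j k. (E j ^^ Suc a) (Al j k (w (k, a))))"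
  unfolding c by (simp add: add.commute)
 qed
 also have "\<dots> = (\<Sum>p\<in>Ix. E j ((E j ^^ snd p) (Al j (fst p) (w p))))"
  unfolding Ix_def by (subst sum.Sigma) (auto simp: case_prod_unfold)
 also have "\<dots> = E j (Ph w)" by (simp add: Ph_def E_simps)
 finally show ?thesis .
qed

lemma out_E: assumes u: "u\<in>V j" shows "out (E j u) = ep (out u)"
proof
 fix p :: "'i \<times> nat" obtain k a where p: "p = (k, a)" by (cases p)
 show "out (E j u) p = ep (out u) p"
 proof (cases "p\<in>Ix")
  case True
  hence k: "adj C j k" "a < cc C j k" by (auto simp: p Ix_iff)
  show ?thesis
  proof (cases a)
  case 0
  have "(E j ^^ (cc C j k - 1)) (E j u) = (E j ^^ cc C j k) u"
  using k by (metis Suc_pred' cc_pos comp_apply funpow_Suc_right)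
  thus ?thesis using 0 k rel_out[OF k(1) u] by (simp add: out_def ep_apply p Ix_iff E_pows)
  next
  case (Suc b)
  have "(E j ^^ (cc C j k - 1 - a)) (E j u) = (E j ^^ (cc C j k - 1 - b)) u"
  using k Suc by (metis (no_types, lifting) Suc_diff_Suc Suc_lessD comp_apply diff_Suc_1 diff_Suc_eq_diff_pred diff_diff_left funpow_Suc_right less_imp_Suc_add plus_1_eq_Suc)
  thus ?thesis using Suc k by (simp add: out_def ep_apply p Ix_iff)
  qed
 qed (simp add: out_def ep_apply)
qed

lemma out_E_pow: "u\<in>V j ==> out ((E j ^^ n) u) = (ep ^^ n) (out u)"
 by (induction n) (auto simp: out_E V_E_pow)

lemma ep_pow_W: "w\<in>W ==> (ep ^^ n) w\<in>W"
 by (induction n) (auto simp: ep_W)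

lemma ep_pow_shift: "(k, a)\<in>Ix ==> b <= a ==> (ep ^^ b) w (k, a) = w (k, a - b)"
proof (induction b arbitrary: a)
 case (Suc b)
 hence "(k, a - 1)\<in>Ix" by (auto simp: Ix_iff)
 hence "(ep ^^ b) w (k, a - 1) = w (k, a - 1 - b)" using Suc.prems by (intro Suc.IH) auto
 moreover have "(ep ^^ Suc b) w (k, a) = ep ((ep ^^ b) w) (k, a)" by simp
 moreover have "\<dots> = (ep ^^ b) w (k, a - 1)" by (subst ep_apply) (use Suc.prems in simp)
 ultimately show ?case by simp
qed simp

text \<open>A full cycle of the variable returns to the same entry and meets the wrap-around once.
  In the last entry \<open>rigid_reflected\<close> reads off a cocycle, and this makes it
  semilinear.\<close>

lemma ep_pow_full:
 assumes k: "adj C j k"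
 shows "(ep ^^ cc C j k) w (k, cc C j k - 1) = (E k ^^ cc C k j) (w (k, cc C j k - 1))"
proof -
 let ?c = "cc C j k - 1"
 have "cc C j k = Suc ?c" using cc_pos[OF k] by simp
 hence "(ep ^^ cc C j k) w = (ep ^^ ?c) (ep w)" by (metis comp_apply funpow_Suc_right)
 hence "(ep ^^ cc C j k) w (k, ?c) = ep w (k, 0)"
  using ep_pow_shift[of k ?c ?c "ep w"] cc_pos[OF k] k by (simp add: Ix_iff)
 thus ?thesis using k cc_pos[OF k] by (simp add: ep_apply Ix_iff)
qed

lemma ep_inj: assumes w: "w\<in>W" and 0: "ep w = 0" shows "w = 0"
proof
 fix p :: "'i \<times> nat" obtain k a where p: "p = (k, a)" by (cases p)
 show "w p = 0 p"
 proof (cases "p\<in>Ix")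
  case True
  hence k: "adj C j k" "a < cc C j k" by (auto simp: p Ix_iff)
  show ?thesis
  proof (cases "Suc a < cc C j k")
  case True
  have "ep w (k, Suc a) = 0" using 0 by simp
  thus ?thesis using True k by (simp add: ep_apply Ix_iff p)
  next
  case False
  hence a: "a = cc C j k - 1" using k by simp
  have "ep w (k, 0) = 0" using 0 by simp
  hence e: "(E k ^^ cc C k j) (w p) = 0" using k a by (simp add: ep_apply Ix_iff p split: if_splits)
  have "x\<in>V k ==> (E k ^^ n) x = 0 ==> x = 0" for n x
  by (induction n) (auto dest: hbasis_inj[OF basis lin_E, rotated] simp: V_E_pow)
  thus ?thesis using e WD(1)[OF w \<open>p\<in>Ix\<close>] by (simp add: p)
  qed
 qed (use WD(2)[OF w] in simp)
qed

lemma ep_pow_dl: "adj C j k ==> a < cc C j k ==> (ep ^^ a) (dl k y) = (%p. if p = (k, a) then y else 0)"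
proof (induction a)
 case 0 thus ?case by (simp add: dl_def)
next
 case (Suc a)
 thus ?case by (auto simp: ep_apply Ix_iff fun_eq_iff E_pows)
qed

lemma ep_pow_dl_full: assumes k: "adj C j k" shows "(ep ^^ cc C j k) (dl k y) = dl k ((E k ^^ cc C k j) y)"
proof -
 obtain c where c: "cc C j k = Suc c" using cc_pos[OF k] gr0_conv_Suc by auto
 have "(ep ^^ cc C j k) (dl k y) = ep (%p. if p = (k, c) then y else 0)"
  using ep_pow_dl[OF k, of c y] by (simp add: c)
 also have "\<dots> = dl k ((E k ^^ cc C k j) y)"
  using k c by (auto simp: ep_apply dl_def Ix_iff fun_eq_iff E_pows)
 finally show ?thesis .
qed

lemma ep_pow_dl_mult:
 "adj C j k ==> (ep ^^ (cc C j k * q)) (dl k y) = dl k ((E k ^^ (cc C k j * q)) y)"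
 by (induction q) (simp_all add: funpow_add ep_pow_dl_full)

text \<open>Over the polynomial ring in \<open>E k ^^ cc C k j\<close>, the module
  \<open>V k\<close> is free on the elements \<open>(E k ^^ r) b\<close> with
  \<open>r < cc C k j\<close>. Inducing up makes them a basis over the variable at \<open>j\<close>,
  whence the factor \<open>cc C k j\<close> in the rank.\<close>

lemma hbasis_W:
 obtains D where "W.hbasis ep D W" "card D = (\<Sum>k\<in>nbs C j. cc C k j * card (B k))"
proof -
 define J where "J = (SIGMA k : nbs C j. {..<cc C k j} \<times> B k)"
 define g where "g = (%(k, r, b). dl k ((E k ^^ r) b))"
 have finJ: "finite J" unfolding J_def using hb_finite[OF basis] by auto
 have gW: "g p\<in>W" if "p\<in>J" for p
  using that hb_pow[OF basis] by (auto simp: g_def J_def intro: dl_W)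
 have ind: "kp p = 0" if s: "(\<Sum>p\<in>J. sW (kp p) (g p))\<in>ep ` W" and p: "p\<in>J" for kp p
 proof -
  obtain k r b where q: "p = (k, r, b)" by (cases p)
  have k: "adj C j k" "r < cc C k j" "b\<in>B k" using p by (auto simp: q J_def)
  obtain w where w: "w\<in>W" "(\<Sum>p\<in>J. sW (kp p) (g p)) = ep w" using s by blast
  \<comment> \<open>The entry at exponent 0 isolates the summand of \<open>k\<close>. An element in
    the image of \<open>ep\<close> has a multiple of \<open>E k ^^ cc C k j\<close> there, and
    \<open>hbasis_mod\<close> applies.\<close>
  have "(\<Sum>p\<in>J. sW (kp p) (g p)) (k, 0)
  = (\<Sum>k'\<in>nbs C j. if k' = k then \<Sum>p\<in>{..<cc C k j} \<times> B k. kp (k, p) *s (E k ^^ fst p) (snd p) else 0)"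
  unfolding J_def sum_apply
  by (subst sum_Sigma, simp, simp add: hb_finite[OF basis], rule sum.cong[OF refl])
  (auto simp: g_def dl_def case_prod_unfold)
  also have "\<dots> = (\<Sum>p\<in>{..<cc C k j} \<times> B k. kp (k, p) *s (E k ^^ fst p) (snd p))" using k by simp
  also have "\<dots> = (\<Sum>r<cc C k j. \<Sum>b\<in>B k. kp (k, r, b) *s (E k ^^ r) b)"
  by (simp add: sum.cartesian_product case_prod_unfold)
  finally have "(\<Sum>r<cc C k j. \<Sum>b\<in>B k. kp (k, r, b) *s (E k ^^ r) b) = ep w (k, 0)" using w(2) by simp
  also have "\<dots> = (E k ^^ cc C k j) (w (k, cc C j k - 1))" using k cc_pos[OF k(1)] by (simp add: ep_apply Ix_iff)
  finally have "(\<Sum>r<cc C k j. \<Sum>b\<in>B k. kp (k, r, b) *s (E k ^^ r) b)\<in>(E k ^^ cc C k j) ` V k"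
  using WD(1)[OF w(1), of "(k, cc C j k - 1)"] k cc_pos[OF k(1)] by (auto simp: Ix_iff)
  from hbasis_mod[OF basis lin_E this k(2,3)] show ?thesis by (simp add: q)
 qed
 have inj: "inj_on g J"
 proof (rule inj_onI, rule ccontr)
  fix p q assume pq: "p\<in>J" "q\<in>J" "g p = g q" "p ~= q"
  define kp where "kp x = (if x = p then 1 else if x = q then - 1 else (0::'k))" for x
  have "(\<Sum>x\<in>J. sW (kp x) (g x)) = (\<Sum>x\<in>J. (if x = p then g x else 0) - (if x = q then g x else 0))"
  using pq(4) by (intro sum.cong) (auto simp: kp_def fun_eq_iff)
  also have "\<dots> = ep 0" using pq finJ by (simp add: sum_subtractf ep_apply E_pows fun_eq_iff)
  finally have "(\<Sum>x\<in>J. sW (kp x) (g x))\<in>ep ` W" using W.subspace_0[OF sub_W] by simp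
  from ind[OF this pq(1)] show False by (simp add: kp_def)
 qed
 let ?T = "W.span {(ep ^^ a) b | a b. b\<in>g ` J}"
 have spV: "(%p. if p = (k, a) then y else 0)\<in>?T" if k: "adj C j k" "a < cc C j k" and y: "y\<in>V k" for k a y
  using y unfolding hb_span[OF basis]
 proof (induction rule: span_induct_alt)
  case base
  have "(%p. if p = (k, a) then 0 else 0) = (0 :: 'i \<times> nat => 'v)" by (auto simp: fun_eq_iff)
  thus ?case using W.span_zero by (simp only:)
 next
  case (step c x y)
  from step(1) obtain A b where x: "x = (E k ^^ A) b" "b\<in>B k" by auto
  \<comment> \<open>A power of \<open>E k\<close> splits into full cycles, which \<open>ep\<close>
    realises, and a remainder, which belongs to the chosen basis.\<close>
  let ?r = "A mod cc C k j" and ?q = "A div cc C k j"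
  have k': "adj C k j" using k(1) by (rule adj_sym)
  have "A = cc C k j * ?q + ?r" by simp
  hence "(E k ^^ (cc C k j * ?q)) ((E k ^^ ?r) b) = x" unfolding x(1) by (metis comp_apply funpow_add)
  hence e: "(ep ^^ (a + cc C j k * ?q)) (dl k ((E k ^^ ?r) b)) = (%p. if p = (k, a) then x else 0)"
  using k by (simp add: funpow_add ep_pow_dl_mult ep_pow_dl)
  have "dl k ((E k ^^ ?r) b)\<in>g ` J"
  using k x(2) cc_pos[OF k'] by (intro image_eqI[of _ _ "(k, ?r, b)"]) (auto simp: g_def J_def)
  hence "(%p. if p = (k, a) then x else 0)\<in>?T"
  unfolding e[symmetric] by (intro W.span_base) blast
  moreover have "(%p. if p = (k, a) then c *s x + y else 0) = sW c (%p. if p = (k, a) then x else 0) + (%p. if p = (k, a) then y else 0)"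
  by (auto simp: fun_eq_iff)
  ultimately show ?case using step(2) by (metis (no_types, lifting) W.span_add W.span_scale)
 qed
 have "W \<subseteq> ?T"
 proof
  fix w assume w: "w\<in>W"
  have eq: "w = (\<Sum>p\<in>Ix. (%q. if q = p then w p else 0))"
  using WD(2)[OF w] finite_Ix by (auto simp: fun_eq_iff sum_apply)
  have m: "(%q. if q = p then w p else 0)\<in>?T" if "p\<in>Ix" for p
  using spV[of "fst p" "snd p" "w p"] WD(1)[OF w that] IxD[OF that] by simp
  show "w\<in>?T" by (subst eq, rule W.span_sum, rule m)
 qed
 hence sp: "W \<subseteq> ?T" .
 have fin: "finite (g ` J)" and sub: "g ` J \<subseteq> W" using finJ gW by auto
 have indJ: "kp x = 0" if s: "(\<Sum>x\<in>g ` J. sW (kp x) x)\<in>ep ` W" and x: "x\<in>g ` J" for kp x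
 proof -
  obtain p where p: "p\<in>J" "x = g p" using x by blast
  have "(\<Sum>p\<in>J. sW (kp (g p)) (g p))\<in>ep ` W"
  using s unfolding sum.reindex[OF inj] comp_def .
  thus ?thesis using ind[of "%p. kp (g p)", OF _ p(1)] p(2) by blast
 qed
 have cl: "ep ` W \<subseteq> W" using ep_W by blast
 have "W.hbasis ep (g ` J) W"
  by (rule W.hbasis_criterion[OF ep_linear sub_W cl _ fin sub _ sp]) (assumption | rule ep_inj indJ)+
 moreover have "card (g ` J) = (\<Sum>k\<in>nbs C j. cc C k j * card (B k))"
  using hb_finite[OF basis] by (subst card_image[OF inj]) (simp add: J_def card_cartesian_product)
 ultimately show ?thesis using that by blast
qed

end

lemma (in vspace) rigidE:
 assumes "rigid C E Al R V"
  and "!!k l. adj C l k ==> R k l ==> vend scale (xi l k)"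
  and "!!k l. adj C l k ==> R k l ==> xi l k ` V k \<subseteq> V l"
  and "!!k l x. adj C l k ==> R k l ==> x\<in>V k ==> xi l k ((E k ^^ cc C k l) x) = (E l ^^ cc C l k) (xi l k x)"
 obtains f where "!!k. vend scale (f k)" "!!k. f k ` V k \<subseteq> V k"
  "!!k x. x\<in>V k ==> f k (E k x) = E k (f k x)"
  "!!k l x. adj C l k ==> R k l ==> x\<in>V k ==> xi l k x = f l (Al l k x) - Al l k (f k x)"
proof -
 have "\<exists>f. (\<forall>k. vend scale (f k) & f k ` V k \<subseteq> V k
  & (\<forall>x\<in>V k. f k (E k x) = E k (f k x)))
  & (\<forall>k l. adj C l k & R k l --> (\<forall>x\<in>V k. xi l k x = f l (Al l k x) - Al l k (f k x)))"
  using assms(2-4) by (intro assms(1)[unfolded rigid_def, rule_format]) auto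
 thus ?thesis by (elim exE conjE) (rule that, simp_all)
qed

lemma (in vspace) rigidI:
 assumes "!!xi. (!!k l. adj C l k ==> R k l ==> vend scale (xi l k)) ==>
  (!!k l. adj C l k ==> R k l ==> xi l k ` V k \<subseteq> V l) ==>
  (!!k l x. adj C l k ==> R k l ==> x\<in>V k ==> xi l k ((E k ^^ cc C k l) x) = (E l ^^ cc C l k) (xi l k x)) ==>
  \<exists>f. (\<forall>k. vend scale (f k) & f k ` V k \<subseteq> V k
  & (\<forall>x\<in>V k. f k (E k x) = E k (f k x)))
  & (\<forall>k l. adj C l k --> R k l --> (\<forall>x\<in>V k. xi l k x = f l (Al l k x) - Al l k (f k x)))"
 shows "rigid C E Al R V"
 unfolding rigid_def
proof (intro allI impI)
 fix xi assume a: "\<forall>k l. adj C l k & R k l --> vend scale (xi l k) & xi l k ` V k \<subseteq> V l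
  & (\<forall>x\<in>V k. xi l k ((E k ^^ cc C k l) x) = (E l ^^ cc C l k) (xi l k x))"
 show "\<exists>f. (\<forall>k. vend scale (f k) & f k ` V k \<subseteq> V k
  & (\<forall>x\<in>V k. f k (E k x) = E k (f k x)))
  & (\<forall>k l. adj C l k & R k l --> (\<forall>x\<in>V k. xi l k x = f l (Al l k x) - Al l k (f k x)))"
  using assms[of xi] a by (simp only: imp_conjL)
qed

text \<open>The mesh sequence from \<open>V j\<close> through \<open>W\<close> to \<open>Y\<close>
  is exact in the middle and on the right. Injectivity modulo the variable on the left is what
  rigidity has to supply.\<close>

locale rigid_reflection = reflection scale C E Al om V B j Y R
 for scale :: "'k::field => 'v::ab_group_add => 'v" (infixr "*s" 75)
  and C :: "'i::finite => 'i => int" and E Al om V B j Y R +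
 assumes gen: "Y = Ph ` W"
  and mesh: "x\<in>V j ==> Ph (out x) = 0"
  and exact: "w\<in>W ==> Ph w = 0 ==> w\<in>out ` V j"
  and rigid_V: "rigid C E Al R V"
begin

lemma EY_sub: "subspace (E j ` Y)"
proof -
 interpret e: Vector_Spaces.linear scale scale "E j" by (rule lin_E)
 show ?thesis using Y(1) by (rule e.subspace_image)
qed

lemma E_pow_EY: "y\<in>Y ==> a > 0 ==> (E j ^^ a) y\<in>E j ` Y"
 using funpow_mem[OF Y(2), of y "a - 1"] by (cases a) auto

text \<open>The cocycle is put on one arrow from \<open>j\<close> to \<open>k0\<close> and adjusted
  to a given \<open>x\<close> in \<open>V k0\<close>. Rigidity trivialises it by a family
  \<open>f\<close>, and the mesh relation at \<open>f j u\<close> then says that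
  \<open>Al j k0 x\<close> lies in \<open>E j Y\<close>. Such elements generate
  \<open>Y\<close>.\<close>

lemma not_reduced_imp_divisible:
 assumes u: "u\<in>V j" "out u\<in>ep ` W" "u \<notin> E j ` V j"
 shows "Y = E j ` Y"
proof -
 obtain mu where "u - (\<Sum>b\<in>B j. mu b *s b)\<in>E j ` V j"
  by (rule hb_comb[OF basis lin_E u(1)])
 then obtain u' where u': "u'\<in>V j" "u - (\<Sum>b\<in>B j. mu b *s b) = E j u'" by blast
 hence ueq: "u = (\<Sum>b\<in>B j. mu b *s b) + E j u'" by (simp add: algebra_simps)
 have "\<exists>b0\<in>B j. mu b0 ~= 0"
 proof (rule ccontr)
  assume "\<not> (\<exists>b0\<in>B j. mu b0 ~= 0)"
  hence "u = E j u'" using ueq by simp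
  thus False using u(3) u'(1) by blast
 qed
 then obtain b0 where b0: "b0\<in>B j" "mu b0 ~= 0" by blast
 have main: "Al j k0 x\<in>E j ` Y" if k0: "adj C j k0" and x: "x\<in>V k0" for k0 x
 proof -
  let ?c = "cc C j k0"
  \<comment> \<open>The factor cancels the coefficient \<open>mu b0\<close> of \<open>u\<close> and
    the sign \<open>om k0\<close>, so that the cocycle term in the mesh relation becomes
    \<open>Al j k0 x\<close> modulo \<open>E j Y\<close>.\<close>
  let ?g = "%r b. if r = ?c - 1 & b = b0 then (1 / (mu b0 * om k0)) *s x else 0"
  have cp: "?c > 0" using cc_pos[OF k0] .
  interpret vv: vspace_pair scale scale ..
  obtain xi0 where xi0: "vend scale xi0" "xi0 ` V j \<subseteq> V k0"
  "!!r b. r < ?c ==> b\<in>B j ==> xi0 ((E j ^^ r) b) = ?g r b"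
  "!!x. x\<in>V j ==> xi0 ((E j ^^ ?c) x) = (E k0 ^^ cc C k0 j) (xi0 x)"
  proof (rule vv.hbasis_extend[OF basis lin_E E_pow_linear V_sub _ cp])
  show "(E k0 ^^ cc C k0 j) ` V k0 \<subseteq> V k0" using V_E_pow by blast
  show "?g r b\<in>V k0" for r b using x by (simp add: subspace_scale[OF V_sub] subspace_0[OF V_sub])
  qed (assumption | rule that)+
  interpret xi0: Vector_Spaces.linear scale scale xi0 by (rule xi0(1))
  define xi where "xi l k = (if l = k0 & k = j then xi0 else (%x. 0))" for l k
  have lin0: "vend scale (%x. 0)"
  by (intro linearI_vs vector_space_axioms) simp_all
  have xi: "vend scale (xi l k)" "xi l k ` V k \<subseteq> V l"
  "x\<in>V k ==> xi l k ((E k ^^ cc C k l) x) = (E l ^^ cc C l k) (xi l k x)" for l k x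
  using xi0 lin0 by (auto simp: xi_def subspace_0[OF V_sub] E_pows)
  obtain f where f: "!!k. vend scale (f k)" "!!k. f k ` V k \<subseteq> V k"
  "!!k x. x\<in>V k ==> f k (E k x) = E k (f k x)"
  "!!k l x. adj C l k ==> R k l ==> x\<in>V k ==> xi l k x = f l (Al l k x) - Al l k (f k x)"
  by (rule rigidE[OF rigid_V xi]) (assumption | rule that)+
  have f_pow: "f k ((E k ^^ n) x) = (E k ^^ n) (f k x)" if "x\<in>V k" for k n x
  using that by (induction n) (auto simp: f(3) V_E_pow)
  let ?y = "f j u"
  have y: "?y\<in>V j" using f(2) u(1) by blast
  let ?z = "%k. (E j ^^ (cc C j k - 1)) u"
  \<comment> \<open>As \<open>out u\<close> is divisible by the variable, the part of the coboundary
    equation that involves \<open>f k\<close> ends up in \<open>E j Y\<close>; the leading mesh term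
    of \<open>f j u\<close> is therefore minus the cocycle term, modulo
    \<open>E j Y\<close>.\<close>
  have lead: "om k *s Al j k (Al k j ((E j ^^ (cc C j k - 1)) ?y)) + om k *s Al j k (xi k j (?z k))\<in>E j ` Y"
  if k: "adj C j k" for k
  proof -
  obtain w where w: "w\<in>W" "out u = ep w" using u(2) by blast
  have zV: "?z k\<in>V j" by (rule V_E_pow[OF u(1)])
  have kj: "k ~= j" "adj C k j" using k adj_sym[OF k] by (auto simp: adj_def)
  have p: "(k, cc C j k - 1)\<in>Ix" "(k, 0)\<in>Ix" using k cc_pos[OF k] by (auto simp: Ix_iff)
  let ?x = "w (k, cc C j k - 1)"
  have xV: "?x\<in>V k" using WD(1)[OF w(1) p(1)] by simp
  have "om k *s Al k j (?z k) = out u (k, 0)" using p by (simp add: out_def)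
  also have "\<dots> = (E k ^^ cc C k j) ?x" unfolding w(2) by (subst ep_apply) (use p in simp)
  finally have eq: "om k *s Al k j (?z k) = (E k ^^ cc C k j) ?x" .
  interpret fk: Vector_Spaces.linear scale scale "f k" by (rule f(1))
  have "Al k j ((E j ^^ (cc C j k - 1)) ?y) = Al k j (f j (?z k))" using f_pow[OF u(1)] by simp
  also have "\<dots> = f k (Al k j (?z k)) - xi k j (?z k)" using f(4)[OF kj(2) R_source[OF kj(1)] zV] by simp
  finally have "om k *s Al k j ((E j ^^ (cc C j k - 1)) ?y) + om k *s xi k j (?z k) = om k *s f k (Al k j (?z k))"
  by (simp add: scale_right_diff_distrib)
  also have "\<dots> = f k (om k *s Al k j (?z k))" by (simp add: fk.scale)
  also have "\<dots> = (E k ^^ cc C k j) (f k ?x)" unfolding eq by (rule f_pow[OF xV])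
  finally have "Al j k (om k *s Al k j ((E j ^^ (cc C j k - 1)) ?y) + om k *s xi k j (?z k)) = (E j ^^ cc C j k) (Al j k (f k ?x))"
  using rel_in[OF k, of "f k ?x"] f(2) xV by auto
  moreover have "\<dots>\<in>E j ` Y" using f(2) xV k cc_pos[OF k] by (intro E_pow_EY Al_in) auto
  ultimately show ?thesis by (simp add: Al_simps)
  qed
  have inY: "Al j k (Al k j ((E j ^^ n) ?y))\<in>Y" if "adj C j k" for k n
  using that by (intro Al_in Al_out V_E_pow y)
  \<comment> \<open>In the mesh relation at \<open>f j u\<close> every term with
    \<open>a > 0\<close> is a multiple of \<open>E j\<close>, so that only the leading terms
    \<open>a = 0\<close> matter.\<close>
  have "Ph (out ?y) = (\<Sum>k\<in>nbs C j. \<Sum>a<cc C j k. om k *s (E j ^^ a) (Al j k (Al k j ((E j ^^ (cc C j k - 1 - a)) ?y))))"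
  unfolding Ph_def by (subst Ix_def, subst sum_Sigma) (auto simp: out_def Ix_iff Al_simps E_pows intro!: sum.cong)
  hence "0 = (\<Sum>k\<in>nbs C j. \<Sum>a<cc C j k. om k *s (E j ^^ a) (Al j k (Al k j ((E j ^^ (cc C j k - 1 - a)) ?y))))"
  using mesh[OF y] by simp
  also have "\<dots> = (\<Sum>k\<in>nbs C j. om k *s Al j k (Al k j ((E j ^^ (cc C j k - 1)) ?y))
  + (\<Sum>a\<in>{0<..<cc C j k}. om k *s (E j ^^ a) (Al j k (Al k j ((E j ^^ (cc C j k - 1 - a)) ?y)))))"
  proof (rule sum.cong[OF refl])
  fix k assume "k\<in>nbs C j"
  hence "{..<cc C j k} = insert 0 {0<..<cc C j k}" using cc_pos[of C j k] by auto
  thus "(\<Sum>a<cc C j k. om k *s (E j ^^ a) (Al j k (Al k j ((E j ^^ (cc C j k - 1 - a)) ?y)))) =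
  om k *s Al j k (Al k j ((E j ^^ (cc C j k - 1)) ?y))
  + (\<Sum>a\<in>{0<..<cc C j k}. om k *s (E j ^^ a) (Al j k (Al k j ((E j ^^ (cc C j k - 1 - a)) ?y))))" by simp
  qed
  finally have s0: "(\<Sum>k\<in>nbs C j. om k *s Al j k (Al k j ((E j ^^ (cc C j k - 1)) ?y)))
  + (\<Sum>k\<in>nbs C j. \<Sum>a\<in>{0<..<cc C j k}. om k *s (E j ^^ a) (Al j k (Al k j ((E j ^^ (cc C j k - 1 - a)) ?y)))) = 0"
  (is "?A + ?B = 0") by (simp add: sum.distrib)
  have "?B\<in>E j ` Y" using inY
  by (intro subspace_sum EY_sub subspace_scale E_pow_EY) auto
  hence "- ?B\<in>E j ` Y" using EY_sub subspace_neg by blast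
  hence A: "?A\<in>E j ` Y" using s0 by (simp add: eq_neg_iff_add_eq_0[symmetric])
  have "?A + (\<Sum>k\<in>nbs C j. om k *s Al j k (xi k j (?z k)))\<in>E j ` Y"
  unfolding sum.distrib[symmetric] using lead by (intro subspace_sum EY_sub) auto
  from subspace_diff[OF EY_sub this A]
  have "(\<Sum>k\<in>nbs C j. om k *s Al j k (xi k j (?z k)))\<in>E j ` Y" by simp
  moreover have "(\<Sum>k\<in>nbs C j. om k *s Al j k (xi k j (?z k))) = (\<Sum>k\<in>nbs C j. if k = k0 then om k0 *s Al j k0 (xi0 (?z k0)) else 0)"
  by (intro sum.cong) (auto simp: xi_def Al_simps)
  ultimately have 1: "om k0 *s Al j k0 (xi0 (?z k0))\<in>E j ` Y" using k0 by simp
  have Suc: "Suc (?c - 1) = ?c" using cp by simp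
  have "(E j ^^ (?c - 1)) (E j u') = (E j ^^ ?c) u'" using Suc by (metis comp_apply funpow_Suc_right)
  \<comment> \<open>The part \<open>E j u'\<close> of \<open>u\<close> contributes a full power
    \<open>E j ^^ cc C j k0\<close>, which the cocycle carries to a multiple of
    \<open>E k0 ^^ cc C k0 j\<close>, and \<open>Al j k0\<close> from there into
    \<open>E j Y\<close>.\<close>
  hence "?z k0 = (\<Sum>b\<in>B j. mu b *s (E j ^^ (?c - 1)) b) + (E j ^^ ?c) u'"
  by (subst ueq) (simp add: E_pows)
  hence "xi0 (?z k0) = (\<Sum>b\<in>B j. mu b *s xi0 ((E j ^^ (?c - 1)) b)) + (E k0 ^^ cc C k0 j) (xi0 u')"
  using xi0(4)[OF u'(1)] by (simp add: xi0.add xi0.sum xi0.scale)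
  also have "(\<Sum>b\<in>B j. mu b *s xi0 ((E j ^^ (?c - 1)) b)) = (\<Sum>b\<in>B j. if b = b0 then (1 / om k0) *s x else 0)"
  using cp b0 by (intro sum.cong) (auto simp: xi0(3))
  also have "\<dots> = (1 / om k0) *s x" using b0(1) hb_finite[OF basis] by simp
  finally have "om k0 *s Al j k0 (xi0 (?z k0)) = Al j k0 x + om k0 *s (E j ^^ ?c) (Al j k0 (xi0 u'))"
  using om[OF k0] rel_in[OF k0, of "xi0 u'"] xi0(2) u'(1) by (auto simp: Al_simps scale_right_distrib)
  moreover have "om k0 *s (E j ^^ ?c) (Al j k0 (xi0 u'))\<in>E j ` Y"
  using xi0(2) u'(1) k0 cp by (intro subspace_scale EY_sub E_pow_EY Al_in) auto
  ultimately show ?thesis using subspace_diff[OF EY_sub 1] by (metis add_diff_cancel)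
 qed
 have "E j ` (E j ` Y) \<subseteq> E j ` Y" using Y(2) by blast
 hence "Ph w\<in>E j ` Y" if "w\<in>W" for w
  unfolding Ph_def using that
  by (intro subspace_sum EY_sub funpow_mem main) (auto dest: IxD WD)
 thus ?thesis using gen Y(2) by blast
qed

text \<open>As for reflection functors, cocycles are transported backwards. The components into the
  new sink \<open>Y\<close> lift to \<open>W\<close>, because the \<open>V k\<close> are free, and
  extend to an endomorphism \<open>N\<close> of \<open>W\<close>; composed with \<open>out\<close>
  it gives a cocycle on the arrows leaving the old \<open>V j\<close>. Rigidity of the old window
  yields \<open>f\<close>, and \<open>f\<close> corrected by \<open>N\<close> preserves the image of
  \<open>out\<close>, so it descends to \<open>Y\<close>.\<close>

lemma rigid_reflected:
 assumes R': "!!k l. k ~= j ==> l ~= j ==> R' k l ==> R k l" "!!k. \<not> R' j k"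
 shows "rigid C E Al R' (V(j := Y))"
proof (rule rigidI)
 fix xi :: "'i => 'i => 'v => 'v"
 assume xi1: "!!k l. adj C l k ==> R' k l ==> vend scale (xi l k)"
  and xi2: "!!k l. adj C l k ==> R' k l ==> xi l k ` (V(j := Y)) k \<subseteq> (V(j := Y)) l"
  and xi3: "!!k l x. adj C l k ==> R' k l ==> x\<in>(V(j := Y)) k ==> xi l k ((E k ^^ cc C k l) x) = (E l ^^ cc C l k) (xi l k x)"
 have neq: "k ~= j" if "adj C j k" for k using that by (auto simp: adj_def)
 \<comment> \<open>Arrows outside \<open>R'\<close> carry no data and get the zero map, so that the
   lifting below is uniform in \<open>k\<close>.\<close>
 define ch where "ch k = (if R' k j then xi j k else (%x. 0))" for k
 have lin0: "vend scale (%x. 0)"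
  by (intro linearI_vs vector_space_axioms) simp_all
 have chi1: "vend scale (ch k)" if "adj C j k" for k
  using xi1[OF that] lin0 by (simp add: ch_def)
 have chi2: "ch k x\<in>Y" if "adj C j k" "x\<in>V k" for k x
  using xi2[OF that(1)] that(2) neq[OF that(1)] subspace_0[OF Y(1)] by (auto simp: ch_def)
 have chi3: "ch k ((E k ^^ cc C k j) x) = (E j ^^ cc C j k) (ch k x)" if "adj C j k" "x\<in>V k" for k x
  using xi3[OF that(1)] that(2) neq[OF that(1)] by (auto simp: ch_def E_pows)
 have epW: "(ep ^^ n) ` W \<subseteq> W" for n using ep_pow_W by blast
 have ep_pow_lin: "vlin sW sW (ep ^^ n)" for n by (rule W.linear_funpow[OF ep_linear])
 have Ph_ep_pow: "Ph ((ep ^^ n) w) = (E j ^^ n) (Ph w)" if "w\<in>W" for n w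
  using that by (induction n) (auto simp: Ph_ep ep_pow_W)
 \<comment> \<open>Lift the values at the elements \<open>(E k ^^ r) b\<close> with
   \<open>r < cc C k j\<close> and extend semilinearly; the lift is then correct everywhere, since
   \<open>ch k\<close> and \<open>Ph\<close> respect the powers too.\<close>
 have "\<exists>et. vlin scale sW et & et ` V k \<subseteq> W & (\<forall>x\<in>V k. Ph (et x) = ch k x)
  & (\<forall>x\<in>V k. et ((E k ^^ cc C k j) x) = (ep ^^ cc C j k) (et x))" if k: "adj C j k" for k
 proof -
  have "\<forall>y. \<exists>w. y\<in>Y --> w\<in>W & Ph w = y" using gen by blast
  then obtain s where s: "!!y. y\<in>Y ==> s y\<in>W" "!!y. y\<in>Y ==> Ph (s y) = y" by metis
  have cp: "cc C k j > 0" by (rule cc_pos[OF adj_sym[OF k]])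
  obtain et where et: "vlin scale sW et" "et ` V k \<subseteq> W"
  "!!r b. r < cc C k j ==> b\<in>B k ==> et ((E k ^^ r) b) = s (ch k ((E k ^^ r) b))"
  "!!x. x\<in>V k ==> et ((E k ^^ cc C k j) x) = (ep ^^ cc C j k) (et x)"
  proof (rule VW.hbasis_extend[OF basis lin_E ep_pow_lin sub_W epW cp])
  show "s (ch k ((E k ^^ r) b))\<in>W" if "b\<in>B k" for r b
  using hb_pow[OF basis that] k by (intro s chi2)
  qed (assumption | rule that)+
  interpret et: Vector_Spaces.linear scale sW et by (rule et(1))
  interpret ch: Vector_Spaces.linear scale scale "ch k" by (rule chi1[OF k])
  interpret Ph: Vector_Spaces.linear sW scale Ph by (rule Ph_linear)
  have pw: "Ph (et ((E k ^^ n) b)) = ch k ((E k ^^ n) b)" if b: "b\<in>B k" for n b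
  proof (induction n rule: less_induct)
  case (less n)
  show ?case
  proof (cases "n < cc C k j")
  case True
  thus ?thesis using et(3)[OF True b] s(2) chi2[OF k] hb_pow[OF basis b] by simp
  next
  case False
  define m where "m = n - cc C k j"
  have n: "n = cc C k j + m" using False by (simp add: m_def)
  have x: "(E k ^^ m) b\<in>V k" by (rule hb_pow[OF basis b])
  have "et ((E k ^^ m) b)\<in>W" using et(2) x by blast
  thus ?thesis using less[of m] cp
  by (simp add: n funpow_add et(4)[OF x] chi3[OF k x] Ph_ep_pow)
  qed
  qed
  have "Ph (et x) = ch k x" if "x\<in>V k" for x
  using that unfolding hb_span[OF basis]
  proof (induction rule: span_induct_alt)
  case base thus ?case by (simp only: et.zero Ph.zero ch.zero)
  next
  case (step c x y)
  hence "Ph (et x) = ch k x" using pw by auto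
  thus ?case using step by (simp only: et.add et.scale Ph.add Ph.scale ch.add ch.scale)
  qed
  thus ?thesis using et by blast
 qed
 hence "\<exists>et. \<forall>k. adj C j k --> vlin scale sW (et k) & et k ` V k \<subseteq> W & (\<forall>x\<in>V k. Ph (et k x) = ch k x)
  & (\<forall>x\<in>V k. et k ((E k ^^ cc C k j) x) = (ep ^^ cc C j k) (et k x))"
  by (intro choice allI) (metis (no_types, lifting))
 then obtain et where eta0: "\<forall>k. adj C j k --> vlin scale sW (et k) & et k ` V k \<subseteq> W & (\<forall>x\<in>V k. Ph (et k x) = ch k x)
  & (\<forall>x\<in>V k. et k ((E k ^^ cc C k j) x) = (ep ^^ cc C j k) (et k x))"
  by (elim exE) (rule that)
 have eta: "adj C j k ==> vlin scale sW (et k)"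
  "adj C j k ==> x\<in>V k ==> et k x\<in>W" "adj C j k ==> x\<in>V k ==> Ph (et k x) = ch k x"
  "adj C j k ==> x\<in>V k ==> et k ((E k ^^ cc C k j) x) = (ep ^^ cc C j k) (et k x)" for k x
  using eta0 by blast+
 \<comment> \<open>The endomorphism of the induced module determined by the \<open>et k\<close> on
   the entries at exponent 0.\<close>
 define N where "N w = (\<Sum>p\<in>Ix. (ep ^^ snd p) (et (fst p) (w p)))" for w
 have epp: "(ep ^^ n) (x + y) = (ep ^^ n) x + (ep ^^ n) y" "(ep ^^ n) (sW c x) = sW c ((ep ^^ n) x)"
  "(ep ^^ n) (sum h I) = (\<Sum>i\<in>I. (ep ^^ n) (h i))" for n x y c and h :: "'i \<times> nat => 'i \<times> nat => 'v" and I
 proof -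
  interpret e: Vector_Spaces.linear sW sW "ep ^^ n" by (rule ep_pow_lin)
  show "(ep ^^ n) (x + y) = (ep ^^ n) x + (ep ^^ n) y" "(ep ^^ n) (sW c x) = sW c ((ep ^^ n) x)"
  "(ep ^^ n) (sum h I) = (\<Sum>i\<in>I. (ep ^^ n) (h i))" by (rule e.add e.scale e.sum)+
 qed
 have etal: "et k (x + y) = et k x + et k y" "et k (c *s x) = sW c (et k x)" if "adj C j k" for k x y c
  using eta(1)[OF that] by (simp_all only: Vector_Spaces.linear_iff)
 have Nlin: "vlin sW sW N"
 proof (intro linearI_vs W.vector_space_axioms)
  show "N (w + w') = N w + N w'" for w w'
  unfolding N_def sum.distrib[symmetric]
  by (intro sum.cong refl) (simp only: plus_fun_apply etal IxD epp)
  show "N (sW c w) = sW c (N w)" for c w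
  unfolding N_def W.scale_sum_right
  by (intro sum.cong refl) (simp only: sW_apply etal IxD epp)
 qed
 have NW: "N w\<in>W" if "w\<in>W" for w
  unfolding N_def using that by (intro W.subspace_sum sub_W ep_pow_W eta IxD) (auto dest: WD)
 have Ph_N: "Ph (N w) = (\<Sum>p\<in>Ix. (E j ^^ snd p) (ch (fst p) (w p)))" if "w\<in>W" for w
 proof -
  interpret Ph: Vector_Spaces.linear sW scale Ph by (rule Ph_linear)
  show ?thesis unfolding N_def Ph.sum
  using that by (intro sum.cong refl) (simp add: Ph_ep_pow eta IxD WD)
 qed
 have Nep: "N (ep w) = ep (N w)" if w: "w\<in>W" for w
 proof -
  have "N (ep w) = (\<Sum>k\<in>nbs C j. \<Sum>a<cc C j k. (ep ^^ a) (et k (ep w (k, a))))"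
  unfolding N_def Ix_def by (subst sum_Sigma) auto
  also have "\<dots> = (\<Sum>k\<in>nbs C j. \<Sum>a<cc C j k. (ep ^^ Suc a) (et k (w (k, a))))"
  proof (rule sum.cong[OF refl])
  fix k assume "k\<in>nbs C j"
  hence k: "adj C j k" by simp
  obtain c where c: "cc C j k = Suc c" using cc_pos[OF k] gr0_conv_Suc by auto
  have wk: "w (k, c)\<in>V k" using WD(1)[OF w, of "(k, c)"] k c by (simp add: Ix_iff)
  have e0: "ep w (k, 0) = (E k ^^ cc C k j) (w (k, c))" by (subst ep_apply) (use k c in \<open>simp add: Ix_iff\<close>)
  have eS: "ep w (k, Suc a) = w (k, a)" if "a < c" for a by (subst ep_apply) (use k c that in \<open>simp add: Ix_iff\<close>)
  have 0: "et k (ep w (k, 0)) = (ep ^^ Suc c) (et k (w (k, c)))"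
  using eta(4)[OF k wk] c e0 by simp
  have "(\<Sum>a<cc C j k. (ep ^^ a) (et k (ep w (k, a))))
  = et k (ep w (k, 0)) + (\<Sum>a<c. (ep ^^ Suc a) (et k (ep w (k, Suc a))))"
  unfolding c by (subst sum.lessThan_Suc_shift) simp
  also have "(\<Sum>a<c. (ep ^^ Suc a) (et k (ep w (k, Suc a)))) = (\<Sum>a<c. (ep ^^ Suc a) (et k (w (k, a))))"
  by (intro sum.cong refl) (simp add: eS)
  finally show "(\<Sum>a<cc C j k. (ep ^^ a) (et k (ep w (k, a)))) = (\<Sum>a<cc C j k. (ep ^^ Suc a) (et k (w (k, a))))"
  unfolding c 0 by (simp only: sum.lessThan_Suc add.commute)
  qed
  also have "\<dots> = (\<Sum>p\<in>Ix. (ep ^^ Suc (snd p)) (et (fst p) (w p)))"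
  unfolding Ix_def by (subst sum_Sigma) auto
  also have "\<dots> = ep (N w)"
  unfolding N_def using epp(3)[of 1 "%p. (ep ^^ snd p) (et (fst p) (w p))" Ix] by simp
  finally show ?thesis .
 qed
 have Nep_pow: "N ((ep ^^ n) w) = (ep ^^ n) (N w)" if "w\<in>W" for n w
  using that by (induction n) (auto simp: Nep ep_pow_W)
 \<comment> \<open>Only the last entry is needed: \<open>out\<close> has
   \<open>om l *s Al l j u\<close> there, free of powers of \<open>E j\<close>, and the other
   entries follow by applying the variable. The factor \<open>- 1 / om l\<close> is dictated by the
   identity \<open>key\<close>.\<close>
 define ze where "ze l k = (if k = j then (%u. (- 1 / om l) *s N (out u) (l, cc C j l - 1)) else xi l k)" for l k
 have N_out_add: "N (out (x + y)) = N (out x) + N (out y)" "N (out (c *s x)) = sW c (N (out x))" for x y c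
  using Nlin out_linear by (simp_all add: Vector_Spaces.linear_iff)
 have zeta1: "vend scale (ze l k)" if "adj C l k" "R k l" and R'': "k ~= j ==> R' k l" for k l
 proof (cases "k = j")
  case True
  thus ?thesis unfolding ze_def
  by (intro linearI_vs vector_space_axioms) (simp_all add: N_out_add scale_right_distrib mult.commute)
 qed (use xi1[OF that(1)] R'' in \<open>simp add: ze_def\<close>)
 have zeta_ok: "vend scale (if k = j \<or> (l ~= j & R' k l) then ze l k else (%x. 0))"
  if "adj C l k" "R k l" for k l
  using zeta1[OF that] lin0 by auto
 \<comment> \<open>Old arrows that do not survive in \<open>R'\<close> get the zero cocycle; those
   out of \<open>j\<close> get the one built from \<open>N\<close>.\<close>
 let ?z = "%l k. if k = j \<or> (l ~= j & R' k l) then ze l k else (%x. 0)"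
 have z2: "?z l k ` V k \<subseteq> V l" if "adj C l k" for k l
 proof (cases "k = j")
  case True
  hence l: "adj C j l" using adj_sym that by blast
  hence "(l, cc C j l - 1)\<in>Ix" using cc_pos[of C j l] by (simp add: Ix_iff)
  hence "N (out u) (l, cc C j l - 1)\<in>V l" if "u\<in>V j" for u using WD(1)[OF NW[OF out_W[OF that]]] by fastforce
  thus ?thesis using True by (auto simp: ze_def intro!: subspace_neg subspace_scale V_sub)
 next
  case False
  thus ?thesis using xi2[OF that] subspace_0[OF V_sub] by (auto simp: ze_def image_subset_iff)
 qed
 have z3: "?z l k ((E k ^^ cc C k l) x) = (E l ^^ cc C l k) (?z l k x)" if a: "adj C l k" and x: "x\<in>V k" for k l x
 proof (cases "k = j")
  case True
  hence l: "adj C j l" using adj_sym a by blast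
  have xj: "x\<in>V j" using x True by simp
  have "N (out ((E j ^^ cc C j l) x)) = (ep ^^ cc C j l) (N (out x))"
  by (simp add: out_E_pow[OF xj] Nep_pow[OF out_W[OF xj]])
  moreover have "(E l ^^ n) (- y) = - (E l ^^ n) y" for n y
  using E_pows(2)[of n l 0 y] by (simp add: E_pows(4))
  ultimately show ?thesis using True by (simp add: ze_def ep_pow_full[OF l, simplified] E_pows)
 next
  case False
  thus ?thesis using xi3[OF a, of x] x by (auto simp: ze_def E_pows)
 qed
 obtain f where f: "!!k. vend scale (f k)" "!!k. f k ` V k \<subseteq> V k"
  "!!k x. x\<in>V k ==> f k (E k x) = E k (f k x)"
  "!!k l x. adj C l k ==> R k l ==> x\<in>V k ==> ?z l k x = f l (Al l k x) - Al l k (f k x)"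
  by (rule rigidE[OF rigid_V zeta_ok z2 z3]) (assumption | rule that)+
 have f_pow: "f k ((E k ^^ n) x) = (E k ^^ n) (f k x)" if "x\<in>V k" for k n x
  using that by (induction n) (auto simp: f(3) V_E_pow)
 have fl: "f k (x + y) = f k x + f k y" "f k (c *s x) = c *s f k x" "f k 0 = 0" for k x y c
 proof -
  interpret fk: Vector_Spaces.linear scale scale "f k" by (rule f(1))
  show "f k (x + y) = f k x + f k y" "f k (c *s x) = c *s f k x" "f k 0 = 0" by (rule fk.add fk.scale fk.zero)+
 qed
 define ft where "ft w = (%p. if p\<in>Ix then f (fst p) (w p) else 0)" for w :: "'i \<times> nat => 'v"
 have ftW: "ft w\<in>W" if "w\<in>W" for w
  using that f(2) unfolding W_def ft_def by (auto simp: image_subset_iff split: if_splits)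
 have ftep: "ft (ep w) = ep (ft w)" if w: "w\<in>W" for w
 proof
  fix p :: "'i \<times> nat" obtain k a where p: "p = (k, a)" by (cases p)
  show "ft (ep w) p = ep (ft w) p"
  proof (cases "p\<in>Ix")
  case True
  hence k: "(k, cc C j k - 1)\<in>Ix" "a > 0 --> (k, a - 1)\<in>Ix" by (auto simp: p Ix_iff)
  have "w (k, cc C j k - 1)\<in>V k" using WD(1)[OF w k(1)] by simp
  hence "f k ((E k ^^ cc C k j) (w (k, cc C j k - 1))) = (E k ^^ cc C k j) (f k (w (k, cc C j k - 1)))"
  by (rule f_pow)
  thus ?thesis using True k unfolding p ft_def
  by (subst (1 2) ep_apply) (cases "a = 0"; simp)
  next
  case False
  thus ?thesis unfolding ft_def by (subst (2) ep_apply) simp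
  qed
 qed
 have ftlin: "vlin sW sW ft"
  by (intro linearI_vs W.vector_space_axioms) (auto simp: ft_def fl fun_eq_iff)
 \<comment> \<open>The coboundary equation at \<open>j\<close>, entry by entry: the entry
   \<open>(k, a)\<close> of \<open>out u\<close> is the last entry of \<open>out\<close> at
   \<open>(E j ^^ b) u\<close> with \<open>b = cc C j k - 1 - a\<close>.\<close>
 have key: "ft (out u) + N (out u) = out (f j u)" if u: "u\<in>V j" for u
 proof
  fix p :: "'i \<times> nat" obtain k a where p: "p = (k, a)" by (cases p)
  have fu: "f j u\<in>V j" using f(2) u by blast
  show "(ft (out u) + N (out u)) p = out (f j u) p"
  proof (cases "p\<in>Ix")
  case True
  hence k: "adj C j k" "a < cc C j k" by (auto simp: p Ix_iff)
  define b where "b = cc C j k - 1 - a"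
  let ?z = "(E j ^^ b) u"
  have zV: "?z\<in>V j" by (rule V_E_pow[OF u])
  have I: "(k, cc C j k - 1)\<in>Ix" using k by (auto simp: Ix_iff)
  have "N (out ?z) = (ep ^^ b) (N (out u))" by (simp add: out_E_pow[OF u] Nep_pow[OF out_W[OF u]])
  hence 1: "N (out ?z) (k, cc C j k - 1) = N (out u) p"
  using ep_pow_shift[OF I, of b "N (out u)"] k by (simp add: b_def p)
  have kj: "k ~= j" "adj C k j" using k adj_sym[OF k(1)] by (auto simp: adj_def)
  have "(- 1 / om k) *s N (out ?z) (k, cc C j k - 1) = f k (Al k j ?z) - Al k j (f j ?z)"
  using f(4)[OF kj(2) R_source[OF kj(1)] zV] by (simp add: ze_def)
  hence "om k *s ((- 1 / om k) *s N (out u) p) = om k *s (f k (Al k j ?z) - Al k j (f j ?z))"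
  by (simp only: 1)
  hence "- N (out u) p = om k *s f k (Al k j ?z) - om k *s Al k j (f j ?z)"
  using om[OF k(1)] by (simp add: scale_right_diff_distrib)
  hence "om k *s f k (Al k j ?z) + N (out u) p = om k *s Al k j (f j ?z)"
  by (simp add: algebra_simps)
  moreover have "ft (out u) p = om k *s f k (Al k j ?z)" using True by (simp add: ft_def out_def p b_def fl)
  moreover have "out (f j u) p = om k *s Al k j (f j ?z)" using True f_pow[OF u] by (simp add: out_def p b_def)
  ultimately show ?thesis by simp
  next
  case False
  thus ?thesis using WD(2)[OF NW[OF out_W[OF u]]] by (simp add: ft_def out_def)
  qed
 qed
 define h where "h w = Ph (ft w + N w)" for w
 have hlin: "vlin sW scale h"
 proof (intro linearI_vs W.vector_space_axioms vector_space_axioms)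
  interpret Ph: Vector_Spaces.linear sW scale Ph by (rule Ph_linear)
  interpret ft: Vector_Spaces.linear sW sW ft by (rule ftlin)
  interpret N: Vector_Spaces.linear sW sW N by (rule Nlin)
  show "h (w + w') = h w + h w'" for w w' by (simp only: h_def ft.add N.add Ph.add ac_simps)
  show "h (sW c w) = c *s h w" for w c
  by (simp only: h_def ft.scale N.scale Ph.scale W.scale_right_distrib[symmetric])
 qed
 \<comment> \<open>By \<open>key\<close> the map under \<open>Ph\<close> preserves the image of
   \<open>out\<close>, which is the kernel of \<open>Ph\<close>; hence \<open>h\<close> factors
   through \<open>Ph\<close>.\<close>
 have hker: "h w = 0" if "w\<in>W" "Ph w = 0" for w
 proof -
  from exact[OF that] obtain u where u: "u\<in>V j" "w = out u" by blast
  thus ?thesis using key[OF u(1)] mesh f(2) by (auto simp: h_def)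
 qed
 obtain g where g: "vend scale g" "!!w. w\<in>W ==> g (Ph w) = h w"
  by (rule WV.factor_through[OF Ph_linear hlin sub_W hker]) (assumption | rule that)+
 have hY: "h w\<in>Y" if "w\<in>W" for w
  unfolding h_def using that by (intro Ph_Y W.subspace_add sub_W ftW NW)
 have gE: "g (E j y) = E j (g y)" if "y\<in>Y" for y
 proof -
  from that obtain w where w: "w\<in>W" "y = Ph w" using gen by blast
  have "g (E j y) = h (ep w)" using g(2)[OF ep_W[OF w(1)]] by (simp add: w(2) Ph_ep[OF w(1)])
  also have "\<dots> = Ph (ep (ft w + N w))"
  using ep_linear by (simp add: h_def ftep[OF w(1)] Nep[OF w(1)] Vector_Spaces.linear_iff)
  also have "\<dots> = E j (h w)" unfolding h_def
  by (rule Ph_ep) (intro W.subspace_add sub_W ftW NW w)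
  finally show ?thesis using g(2)[OF w(1)] w(2) by simp
 qed
 show "\<exists>f. (\<forall>k. vend scale (f k) & f k ` (V(j := Y)) k \<subseteq> (V(j := Y)) k
  & (\<forall>x\<in>(V(j := Y)) k. f k (E k x) = E k (f k x)))
  & (\<forall>k l. adj C l k --> R' k l --> (\<forall>x\<in>(V(j := Y)) k. xi l k x = f l (Al l k x) - Al l k (f k x)))"
 proof (intro exI[of _ "f(j := g)"] conjI allI impI ballI)
  fix k
  show "vend scale ((f(j := g)) k)" using f(1) g(1) by simp
  show "(f(j := g)) k ` (V(j := Y)) k \<subseteq> (V(j := Y)) k"
  using f(2) g(2) hY gen by auto
  show "(f(j := g)) k (E k x) = E k ((f(j := g)) k x)" if "x\<in>(V(j := Y)) k" for x
  using that f(3) gE by (cases "k = j") auto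
  fix l x assume a: "adj C l k" and r: "R' k l" and x: "x\<in>(V(j := Y)) k"
  have kj: "k ~= j" using r R'(2) by blast
  hence xV: "x\<in>V k" using x by simp
  show "xi l k x = (f(j := g)) l (Al l k x) - Al l k ((f(j := g)) k x)"
  proof (cases "l = j")
  case True
  hence jk: "adj C j k" using a by simp
  have d: "dl k x\<in>W" by (rule dl_W[OF jk xV])
  have p: "(k, 0)\<in>Ix" using jk cc_pos[OF jk] by (simp add: Ix_iff)
  interpret Ph: Vector_Spaces.linear sW scale Ph by (rule Ph_linear)
  have "ft (dl k x) = dl k (f k x)" using p by (auto simp: ft_def dl_def fl)
  moreover have "Ph (N (dl k x)) = (\<Sum>p\<in>Ix. if p = (k, 0) then ch k x else 0)"
  unfolding Ph_N[OF d]
  proof (intro sum.cong refl)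
  fix p assume p: "p\<in>Ix"
  have "ch (fst p) 0 = 0"
  using module_hom.zero[OF chi1[OF IxD(1)[OF p], unfolded linear_iff_module_hom]] .
  thus "(E j ^^ snd p) (ch (fst p) (dl k x p)) = (if p = (k, 0) then ch k x else 0)"
  by (auto simp: dl_def E_pows)
  qed
  ultimately have "h (dl k x) = Al j k (f k x) + ch k x"
  using p finite_Ix by (simp add: h_def Ph.add Ph_dl[OF jk])
  moreover have "g (Al j k x) = h (dl k x)" using g(2)[OF d] by (simp add: Ph_dl[OF jk])
  ultimately show ?thesis using True kj r by (simp add: ch_def)
  next
  case False
  have "R k l" by (rule R'(1)[OF kj False r])
  from f(4)[OF a this xV] show ?thesis using kj False r by (simp add: ze_def)
  qed
 qed
qed

end

locale injective_reflection = rigid_reflection scale C E Al om V B j Y R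
 for scale :: "'k::field => 'v::ab_group_add => 'v" (infixr "*s" 75)
  and C :: "'i::finite => 'i => int" and E Al om V B j Y R +
 assumes inj: "u\<in>V j ==> out u\<in>ep ` W ==> u\<in>E j ` V j"
begin

text \<open>A snake argument: the variable is injective on \<open>W\<close> and \<open>out\<close>
  is injective modulo it, so \<open>E j\<close> is injective on the cokernel of
  \<open>out\<close>.\<close>

lemma Y_inj: assumes y: "y\<in>Y" and 0: "E j y = 0" shows "y = 0"
proof -
 obtain w where w: "w\<in>W" "y = Ph w" using y gen by blast
 hence "Ph (ep w) = 0" using 0 Ph_ep by simp
 then obtain u where u: "u\<in>V j" "ep w = out u" using exact[OF ep_W[OF w(1)]] by blast
 then obtain u' where u': "u'\<in>V j" "u = E j u'" using inj w(1) by (metis imageE image_eqI)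
 interpret ep: Vector_Spaces.linear sW sW ep by (rule ep_linear)
 have "ep (w - out u') = 0" using u u' by (simp add: ep.diff out_E)
 hence "w - out u' = 0" by (rule ep_inj[OF W.subspace_diff[OF sub_W w(1) out_W[OF u'(1)]]])
 thus ?thesis using w(2) mesh[OF u'(1)] by simp
qed

lemma card_basis:
 assumes "hbasis (E j) F Y"
 shows "card (B j) + card F = (\<Sum>k\<in>nbs C j. cc C k j * card (B k))"
proof -
 obtain D where D: "W.hbasis ep D W" "card D = (\<Sum>k\<in>nbs C j. cc C k j * card (B k))"
  by (rule hbasis_W)
 have "card D = card (B j) + card F"
  by (rule VW.hbasis_exact[OF basis lin_E D(1) ep_linear assms out_linear _ _ Ph_linear])
  (auto simp: gen out_E Ph_ep mesh intro: exact inj out_W)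
 thus ?thesis using D(2) by simp
qed

end

section \<open>Finite root systems: the longest element and orbits under periodic
  reflections\<close>

definition refl :: "('i::finite => 'i => int) => 'i => ('i => int) => 'i => int" where
 "refl C j n = n(j := n j - (\<Sum>k\<in>UNIV. C j k * n k))"

definition uvec :: "'i => 'i => int" where
 "uvec i = (%k. if k = i then 1 else 0)"

lemma refl_sum: "refl C j (%k. \<Sum>m\<in>M. x m * f m k) = (%k. \<Sum>m\<in>M. x m * refl C j (f m) k)"
proof
 fix k
 have "(\<Sum>k\<in>UNIV. C j k * (\<Sum>m\<in>M. x m * f m k)) = (\<Sum>m\<in>M. x m * (\<Sum>k\<in>UNIV. C j k * f m k))"
  by (simp add: sum_distrib_left algebra_simps sum.swap[of _ M])
 thus "refl C j (%k. \<Sum>m\<in>M. x m * f m k) k = (\<Sum>m\<in>M. x m * refl C j (f m) k)"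
  by (simp add: refl_def algebra_simps sum_subtractf)
qed

text \<open>The roots in coordinates with respect to the simple roots, which are the vectors
  \<open>uvec i\<close>.\<close>

locale finite_roots =
 fixes C :: "'i::finite => 'i => int" and Ph :: "('i => int) set"
 assumes fin: "finite Ph"
  and simple: "uvec i\<in>Ph"
  and sign: "n\<in>Ph ==> (\<forall>k. 0 <= n k) \<or> (\<forall>k. n k <= 0)"
  and nonzero: "(%k. 0) \<notin> Ph"
  and refl_closed: "n\<in>Ph ==> refl C j n\<in>Ph"
  and diag: "C i i = 2"
begin

definition act :: "'i list => ('i => int) => 'i => int" where
 "act L x = foldr (refl C) L x"

text \<open>The inversion set of a word in the simple reflections; its size stands in for the
  length.\<close>

definition invs :: "'i list => ('i => int) set" where
 "invs L = {n\<in>Ph. (\<forall>k. 0 <= n k) & \<not> (\<forall>k. 0 <= act L n k)}"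

lemma act_closed: "n\<in>Ph ==> act L n\<in>Ph"
 by (induction L) (auto simp: act_def refl_closed)

lemma act_expand: "act L x = (%k. \<Sum>j\<in>UNIV. x j * act L (uvec j) k)"
proof (induction L)
 case Nil
 show ?case by (simp add: act_def uvec_def fun_eq_iff if_distrib sum.delta cong: if_cong)
next
 case (Cons i L)
 have "act (i # L) x = refl C i (act L x)" by (simp add: act_def)
 also have "\<dots> = (%k. \<Sum>j\<in>UNIV. x j * refl C i (act L (uvec j)) k)"
  by (subst Cons) (rule refl_sum)
 finally show ?case by (simp add: act_def)
qed

lemma refl_refl: "refl C j (refl C j n) = n"
proof -
 have "(\<Sum>k\<in>UNIV. C j k * refl C j n k) = (\<Sum>k\<in>UNIV. C j k * n k - (if k = j then C j j * (\<Sum>k\<in>UNIV. C j k * n k) else 0))"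
  by (intro sum.cong) (auto simp: refl_def algebra_simps)
 hence "(\<Sum>k\<in>UNIV. C j k * refl C j n k) = - (\<Sum>k\<in>UNIV. C j k * n k)"
  by (simp add: sum_subtractf diag)
 thus ?thesis by (subst refl_def) (simp add: refl_def fun_eq_iff)
qed

text \<open>A word with the largest inversion set behaves like the longest element: if it kept
  \<open>uvec j\<close> positive, appending \<open>j\<close> would carry over all inversions and add
  \<open>uvec j\<close>.\<close>

lemma exists_longest: "\<exists>L. \<forall>j k. act L (uvec j) k <= 0"
proof -
 have "card (invs L) < Suc (card Ph)" for L
  using card_mono[OF fin, of "invs L"] by (auto simp: invs_def)
 then obtain L where max: "!!L'. card (invs L') <= card (invs L)"
  using ex_has_greatest_nat[of "%_. True" "[]" "%L. card (invs L)" "Suc (card Ph)"] by auto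
 have "\<not> (\<forall>k. 0 <= act L (uvec j) k)" for j
 proof
  assume pos: "\<forall>k. 0 <= act L (uvec j) k"
  let ?L = "L @ [j]"
  have act': "act ?L x = act L (refl C j x)" for x by (simp add: act_def)
  \<comment> \<open>An inversion supported at \<open>j\<close> alone would be a nonnegative multiple
    of the simple root, which the word keeps positive. So some other coordinate is positive, and
    reflecting at \<open>j\<close> does not touch it.\<close>
  have off: "\<exists>k. k ~= j & n k > 0" if "n\<in>invs L" for n
  proof (rule ccontr)
  assume no: "\<not> ?thesis"
  hence 0: "n k = 0" if "k ~= j" for k
  using \<open>n\<in>invs L\<close> that by (auto simp: invs_def) (metis order_antisym_conv not_less)
  have "act L n k = n j * act L (uvec j) k" for k
  proof -
  have "act L n k = (\<Sum>i\<in>UNIV. if i = j then n j * act L (uvec j) k else 0)"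
  by (subst act_expand, intro sum.cong refl) (simp add: 0)
  thus ?thesis by simp
  qed
  thus False using that pos by (auto simp: invs_def)
  qed
  have sub: "refl C j ` invs L \<subseteq> invs ?L"
  proof clarify
  fix n assume n: "n\<in>invs L"
  hence "refl C j n\<in>Ph" by (simp add: invs_def refl_closed)
  moreover obtain k where "k ~= j" "n k > 0" using off[OF n] by blast
  hence "refl C j n k > 0" by (simp add: refl_def)
  ultimately have "\<forall>k. 0 <= refl C j n k" using sign by (meson leD)
  thus "refl C j n\<in>invs ?L"
  using n \<open>refl C j n\<in>Ph\<close> by (simp add: invs_def act' refl_refl)
  qed
  have "refl C j (uvec j) = (%k. - uvec j k)"
  by (auto simp: refl_def uvec_def fun_eq_iff diag if_distrib sum.delta cong: if_cong)
  hence eq: "act ?L (uvec j) = act L (%k. - uvec j k)" by (simp add: act')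
  have neg: "act ?L (uvec j) = (%k. - act L (uvec j) k)"
  proof
  fix k
  have "act ?L (uvec j) k = (\<Sum>i\<in>UNIV. - uvec j i * act L (uvec i) k)"
  unfolding eq by (subst act_expand) simp
  also have "\<dots> = (\<Sum>i\<in>UNIV. if i = j then - act L (uvec j) k else 0)"
  by (intro sum.cong refl) (simp add: uvec_def[of j])
  finally show "act ?L (uvec j) k = - act L (uvec j) k" by simp
  qed
  have "act L (uvec j) ~= (%k. 0)" using act_closed[OF simple] nonzero by metis
  then obtain k where "act L (uvec j) k ~= 0" by auto
  hence "\<not> (\<forall>k. 0 <= act ?L (uvec j) k)" unfolding neg using pos by (metis neg_0_le_iff_le order_antisym)
  hence jI: "uvec j\<in>invs ?L" by (auto simp: invs_def simple) (simp add: uvec_def)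
  have jn: "uvec j \<notin> refl C j ` invs L"
  proof
  assume "uvec j\<in>refl C j ` invs L"
  then obtain n where n: "n\<in>invs L" "uvec j = refl C j n" by blast
  obtain k where "k ~= j" "n k > 0" using off[OF n(1)] by blast
  thus False using fun_cong[OF n(2), of k] by (simp add: uvec_def refl_def)
  qed
  have finI: "finite (invs L)" for L using fin by (simp add: invs_def)
  have "inj_on (refl C j) (invs L)" by (metis inj_onI refl_refl)
  hence "card (invs L) = card (refl C j ` invs L)" by (simp add: card_image)
  also have "\<dots> < card (insert (uvec j) (refl C j ` invs L))" using jn finI by simp
  also have "\<dots> <= card (invs ?L)" using sub jI finI by (intro card_mono) auto
  finally show False using max[of ?L] by simp
 qed
 thus ?thesis using sign act_closed[OF simple] by metis
qed

text \<open>A vector fixed by all simple reflections is fixed by the word of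
  \<open>exists_longest\<close>, which sends nonnegative vectors to nonpositive ones.\<close>

lemma no_invariant_vector:
 assumes "!!j. refl C j w = w" "!!k. 0 <= w k" shows "w = (%k. 0)"
proof -
 obtain L where L: "!!j k. act L (uvec j) k <= 0" using exists_longest by blast
 have "act L w = w" by (induction L) (auto simp: act_def assms(1))
 hence "w k = (\<Sum>j\<in>UNIV. w j * act L (uvec j) k)" for k using act_expand[of L w] by (simp add: fun_eq_iff)
 moreover have "(\<Sum>j\<in>UNIV. w j * act L (uvec j) k) <= 0" for k
  using L assms(2) by (intro sum_nonpos) (simp add: mult_nonneg_nonpos)
 ultimately show ?thesis using assms(2) by (metis antisym)
qed

text \<open>Otherwise the sum over a period of the sequence would be a nonzero vector fixed by all
 reflections.\<close>

lemma no_positive_orbit: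
 assumes N: "!!t. N t\<in>Ph" "!!t k. 0 <= N t k" "!!t. N (Suc t) = refl C (v t) (N t)"
  and v: "!!t. v (t + n) = v t" "bij_betw v {..<n} UNIV"
 shows False
proof -
 \<comment> \<open>Pigeonhole on the roots reached after full periods.\<close>
 have "\<not> inj_on (%a. N (a * n)) UNIV"
  using N(1) fin finite_imageD[of "%a. N (a * n)" UNIV] by (metis finite_subset image_subsetI infinite_UNIV_nat)
 then obtain a b where ab: "a < b" "N (a * n) = N (b * n)"
  unfolding inj_on_def by (metis linorder_neqE_nat)
 define w where "w t = (%k. \<Sum>m\<in>{a..<b}. 1 * N (m * n + t) k)" for t
 have vm: "v (m * n + t) = v t" for m t
  using v(1)[of "m * n + t" for m] by (induction m) (simp_all add: ac_simps)
 have step: "w (Suc t) = refl C (v t) (w t)" for t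
  unfolding w_def by (subst refl_sum) (simp add: N(3) vm)
 have wn: "w n = w 0"
 proof
  fix k
  have "w n k = (\<Sum>m\<in>{a..<b}. N (Suc m * n) k)" by (simp add: w_def add.commute)
  also have "\<dots> = (\<Sum>m\<in>{Suc a..<Suc b}. N (m * n) k)" by (subst sum.shift_bounds_Suc_ivl) simp
  also have "\<dots> = (\<Sum>m\<in>{a..<b}. N (m * n) k)"
  using ab by (simp add: sum.atLeast_Suc_lessThan[of a b])
  finally show "w n k = w 0 k" by (simp add: w_def)
 qed
 have keep: "w t' k = w t k" if "t <= t'" "!!s. t <= s ==> s < t' ==> v s ~= k" for t t' k
  using that
 proof (induction t' rule: dec_induct)
  case (step s)
  thus ?case by (auto simp: \<open>!!t. w (Suc t) = refl C (v t) (w t)\<close> refl_def)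
 qed simp
 have inj: "inj_on v {..<n}" using v(2) by (simp add: bij_betw_def)
 \<comment> \<open>Within one period a coordinate changes at most at the single time when its vertex
   is visited, and after the period it is back; so it does not change at all.\<close>
 have const: "w (Suc t) = w t" if t: "t < n" for t
 proof
  fix k
  show "w (Suc t) k = w t k"
  proof (cases "v t = k")
  case True
  have "w n k = w (Suc t) k"
  using t True inj by (intro keep) (auto dest: inj_onD)
  moreover have "w t k = w 0 k"
  using t True inj by (intro keep) (auto dest: inj_onD)
  ultimately show ?thesis using wn by simp
  qed (simp add: step refl_def)
 qed
 have w0: "t <= n ==> w t = w 0" for t by (induction t) (auto simp: const)
 have "refl C j (w 0) = w 0" for j
 proof -
  obtain t where "t < n" "v t = j" using v(2) by (auto simp: bij_betw_def) (metis UNIV_I imageE lessThan_iff)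
  thus ?thesis using step[of t] w0[of t] w0[of "Suc t"] by simp
 qed
 moreover have "0 <= w 0 k" for k unfolding w_def by (simp add: N(2) sum_nonneg)
 ultimately have "w 0 = (%k. 0)" by (rule no_invariant_vector)
 hence "(\<Sum>m\<in>{a..<b}. N (m * n) k) = 0" for k by (simp add: w_def fun_eq_iff)
 hence "N (a * n) k = 0" for k
  using N(2) ab(1) by (subst (asm) sum_nonneg_eq_0_iff) auto
 hence "N (a * n) = (%k. 0)" by blast
 thus False using N(1) nonzero by metis
qed

end

section \<open>Generators of the new piece, and the case where it vanishes\<close>

context rigid_reflection
begin

text \<open>Powers of \<open>E k\<close> from \<open>cc C k j\<close> on pass through
  \<open>Al j k\<close> as powers of \<open>E j\<close>, so finitely many generators remain over the
  variable at \<open>j\<close>.\<close>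

definition gens :: "'v set" where
 "gens = (\<Union>k\<in>nbs C j. \<Union>r\<in>{..<cc C k j}. (%b. Al j k ((E k ^^ r) b)) ` B k)"

lemma finite_gens: "finite gens"
 using hb_finite[OF basis] by (auto simp: gens_def)

lemma Y_span: "Y = span {(E j ^^ a) g | a g. g\<in>gens}" (is "_ = ?S")
proof
 have "gens \<subseteq> Y" using hb_pow[OF basis] by (auto simp: gens_def intro: Al_in)
 thus "?S \<subseteq> Y" using Y by (intro span_minimal) (auto intro: funpow_mem)
 have S_E: "(E j ^^ n) x\<in>?S" if "x\<in>?S" for n x
  using that by (induction n) (auto intro: span_funpow_closed[OF lin_E])
 have Al: "Al j k x\<in>?S" if k: "adj C j k" and x: "x\<in>V k" for k x
  using x unfolding hb_span[OF basis]
 proof (induction rule: span_induct_alt)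
  case base thus ?case by (simp only: Al_simps span_zero)
 next
  case (step c x y)
  from step(1) obtain A b where x: "x = (E k ^^ A) b" "b\<in>B k" by auto
  let ?r = "A mod cc C k j" and ?q = "A div cc C k j"
  have pw: "Al j k ((E k ^^ (cc C k j * q)) z) = (E j ^^ (cc C j k * q)) (Al j k z)" if "z\<in>V k" for q z
  using that by (induction q) (simp_all add: funpow_add rel_in[OF k] V_E_pow)
  have "A = cc C k j * ?q + ?r" by simp
  hence "x = (E k ^^ (cc C k j * ?q)) ((E k ^^ ?r) b)" unfolding x(1) by (metis comp_apply funpow_add)
  hence "Al j k x = (E j ^^ (cc C j k * ?q)) (Al j k ((E k ^^ ?r) b))"
  using pw[OF hb_pow[OF basis x(2)]] by simp
  moreover have "Al j k ((E k ^^ ?r) b)\<in>gens"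
  unfolding gens_def using k x(2) cc_pos[OF adj_sym[OF k]] by (intro UN_I[of k] UN_I[of ?r] imageI) auto
  ultimately have "Al j k x\<in>?S" by (intro span_base) blast
  thus ?case using step(2) by (simp only: Al_simps span_add span_scale)
 qed
 have "Ph w\<in>?S" if "w\<in>W" for w
  unfolding Ph_def using that by (intro span_sum S_E Al) (auto dest: IxD WD)
 thus "Y \<subseteq> ?S" using gen by blast
qed

text \<open>If \<open>Y\<close> vanishes, the mesh map is onto, so the images of a basis of
  \<open>V j\<close> generate \<open>W\<close> modulo the variable. When they are at most as many as
  the rank of \<open>W\<close>, they form a basis there, and \<open>out\<close> is injective modulo
  the variable.\<close>

lemma reduced_of_card_le:
 assumes Y0: "Y = {0}" and card: "card (B j) <= (\<Sum>k\<in>nbs C j. cc C k j * card (B k))"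
  and u: "u\<in>V j" "out u\<in>ep ` W"
 shows "u\<in>E j ` V j"
proof -
 interpret o: Vector_Spaces.linear scale sW out by (rule out_linear)
 obtain D where D: "W.hbasis ep D W" "card D = (\<Sum>k\<in>nbs C j. cc C k j * card (B k))"
  by (rule hbasis_W)
 have fin: "finite (out ` B j)" using hb_finite[OF basis] by simp
 have sub: "out ` B j \<subseteq> W" using hbasis_mem[OF basis] out_W by blast
 have dec: "\<exists>mu u'. u = (\<Sum>b\<in>B j. mu b *s b) + E j u' & u'\<in>V j" if u: "u\<in>V j" for u
 proof -
  obtain mu where "u - (\<Sum>b\<in>B j. mu b *s b)\<in>E j ` V j" by (rule hb_comb[OF basis lin_E u])
  then obtain u' where "u'\<in>V j" "u - (\<Sum>b\<in>B j. mu b *s b) = E j u'" by blast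
  thus ?thesis by (intro exI[of _ mu] exI[of _ u']) (simp add: algebra_simps)
 qed
 have out_dec: "out ((\<Sum>b\<in>B j. mu b *s b) + E j u') = (\<Sum>b\<in>B j. sW (mu b) (out b)) + ep (out u')" if "u'\<in>V j" for mu u'
  by (simp only: o.add o.sum o.scale out_E[OF that])
 have sp: "\<exists>y\<in>W.span (out ` B j). w - y\<in>ep ` W" if w: "w\<in>W" for w
 proof -
  have "Ph w = 0" using gen Y0 w by blast
  from exact[OF w this] obtain u where u: "u\<in>V j" "w = out u" by blast
  obtain mu u' where u': "u = (\<Sum>b\<in>B j. mu b *s b) + E j u'" "u'\<in>V j" using dec[OF u(1)] by blast
  have "w - (\<Sum>b\<in>B j. sW (mu b) (out b)) = ep (out u')" unfolding u(2) u'(1) out_dec[OF u'(2)] by simp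
  moreover have "(\<Sum>b\<in>B j. sW (mu b) (out b))\<in>W.span (out ` B j)"
  by (intro W.span_sum W.span_scale W.span_base) auto
  ultimately show ?thesis using out_W[OF u'(2)] by (intro bexI) auto
 qed
 have le: "card D <= card (out ` B j)"
  by (rule W.card_le_spanning(1)[OF D(1) ep_linear fin sub sp])
 have le': "card (out ` B j) <= card (B j)" by (rule card_image_le[OF hb_finite[OF basis]])
 have eq: "card D = card (out ` B j)" "card (out ` B j) = card (B j)" using le le' card D(2) by auto
 have inj: "inj_on out (B j)" by (rule eq_card_imp_inj_on[OF hb_finite[OF basis] eq(2)])
 obtain mu u' where u': "u = (\<Sum>b\<in>B j. mu b *s b) + E j u'" "u'\<in>V j" using dec[OF u(1)] by blast
 have "(\<Sum>b\<in>B j. sW (mu b) (out b)) = out u - ep (out u')" unfolding u'(1) out_dec[OF u'(2)] by simp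
 moreover have "out u - ep (out u')\<in>ep ` W"
 proof -
  interpret ep: Vector_Spaces.linear sW sW ep by (rule ep_linear)
  show ?thesis using W.subspace_diff[OF ep.subspace_image[OF sub_W] u(2)] out_W[OF u'(2)] by blast
 qed
 ultimately have k: "(\<Sum>g\<in>out ` B j. sW (mu (inv_into (B j) out g)) g)\<in>ep ` W"
  by (simp add: sum.reindex[OF inj] inj cong: sum.cong)
 have "mu b = 0" if "b\<in>B j" for b
  using W.card_le_spanning(2)[OF D(1) ep_linear fin sub sp eq(1) k, of "out b"] that inj by simp
 hence "u = E j u'" using u'(1) by simp
 thus ?thesis using u'(2) by blast
qed

end

section \<open>Knitting: reflections iterated along the cyclic sequence of vertices\<close>

text \<open>Time \<open>t\<close> visits the vertices cyclically in the order \<open>pos\<close>,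
  and \<open>X t\<close> is a piece at vertex \<open>vt t\<close>; a window consists of
  \<open>n\<close> consecutive times. More than a whole cycle of zero pieces precedes the start at
  time \<open>n + pos i0\<close>, so that the first steps are ordinary mesh steps. Generation by
  neighbours is asked for from the next piece on, because the starting piece is generated by
  \<open>g0\<close> instead.\<close>

locale knitting = vspace scale
 for scale :: "'k::field => 'v::ab_group_add => 'v" (infixr "*s" 75) +
 fixes C :: "'i::finite => 'i => int" and d :: "'i => int" and Rt :: "('i => int) set"
  and pos :: "'i => nat" and X :: "nat => 'v set" and E :: "'i => 'v => 'v"
  and Al :: "'i => 'i => 'v => 'v" and om :: "'i => 'i => 'k" and pr :: "int => 'v => 'v"
  and i0 :: 'i and g0 :: 'v and vt :: "nat => 'i" and n :: nat
 assumes n_card: "n = card (UNIV :: 'i set)" and roots: "finite_roots C Rt"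
  and pos: "bij_betw pos UNIV {..<n}"
  and vt: "vt t = inv_into UNIV pos (t mod n)"
  and d: "d i > 0" "d i * C i j = d j * C j i"
  and om: "adj C j k ==> om j k ~= 0"
  and lin_E: "vend scale (E k)"
  and lin_Al: "vend scale (Al k l)"
  and lin_pr: "vend scale (pr u)"
  and X_sub: "subspace (X t)"
  and X_E: "x\<in>X t ==> E (vt t) x\<in>X t"
  and X_Al: "adj C (vt t) (vt s) ==> s < t ==> t < s + n ==> x\<in>X s ==> Al (vt t) (vt s) x\<in>X t"
  and rel: "adj C (vt t) (vt s) ==> s < t ==> t < s + n ==> x\<in>X s ==>
  Al (vt t) (vt s) ((E (vt s) ^^ cc C (vt s) (vt t)) x) = (E (vt t) ^^ cc C (vt t) (vt s)) (Al (vt t) (vt s) x)"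
  and X_early: "s < n + pos i0 ==> X s = {0}"
  and X_start: "hbasis (E i0) {g0} (X (n + pos i0))"
  and hom_start: "\<exists>u. pr u g0 = g0 & (\<forall>u'. u' ~= u --> pr u' g0 = 0)"
  and gen: "t > pos i0 ==> (!!k. k ~= vt t ==> t < tm k & tm k < t + n & vt (tm k) = k) ==> x\<in>X (t + n) ==>
  \<exists>w. (\<forall>k a. if adj C (vt t) k & a < cc C (vt t) k then w (k, a)\<in>X (tm k) else w (k, a) = 0) &
  x = (\<Sum>(k, a)\<in>(SIGMA k : {k. adj C (vt t) k}. {..<cc C (vt t) k}). (E (vt t) ^^ a) (Al (vt t) k (w (k, a))))"
  and mesh: "t > pos i0 ==> x\<in>X t ==>
  (\<Sum>(k, a)\<in>(SIGMA k : {k. adj C (vt t) k}. {..<cc C (vt t) k}).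
  (E (vt t) ^^ a) (Al (vt t) k (om (vt t) k *s Al k (vt t) ((E (vt t) ^^ (cc C (vt t) k - 1 - a)) x)))) = 0"
  and exact: "t > pos i0 ==> (!!k. k ~= vt t ==> t < tm k & tm k < t + n & vt (tm k) = k) ==>
  (!!k a. adj C (vt t) k ==> a < cc C (vt t) k ==> w (k, a)\<in>X (tm k)) ==>
  (\<Sum>(k, a)\<in>(SIGMA k : {k. adj C (vt t) k}. {..<cc C (vt t) k}). (E (vt t) ^^ a) (Al (vt t) k (w (k, a)))) = 0 ==>
  \<exists>x\<in>X t. \<forall>k a. adj C (vt t) k --> a < cc C (vt t) k -->
  w (k, a) = om (vt t) k *s Al k (vt t) ((E (vt t) ^^ (cc C (vt t) k - 1 - a)) x)"
  and pr_X: "x\<in>X t ==> pr u x\<in>X t"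
  and pr_idem: "x\<in>X t ==> pr u (pr u x) = pr u x"
  and pr_E: "x\<in>X t ==> pr u (E (vt t) x) = E (vt t) (pr (u - 2 * d (vt t)) x)"
  and pr_Al: "adj C (vt t) (vt s) ==> s < t ==> t < s + n ==> x\<in>X s ==>
  pr u (Al (vt t) (vt s) x) = Al (vt t) (vt s) (pr (u + max (d (vt t)) (d (vt s))) x)"
  and pr_low: "\<exists>L. \<forall>u<L. \<forall>x\<in>X t. pr u x = 0"
  and pr_zero: "x\<in>X t ==> (!!u. pr u x = 0) ==> x = 0"
begin

definition hom :: "'v => bool" where
 "hom x \<longleftrightarrow> (\<exists>u. pr u x = x & (\<forall>u'. u' ~= u --> pr u' x = 0))"

text \<open>The first time from \<open>t\<close> on at which \<open>k\<close> is visited. The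
  difference is written with \<open>n - t mod n\<close>, which never truncates.\<close>

definition tm :: "nat => 'i => nat" where
 "tm t k = t + (pos k + (n - t mod n)) mod n"

interpretation roots: finite_roots C Rt by (rule roots)

lemma n_pos: "n > 0"
 by (simp add: n_card finite_UNIV_card_ge_0)

lemma pos_less: "pos k < n"
 using pos by (auto simp: bij_betw_def)

lemma pos_inj: "inj pos"
 using pos by (simp add: bij_betw_def)

lemma pos_vt: "pos (vt t) = t mod n"
 unfolding vt using pos n_pos by (intro f_inv_into_f) (auto simp: bij_betw_def)

lemma vt_eq_iff: "vt t = k \<longleftrightarrow> t mod n = pos k"
 using pos_vt pos_inj by (metis injD)

lemma tm_bounds: "t <= tm t k" "tm t k < t + n"
 using n_pos by (auto simp: tm_def)

lemma vt_tm: "vt (tm t k) = k"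
proof -
 have "(t + (pos k + (n - t mod n))) mod n = (pos k + (t - t mod n) + n) mod n"
 proof -
  have "t mod n <= t" "t mod n <= n" using n_pos by (simp_all add: less_imp_le)
  hence "t + (pos k + (n - t mod n)) = pos k + (t - t mod n) + n" by linarith
  thus ?thesis by simp
 qed
 also have "\<dots> = (pos k + n * (t div n)) mod n" by (simp add: minus_mod_eq_mult_div)
 also have "\<dots> = pos k" using pos_less by simp
 finally show ?thesis unfolding vt_eq_iff tm_def by (simp add: mod_add_right_eq)
qed

lemma tm_unique: assumes "t <= s" "s < t + n" "vt s = k" shows "s = tm t k"
proof -
 have "s mod n = tm t k mod n" using assms(3) vt_tm[of t k] by (metis vt_eq_iff)
 moreover have "\<bar>int s - int (tm t k)\<bar> < int n" using assms tm_bounds[of t k] by linarith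
 ultimately show ?thesis
  by (metis abs_minus_commute dvd_imp_le_int linorder_not_le mod_eq_dvd_iff of_nat_eq_iff of_nat_mod abs_of_nat right_minus_eq)
qed

lemma vt_add: "vt (t + n) = vt t"
 by (simp add: vt)

lemma tm_self: "tm t (vt t) = t"
 using tm_unique[of t t "vt t"] n_pos by simp

lemma tm_gt: "k ~= vt t ==> t < tm t k"
 using tm_bounds(1)[of t k] vt_tm[of t k] by (metis le_neq_implies_less)

lemma tm_Suc: "tm (Suc t) k = (if k = vt t then t + n else tm t k)"
proof (cases "k = vt t")
 case True
 thus ?thesis using tm_unique[of "Suc t" "t + n" k] n_pos by (simp add: vt_add)
next
 case False
 thus ?thesis using tm_unique[of "Suc t" "tm t k" k] tm_gt[OF False] tm_bounds[of t k] vt_tm[of t k] by simp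
qed

lemma C_nonpos: "i ~= j ==> C j i <= 0"
proof -
 assume ij: "i ~= j"
 have "(\<Sum>k\<in>UNIV. C j k * uvec i k) = C j i"
  by (simp add: uvec_def if_distrib cong: if_cong)
 hence "refl C j (uvec i) i = 1" "refl C j (uvec i) j = - C j i"
  using ij by (auto simp: refl_def uvec_def)
 thus ?thesis using roots.sign[OF roots.refl_closed[OF roots.simple[of i]], of j] by (metis neg_0_le_iff_le not_one_le_zero)
qed

lemma adj_sym: "adj C i j ==> adj C j i"
proof -
 assume a: "adj C i j"
 hence "d i * C i j < 0" using d(1)[of i] by (simp add: adj_def mult_pos_neg)
 hence "d j * C j i < 0" using d(2) by simp
 thus ?thesis using a d(1)[of j] by (auto simp: adj_def zero_less_mult_iff mult_less_0_iff)
qed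

text \<open>The rank at \<open>k\<close> is \<open>d k / d i0\<close> times the coordinate
  \<open>N k\<close> of a root, written without division. Ranks transform by the transpose of
  \<open>C\<close>, and the factors \<open>d k\<close> convert this into \<open>refl C\<close>; the
  denominator gives the starting piece rank one.\<close>

definition state :: "nat => ('i => int) => bool" where
 "state t N \<longleftrightarrow> (\<exists>B. (\<forall>k. hbasis (E k) (B k) (X (tm t k)) & (\<forall>b\<in>B k. hom b) & int (card (B k)) * d i0 = d k * N k))
  & N\<in>Rt & (\<forall>k. 0 <= N k) & rigid C E Al (%k l. tm t k < tm t l) (%k. X (tm t k))"

lemma step_reflection:
 assumes t: "t > pos i0" and B: "!!k. hbasis (E k) (B k) (X (tm t k))"
  and rig: "rigid C E Al (%k l. tm t k < tm t l) (%k. X (tm t k))"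
 shows "rigid_reflection scale C E Al (om (vt t)) (%k. X (tm t k)) B (vt t) (X (t + n)) (%k l. tm t k < tm t l)"
proof -
 have lt: "t < tm t k" "tm t k < t + n" "vt (tm t k) = k" if "adj C (vt t) k" for k
  using that tm_gt[of k t] tm_bounds[of t k] vt_tm[of t k] by (auto simp: adj_def)
 have window: "t < tm t k & tm t k < t + n & vt (tm t k) = k" if "k ~= vt t" for k
  using tm_gt[OF that] tm_bounds[of t k] vt_tm[of t k] by auto
 interpret reflection scale C E Al "om (vt t)" "%k. X (tm t k)" B "vt t" "X (t + n)" "%k l. tm t k < tm t l"
 proof (intro reflection.intro reflection_axioms.intro vspace_axioms)
  show "k ~= vt t ==> tm t (vt t) < tm t k" for k using tm_gt by (simp add: tm_self)
  show "E (vt t) ` X (t + n) \<subseteq> X (t + n)" using X_E[of _ "t + n"] by (auto simp: vt_add)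
  fix k x assume a: "adj C (vt t) k"
  note l = lt[OF a]
  show "x\<in>X (tm t (vt t)) ==> Al k (vt t) x\<in>X (tm t k)"
  using X_Al[of "tm t k" t x] l adj_sym[OF a] by (simp add: tm_self)
  show "x\<in>X (tm t k) ==> Al (vt t) k x\<in>X (t + n)"
  using X_Al[of "t + n" "tm t k" x] l a by (simp add: vt_add)
  show "x\<in>X (tm t (vt t)) ==> Al k (vt t) ((E (vt t) ^^ cc C (vt t) k) x) = (E k ^^ cc C k (vt t)) (Al k (vt t) x)"
  using rel[of "tm t k" t x] l adj_sym[OF a] by (simp add: tm_self)
  show "x\<in>X (tm t k) ==> Al (vt t) k ((E k ^^ cc C k (vt t)) x) = (E (vt t) ^^ cc C (vt t) k) (Al (vt t) k x)"
  using rel[of "t + n" "tm t k" x] l a by (simp add: vt_add)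
 qed (fact lin_E lin_Al adj_sym om B X_sub)+
 have Ph_eq: "Ph w = (\<Sum>(k, a)\<in>(SIGMA k : {k. adj C (vt t) k}. {..<cc C (vt t) k}). (E (vt t) ^^ a) (Al (vt t) k (w (k, a))))" for w
  by (simp add: Ph_def Ix_def case_prod_unfold)
 show ?thesis
 proof
  show "X (t + n) = Ph ` W"
  proof
  show "X (t + n) \<subseteq> Ph ` W"
  proof
  fix x assume "x\<in>X (t + n)"
  then obtain w where w: "\<forall>k a. if adj C (vt t) k & a < cc C (vt t) k then w (k, a)\<in>X (tm t k) else w (k, a) = 0"
  "x = (\<Sum>(k, a)\<in>(SIGMA k : {k. adj C (vt t) k}. {..<cc C (vt t) k}). (E (vt t) ^^ a) (Al (vt t) k (w (k, a))))"
  using gen[OF t, of "tm t" x] window by blast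
  have "w\<in>W" using w(1) unfolding W_def by (auto simp: Ix_iff split: if_splits)
  thus "x\<in>Ph ` W" using w(2) Ph_eq by auto
  qed
  qed (use Ph_Y in blast)
  show "Ph (out x) = 0" if "x\<in>X (tm t (vt t))" for x
  proof -
  have "Ph (out x) = (\<Sum>(k, a)\<in>(SIGMA k : {k. adj C (vt t) k}. {..<cc C (vt t) k}).
  (E (vt t) ^^ a) (Al (vt t) k (om (vt t) k *s Al k (vt t) ((E (vt t) ^^ (cc C (vt t) k - 1 - a)) x))))"
  unfolding Ph_eq by (intro sum.cong refl) (auto simp: out_def Ix_iff)
  thus ?thesis using mesh[OF t, of x] that by (simp add: tm_self)
  qed
  show "w\<in>out ` X (tm t (vt t))" if w: "w\<in>W" "Ph w = 0" for w
  proof -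
  have wX: "w (k, a)\<in>X (tm t k)" if "adj C (vt t) k" "a < cc C (vt t) k" for k a
  using WD(1)[OF w(1), of "(k, a)"] that by (simp add: Ix_iff)
  have "\<exists>x\<in>X t. \<forall>k a. adj C (vt t) k --> a < cc C (vt t) k -->
  w (k, a) = om (vt t) k *s Al k (vt t) ((E (vt t) ^^ (cc C (vt t) k - 1 - a)) x)"
  by (rule exact[OF t, of "tm t"]) (use window wX w(2) Ph_eq in auto)
  then obtain x where x: "x\<in>X t" "!!k a. adj C (vt t) k ==> a < cc C (vt t) k ==>
  w (k, a) = om (vt t) k *s Al k (vt t) ((E (vt t) ^^ (cc C (vt t) k - 1 - a)) x)" by blast
  have "w p = out x p" for p
  using x(2) WD(2)[OF w(1)] by (cases p) (auto simp: out_def Ix_iff)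
  hence "w = out x" by blast
  thus ?thesis using x(1) by (simp add: tm_self)
  qed
 qed (rule rig)
qed

text \<open>The symmetry \<open>d k * C k j = d j * C j k\<close> trades the column of
  \<open>C\<close> in the rank of the induced module for the row of \<open>C\<close> in
  \<open>refl\<close>.\<close>

lemma card_relation:
 assumes B: "!!k. int (card (B k)) * d i0 = d k * N k"
 shows "int (\<Sum>k\<in>nbs C j. cc C k j * card (B k)) * d i0 = d j * refl C j N j + int (card (B j)) * d i0"
proof -
 have t: "int (cc C k j * card (B k)) * d i0 = - (d j * (C j k * N k))" if "adj C j k" for k
 proof -
  have "int (cc C k j * card (B k)) * d i0 = - C k j * (d k * N k)"
  using adj_sym[OF that] B[of k] by (simp add: cc_def adj_def)
  also have "\<dots> = - (d k * C k j) * N k" by simp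
  finally show ?thesis using d(2)[of k j] by (simp add: algebra_simps)
 qed
 have z: "C j k = 0" if "\<not> adj C j k" "k ~= j" for k
  using that C_nonpos[of k j] by (auto simp: adj_def)
 have "(\<Sum>k\<in>UNIV. C j k * N k) = (\<Sum>k\<in>insert j (nbs C j). C j k * N k)"
  using z by (intro sum.mono_neutral_right) auto
 also have "\<dots> = 2 * N j + (\<Sum>k\<in>nbs C j. C j k * N k)"
  by (subst sum.insert) (auto simp: adj_def roots.diag)
 finally have "d j * refl C j N j + d j * N j = - (\<Sum>k\<in>nbs C j. d j * (C j k * N k))"
  by (simp add: refl_def algebra_simps sum_distrib_left)
 moreover have "int (\<Sum>k\<in>nbs C j. cc C k j * card (B k)) * d i0 = (\<Sum>k\<in>nbs C j. - (d j * (C j k * N k)))"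
  unfolding of_nat_sum sum_distrib_right by (intro sum.cong refl t) simp
 ultimately show ?thesis using B[of j] by (simp add: sum_negf)
qed

lemma step:
 assumes t: "t > pos i0" and st: "state t N" and pos': "!!k. 0 <= refl C (vt t) N k"
 shows "state (Suc t) (refl C (vt t) N)"
proof -
 obtain B where B: "!!k. hbasis (E k) (B k) (X (tm t k))" "!!k b. b\<in>B k ==> hom b"
  "!!k. int (card (B k)) * d i0 = d k * N k"
  and N: "N\<in>Rt" and rig: "rigid C E Al (%k l. tm t k < tm t l) (%k. X (tm t k))"
  using st unfolding state_def by blast
 let ?j = "vt t"
 let ?Y = "X (t + n)"
 interpret rr: rigid_reflection scale C E Al "om ?j" "%k. X (tm t k)" B ?j ?Y "%k l. tm t k < tm t l"
  by (rule step_reflection[OF t B(1) rig])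
 obtain L where L: "!!u x. u < L ==> x\<in>?Y ==> pr u x = 0" using pr_low by blast
 have d2: "0 < 2 * d ?j" using d(1) by simp
 have pr_EY: "pr u (E ?j x) = E ?j (pr (u - 2 * d ?j) x)" if "x\<in>?Y" for u x
  using pr_E[OF that] by (simp add: vt_add)
 have card: "int (\<Sum>k\<in>{k. adj C ?j k}. cc C k ?j * card (B k)) * d i0 = d ?j * refl C ?j N ?j + int (card (B ?j)) * d i0"
  by (rule card_relation[OF B(3)])
 have inj: "u\<in>E ?j ` X (tm t ?j)" if u: "u\<in>X (tm t ?j)" "rr.out u\<in>rr.ep ` rr.W" for u
 proof (rule ccontr)
  assume n: "u \<notin> E ?j ` X (tm t ?j)"
  have div: "?Y = E ?j ` ?Y" by (rule rr.not_reduced_imp_divisible[OF u n])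
  \<comment> \<open>Dividing by \<open>E ?j\<close> lowers the degree by \<open>2 * d ?j\<close>;
    after finitely many divisions the component lies below the bound \<open>L\<close>.\<close>
  have "pr u x = 0" if "x\<in>?Y" for u x using that
  proof (induction "nat (u - L + 1)" arbitrary: u x rule: less_induct)
  case less
  show ?case
  proof (cases "u < L")
  case True thus ?thesis using L less.prems by blast
  next
  case False
  obtain y where y: "y\<in>?Y" "x = E ?j y" using div less.prems by blast
  have "pr (u - 2 * d ?j) y = 0" using False d2 less.hyps[of "u - 2 * d ?j" y] y(1) by simp
  thus ?thesis using pr_EY[OF y(1)] y(2) rr.E_simps(4) by simp
  qed
  qed
  hence "?Y = {0}" using pr_zero X_sub[of "t + n"] subspace_0 by blast
  \<comment> \<open>Nonnegativity of the reflected coordinate says exactly that the rank of the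
    oldest piece is at most that of the induced module.\<close>
  moreover have "int (card (B ?j)) * d i0 <= int (\<Sum>k\<in>{k. adj C ?j k}. cc C k ?j * card (B k)) * d i0"
  unfolding card using pos'[of ?j] d(1)[of ?j] by simp
  hence "card (B ?j) <= (\<Sum>k\<in>{k. adj C ?j k}. cc C k ?j * card (B k))"
  using d(1)[of i0] by (simp only: mult_le_cancel_right_pos)
  ultimately show False using rr.reduced_of_card_le u n by blast
 qed
 interpret ir: injective_reflection scale C E Al "om ?j" "%k. X (tm t k)" B ?j ?Y "%k l. tm t k < tm t l"
  by unfold_locales (rule inj)
 have homG: "\<exists>u. pr u g = g & (\<forall>u'. u' ~= u --> pr u' g = 0)" if "g\<in>rr.gens" for g
 proof -
  from that obtain k r b where k: "adj C ?j k" "b\<in>B k" "g = Al ?j k ((E k ^^ r) b)"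
  by (auto simp: rr.gens_def)
  have lt: "t < tm t k" "tm t k < t + n" "vt (tm t k) = k"
  using k tm_gt[of k t] tm_bounds[of t k] vt_tm[of t k] by (auto simp: adj_def)
  have bX: "(E k ^^ m) b\<in>X (tm t k)" for m by (rule hb_pow[OF B(1) k(2)])
  obtain u where u: "pr u b = b" "!!u'. u' ~= u ==> pr u' b = 0" using B(2)[OF k(2)] by (auto simp: hom_def)
  have E: "pr (u' + int m * (2 * d k)) ((E k ^^ m) b) = (E k ^^ m) (pr u' b)" for m u'
  proof (induction m arbitrary: u')
  case (Suc m)
  have "pr (u' + int (Suc m) * (2 * d k)) ((E k ^^ Suc m) b) = E k (pr (u' + int m * (2 * d k)) ((E k ^^ m) b))"
  using pr_E[OF bX[of m]] lt(3) by (simp add: algebra_simps)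
  thus ?case using Suc by simp
  qed simp
  have A: "pr u' g = Al ?j k ((E k ^^ r) (pr (u' + max (d ?j) (d k) - int r * (2 * d k)) b))" for u'
  using pr_Al[of "t + n" "tm t k" "(E k ^^ r) b" u'] k lt bX[of r] E[of "u' + max (d ?j) (d k) - int r * (2 * d k)" r]
  by (simp add: vt_add)
  show ?thesis
  proof (intro exI conjI allI impI)
  let ?u = "u - max (d ?j) (d k) + int r * (2 * d k)"
  show "pr ?u g = g" by (subst A) (simp add: u(1) k(3))
  fix u' assume "u' ~= ?u"
  thus "pr u' g = 0" by (simp add: A u(2) rr.E_pows(4) rr.Al_simps(4))
  qed
 qed
 obtain F where F: "F \<subseteq> rr.gens" "hbasis (E ?j) F ?Y"
  by (rule graded_nakayama[OF lin_E rr.finite_gens rr.Y_span ir.Y_inj lin_pr pr_X pr_EY pr_idem L d2 homG])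
  (assumption | rule that)+
 define B' where "B' = B(?j := F)"
 have "hbasis (E k) (B' k) (X (tm (Suc t) k)) & (\<forall>b\<in>B' k. hom b) & int (card (B' k)) * d i0 = d k * refl C ?j N k" for k
 proof (cases "k = ?j")
  case True
  have "(card (B ?j) + card F) = (\<Sum>k\<in>{k. adj C ?j k}. cc C k ?j * card (B k))" by (rule ir.card_basis[OF F(2)])
  hence "int (card (B ?j) + card F) * d i0 = d ?j * refl C ?j N ?j + int (card (B ?j)) * d i0" using card by simp
  hence "int (card F) * d i0 = d ?j * refl C ?j N ?j" by (simp add: algebra_simps)
  moreover have "\<forall>b\<in>F. hom b" using F(1) homG by (auto simp: hom_def)
  ultimately show ?thesis using True F(2) by (simp add: B'_def tm_Suc)
 next
  case False
  thus ?thesis using B by (simp add: B'_def tm_Suc refl_def)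
 qed
 moreover have "refl C ?j N\<in>Rt" by (rule roots.refl_closed[OF N])
 moreover have "rigid C E Al (%k l. tm (Suc t) k < tm (Suc t) l) (%k. X (tm (Suc t) k))"
 proof -
  have "(%k. X (tm (Suc t) k)) = (%k. X (tm t k))(?j := ?Y)" by (simp add: fun_eq_iff tm_Suc)
  moreover have "rigid C E Al (%k l. tm (Suc t) k < tm (Suc t) l) ((%k. X (tm t k))(?j := ?Y))"
  proof (rule rr.rigid_reflected)
  show "k ~= ?j ==> l ~= ?j ==> tm (Suc t) k < tm (Suc t) l ==> tm t k < tm t l" for k l
  by (simp add: tm_Suc)
  show "\<not> tm (Suc t) ?j < tm (Suc t) k" for k using tm_bounds(2)[of t k] by (auto simp: tm_Suc)
  qed
  ultimately show ?thesis by simp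
 qed
 ultimately show ?thesis unfolding state_def using pos' by blast
qed

text \<open>When the reflection leaves the positive cone, the root is supported at the current
  vertex, so every other piece of the window is zero. Each later piece is generated by earlier
  pieces that still come after \<open>t\<close>, and vanishes by induction.\<close>

lemma dead:
 assumes t: "t > pos i0" and st: "state t N" and neg: "\<not> (\<forall>k. 0 <= refl C (vt t) N k)"
 shows "s > t ==> X s = {0}"
proof (induction s rule: less_induct)
 case (less s)
 obtain B where B: "!!k. hbasis (E k) (B k) (X (tm t k))" "!!k. int (card (B k)) * d i0 = d k * N k"
  and N: "N\<in>Rt" "!!k. 0 <= N k"
  using st unfolding state_def by blast
 have "refl C (vt t) N\<in>Rt" by (rule roots.refl_closed[OF N(1)])
 \<comment> \<open>The reflected root is nonpositive and agrees with the nonnegative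
   \<open>N\<close> away from \<open>vt t\<close>.\<close>
 hence "\<forall>k. refl C (vt t) N k <= 0" using roots.sign neg by blast
 hence "N k <= 0" if "k ~= vt t" for k using that by (metis fun_upd_other refl_def)
 hence N0: "N k = 0" if "k ~= vt t" for k using that N(2)[of k] by (metis antisym)
 show ?case
 proof (cases "s < t + n")
  case True
  let ?k = "vt s"
  have s: "s = tm t ?k" using tm_unique[of t s ?k] less.prems True by simp
  hence "?k ~= vt t" using less.prems by (metis nat_neq_iff tm_self)
  hence "card (B ?k) = 0" using B(2)[of ?k] N0 d(1)[of i0] by simp
  hence "B ?k = {}" using hb_finite[OF B(1)] by simp
  thus ?thesis using hbasis_empty B(1)[of ?k] s by metis
 next
  case False
  define r where "r = s - n"
  have r: "s = r + n" "r >= t" using False by (auto simp: r_def)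
  have "x = 0" if x: "x\<in>X s" for x
  proof -
  have window: "r < tm r k & tm r k < r + n & vt (tm r k) = k" if "k ~= vt r" for k
  using tm_gt[OF that] tm_bounds[of r k] vt_tm[of r k] by auto
  have rp: "r > pos i0" using r t by simp
  have xr: "x\<in>X (r + n)" using x r by simp
  obtain w where w: "\<forall>k a. if adj C (vt r) k & a < cc C (vt r) k then w (k, a)\<in>X (tm r k) else w (k, a) = 0"
  "x = (\<Sum>(k, a)\<in>(SIGMA k : {k. adj C (vt r) k}. {..<cc C (vt r) k}). (E (vt r) ^^ a) (Al (vt r) k (w (k, a))))"
  using gen[OF rp _ xr, of "tm r"] window by blast
  have "w (k, a) = 0" if "adj C (vt r) k" "a < cc C (vt r) k" for k a
  proof -
  have "k ~= vt r" using that by (auto simp: adj_def)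
  hence "X (tm r k) = {0}" using window[of k] r by (intro less.IH) auto
  thus ?thesis using w(1) that by (metis singletonD)
  qed
  moreover have "Al j k 0 = 0" "(E j ^^ m) 0 = 0" for j k m
  proof -
  interpret a: Vector_Spaces.linear scale scale "Al j k" by (rule lin_Al)
  interpret e: Vector_Spaces.linear scale scale "E j ^^ m" by (rule linear_funpow[OF lin_E])
  show "Al j k 0 = 0" "(E j ^^ m) 0 = 0" by (rule a.zero e.zero)+
  qed
  ultimately show ?thesis unfolding w(2) by (intro sum.neutral) auto
  qed
  thus ?thesis using subspace_0[OF X_sub] by blast
 qed
qed

text \<open>The window from \<open>Suc (pos i0)\<close> ends with the starting time
  \<open>n + pos i0\<close>, so it has a single nonzero piece, free of rank one. No arrow joins two
  nonzero pieces, and every cocycle is zero.\<close>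

lemma state_start: "state (Suc (pos i0)) (uvec i0)"
proof -
 let ?t = "Suc (pos i0)"
 have ti: "tm ?t i0 = n + pos i0"
  using tm_unique[of ?t "n + pos i0" i0] n_pos pos_less[of i0] vt_eq_iff[of "n + pos i0" i0] by simp
 have tk: "X (tm ?t k) = {0}" if "k ~= i0" for k
 proof -
  have "tm ?t k ~= tm ?t i0" using that vt_tm by metis
  thus ?thesis using tm_bounds[of ?t k] ti by (intro X_early) linarith
 qed
 let ?B = "%k. if k = i0 then {g0} else {}"
 have "hbasis (E k) (?B k) (X (tm ?t k)) & (\<forall>b\<in>?B k. hom b) & int (card (?B k)) * d i0 = d k * uvec i0 k" for k
  using X_start hom_start tk[of k] by (auto simp: ti hom_def uvec_def hbasis_def)
 moreover have "rigid C E Al (%k l. tm ?t k < tm ?t l) (%k. X (tm ?t k))"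
 proof (rule rigidI)
  fix xi :: "'i => 'i => 'v => 'v"
  assume 1: "!!k l. adj C l k ==> tm ?t k < tm ?t l ==> vend scale (xi l k)"
  and 2: "!!k l. adj C l k ==> tm ?t k < tm ?t l ==> xi l k ` X (tm ?t k) \<subseteq> X (tm ?t l)"
  interpret vv: vspace_pair scale scale ..
  have "xi l k x = 0" if a: "adj C l k" "tm ?t k < tm ?t l" "x\<in>X (tm ?t k)" for k l x
  proof (cases "l = i0")
  case True
  hence "x = 0" using a tk[of k] by (auto simp: adj_def)
  interpret x: Vector_Spaces.linear scale scale "xi l k" using 1[OF a(1,2)] .
  show ?thesis using \<open>x = 0\<close> x.zero by simp
  next
  case False
  thus ?thesis using 2[OF a(1,2)] a(3) tk[of l] by blast
  qed
  moreover have "vend scale (%x. 0)"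
  by (simp add: Vector_Spaces.linear_iff vector_space_axioms)
  moreover have "Al l k 0 = 0" "E k 0 = 0" for k l
  proof -
  interpret a: Vector_Spaces.linear scale scale "Al l k" by (rule lin_Al)
  interpret e: Vector_Spaces.linear scale scale "E k" by (rule lin_E)
  show "Al l k 0 = 0" "E k 0 = 0" by (rule a.zero e.zero)+
  qed
  ultimately show "\<exists>f. (\<forall>k. vend scale (f k) & f k ` X (tm ?t k) \<subseteq> X (tm ?t k)
  & (\<forall>x\<in>X (tm ?t k). f k (E k x) = E k (f k x)))
  & (\<forall>k l. adj C l k --> tm ?t k < tm ?t l --> (\<forall>x\<in>X (tm ?t k). xi l k x = f l (Al l k x) - Al l k (f k x)))"
  by (intro exI[of _ "%k x. 0"]) (auto simp: subspace_0[OF X_sub])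
 qed
 ultimately show ?thesis unfolding state_def
  using roots.simple[of i0] by (intro exI[of _ ?B] conjI allI) (auto simp: uvec_def)
qed

lemma main:
 obtains T where "!!s. s >= T ==> X s = {0}" "!!s x. x\<in>X s ==> E (vt s) x = 0 ==> x = 0"
proof -
 let ?t1 = "Suc (pos i0)"
 define N where "N = rec_nat (uvec i0) (%m. refl C (vt (?t1 + m)))"
 have N0: "N 0 = uvec i0" and NS: "N (Suc m) = refl C (vt (?t1 + m)) (N m)" for m
  by (simp_all add: N_def)
 have NR: "N m\<in>Rt" for m by (induction m) (simp_all add: N0 NS roots.simple roots.refl_closed)
 have "\<exists>m. \<not> (\<forall>k. 0 <= N m k)"
 proof (rule ccontr)
  assume "\<not> ?thesis"
  hence "0 <= N m k" for m k by blast
  moreover have "vt (?t1 + (m + n)) = vt (?t1 + m)" for m using vt_add[of "?t1 + m"] by (simp add: add.assoc)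
  moreover have "bij_betw (%m. vt (?t1 + m)) {..<n} UNIV"
  proof (rule bij_betwI[where g = "%k. tm ?t1 k - ?t1"])
  show "(%m. vt (?t1 + m))\<in>{..<n} \<rightarrow> UNIV" by simp
  show "(%k. tm ?t1 k - ?t1)\<in>UNIV \<rightarrow> {..<n}" using tm_bounds[of ?t1] by (auto simp: less_diff_conv2 add.commute)
  show "tm ?t1 (vt (?t1 + m)) - ?t1 = m" if "m\<in>{..<n}" for m
  using tm_unique[of ?t1 "?t1 + m" "vt (?t1 + m)"] that by simp
  show "vt (?t1 + (tm ?t1 k - ?t1)) = k" for k using tm_bounds(1)[of ?t1 k] vt_tm[of ?t1 k] by simp
  qed
  ultimately show False using roots.no_positive_orbit[of N "%m. vt (?t1 + m)" n] NR NS by blast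
 qed
 \<comment> \<open>The first time at which positivity fails: before it the windows are described by
   \<open>state\<close>, and from it on all pieces vanish.\<close>
 then obtain m where m: "\<not> (\<forall>k. 0 <= N m k)" "!!m'. m' < m ==> \<forall>k. 0 <= N m' k"
  using exists_least_iff[of "%m. \<not> (\<forall>k. 0 <= N m k)"] by blast
 have st: "m' < m ==> state (?t1 + m') (N m')" for m'
 proof (induction m')
  case 0 thus ?case using state_start by (simp add: N0)
 next
  case (Suc m')
  hence "state (?t1 + m') (N m')" by simp
  from step[OF _ this] show ?case using m(2)[OF Suc.prems] by (simp add: NS)
 qed
 obtain m' where m': "m = Suc m'" using m(1) by (cases m) (auto simp: N0 uvec_def split: if_splits)
 have dead': "X s = {0}" if "s >= ?t1 + m" for s
  using dead[OF _ st[of m'], of s] m(1) that by (simp add: m' NS)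
 have "x = 0" if x: "x\<in>X s" "E (vt s) x = 0" for s x
 proof (cases "s < ?t1")
  case True
  hence "s < n + pos i0" using n_pos by linarith
  thus ?thesis using X_early x(1) by blast
 next
  case False
  show ?thesis
  proof (cases "s < ?t1 + m")
  case True
  define m'' where "m'' = s - ?t1"
  have m'': "s = ?t1 + m''" "m'' < m" using True False by (auto simp: m''_def)
  have "state s (N m'')" using st[OF m''(2)] m''(1) by simp
  then obtain B where "hbasis (E (vt s)) B (X (tm s (vt s)))" unfolding state_def by blast
  hence "hbasis (E (vt s)) B (X s)" by (simp add: tm_self)
  from hbasis_inj[OF this lin_E x] show ?thesis .
  next
  case False
  thus ?thesis using dead' x(1) by (metis not_less singletonD)
  qed
 qed
 thus ?thesis using that[OF dead'] by blast
qed

end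

section \<open>Roots of a complex Lie algebra: finiteness and closure under reflections\<close>

context complex_lie_algebra
begin

lemma br_0_left [simp]: "br 0 x = 0" and br_0_right [simp]: "br x 0 = 0"
 using br_scale_left[of 0 0 x] br_scale_right[of x 0 0] by simp_all

lemma br_neg_left: "br (- x) y = - br x y" and br_neg_right: "br x (- y) = - br x y"
 using br_scale_left[of "-1" x y] br_scale_right[of x "-1" y] by simp_all

lemma br_anti: "br x y = - br y x"
proof -
 have "br (x + y) (x + y) = br x (x + y) + br y (x + y)" by (rule br_add_left)
 also have "\<dots> = br x y + br y x" by (simp add: br_add_right br_self)
 finally have "br x y + br y x = 0" by (simp add: br_self)
 thus ?thesis by (simp add: eq_neg_iff_add_eq_0)
qed

lemma jacobi_derivation: "br x (br y z) = br (br x y) z + br y (br x z)"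
proof -
 have "br x (br y z) + br y (br z x) + br z (br x y) = 0" by (rule jacobi)
 moreover have "br y (br z x) = - br y (br x z)" by (subst br_anti[of z x]) (rule br_neg_right)
 moreover have "br z (br x y) = - br (br x y) z" by (rule br_anti)
 ultimately show ?thesis by (simp add: algebra_simps)
qed

lemma br_sum_right: "br x (\<Sum>i\<in>I. f i) = (\<Sum>i\<in>I. br x (f i))"
 by (induction I rule: infinite_finite_induct) (auto simp: br_add_right)

lemma root_space_zero: "0\<in>root_space H be"
 by (simp add: root_space_def)

lemma root_space_br:
 assumes "x\<in>root_space H \<alpha>" "y\<in>root_space H be"
 shows "br x y\<in>root_space H (%h. \<alpha> h + be h)"
 using assms by (auto simp: root_space_def jacobi_derivation[of _ x y] br_scale_left br_scale_right scale_left_distrib)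

lemma ad_pow_root_space:
 assumes "e\<in>root_space H \<alpha>" "v\<in>root_space H be"
 shows "(br e ^^ k) v\<in>root_space H (%h. be h + of_nat k * \<alpha> h)"
proof (induction k)
 case 0 thus ?case using assms by simp
next
 case (Suc k)
 have "br e ((br e ^^ k) v)\<in>root_space H (%h. \<alpha> h + (be h + of_nat k * \<alpha> h))"
  by (rule root_space_br[OF assms(1) Suc])
 thus ?case by (simp add: algebra_simps)
qed

text \<open>Applying an \<open>h\<close> that separates two weights and subtracting a multiple of
  the relation removes one term.\<close>

lemma eigenvectors_independent:
 assumes "finite F" "!!n. n\<in>F ==> x n\<in>root_space H (b n)" "!!n. n\<in>F ==> x n ~= 0"
  "!!n m. n\<in>F ==> m\<in>F ==> n ~= m ==> \<exists>h\<in>H. b n h ~= b m h"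
  "(\<Sum>n\<in>F. scale (c n) (x n)) = 0" "n\<in>F"
 shows "c n = 0"
 using assms
proof (induction F arbitrary: c n rule: finite_induct)
 case empty thus ?case by simp
next
 case (insert m F)
 have IH: "c' n = 0" if "(\<Sum>n\<in>F. scale (c' n) (x n)) = 0" "n\<in>F" for c' n
  by (rule insert.IH[OF _ _ _ that]) (use insert.prems in auto)
 have s: "scale (c m) (x m) + (\<Sum>n\<in>F. scale (c n) (x n)) = 0"
  using insert.prems(4) insert.hyps by simp
 have F0: "c n = 0" if n: "n\<in>F" for n
 proof -
  obtain h where h: "h\<in>H" "b n h ~= b m h" using insert.prems(3)[of n m] n insert.hyps by auto
  have eig: "br h (x n) = scale (b n h) (x n)" if "n\<in>insert m F" for n
  using insert.prems(1)[OF that] h(1) by (simp add: root_space_def)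
  have "br h (scale (c m) (x m) + (\<Sum>n\<in>F. scale (c n) (x n))) = 0" by (simp only: s br_0_right)
  hence 1: "scale (b m h) (scale (c m) (x m)) + (\<Sum>n\<in>F. scale (c n * b n h) (x n)) = 0"
  by (simp add: br_add_right br_sum_right br_scale_right eig mult.commute)
  have "scale (b m h) (scale (c m) (x m) + (\<Sum>n\<in>F. scale (c n) (x n))) = 0" by (simp only: s scale_zero_right)
  hence 2: "scale (b m h) (scale (c m) (x m)) + (\<Sum>n\<in>F. scale (b m h * c n) (x n)) = 0"
  by (simp add: scale_right_distrib scale_sum_right)
  have "(\<Sum>n\<in>F. scale (c n * b n h) (x n)) - (\<Sum>n\<in>F. scale (b m h * c n) (x n)) = 0"
  using add_left_imp_eq[OF trans[OF 1 2[symmetric]]] by simp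
  moreover have "(\<Sum>n\<in>F. scale (c n * (b n h - b m h)) (x n))
  = (\<Sum>n\<in>F. scale (c n * b n h) (x n) - scale (b m h * c n) (x n))"
  by (intro sum.cong refl) (simp add: right_diff_distrib scale_left_diff_distrib mult.commute)
  ultimately have "(\<Sum>n\<in>F. scale (c n * (b n h - b m h)) (x n)) = 0"
  by (simp only: sum_subtractf)
  from IH[OF this n] show ?thesis using h(2) by simp
 qed
 hence "scale (c m) (x m) = 0" using s by simp
 hence "c m = 0" using insert.prems(2)[of m] by simp
 thus ?case using F0 insert.prems(5) by auto
qed

text \<open>The representation theory of \<open>sl2\<close> behind root strings: the \<open>p\<close>-th power of \<open>ad e\<close> takes \<open>v\<close> to
 a highest weight vector of weight \<open>m + 2 p\<close>, on which \<open>ad f\<close> can be iterated \<open>m + 2 p\<close> times.\<close>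

lemma sl2_string:
 assumes fd: "finite Bs" "span Bs = UNIV"
  and h: "h\<in>H" "br e f = h" "br h e = scale 2 e" "br h f = scale (-2) f"
  and e: "e\<in>root_space H \<alpha>" and f: "f\<in>root_space H (%h. - \<alpha> h)"
  and v: "v\<in>root_space H be" "v ~= 0" "br h v = scale (of_nat m) v"
 shows "root_space H (%h. be h - of_nat m * \<alpha> h) ~= {0}"
proof -
 have eig_e: "br h ((br e ^^ k) v) = scale (of_nat (m + 2 * k)) ((br e ^^ k) v)" for k
 proof (induction k)
  case (Suc k)
  have "br h (br e ((br e ^^ k) v)) = scale 2 (br e ((br e ^^ k) v)) + scale (of_nat (m + 2 * k)) (br e ((br e ^^ k) v))"
  by (subst jacobi_derivation) (simp add: h(3) Suc br_scale_left br_scale_right)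
  also have "\<dots> = scale (of_nat (m + 2 * Suc k)) (br e ((br e ^^ k) v))"
  by (simp add: scale_left_distrib[symmetric])
  finally show ?case by simp
 qed (simp add: v(3))
 \<comment> \<open>Otherwise the powers would be eigenvectors of \<open>br h\<close> for the
   distinct eigenvalues \<open>m + 2 k\<close>, too many for a finite dimension.\<close>
 have "\<exists>k. (br e ^^ k) v = 0"
 proof (rule ccontr)
  assume no: "\<not> ?thesis"
  let ?x = "%k. (br e ^^ k) v"
  let ?F = "{..card Bs}"
  have eq: "?x k\<in>root_space {h} (%_. of_nat (m + 2 * k))" for k using eig_e by (simp add: root_space_def)
  have ind: "c k = 0" if "(\<Sum>k\<in>?F. scale (c k) (?x k)) = 0" "k\<in>?F" for c k
  using eq no by (intro eigenvectors_independent[OF _ _ _ _ that, where b = "%k _. of_nat (m + 2 * k)" and H = "{h}"]) auto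
  have inj: "inj_on ?x ?F"
  proof (rule inj_onI, rule ccontr)
  fix i j assume ij: "i\<in>?F" "j\<in>?F" "?x i = ?x j" "i ~= j"
  have "scale (of_nat (m + 2 * i)) (?x i) = scale (of_nat (m + 2 * j)) (?x i)" using eig_e ij(3) by metis
  hence "of_nat (m + 2 * i) = (of_nat (m + 2 * j) :: complex)" using no by (metis scale_right_imp_eq)
  thus False using ij(4) by (simp only: of_nat_eq_iff)
  qed
  have "independent (?x ` ?F)"
  proof (rule independent_if_scalars_zero)
  fix u x assume "(\<Sum>x\<in>?x ` ?F. scale (u x) x) = 0" "x\<in>?x ` ?F"
  thus "u x = 0" using ind[of "%k. u (?x k)"] by (auto simp: sum.reindex[OF inj])
  qed simp
  hence "card (?x ` ?F) <= card Bs" using independent_span_bound[OF fd(1)] fd(2) by auto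
  thus False by (simp add: card_image[OF inj])
 qed
 then obtain q where q: "(br e ^^ q) v = 0" "!!k. k < q ==> (br e ^^ k) v ~= 0"
  using exists_least_iff[of "%k. (br e ^^ k) v = 0"] by blast
 then obtain p where p: "q = Suc p" using v(2) by (cases q) auto
 define u where "u = (br e ^^ p) v"
 have u: "u ~= 0" "br e u = 0" using q p by (auto simp: u_def)
 define N where "N = m + 2 * p"
 have hu: "br h ((br f ^^ k) u) = scale (of_nat N - 2 * of_nat k) ((br f ^^ k) u)" for k
 proof (induction k)
  case 0 thus ?case using eig_e[of p] by (simp add: u_def N_def)
 next
  case (Suc k)
  have "br h (br f ((br f ^^ k) u)) = scale (-2) (br f ((br f ^^ k) u)) + scale (of_nat N - 2 * of_nat k) (br f ((br f ^^ k) u))"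
  by (subst jacobi_derivation) (simp only: h(4) Suc br_scale_left br_scale_right)
  also have "\<dots> = scale (of_nat N - 2 * of_nat (Suc k)) (br f ((br f ^^ k) u))"
  unfolding scale_left_distrib[symmetric] by (rule arg_cong2[where f = scale]) simp_all
  finally show ?case by simp
 qed
 \<comment> \<open>The standard formula for \<open>e\<close> on the string below a highest weight
   vector; the factor is nonzero as long as \<open>k < N\<close>.\<close>
 have ef: "br e ((br f ^^ Suc k) u) = scale (of_nat (Suc k) * (of_nat N - of_nat k)) ((br f ^^ k) u)" for k
 proof (induction k)
  case 0
  have "br e (br f u) = br h u" by (subst jacobi_derivation) (simp add: h(2) u(2))
  thus ?case using hu[of 0] by simp
 next
  case (Suc k)
  have "br e (br f ((br f ^^ Suc k) u)) = br h ((br f ^^ Suc k) u) + br f (br e ((br f ^^ Suc k) u))"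
  by (subst jacobi_derivation) (simp add: h(2))
  also have "\<dots> = scale (of_nat N - 2 * of_nat (Suc k)) ((br f ^^ Suc k) u)
  + scale (of_nat (Suc k) * (of_nat N - of_nat k)) ((br f ^^ Suc k) u)"
  unfolding hu Suc by (simp add: br_scale_right)
  also have "\<dots> = scale (of_nat (Suc (Suc k)) * (of_nat N - of_nat (Suc k))) ((br f ^^ Suc k) u)"
  unfolding scale_left_distrib[symmetric] by (rule arg_cong2[where f = scale]) (simp_all add: algebra_simps)
  finally show ?case by simp
 qed
 have ne: "(br f ^^ k) u ~= 0" if "k <= N" for k
  using that
 proof (induction k)
  case (Suc k)
  show ?case
  proof
  assume "(br f ^^ Suc k) u = 0"
  hence "scale (of_nat (Suc k) * (of_nat N - of_nat k)) ((br f ^^ k) u) = 0" using ef[of k] by simp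
  moreover have "(of_nat N :: complex) ~= of_nat k" using Suc.prems by simp
  moreover have "(of_nat (Suc k) :: complex) ~= 0" by (simp only: of_nat_eq_0_iff)
  ultimately show False using Suc by simp
  qed
 qed (simp add: u(1))
 \<comment> \<open>As \<open>m + p <= N\<close>, the string is still nonzero after
   \<open>m + p\<close> steps, and its weight there is \<open>be - m \<alpha>\<close>.\<close>
 have "u\<in>root_space H (%h. be h + of_nat p * \<alpha> h)"
  unfolding u_def by (rule ad_pow_root_space[OF e v(1)])
 from ad_pow_root_space[OF f this, of "m + p"]
 have "(br f ^^ (m + p)) u\<in>root_space H (%h. be h - of_nat m * \<alpha> h)" by (simp add: algebra_simps)
 thus ?thesis using ne[of "m + p"] by (auto simp: N_def)
qed

lemma root_string:
 assumes fd: "finite Bs" "span Bs = UNIV" and H: "cartan_subalgebra H"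
  and \<alpha>: "is_root H \<alpha>" "is_coroot H \<alpha> t" and be: "root_space H be ~= {0}" "be t = of_int m"
 shows "root_space H (%h. be h - of_int m * \<alpha> h) ~= {0}"
proof -
 obtain e f where ef: "e\<in>root_space H \<alpha>" "f\<in>root_space H (%h. - \<alpha> h)" "t = br e f" and \<alpha>t: "\<alpha> t = 2"
  using \<alpha>(2) by (auto simp: is_coroot_def)
 have "br e f\<in>root_space H (%h. \<alpha> h + - \<alpha> h)" by (rule root_space_br[OF ef(1,2)])
 hence "\<forall>h\<in>H. br h t = 0" using ef(3) by (simp add: root_space_def)
 \<comment> \<open>\<open>t\<close> has weight 0, so it commutes with \<open>H\<close>, and
   \<open>H\<close> is its own centralizer.\<close>
 hence tH: "t\<in>H" using H unfolding cartan_subalgebra_def by blast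
 have te: "br t e = scale 2 e" "br t f = scale (-2) f" using ef(1,2) tH \<alpha>t by (auto simp: root_space_def)
 obtain v where v: "v\<in>root_space H be" "v ~= 0" using be(1) root_space_zero by blast
 have tv: "br t v = scale (of_int m) v" using v(1) tH be(2) by (simp add: root_space_def)
 show ?thesis
 proof (cases "m >= 0")
  case True
  then obtain k where k: "m = int k" by (metis nonneg_int_cases)
  show ?thesis using sl2_string[OF fd tH ef(3)[symmetric] te ef(1,2) v, of k] tv k by simp
 next
  case False
  \<comment> \<open>For negative \<open>m\<close> the roles of \<open>e\<close> and \<open>f\<close>
    are exchanged and \<open>t\<close> is replaced by \<open>- t\<close>.\<close>
  define k where "k = nat (- m)"
  have k: "m = - int k" using False by (simp add: k_def)
  have "subspace H" using H unfolding cartan_subalgebra_def by blast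
  hence nH: "- t\<in>H" using tH by (rule subspace_neg)
  have fe: "br f e = - t" using br_anti[of f e] ef(3) by simp
  have e': "e\<in>root_space H (%h. - (- \<alpha> h))" using ef(1) by simp
  have "root_space H (%h. be h - of_nat k * - \<alpha> h) ~= {0}"
  by (rule sl2_string[OF fd nH fe _ _ ef(2) e' v]) (simp_all add: br_neg_left te tv k)
  thus ?thesis using k by simp
 qed
qed

text \<open>\<open>Rt\<close> collects the coordinate vectors of the roots, which \<open>b\<close>
  turns back into functions. Closure under reflections comes from root strings: the value of a root
  at the coroot \<open>t j\<close> is the integer that \<open>refl\<close> subtracts.\<close>

lemma cartan_matrix_finite_roots:
 fixes C :: "'i::finite => 'i => int"
 assumes fd: "finite Bs" "span Bs = UNIV" and C: "has_cartan_matrix C"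
 shows "\<exists>Rt. finite_roots C Rt"
proof -
 obtain H \<alpha> t where H: "cartan_subalgebra H" and sr: "simple_roots H \<alpha>"
  and co: "!!i. is_coroot H (\<alpha> i) (t i)" and Ct: "!!i j. of_int (C i j) = \<alpha> j (t i)"
  using C unfolding has_cartan_matrix_def by blast
 have simple: "!!i. is_root H (\<alpha> i)"
  and indep: "!!a i. (\<forall>h\<in>H. (\<Sum>i\<in>UNIV. a i * \<alpha> i h) = 0) ==> a i = 0"
  and sgn: "!!be. is_root H be ==> \<exists>n :: 'i => nat. (\<forall>h\<in>H. be h = (\<Sum>i\<in>UNIV. of_nat (n i) * \<alpha> i h))
  \<or> (\<forall>h\<in>H. be h = - (\<Sum>i\<in>UNIV. of_nat (n i) * \<alpha> i h))"
  using sr unfolding simple_roots_def by blast+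
 define b where "b n h = (\<Sum>k\<in>UNIV. of_int (n k) * \<alpha> k h)" for n :: "'i => int" and h
 define Rt where "Rt = {n. is_root H (b n)}"
 have b_inj: "n = n'" if "!!h. h\<in>H ==> b n h = b n' h" for n n'
 proof
  fix i
  have "\<forall>h\<in>H. (\<Sum>i\<in>UNIV. of_int (n i - n' i) * \<alpha> i h) = 0"
  using that by (simp add: b_def algebra_simps sum_subtractf)
  from indep[OF this, of i] show "n i = n' i" by simp
 qed
 \<comment> \<open>Root vectors of distinct roots are independent, so the dimension bounds the
   number of roots.\<close>
 have "finite Rt"
 proof (rule ccontr)
  assume "infinite Rt"
  then obtain F where F: "F \<subseteq> Rt" "finite F" "card F = Suc (card Bs)" by (meson infinite_arbitrarily_large)
  have "\<forall>n\<in>F. \<exists>x. x\<in>root_space H (b n) & x ~= 0"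
  using F(1) root_space_zero by (fastforce simp: Rt_def is_root_def)
  then obtain x where x: "!!n. n\<in>F ==> x n\<in>root_space H (b n)" "!!n. n\<in>F ==> x n ~= 0" by metis
  have dist: "\<exists>h\<in>H. b n h ~= b m h" if "n ~= m" for n m using b_inj[of n m] that by blast
  have ind: "c k = 0" if "(\<Sum>k\<in>F. scale (c k) (x k)) = 0" "k\<in>F" for c k
  by (rule eigenvectors_independent[OF F(2) x _ that]) (use dist in auto)
  have inj: "inj_on x F"
  proof (rule inj_onI, rule ccontr)
  fix n m assume nm: "n\<in>F" "m\<in>F" "x n = x m" "n ~= m"
  obtain h where h: "h\<in>H" "b n h ~= b m h" using dist[OF nm(4)] by blast
  have "scale (b n h) (x n) = scale (b m h) (x n)" using x(1)[OF nm(1)] x(1)[OF nm(2)] nm(3) h(1) by (auto simp: root_space_def)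
  thus False using h(2) x(2)[OF nm(1)] by (metis scale_right_imp_eq)
  qed
  have "independent (x ` F)"
  proof (rule independent_if_scalars_zero)
  fix u y assume "(\<Sum>y\<in>x ` F. scale (u y) y) = 0" "y\<in>x ` F"
  thus "u y = 0" using ind[of "%k. u (x k)"] by (auto simp: sum.reindex[OF inj])
  qed (use F(2) in simp)
  hence "card (x ` F) <= card Bs" using independent_span_bound[OF fd(1)] fd(2) by auto
  thus False using F(3) by (simp add: card_image[OF inj])
 qed
 moreover have "uvec i\<in>Rt" for i
 proof -
  have "b (uvec i) h = \<alpha> i h" for h
  proof -
  have "b (uvec i) h = (\<Sum>k\<in>UNIV. if k = i then \<alpha> i h else 0)"
  unfolding b_def by (intro sum.cong) (auto simp: uvec_def)
  thus ?thesis by simp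
  qed
  hence "b (uvec i) = \<alpha> i" by blast
  thus ?thesis using simple by (simp add: Rt_def)
 qed
 moreover have "(\<forall>k. 0 <= n k) \<or> (\<forall>k. n k <= 0)" if n: "n\<in>Rt" for n
 proof -
  obtain m :: "'i => nat" where m: "(\<forall>h\<in>H. b n h = (\<Sum>i\<in>UNIV. of_nat (m i) * \<alpha> i h))
  \<or> (\<forall>h\<in>H. b n h = - (\<Sum>i\<in>UNIV. of_nat (m i) * \<alpha> i h))"
  using sgn n unfolding Rt_def by blast
  have "b (%i. int (m i)) h = (\<Sum>i\<in>UNIV. of_nat (m i) * \<alpha> i h)" "b (%i. - int (m i)) h = - (\<Sum>i\<in>UNIV. of_nat (m i) * \<alpha> i h)" for h
  by (simp_all add: b_def sum_negf)
  hence "n = (%i. int (m i)) \<or> n = (%i. - int (m i))" using m b_inj by metis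
  thus ?thesis by auto
 qed
 moreover have b0: "b (%k. 0) h = 0" for h by (simp add: b_def)
 hence "(%k. 0) \<notin> Rt" by (simp add: Rt_def is_root_def)
 moreover have diag: "C i i = 2" for i
 proof -
  have "of_int (C i i) = (of_int 2 :: complex)" using Ct[of i i] co[of i] by (simp add: is_coroot_def)
  thus ?thesis by (simp only: of_int_eq_iff)
 qed
 moreover have "refl C j n\<in>Rt" if n: "n\<in>Rt" for j n
 proof -
  let ?m = "\<Sum>k\<in>UNIV. C j k * n k"
  have bt: "b n (t j) = of_int ?m" by (simp add: b_def Ct[symmetric] mult.commute)
  have "root_space H (b n) ~= {0}" using n by (simp add: Rt_def is_root_def)
  from root_string[OF fd H simple[of j] co[of j] this bt]
  have 1: "root_space H (%h. b n h - of_int ?m * \<alpha> j h) ~= {0}" .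
  have beq: "b (refl C j n) = (%h. b n h - of_int ?m * \<alpha> j h)"
  proof
  fix h
  have "b (refl C j n) h = (\<Sum>k\<in>UNIV. of_int (n k) * \<alpha> k h - (if k = j then of_int ?m * \<alpha> j h else 0))"
  unfolding b_def by (intro sum.cong) (auto simp: refl_def algebra_simps)
  thus "b (refl C j n) h = b n h - of_int ?m * \<alpha> j h" by (simp add: sum_subtractf b_def)
  qed
  have 2: "root_space H (b (refl C j n)) ~= {0}" by (subst beq) (rule 1)
  \<comment> \<open>A reflection with zero result forces \<open>n\<close> to be supported at
    \<open>j\<close>, where the reflection only changes the sign.\<close>
  have "\<exists>h\<in>H. b (refl C j n) h ~= 0"
  proof (rule ccontr)
  assume "\<not> ?thesis"
  hence z: "refl C j n = (%k. 0)" using b_inj[of "refl C j n" "%k. 0"] b0 by metis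
  hence nk: "n k = 0" if "k ~= j" for k using that by (metis fun_upd_other refl_def)
  have "?m = (\<Sum>k\<in>UNIV. if k = j then 2 * n j else 0)" by (intro sum.cong) (auto simp: nk diag)
  hence "refl C j n j = - n j" by (simp add: refl_def)
  hence "n j = 0" using z by simp
  hence "n = (%k. 0)" using nk by metis
  thus False using n \<open>(%k. 0) \<notin> Rt\<close> by simp
  qed
  thus ?thesis using 2 by (simp add: Rt_def is_root_def)
 qed
 ultimately have "finite_roots C Rt" by unfold_locales
 thus ?thesis by blast
qed

end

section \<open>The path algebra and its relations\<close>

abbreviation bas :: "'i path => ('i, 'k::field) pelem" where
 "bas \<equiv> path_basis"

abbreviation "anti \<equiv> path_anti"

abbreviation pmul :: "('i, 'k::field) pelem => ('i, 'k) pelem => ('i, 'k) pelem" where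
 "pmul \<equiv> path_mult"

lemma pm_add_left: "pmul (f + g) h = pmul f h + pmul g h"
 by (auto simp: path_mult_def fun_eq_iff algebra_simps sum.distrib)

lemma pm_add_right: "pmul f (g + h) = pmul f g + pmul f h"
 by (auto simp: path_mult_def fun_eq_iff algebra_simps sum.distrib)

lemma pm_scale_left: "pmul (fsc c f) h = fsc c (pmul f h)"
 by (auto simp: path_mult_def fun_eq_iff sum_distrib_left mult.assoc)

lemma pm_scale_right: "pmul f (fsc c h) = fsc c (pmul f h)"
 by (auto simp: path_mult_def fun_eq_iff sum_distrib_left algebra_simps)

lemma pm_0_left [simp]: "pmul 0 h = 0" and pm_0_right [simp]: "pmul h 0 = 0"
 by (auto simp: path_mult_def)

lemma pm_diff_left: "pmul (f - g) h = pmul f h - pmul g h"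
 by (auto simp: path_mult_def fun_eq_iff algebra_simps sum_subtractf)

lemma pm_diff_right: "pmul f (g - h) = pmul f g - pmul f h"
 by (auto simp: path_mult_def fun_eq_iff algebra_simps sum_subtractf)

lemma pm_sum_left: "pmul (\<Sum>i\<in>I. f i) h = (\<Sum>i\<in>I. pmul (f i) h)"
 by (induction I rule: infinite_finite_induct) (simp_all only: sum.infinite sum.empty sum.insert not_False_eq_True pm_0_left pm_add_left)

lemma pm_sum_right: "pmul h (\<Sum>i\<in>I. f i) = (\<Sum>i\<in>I. pmul h (f i))"
 by (induction I rule: infinite_finite_induct) (simp_all only: sum.infinite sum.empty sum.insert not_False_eq_True pm_0_right pm_add_right)

lemma pm_Nil: "pmul f g (i, []) = f (i, []) * g (i, [])"
 by (simp add: path_mult_def)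

text \<open>Splitting off the first arrow reduces associativity to an induction along the
  path.\<close>

lemma pm_Cons:
 "pmul f g (i, a # p) = f (i, []) * g (i, a # p) + pmul (%(k, q). f (i, a # q)) g (src a, p)"
 unfolding path_mult_def prod.case list.size(4)
 by (subst sum.atMost_shift) (simp add: sum.atMost_shift lessThan_Suc_atMost)

lemma pm_cong_left: "(!!q. f (i, q) = f' (i, q)) ==> pmul f g (i, p) = pmul f' g (i, p)"
 by (simp add: path_mult_def)

lemma pm_assoc: "pmul (pmul f g) h = pmul f (pmul g h)"
proof -
 have "pmul (pmul f g) h (i, p) = pmul f (pmul g h) (i, p)" for f i p
 proof (induction p arbitrary: f i)
  case Nil thus ?case by (simp add: pm_Nil)
 next
  case (Cons a p)
  let ?sf = "%(k :: 'a, q). f (i, a # q)" and ?sg = "%(k :: 'a, q). g (i, a # q)"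
  have "pmul (%(k, q). pmul f g (i, a # q)) h (src a, p)
  = pmul (fsc (f (i, [])) ?sg + pmul ?sf g) h (src a, p)"
  by (intro pm_cong_left) (simp add: pm_Cons)
  also have "\<dots> = f (i, []) * pmul ?sg h (src a, p) + pmul ?sf (pmul g h) (src a, p)"
  by (simp add: pm_add_left pm_scale_left Cons.IH)
  finally show ?case
  by (simp add: pm_Cons pm_Nil algebra_simps)
 qed
 thus ?thesis by auto
qed

definition path_one :: "('i, 'k::field) pelem" where
 "path_one = (%(i, p). if p = [] then 1 else 0)"

lemma pm_one_left [simp]: "pmul path_one f = f"
proof
 fix x show "pmul path_one f x = f x"
 proof (cases x)
  case (Pair i p)
  have "pmul path_one f (i, p) = (\<Sum>n\<le>length p. if n = 0 then f (i, p) else 0)"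
  unfolding path_mult_def prod.case by (intro sum.cong) (auto simp: path_one_def)
  thus ?thesis by (simp add: Pair)
 qed
qed

lemma pm_one_right [simp]: "pmul f path_one = f"
proof
 fix x show "pmul f path_one x = f x"
 proof (cases x)
  case (Pair i p)
  have "pmul f path_one (i, p) = (\<Sum>n\<le>length p. if n = length p then f (i, p) else 0)"
  unfolding path_mult_def prod.case by (intro sum.cong) (auto simp: path_one_def)
  thus ?thesis by (simp add: Pair)
 qed
qed

lemma path_one_eq: "path_one = (\<Sum>i\<in>UNIV. idem i :: ('i::finite, 'k::field) pelem)"
proof
 fix x :: "'i path"
 show "path_one x = (\<Sum>i\<in>UNIV. idem i :: ('i, 'k) pelem) x"
 proof (cases x)
  case (Pair i p)
  have "(\<Sum>k\<in>UNIV. bas (k, []) (i, p) :: 'k) = (\<Sum>k\<in>UNIV. if k = i then (if p = [] then 1 else 0) else 0)"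
  by (intro sum.cong) (auto simp: path_basis_def)
  thus ?thesis by (simp add: Pair path_one_def sum_apply)
 qed
qed

lemma psrc_app: "psrc i (p @ q) = psrc (psrc i p) q"
 by (induction p arbitrary: i) auto

lemma path_app: "is_path C i (p @ q) \<longleftrightarrow> is_path C i p & is_path C (psrc i p) q"
 by (induction p arbitrary: i) auto

lemma pm_basis:
 "pmul (bas (i, p)) (bas (j, q)) = (if psrc i p = j then bas (i, p @ q) else 0 :: ('i, 'k::field) pelem)"
proof
 fix x :: "'i path" show "pmul (bas (i, p)) (bas (j, q)) x = (if psrc i p = j then bas (i, p @ q) else 0 :: ('i, 'k) pelem) x"
 proof (cases x)
  case (Pair k r)
  have "pmul (bas (i, p)) (bas (j, q)) (k, r)
  = (\<Sum>n\<le>length r. if n = length p then (if psrc i p = j & (k, r) = (i, p @ q) then 1 else 0) else (0 :: 'k))"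
  unfolding path_mult_def prod.case
  proof (intro sum.cong refl)
  fix n assume n: "n\<in>{..length r}"
  have iff: "k = i & take n r = p & psrc k (take n r) = j & drop n r = q \<longleftrightarrow> n = length p & psrc i p = j & k = i & r = p @ q"
  proof
  assume a: "k = i & take n r = p & psrc k (take n r) = j & drop n r = q"
  hence "r = p @ q" by (metis append_take_drop_id)
  moreover have "k = i" "take n r = p" "psrc k (take n r) = j" using a by blast+
  moreover from this have "n = length p" using n by (metis atMost_iff length_take min.absorb2)
  ultimately show "n = length p & psrc i p = j & k = i & r = p @ q" by metis
  qed auto
  have "bas (i, p) (k, take n r) * bas (j, q) (psrc k (take n r), drop n r)
  = (if k = i & take n r = p & psrc k (take n r) = j & drop n r = q then 1 else (0 :: 'k))"
  by (auto simp: path_basis_def)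
  also have "\<dots> = (if n = length p then (if psrc i p = j & (k, r) = (i, p @ q) then 1 else 0) else 0)"
  by (simp only: iff) simp
  finally show "bas (i, p) (k, take n r) * bas (j, q) (psrc k (take n r), drop n r)
  = (if n = length p then (if psrc i p = j & (k, r) = (i, p @ q) then 1 else 0) else (0 :: 'k))" .
  qed
  also have "\<dots> = (if psrc i p = j & (k, r) = (i, p @ q) then 1 else 0)" by (auto simp: sum.delta)
  finally show ?thesis by (auto simp: Pair path_basis_def)
 qed
qed

interpretation fs: vspace "fsc :: 'k::field => ('x => 'k) => _"
 by (rule vspace_fscale)

abbreviation fspan :: "('x => 'k::field) set => ('x => 'k) set" where
 "fspan \<equiv> module.span fsc"

abbreviation flinear :: "(('x => 'k::field) => 'y => 'k) => bool" where
 "flinear \<equiv> vlin fsc fsc"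

lemma fl_iff: "flinear f \<longleftrightarrow> (\<forall>x y. f (x + y) = f x + f y) & (\<forall>c x. f (fsc c x) = fsc c (f x))"
 by (simp add: Vector_Spaces.linear_iff fs.vector_space_axioms)

lemma fl_mulL: "flinear (pmul f)"
 by (simp add: fl_iff pm_add_right pm_scale_right)

lemma fl_mulR: "flinear (%f. pmul f g)"
 by (simp add: fl_iff pm_add_left pm_scale_left)

lemma fl_span_sub:
 assumes "flinear f" "!!x. x\<in>S ==> f x\<in>T" "module.subspace fsc T" "x\<in>fspan S"
 shows "f x\<in>T"
proof -
 interpret f: Vector_Spaces.linear fsc fsc f by fact
 show ?thesis using assms(4)
 proof (induction rule: fs.span_induct_alt)
  case base thus ?case using assms(3) by (simp only: f.zero fs.subspace_0)
 next
  case (step c x y)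
  thus ?case using assms(2,3) by (simp only: f.add f.scale fs.subspace_add fs.subspace_scale)
 qed
qed

definition pcar :: "('i => 'i => int) => ('i, 'k::field) pelem set" where
 "pcar C = {f. finite {x. f x ~= 0} & (\<forall>i p. f (i, p) ~= 0 --> is_path C i p)}"

lemma sum_basis: assumes "finite {x. f x ~= 0}" "finite S" "{x. f x ~= 0} \<subseteq> S"
 shows "f = (\<Sum>x\<in>S. fsc (f x) (bas x))"
proof
 fix y
 have "(\<Sum>x\<in>S. f x * bas x y) = (\<Sum>x\<in>S. if x = y then f y else 0)"
  by (intro sum.cong) (auto simp: path_basis_def)
 thus "f y = (\<Sum>x\<in>S. fsc (f x) (bas x)) y" using assms by (auto simp: sum_apply)
qed

lemma pcar_sub: "module.subspace fsc (pcar C :: ('i, 'k::field) pelem set)"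
 unfolding fs.subspace_def
proof (intro conjI ballI allI)
 show "0\<in>pcar C" by (simp add: pcar_def)
 fix f g :: "('i, 'k) pelem" assume f: "f\<in>pcar C" "g\<in>pcar C"
 hence "finite ({x. f x ~= 0} \<union> {x. g x ~= 0})" by (simp add: pcar_def)
 hence "finite {x. (f + g) x ~= 0}" by (rule rev_finite_subset) auto
 thus "f + g\<in>pcar C" using f by (auto simp: pcar_def) (metis add.left_neutral)
next
 fix f :: "('i, 'k) pelem" and c assume f: "f\<in>pcar C"
 have "finite {x. fsc c f x ~= 0}" using f by (auto simp: pcar_def intro: rev_finite_subset)
 thus "fsc c f\<in>pcar C" using f by (auto simp: pcar_def)
qed

lemma pcar_basis: "is_path C i p ==> bas (i, p)\<in>pcar C"
 by (auto simp: pcar_def path_basis_def)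

lemma pcar_span: "(pcar C :: ('i, 'k::field) pelem set) = fspan {bas (i, p) | i p. is_path C i p}"
proof
 show "(pcar C :: ('i, 'k) pelem set) \<subseteq> fspan {bas (i, p) | i p. is_path C i p}"
 proof
  fix f :: "('i, 'k) pelem" assume f: "f\<in>pcar C"
  hence "f = (\<Sum>x\<in>{x. f x ~= 0}. fsc (f x) (bas x))"
  by (intro sum_basis) (auto simp: pcar_def)
  moreover have "bas x\<in>fspan {bas (i, p) | i p. is_path C i p}" if "f x ~= 0" for x
  using f that by (cases x) (auto simp: pcar_def intro!: fs.span_base)
  ultimately show "f\<in>fspan {bas (i, p) | i p. is_path C i p}"
  by (metis (mono_tags, lifting) fs.span_scale fs.span_sum mem_Collect_eq)
 qed
 show "fspan {bas (i, p) | i p. is_path C i p} \<subseteq> (pcar C :: ('i, 'k) pelem set)"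
  by (intro fs.span_minimal pcar_sub) (auto intro: pcar_basis)
qed

lemma pcar_mult: fixes f g :: "('i, 'k::field) pelem" assumes "f\<in>pcar C" "g\<in>pcar C" shows "pmul f g\<in>pcar C"
proof -
 have 1: "pmul (bas (i, p)) g\<in>pcar C" if ip: "is_path C i p" for i p
 proof -
  have g: "g\<in>fspan {bas (i, p) | i p. is_path C i p}" using assms(2) pcar_span by blast
  have "pmul (bas (i, p)) x\<in>pcar C" if "x\<in>{bas (i, p) | i p. is_path C i p}" for x :: "('i, 'k) pelem"
  using that ip fs.subspace_0[OF pcar_sub] by (auto simp: pm_basis path_app intro!: pcar_basis)
  from fl_span_sub[OF fl_mulL[of "bas (i, p)"] this pcar_sub g]
  show ?thesis by blast
 qed
 have "f\<in>fspan {bas (i, p) | i p. is_path C i p}" using assms(1) pcar_span by blast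
 from fl_span_sub[OF fl_mulR[of g] _ pcar_sub this] 1
 show ?thesis by blast
qed

lemma pcar_one: "path_one\<in>pcar (C :: 'i::finite => _)"
 unfolding path_one_eq by (intro fs.subspace_sum pcar_sub pcar_basis) simp

lemma pa_simps [simp]:
 "carrier (path_algebra C) = pcar C" "x \<otimes>\<^bsub>path_algebra C\<^esub> y = pmul x y"
 "\<one>\<^bsub>path_algebra C\<^esub> = path_one" "\<zero>\<^bsub>path_algebra C\<^esub> = 0" "x \<oplus>\<^bsub>path_algebra C\<^esub> y = x + y"
 "c \<odot>\<^bsub>path_algebra C\<^esub> x = fsc c x"
 by (simp_all only: path_algebra_def pcar_def path_one_def fsc_def plus_fun_def zero_fun_def
  partial_object.simps monoid.simps ring.simps module.simps)

lemma pa_ring: "ring (path_algebra C :: ('k::field, ('i::finite, 'k) pelem) module)"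
proof (rule ringI)
 show "abelian_group (path_algebra C :: ('k::field, ('i::finite, 'k) pelem) module)"
 proof (rule abelian_groupI)
  fix x :: "('i, 'k) pelem" assume "x\<in>carrier (path_algebra C)"
  thus "\<exists>y\<in>carrier (path_algebra C). y \<oplus>\<^bsub>path_algebra C\<^esub> x = \<zero>\<^bsub>path_algebra C\<^esub>"
  using fs.subspace_neg[OF pcar_sub] by (intro bexI[of _ "- x"]) auto
 qed (auto simp: fs.subspace_add[OF pcar_sub] fs.subspace_0[OF pcar_sub] ac_simps)
 show "Group.monoid (path_algebra C :: ('k::field, ('i::finite, 'k) pelem) module)"
  by (rule monoidI) (auto simp: pcar_mult pcar_one pm_assoc)
qed (auto simp: pm_add_left pm_add_right)

lemma pa_minus:
 assumes "y\<in>pcar C" shows "\<ominus>\<^bsub>path_algebra C\<^esub> y = (- y :: ('i::finite, 'k::field) pelem)"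
proof -
 interpret ring "path_algebra C :: ('k, ('i, 'k) pelem) module" by (rule pa_ring)
 show ?thesis using assms fs.subspace_neg[OF pcar_sub]
  by (intro minus_equality) auto
qed

lemma pa_finsum:
 assumes "finite S" "!!x. x\<in>S ==> f x\<in>pcar C"
 shows "finsum (path_algebra C) f S = (\<Sum>x\<in>S. f x :: ('i::finite, 'k::field) pelem)"
 using assms
proof (induction S rule: finite_induct)
 case empty
 interpret ring "path_algebra C :: ('k, ('i, 'k) pelem) module" by (rule pa_ring)
 show ?case by (simp add: finsum_empty)
next
 case (insert x S)
 interpret ring "path_algebra C :: ('k, ('i, 'k) pelem) module" by (rule pa_ring)
 have "f\<in>S \<rightarrow> carrier (path_algebra C)" "f x\<in>carrier (path_algebra C)" using insert.prems by auto
 hence "finsum (path_algebra C) f (insert x S) = f x \<oplus>\<^bsub>path_algebra C\<^esub> finsum (path_algebra C) f S"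
  using insert.hyps by (intro finsum_insert) auto
 thus ?case using insert by simp
qed

abbreviation epow :: "'i => nat => 'i arrow list" where
 "epow i m \<equiv> replicate m (Eps i)"

lemma psrc_epow [simp]: "psrc i (epow i m) = i"
 by (induction m) auto

lemma is_path_epow [simp]: "is_path C i (epow i m)"
 by (induction m) auto

lemma arr_epow:
 "bas (i, [Eps i]) [^]\<^bsub>path_algebra C\<^esub> m = (if m = 0 then path_one else bas (i, epow i m) :: ('i::finite, 'k::field) pelem)"
proof (induction m)
 case (Suc m)
 thus ?case by (cases m) (auto simp: nat_pow_def pm_basis replicate_append_same)
qed (simp add: nat_pow_def)

lemma epow_mult:
 "pmul (bas (i, [Eps i]) [^]\<^bsub>path_algebra C\<^esub> m) (bas (i, p)) = (bas (i, epow i m @ p) :: ('i::finite, 'k::field) pelem)"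
 unfolding arr_epow by (auto simp: pm_basis)

lemma mult_epow:
 "psrc j p = i ==> pmul (bas (j, p)) (bas (i, [Eps i]) [^]\<^bsub>path_algebra C\<^esub> m) = (bas (j, p @ epow i m) :: ('i::finite, 'k::field) pelem)"
 unfolding arr_epow by (auto simp: pm_basis)

lemma rel_commute_eq:
 assumes "adj C i j" "adj C j i"
 shows "rel_commute C i j = (bas (i, epow i (cc C i j) @ [Alpha i j])
  - bas (i, Alpha i j # epow j (cc C j i)) :: ('i::finite, 'k::field) pelem)"
proof -
 have "bas (i, Alpha i j # epow j (cc C j i))\<in>(pcar C :: ('i, 'k) pelem set)"
  using assms by (intro pcar_basis) simp
 thus ?thesis
  unfolding rel_commute_def Let_def a_minus_def pa_simps tgt.simps
  by (simp add: epow_mult mult_epow cc_def[symmetric] pa_minus)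
qed

lemma rel_mesh_eq:
 assumes "!!i j. adj C i j ==> adj C j i"
 shows "rel_mesh C \<omega> i = (\<Sum>j\<in>{j. adj C i j}. \<Sum>k<cc C i j. fsc (of_int (\<omega> i j))
  (bas (i, epow i k @ [Alpha i j, Alpha j i] @ epow i (cc C i j - 1 - k))) :: ('i::finite, 'k::field) pelem)"
proof -
 let ?R = "path_algebra C :: ('k, ('i, 'k) pelem) module"
 let ?t = "%j k. fsc (of_int (\<omega> i j)) (bas (i, epow i k @ [Alpha i j, Alpha j i] @ epow i (cc C i j - 1 - k))) :: ('i, 'k) pelem"
 have set: "{j. adj C j i} = {j. adj C i j}" using assms by blast
 have term_eq: "of_int (\<omega> i j) \<odot>\<^bsub>?R\<^esub> ((arr (Eps i) [^]\<^bsub>?R\<^esub> k) \<otimes>\<^bsub>?R\<^esub> arr (Alpha i j) \<otimes>\<^bsub>?R\<^esub> arr (Alpha j i)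
  \<otimes>\<^bsub>?R\<^esub> (arr (Eps i) [^]\<^bsub>?R\<^esub> (nat (- C i j) - 1 - k))) = ?t j k" for j k
  by (simp add: epow_mult mult_epow pm_basis psrc_app cc_def)
 have car: "?t j k\<in>pcar C" if "adj C i j" for j k
  using that assms by (intro fs.subspace_scale pcar_sub pcar_basis) (auto simp: path_app)
 have inner: "finsum ?R (%k. ?t j k) {..<cc C i j} = (\<Sum>k<cc C i j. ?t j k)" if "adj C i j" for j
  using car[OF that] by (intro pa_finsum) auto
 interpret ring ?R by (rule pa_ring)
 have "rel_mesh C \<omega> i = finsum ?R (%j. finsum ?R (%k. ?t j k) {..<cc C i j}) {j. adj C i j}"
  unfolding rel_mesh_def Let_def term_eq set cc_def by simp
 also have "\<dots> = finsum ?R (%j. (\<Sum>k<cc C i j. ?t j k)) {j. adj C i j}"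
  using inner car by (intro finsum_cong') (auto simp: Pi_def intro!: fs.subspace_sum pcar_sub)
 also have "\<dots> = (\<Sum>j\<in>{j. adj C i j}. \<Sum>k<cc C i j. ?t j k)"
  using car by (intro pa_finsum) (auto intro!: fs.subspace_sum pcar_sub)
 finally show ?thesis .
qed

text \<open>Otherwise the alternating reflections at \<open>i\<close> and \<open>j\<close> would
  produce roots with ever larger coordinates. So of two opposite negative entries one is -1, which
  is the input to \<open>cc_d\<close>.\<close>

lemma (in finite_roots) rank_two:
 assumes ij: "i ~= j" and c: "C i j <= -2" "C j i <= -2"
 shows False
proof -
 define s where "s m = (if even m then j else i)" for m :: nat
 define N where "N = rec_nat (uvec i) (%m. refl C (s m))"
 have N0: "N 0 = uvec i" and NS: "N (Suc m) = refl C (s m) (N m)" for m by (simp_all add: N_def)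
 have NR: "N m\<in>Ph" for m by (induction m) (simp_all add: N0 NS simple refl_closed)
 have out: "N m k = 0" if "k ~= i" "k ~= j" for m k
  using that by (induction m) (auto simp: N0 NS uvec_def refl_def s_def)
 have sum2: "(\<Sum>k\<in>UNIV. C l k * N m k) = C l i * N m i + C l j * N m j" for l m
 proof -
  have "(\<Sum>k\<in>UNIV. C l k * N m k) = (\<Sum>k\<in>{i, j}. C l k * N m k)"
  using out by (intro sum.mono_neutral_right) auto
  thus ?thesis using ij by simp
 qed
 \<comment> \<open>\<open>x\<close> is the coordinate at the vertex reflected last (initially the
   entry 1 at \<open>i\<close>), \<open>y\<close> the one at the vertex reflected next.\<close>
 define x where "x m = (if even m then N m i else N m j)" for m
 define y where "y m = (if even m then N m j else N m i)" for m
 have yS: "x (Suc m) = - y m + - (if even m then C j i else C i j) * x m" "y (Suc m) = x m" for m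
  using ij by (auto simp: x_def y_def NS s_def refl_def sum2 diag)
 have inv: "0 <= y m & y m < x m" for m
 proof (induction m)
  case 0 thus ?case using ij by (simp add: x_def y_def N0 uvec_def)
 next
  case (Suc m)
  have "2 * x m <= - (if even m then C j i else C i j) * x m"
  using c Suc by (intro mult_right_mono) auto
  thus ?case using Suc yS[of m] by linarith
 qed
 hence "x m < x (Suc m)" for m using yS(2)[of m] inv[of "Suc m"] by simp
 hence mono: "strict_mono x" by (simp add: strict_mono_Suc_iff)
 have "inj (%m. N (2 * m))"
 proof (rule injI)
  fix m n assume "N (2 * m) = N (2 * n)"
  hence "x (2 * m) = x (2 * n)" by (simp add: x_def)
  thus "m = n" using mono by (simp add: strict_mono_eq)
 qed
 moreover have "range (%m. N (2 * m)) \<subseteq> Ph" using NR by blast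
 ultimately show False using fin finite_imageD finite_subset infinite_UNIV_nat by metis
qed

section \<open>Weights of paths and the ideal of relations\<close>

fun wt :: "('i arrow => int) => 'i path => int" where
 "wt f (i, p) = sum_list (map f p)"

definition cut :: "('x => bool) => ('x => 'k::field) => 'x => 'k" where
 "cut Q f = (%x. if Q x then f x else 0)"

lemma fl_cut: "flinear (cut Q)"
 by (auto simp: fl_iff cut_def)

lemma cut_basis: "cut Q (bas x) = (if Q x then bas x else 0)"
 by (auto simp: cut_def path_basis_def)

lemma pcar_cut: assumes "f\<in>pcar C" shows "cut Q f\<in>pcar C"
proof -
 have "finite {x. cut Q f x ~= 0}" using assms by (auto simp: pcar_def cut_def intro: rev_finite_subset)
 thus ?thesis using assms by (auto simp: pcar_def cut_def)
qed

text \<open>Paths are independent in the space of all functions but span only those of finite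
  support; nothing is said about \<open>N\<close> on the others.\<close>

lemma basis_extension:
 fixes h :: "'i path => 'y => 'k::field"
 obtains N where "flinear N" "!!x. N (bas x) = h x"
proof -
 have inj: "inj (bas :: 'i path => ('i, 'k) pelem)"
  by (rule injI) (metis path_basis_def zero_neq_one)
 have ind: "fs.independent (range (bas :: 'i path => ('i, 'k) pelem))"
  unfolding fs.independent_explicit_finite_subsets
 proof (intro allI impI ballI)
  fix S u v assume S: "S \<subseteq> range (bas :: 'i path => ('i, 'k) pelem)" "finite S" "(\<Sum>v\<in>S. fsc (u v) v) = 0" "v\<in>S"
  then obtain y where y: "v = bas y" by blast
  have "(\<Sum>v\<in>S. fsc (u v) v) y = (\<Sum>w\<in>S. if w = v then u v else 0)"
  unfolding sum_apply
  proof (intro sum.cong refl)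
  fix w assume "w\<in>S"
  then obtain z where "w = bas z" using S by blast
  thus "fsc (u w) w y = (if w = v then u v else 0)"
  using inj y by (auto simp: path_basis_def) (metis zero_neq_one)
  qed
  thus "u v = 0" using S by simp
 qed
 interpret p: vspace_pair "fsc :: 'k => ('i, 'k) pelem => _" "fsc :: 'k => ('y => 'k) => _" ..
 obtain N where "flinear N" "\<forall>x\<in>range bas. N x = h (inv_into UNIV bas x)"
  using p.linear_independent_extend[OF ind, of "%x. h (inv_into UNIV bas x)"] by blast
 hence "N (bas x) = h x" for x using inv_into_f_f[OF inj, of x] by (metis UNIV_I rangeI)
 thus ?thesis using that[of N] \<open>flinear N\<close> by blast
qed

locale gpp =
 fixes C :: "'i::finite => 'i => int" and d :: "'i => int" and \<omega> :: "'i => 'i => int"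
  and Rt :: "('i => int) set" and I :: "('i, 'k::field) pelem set"
 assumes roots: "finite_roots C Rt" and symm: "symmetrizer C d" and signs: "sign_choice C \<omega>"
  and I_def: "I = rel_ideal C \<omega>"
begin

lemma d_pos: "d i > 0" and d_sym: "d i * C i j = d j * C j i"
 using symm by (auto simp: symmetrizer_def)

lemma adj_sym: "adj C i j ==> adj C j i"
proof -
 assume a: "adj C i j"
 hence "d i * C i j < 0" using d_pos[of i] by (simp add: adj_def mult_pos_neg)
 hence "d j * C j i < 0" using d_sym by simp
 thus ?thesis using a d_pos[of j] by (auto simp: adj_def zero_less_mult_iff mult_less_0_iff)
qed

lemma adj_neq: "adj C i j ==> i ~= j"
 by (simp add: adj_def)

text \<open>By \<open>rank_two\<close> one of the two entries is -1, so the larger of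
  \<open>d i\<close> and \<open>d j\<close> is a multiple of the smaller. This is what makes both
  relations homogeneous for the degree.\<close>

lemma cc_d: assumes "adj C i j" shows "int (cc C i j) * d i = max (d i) (d j)"
proof -
 interpret finite_roots C Rt by (rule roots)
 have a: "adj C j i" using assms by (rule adj_sym)
 have neg: "C i j < 0" "C j i < 0" using assms a by (auto simp: adj_def)
 have "\<not> (C i j <= -2 & C j i <= -2)" using rank_two adj_neq[OF assms] by blast
 hence or: "C i j = -1 \<or> C j i = -1" using neg by linarith
 have cc: "int (cc C i j) = - C i j" using neg by (simp add: cc_def)
 have eq: "d i * C i j = d j * C j i" by (rule d_sym)
 show ?thesis
 proof (cases "C i j = -1")
  case True
  hence "d i = d j * - C j i" using eq by simp
  moreover have "d j * 1 <= d j * - C j i" using neg d_pos[of j] by (intro mult_left_mono) auto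
  ultimately have "d j <= d i" by simp
  thus ?thesis using True cc by simp
 next
  case False
  hence "d j = d i * - C i j" using eq or by simp
  moreover have "d i * 1 <= d i * - C i j" using neg d_pos[of i] by (intro mult_left_mono) auto
  ultimately show ?thesis using cc by (simp add: max_def)
 qed
qed

abbreviation pc :: "('i, 'k) pelem set" where "pc \<equiv> pcar C"

definition rels :: "('i, 'k) pelem set" where
 "rels = {rel_commute C i j | i j. adj C i j} \<union> range (rel_mesh C \<omega>)"

text \<open>Multiples of the relations by paths on both sides. They span the ideal, and each of them
  is homogeneous, which gives access to the components of elements of \<open>I\<close>.\<close>

definition Igens :: "('i, 'k) pelem set" where
 "Igens = {pmul (pmul (bas (i, p)) rh) (bas (j, q)) | i p j q rh.
  is_path C i p & is_path C j q & rh\<in>rels}"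

lemma IgensI: "is_path C i p ==> is_path C j q ==> rh\<in>rels
  ==> pmul (pmul (bas (i, p)) rh) (bas (j, q))\<in>Igens"
 unfolding Igens_def by blast

lemma commute_eq: "adj C i j ==> rel_commute C i j = (bas (i, epow i (cc C i j) @ [Alpha i j])
  - bas (i, Alpha i j # epow j (cc C j i)) :: ('i, 'k) pelem)"
 by (rule rel_commute_eq) (assumption | erule adj_sym)+

lemma mesh_eq: "rel_mesh C \<omega> i = (\<Sum>j\<in>{j. adj C i j}. \<Sum>k<cc C i j. fsc (of_int (\<omega> i j))
  (bas (i, epow i k @ [Alpha i j, Alpha j i] @ epow i (cc C i j - 1 - k))) :: ('i, 'k) pelem)"
 by (rule rel_mesh_eq) (erule adj_sym)

lemma rels_pc: assumes "rh\<in>rels" shows "rh\<in>pc"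
proof -
 consider i j where "adj C i j" "rh = rel_commute C i j" | i where "rh = rel_mesh C \<omega> i"
  using assms unfolding rels_def by blast
 thus ?thesis
 proof cases
  case 1
  thus ?thesis
  by (auto simp: commute_eq path_app intro!: fs.subspace_diff pcar_sub pcar_basis)
 next
  case 2
  have m: "bas (i, epow i m @ [Alpha i j, Alpha j i] @ epow i m')\<in>pc" if "adj C i j" for j m m'
  by (rule pcar_basis) (use that adj_sym[OF that] in \<open>simp add: path_app\<close>)
  have t: "fsc c (bas (i, epow i k @ [Alpha i j, Alpha j i] @ epow i m'))\<in>pc"
  if "j\<in>{j. adj C i j}" for c j k m'
  using m that by (intro fs.subspace_scale[OF pcar_sub]) blast
  show ?thesis unfolding 2 mesh_eq by (rule fs.subspace_sum[OF pcar_sub], rule fs.subspace_sum[OF pcar_sub], rule t)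
 qed
qed

lemma I_subspace_aux: "module.subspace fsc (fspan Igens)"
 by (rule fs.subspace_span)

lemma Igens_pc: "Igens \<subseteq> pc"
 by (auto simp: Igens_def intro!: pcar_mult pcar_basis dest: rels_pc)

lemma spanIgens_pc: "fspan Igens \<subseteq> pc"
 by (rule fs.span_minimal[OF Igens_pc pcar_sub])

lemma spanIgens_left: assumes "f\<in>pc" "x\<in>fspan Igens" shows "pmul f x\<in>fspan Igens"
proof -
 have 1: "pmul (bas (k, r)) y\<in>fspan Igens" if kr: "is_path C k r" and y: "y\<in>fspan Igens" for k r y
 proof -
  have "pmul (bas (k, r)) y\<in>fspan Igens" if "y\<in>Igens" for y
  proof -
  obtain i p j q rh where y: "y = pmul (pmul (bas (i, p)) rh) (bas (j, q))"
  "is_path C i p" "is_path C j q" "rh\<in>rels" using \<open>y\<in>Igens\<close> unfolding Igens_def by blast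
  have "pmul (bas (k, r)) y = pmul (pmul (pmul (bas (k, r)) (bas (i, p))) rh) (bas (j, q))"
  unfolding y(1) by (simp only: pm_assoc)
  also have "\<dots>\<in>fspan Igens"
  proof (cases "psrc k r = i")
  case True
  hence "pmul (pmul (bas (k, r @ p)) rh) (bas (j, q))\<in>Igens"
  using y kr True by (intro IgensI) (auto simp: path_app)
  thus ?thesis using True by (simp add: pm_basis fs.span_base)
  next
  case False
  thus ?thesis by (simp only: pm_basis if_False pm_0_left fs.span_zero)
  qed
  finally show ?thesis .
  qed
  from fl_span_sub[OF fl_mulL this I_subspace_aux y] show ?thesis .
 qed
 have "f\<in>fspan {bas (i, p) | i p. is_path C i p}" using assms(1) pcar_span by blast
 from fl_span_sub[OF fl_mulR[of x] _ I_subspace_aux this] 1 assms(2)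
 show ?thesis by blast
qed

lemma spanIgens_right: assumes "f\<in>pc" "x\<in>fspan Igens" shows "pmul x f\<in>fspan Igens"
proof -
 have 1: "pmul y (bas (k, r))\<in>fspan Igens" if kr: "is_path C k r" and y: "y\<in>fspan Igens" for k r y
 proof -
  have "pmul y (bas (k, r))\<in>fspan Igens" if "y\<in>Igens" for y
  proof -
  obtain i p j q rh where y: "y = pmul (pmul (bas (i, p)) rh) (bas (j, q))"
  "is_path C i p" "is_path C j q" "rh\<in>rels" using \<open>y\<in>Igens\<close> unfolding Igens_def by blast
  have "pmul y (bas (k, r)) = pmul (pmul (bas (i, p)) rh) (pmul (bas (j, q)) (bas (k, r)))"
  unfolding y(1) by (simp only: pm_assoc)
  also have "\<dots>\<in>fspan Igens"
  proof (cases "psrc j q = k")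
  case True
  hence "pmul (pmul (bas (i, p)) rh) (bas (j, q @ r))\<in>Igens"
  using y kr True by (intro IgensI) (auto simp: path_app)
  thus ?thesis using True by (simp add: pm_basis fs.span_base)
  next
  case False
  thus ?thesis by (simp only: pm_basis if_False pm_0_right fs.span_zero)
  qed
  finally show ?thesis .
  qed
  from fl_span_sub[OF fl_mulR this I_subspace_aux y] show ?thesis .
 qed
 have "f\<in>fspan {bas (i, p) | i p. is_path C i p}" using assms(1) pcar_span by blast
 from fl_span_sub[OF fl_mulL[of x] _ I_subspace_aux this] 1 assms(2)
 show ?thesis by blast
qed

lemma pc_diff: "x\<in>pc ==> y\<in>pc ==> x + y\<in>pc" "x\<in>pc ==> - x\<in>pc" "x\<in>pc ==> fsc c x\<in>pc" "0\<in>pc"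
 using fs.subspace_add[OF pcar_sub] fs.subspace_neg[OF pcar_sub] fs.subspace_scale[OF pcar_sub]
  fs.subspace_0[OF pcar_sub] by auto

lemma pc_expand: "f = (\<Sum>j\<in>UNIV. \<Sum>i\<in>UNIV. pmul (pmul (idem i) f) (idem j))" for f :: "('i, 'k) pelem"
proof -
 have "f = pmul (pmul path_one f) path_one" by simp
 thus ?thesis unfolding path_one_eq pm_sum_left pm_sum_right .
qed

lemma I_span: "I = fspan Igens"
proof
 interpret R: ring "path_algebra C :: ('k, ('i, 'k) pelem) module" by (rule pa_ring)
 have rel_eq: "I = genideal (path_algebra C) rels" by (simp add: I_def rel_ideal_def rels_def)
 have sub: "rels \<subseteq> carrier (path_algebra C)" using rels_pc by auto
 interpret Id: ideal "genideal (path_algebra C) rels" "path_algebra C :: ('k, ('i, 'k) pelem) module"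
  by (rule R.genideal_ideal[OF sub])
 have "ideal (fspan Igens) (path_algebra C)"
 proof (rule idealI[OF pa_ring])
  show "subgroup (fspan Igens) (add_monoid (path_algebra C))"
  proof (rule R.add.subgroupI)
  show "fspan Igens \<subseteq> carrier (path_algebra C)" using spanIgens_pc by simp
  show "fspan Igens ~= {}" using fs.span_zero by blast
  show "\<ominus>\<^bsub>path_algebra C\<^esub> a\<in>fspan Igens" if "a\<in>fspan Igens" for a
  using that spanIgens_pc by (subst pa_minus) (auto intro: fs.span_neg)
  show "a \<oplus>\<^bsub>path_algebra C\<^esub> b\<in>fspan Igens" if "a\<in>fspan Igens" "b\<in>fspan Igens" for a b
  using that by (simp add: fs.span_add)
  qed
 qed (auto intro: spanIgens_left spanIgens_right)
 moreover have "rels \<subseteq> fspan Igens"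
 proof
  fix rh assume r: "rh\<in>rels"
  have "pmul (pmul (idem i) rh) (idem j)\<in>fspan Igens" for i j
  proof (rule fs.span_base)
  show "pmul (pmul (idem i) rh) (idem j)\<in>Igens"
  using r by (intro IgensI) auto
  qed
  hence "(\<Sum>j\<in>UNIV. \<Sum>i\<in>UNIV. pmul (pmul (idem i) rh) (idem j))\<in>fspan Igens"
  by (intro fs.span_sum)
  thus "rh\<in>fspan Igens" using pc_expand[of rh] by simp
 qed
 ultimately show "I \<subseteq> fspan Igens" unfolding rel_eq by (rule R.genideal_minimal)
 have "x\<in>I" if "x\<in>Igens" for x
 proof -
  obtain i p j q rh where x: "x = pmul (pmul (bas (i, p)) rh) (bas (j, q))"
  "is_path C i p" "is_path C j q" "rh\<in>rels" using \<open>x\<in>Igens\<close> unfolding Igens_def by blast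
  have "rh\<in>I" using x(4) R.genideal_self[OF sub] rel_eq by blast
  hence "bas (i, p) \<otimes>\<^bsub>path_algebra C\<^esub> rh\<in>I" unfolding rel_eq
  using pcar_basis[OF x(2)] by (intro Id.I_l_closed) auto
  hence "(bas (i, p) \<otimes>\<^bsub>path_algebra C\<^esub> rh) \<otimes>\<^bsub>path_algebra C\<^esub> bas (j, q)\<in>I" unfolding rel_eq
  by (rule Id.I_r_closed) (use pcar_basis[OF x(3)] in simp)
  thus ?thesis using x(1) by simp
 qed
 moreover have "module.subspace fsc I"
  unfolding fs.subspace_def
 proof (intro conjI ballI allI)
  show "0\<in>I" using Id.zero_closed rel_eq by simp
  show "x + y\<in>I" if "x\<in>I" "y\<in>I" for x y using Id.a_closed[of x y] that rel_eq by simp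
  show "fsc c x\<in>I" if "x\<in>I" for c x
  proof -
  have "fsc c path_one \<otimes>\<^bsub>path_algebra C\<^esub> x\<in>I" unfolding rel_eq
  using that rel_eq by (intro Id.I_l_closed) (auto intro: pcar_one fs.subspace_scale[OF pcar_sub])
  thus ?thesis by (simp add: pm_scale_left)
  qed
 qed
 ultimately show "fspan Igens \<subseteq> I" by (intro fs.span_minimal) auto
qed

lemma I_sub: "module.subspace fsc I" and I_pc: "x\<in>I ==> x\<in>pc"
 and I_left: "f\<in>pc ==> x\<in>I ==> pmul f x\<in>I" and I_right: "f\<in>pc ==> x\<in>I ==> pmul x f\<in>I"
 using I_subspace_aux spanIgens_pc spanIgens_left spanIgens_right unfolding I_span by auto

lemma rels_I: "rh\<in>rels ==> rh\<in>I"
proof -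
 assume r: "rh\<in>rels"
 have "pmul (pmul (idem i) rh) (idem j)\<in>I" for i j
  unfolding I_span
 proof (rule fs.span_base)
  show "pmul (pmul (idem i) rh) (idem j)\<in>Igens"
  using r by (intro IgensI) auto
 qed
 hence "(\<Sum>j\<in>UNIV. \<Sum>i\<in>UNIV. pmul (pmul (idem i) rh) (idem j))\<in>I"
  by (intro fs.subspace_sum I_sub)
 thus ?thesis using pc_expand[of rh] by simp
qed

text \<open>The weights for which both relations are homogeneous: the first clause is (R1), the
  second is (R2), where all mesh terms at \<open>i\<close> share the weight \<open>w\<close>. The
  degree and the cycle counter \<open>dw\<close> are instances.\<close>

definition homog_weight :: "('i arrow => int) => bool" where
 "homog_weight f \<longleftrightarrow> (\<forall>i j. adj C i j --> f (Eps i) * int (cc C i j) = f (Eps j) * int (cc C j i))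
  & (\<forall>i. \<exists>w. \<forall>j. adj C i j --> f (Alpha i j) + f (Alpha j i) + (int (cc C i j) - 1) * f (Eps i) = w)"

definition homog :: "('i arrow => int) => ('i, 'k) pelem => bool" where
 "homog f x \<longleftrightarrow> (\<exists>i j w. \<forall>k p. x (k, p) ~= 0 --> k = i & psrc k p = j & wt f (k, p) = w)"

lemma homog_basis: "homog f (bas x)"
 by (cases x) (auto simp: homog_def path_basis_def)

lemma homog_mult: assumes "homog f x" "homog f y" shows "homog f (pmul x y)"
proof -
 obtain i j w where x: "!!k p. x (k, p) ~= 0 ==> k = i & psrc k p = j & wt f (k, p) = w"
  using assms(1) unfolding homog_def by blast
 obtain i' j' w' where y: "!!k p. y (k, p) ~= 0 ==> k = i' & psrc k p = j' & wt f (k, p) = w'"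
  using assms(2) unfolding homog_def by blast
 have "k = i & psrc k p = j' & wt f (k, p) = w + w'" if nz: "pmul x y (k, p) ~= 0" for k p
 proof -
  obtain n where n: "x (k, take n p) ~= 0" "y (psrc k (take n p), drop n p) ~= 0"
  using nz unfolding path_mult_def by (auto elim!: sum.not_neutral_contains_not_neutral)
  have "psrc k p = psrc (psrc k (take n p)) (drop n p)" by (simp add: psrc_app[symmetric])
  moreover have "wt f (k, p) = wt f (k, take n p) + wt f (psrc k (take n p), drop n p)"
  by simp (metis append_take_drop_id map_append sum_list_append)
  ultimately show ?thesis using x[OF n(1)] y[OF n(2)] by metis
 qed
 thus ?thesis unfolding homog_def by blast
qed

lemma basis_nonzero: "bas x y ~= (0 :: 'k) \<longleftrightarrow> y = x"
 by (simp add: path_basis_def)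

lemma homog_rels: assumes f: "homog_weight f" and r: "rh\<in>rels" shows "homog f rh"
proof -
 consider i j where "adj C i j" "rh = rel_commute C i j" | i where "rh = rel_mesh C \<omega> i"
  using r unfolding rels_def by blast
 thus ?thesis
 proof cases
  case 1
  have w: "f (Eps i) * int (cc C i j) = f (Eps j) * int (cc C j i)" using f 1(1) unfolding homog_weight_def by blast
  show ?thesis unfolding homog_def 1(2) commute_eq[OF 1(1)]
  proof (intro exI allI impI)
  fix k p assume "(bas (i, epow i (cc C i j) @ [Alpha i j]) - bas (i, Alpha i j # epow j (cc C j i))) (k, p) ~= (0 :: 'k)"
  hence "(k, p) = (i, epow i (cc C i j) @ [Alpha i j]) \<or> (k, p) = (i, Alpha i j # epow j (cc C j i))"
  by (auto simp: path_basis_def split: if_splits)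
  thus "k = i & psrc k p = j & wt f (k, p) = int (cc C i j) * f (Eps i) + f (Alpha i j)"
  using w by (auto simp: psrc_app sum_list_replicate mult.commute)
  qed
 next
  case 2
  obtain w where w: "!!j. adj C i j ==> f (Alpha i j) + f (Alpha j i) + (int (cc C i j) - 1) * f (Eps i) = w"
  using f unfolding homog_weight_def by blast
  show ?thesis unfolding homog_def 2 mesh_eq
  proof (intro exI allI impI)
  fix k p assume "(\<Sum>j\<in>{j. adj C i j}. \<Sum>k<cc C i j. fsc (of_int (\<omega> i j))
  (bas (i, epow i k @ [Alpha i j, Alpha j i] @ epow i (cc C i j - 1 - k)))) (k, p) ~= (0 :: 'k)"
  then obtain j where j: "adj C i j" "(\<Sum>k<cc C i j. fsc (of_int (\<omega> i j))
  (bas (i, epow i k @ [Alpha i j, Alpha j i] @ epow i (cc C i j - 1 - k)))) (k, p) ~= (0 :: 'k)"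
  unfolding sum_apply[of _ "{j. adj C i j}"] by (auto elim: sum.not_neutral_contains_not_neutral)
  then obtain m where m: "m < cc C i j" "fsc (of_int (\<omega> i j))
  (bas (i, epow i m @ [Alpha i j, Alpha j i] @ epow i (cc C i j - 1 - m))) (k, p) ~= (0 :: 'k)"
  unfolding sum_apply by (auto elim: sum.not_neutral_contains_not_neutral)
  hence "(k, p) = (i, epow i m @ [Alpha i j, Alpha j i] @ epow i (cc C i j - 1 - m))"
  by (metis basis_nonzero fscale_apply mult_zero_right)
  moreover have "int m * f (Eps i) + int (cc C i j - 1 - m) * f (Eps i) = (int (cc C i j) - 1) * f (Eps i)"
  using m(1) by (simp add: algebra_simps)
  ultimately show "k = i & psrc k p = i & wt f (k, p) = w"
  using w[OF j(1)] by (auto simp: psrc_app sum_list_replicate)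
  qed
 qed
qed

text \<open>\<open>I\<close> is spanned by elements whose paths share target, source and weight; on
  such an element the cut is the identity or zero.\<close>

lemma I_cut:
 assumes f: "homog_weight f" and x: "x\<in>I"
 shows "cut (%(k, p). P k (psrc k p) (wt f (k, p))) x\<in>I"
proof (rule fl_span_sub[OF fl_cut _ I_sub])
 show "x\<in>fspan Igens" using x I_span by blast
 fix x assume "x\<in>Igens"
 then obtain i p j q rh where y: "x = pmul (pmul (bas (i, p)) rh) (bas (j, q))" "rh\<in>rels"
  unfolding Igens_def by blast
 have "homog f x" unfolding y(1) by (intro homog_mult homog_basis homog_rels f y(2))
 then obtain i j w where h: "!!k p. x (k, p) ~= 0 ==> k = i & psrc k p = j & wt f (k, p) = w"
  unfolding homog_def by blast
 have "cut (%(k, p). P k (psrc k p) (wt f (k, p))) x = (if P i j w then x else 0)"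
 proof
  fix z show "cut (%(k, p). P k (psrc k p) (wt f (k, p))) x z = (if P i j w then x else 0) z"
  proof (cases z)
  case (Pair k p)
  show ?thesis
  proof (cases "x (k, p) = 0")
  case False
  thus ?thesis using h[OF False] by (auto simp: cut_def Pair)
  qed (auto simp: cut_def Pair)
  qed
 qed
 moreover have "x\<in>I" unfolding I_span by (rule fs.span_base) fact
 ultimately show "cut (%(k, p). P k (psrc k p) (wt f (k, p))) x\<in>I"
  using fs.subspace_0[OF I_sub] by (simp only: split: if_split) simp
qed

fun is_alpha :: "'i arrow => int" where
 "is_alpha (Alpha i j) = 1"
| "is_alpha (Eps i) = 0"

lemma homog_deg: "homog_weight (arrow_deg d)"
 unfolding homog_weight_def
proof (intro conjI allI impI)
 fix i j assume a: "adj C i j"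
 show "arrow_deg d (Eps i) * int (cc C i j) = arrow_deg d (Eps j) * int (cc C j i)"
  using cc_d[OF a] cc_d[OF adj_sym[OF a]] by (simp add: mult.commute)
next
 fix i
 have "arrow_deg d (Alpha i j) + arrow_deg d (Alpha j i) + (int (cc C i j) - 1) * arrow_deg d (Eps i) = - 2 * d i"
  if "adj C i j" for j
  using cc_d[OF that] by (simp add: algebra_simps)
 thus "\<exists>w. \<forall>j. adj C i j --> arrow_deg d (Alpha i j) + arrow_deg d (Alpha j i) + (int (cc C i j) - 1) * arrow_deg d (Eps i) = w"
  by blast
qed

text \<open>Every term of every relation contains an arrow \<alpha>, and multiplication by paths
  keeps it. Hence the powers of a loop are independent modulo \<open>I\<close>, which makes the
  first piece of the knitting free.\<close>

lemma I_has_alpha: assumes x: "x\<in>I" "x (k, p) ~= 0" shows "wt is_alpha (k, p) > 0"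
proof -
 have nn: "0 <= wt is_alpha (k, p)" for k p
 proof -
  have "0 <= is_alpha a" for a by (cases a) auto
  thus ?thesis by (auto intro!: sum_list_nonneg)
 qed
 have mult1: "pmul a b (k, p) ~= 0 ==> \<exists>n. a (k, take n p) ~= 0 & b (psrc k (take n p), drop n p) ~= 0"
  for a b :: "('i, 'k) pelem" and k p
  unfolding path_mult_def by (auto elim!: sum.not_neutral_contains_not_neutral)
 have wadd: "wt is_alpha (k, p) = wt is_alpha (k, take n p) + wt is_alpha (psrc k (take n p), drop n p)" for k p n
  by simp (metis append_take_drop_id map_append sum_list_append)
 have rel: "wt is_alpha (k, p) > 0" if r: "rh\<in>rels" and nz: "rh (k, p) ~= 0" for rh k p
 proof -
  have pos: "Alpha i j\<in>set q ==> wt is_alpha (k, q) > 0" for i j k q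
  proof (induction q)
  case (Cons a q)
  thus ?case using nn[of k q] by (cases a) auto
  qed simp
  have "\<exists>i j. Alpha i j\<in>set p"
  proof -
  consider i j where "adj C i j" "rh = rel_commute C i j" | i where "rh = rel_mesh C \<omega> i"
  using r unfolding rels_def by blast
  thus ?thesis
  proof cases
  case 1
  hence "(k, p) = (i, epow i (cc C i j) @ [Alpha i j]) \<or> (k, p) = (i, Alpha i j # epow j (cc C j i))"
  using nz by (auto simp: commute_eq path_basis_def split: if_splits)
  thus ?thesis by auto
  next
  case 2
  then obtain j m where "fsc (of_int (\<omega> i j))
  (bas (i, epow i m @ [Alpha i j, Alpha j i] @ epow i (cc C i j - 1 - m))) (k, p) ~= (0 :: 'k)"
  using nz unfolding mesh_eq sum_apply by (auto elim!: sum.not_neutral_contains_not_neutral)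
  hence "(k, p) = (i, epow i m @ [Alpha i j, Alpha j i] @ epow i (cc C i j - 1 - m))"
  by (metis basis_nonzero fscale_apply mult_zero_right)
  thus ?thesis by auto
  qed
  qed
  thus ?thesis using pos by blast
 qed
 define Q where "Q = {x :: ('i, 'k) pelem. \<forall>k p. x (k, p) ~= 0 --> wt is_alpha (k, p) > 0}"
 have "Igens \<subseteq> Q"
 proof
  fix x assume "x\<in>Igens"
  then obtain i p j q rh where y: "x = pmul (pmul (bas (i, p)) rh) (bas (j, q))" "rh\<in>rels"
  unfolding Igens_def by blast
  show "x\<in>Q" unfolding Q_def
  proof (intro CollectI allI impI)
  fix k r assume "x (k, r) ~= 0"
  then obtain n where "pmul (bas (i, p)) rh (k, take n r) ~= 0" using mult1 y(1) by blast
  then obtain m where "rh (psrc k (take m (take n r)), drop m (take n r)) ~= 0" using mult1 by blast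
  from rel[OF y(2) this] show "wt is_alpha (k, r) > 0"
  using wadd[of k r n] wadd[of k "take n r" m] nn[of k "take m (take n r)"] nn[of "psrc k (take n r)" "drop n r"] by linarith
  qed
 qed
 moreover have "module.subspace fsc Q"
  unfolding fs.subspace_def Q_def by auto (metis add.right_neutral)
 ultimately have "I \<subseteq> Q" unfolding I_span by (rule fs.span_minimal)
 thus ?thesis using x unfolding Q_def by blast
qed

lemma commute_I:
 assumes a: "adj C i j" and q: "is_path C j q"
 shows "bas (i, epow i (cc C i j * m) @ Alpha i j # q) - bas (i, Alpha i j # epow j (cc C j i * m) @ q)\<in>I"
 using q
proof (induction m arbitrary: q)
 case 0
 show ?case by (simp only: mult_0_right replicate_0 append_Nil diff_self fs.subspace_0[OF I_sub])
next
 case (Suc m)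
 have r: "rel_commute C i j\<in>I" using a by (intro rels_I) (auto simp: rels_def)
 have e: "epow k (n * m) @ epow k n = epow k (n * Suc m)" for k :: 'i and n
  by (simp add: replicate_add[symmetric] add.commute)
 have "pmul (pmul (bas (i, epow i (cc C i j * m))) (rel_commute C i j)) (bas (j, q))\<in>I"
  using Suc.prems by (intro I_right I_left pcar_basis r) auto
 moreover have "pmul (pmul (bas (i, epow i (cc C i j * m))) (rel_commute C i j)) (bas (j, q))
  = bas (i, epow i (cc C i j * Suc m) @ Alpha i j # q) - (bas (i, epow i (cc C i j * m) @ Alpha i j # epow j (cc C j i) @ q) :: ('i, 'k) pelem)"
  by (simp add: commute_eq[OF a] pm_diff_left pm_diff_right pm_basis psrc_app e[symmetric] del: mult_Suc_right)
 moreover have "bas (i, epow i (cc C i j * m) @ Alpha i j # epow j (cc C j i) @ q)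
  - bas (i, Alpha i j # epow j (cc C j i * m) @ epow j (cc C j i) @ q)\<in>I"
  using Suc.prems by (intro Suc.IH) (simp add: path_app)
 ultimately have "bas (i, epow i (cc C i j * Suc m) @ Alpha i j # q)
  - bas (i, Alpha i j # epow j (cc C j i * m) @ epow j (cc C j i) @ q)\<in>I"
  using fs.subspace_add[OF I_sub] by fastforce
 moreover have "epow j (cc C j i * m) @ epow j (cc C j i) @ q = epow j (cc C j i * Suc m) @ q"
  by (simp add: e[symmetric] del: mult_Suc_right)
 ultimately show ?case by (simp only:)
qed

end

lemma fl_comp: "flinear f ==> flinear g ==> flinear (%x. g (f x))"
 by (simp add: fl_iff)

lemma fl_fscale: "flinear f ==> flinear (%x. fsc c (f x))"
 by (simp add: fl_iff fs.scale_right_distrib)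

lemma fl_sum: "(!!i. i\<in>A ==> flinear (f i)) ==> flinear (%x. \<Sum>i\<in>A. f i x)"
 by (simp add: fl_iff sum.distrib fs.scale_sum_right)

lemma fl_diff: "flinear f ==> flinear g ==> flinear (%x. f x - g x)"
 by (simp add: fl_iff fs.scale_right_diff_distrib)

lemma fl_0: "flinear f ==> f 0 = 0"
 using fl_iff[of f] fs.scale_zero_left by metis

lemma fl_minus: assumes "flinear f" shows "f (x - y) = f x - f y"
proof -
 interpret f: Vector_Spaces.linear fsc fsc f by fact
 show ?thesis by (rule f.diff)
qed

lemma fl_of_sum: assumes "flinear f" shows "f (\<Sum>i\<in>A. g i) = (\<Sum>i\<in>A. f (g i))"
proof -
 interpret f: Vector_Spaces.linear fsc fsc f by fact
 show ?thesis by (rule f.sum)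
qed

lemma fl_of_scale: "flinear f ==> f (fsc c x) = fsc c (f x)"
 by (simp add: fl_iff)

lemma pcar_memI:
 assumes f: "flinear f" and T: "module.subspace fsc T" and y: "y\<in>pcar C"
  and b: "!!i p. is_path C i p ==> f (bas (i, p))\<in>T"
 shows "f y\<in>T"
proof (rule fl_span_sub[OF f _ T])
 show "y\<in>fspan {bas (i, p) | i p. is_path C i p}" using y pcar_span by blast
qed (use b in blast)

lemma pcar_eqI:
 assumes f: "flinear f" and g: "flinear g" and y: "y\<in>pcar C"
  and b: "!!i p. is_path C i p ==> f (bas (i, p)) = g (bas (i, p))"
 shows "f y = g y"
proof -
 have "f y - g y\<in>{0}"
  by (rule pcar_memI[OF fl_diff[OF f g] _ y]) (simp_all only: fs.subspace_single_0 b diff_self singletonI)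
 thus ?thesis by simp
qed

lemma takeWhile_epow: "takeWhile (%b. b = Eps j) (epow j m @ Alpha i k # q) = epow j m"
 and dropWhile_epow: "dropWhile (%b. b = Eps j) (epow j m @ Alpha i k # q) = Alpha i k # q"
 by (induction m) auto

lemma path_cases:
 assumes "is_path C j l"
 obtains m where "l = epow j m"
 | m k q where "l = epow j m @ Alpha j k # q" "adj C j k" "is_path C k q"
proof -
 have "(\<exists>m. l = epow j m) \<or> (\<exists>m k q. l = epow j m @ Alpha j k # q & adj C j k & is_path C k q)"
  using assms
 proof (induction l)
  case Nil
  have "[] = epow j 0" by simp
  thus ?case by blast
 next
  case (Cons a l)
  show ?case
  proof (cases a)
  case (Alpha i k)
  hence "a # l = epow j 0 @ Alpha j k # l" "adj C j k" "is_path C k l" using Cons.prems by auto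
  thus ?thesis by blast
  next
  case (Eps i)
  hence i: "i = j" "is_path C j l" using Cons.prems by auto
  from Cons.IH[OF i(2)] show ?thesis
  proof (elim disjE exE conjE)
  fix m assume "l = epow j m"
  hence "a # l = epow j (Suc m)" using Eps i by simp
  thus ?thesis by blast
  next
  fix m k q assume "l = epow j m @ Alpha j k # q" "adj C j k" "is_path C k q"
  hence "a # l = epow j (Suc m) @ Alpha j k # q" using Eps i by simp
  thus ?thesis using \<open>adj C j k\<close> \<open>is_path C k q\<close> by blast
  qed
  qed
 qed
 thus ?thesis using that by blast
qed

section \<open>Exactness of the mesh relation in the path algebra modulo the relations\<close>

context gpp
begin

definition om :: "'i => 'i => 'k" where "om i j = of_int (\<omega> i j)"

definition J :: "'i => ('i \<times> nat) set" where
 "J j = (SIGMA k : nbs C j. {..<cc C j k})"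

lemma J_iff: "(k, a)\<in>J j \<longleftrightarrow> adj C j k & a < cc C j k"
 by (auto simp: J_def)

lemma finite_J: "finite (J j)"
 by (simp add: J_def)

text \<open>The coefficient at \<open>\<epsilon>\<^sub>j\<^sup>a \<alpha>\<^sub>j\<^sub>k\<close>, for \<open>a < - c\<^sub>j\<^sub>k\<close>, of a path with target \<open>j\<close>, once the surplus
 powers of \<open>\<epsilon>\<^sub>j\<close> have been moved through \<open>\<alpha>\<^sub>j\<^sub>k\<close>.\<close>

definition N0 :: "'i => 'i => nat => 'i path => ('i, 'k) pelem" where
 "N0 j k a x = (if fst x = j then
  (case dropWhile (%b. b = Eps j) (snd x) of
  Alpha i k' # q =>
  (let m = length (takeWhile (%b. b = Eps j) (snd x))
  in if k' = k & m mod cc C j k = a then bas (k, epow k (cc C k j * (m div cc C j k)) @ q) else 0)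
  | _ => 0) else 0)"

definition N :: "'i => 'i => nat => ('i, 'k) pelem => ('i, 'k) pelem" where
 "N j k a = (SOME N. flinear N & (\<forall>x. N (bas x) = N0 j k a x))"

lemma N_linear: "flinear (N j k a)" and N_basis: "N j k a (bas x) = N0 j k a x"
proof -
 have "\<exists>N. flinear N & (\<forall>x. N (bas x) = N0 j k a x)"
  by (rule basis_extension[of "N0 j k a"]) blast
 from someI_ex[OF this] show "flinear (N j k a)" "N j k a (bas x) = N0 j k a x"
  unfolding N_def by blast+
qed

lemma N_alpha: "N j k a (bas (j, epow j m @ Alpha j k' # q)) =
  (if k' = k & m mod cc C j k = a then bas (k, epow k (cc C k j * (m div cc C j k)) @ q) else 0)"
 unfolding N_basis N0_def fst_conv snd_conv takeWhile_epow dropWhile_epow Let_def by simp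

lemma dropWhile_only_eps: "dropWhile (%b. b = Eps j) (epow j m) = []"
 by (simp add: dropWhile_eq_Nil_conv)

lemma N_eps: "N j k a (bas (j, epow j m)) = 0"
 unfolding N_basis N0_def fst_conv snd_conv dropWhile_only_eps by simp

lemma N_other: "i ~= j ==> N j k a (bas (i, p)) = 0"
 unfolding N_basis N0_def fst_conv by simp

lemma N_0: "N j k a 0 = 0"
 by (rule fl_0[OF N_linear])

lemma N_mult_other: assumes "i ~= j" "y\<in>pc" shows "N j k a (pmul (bas (i, p)) y) = 0"
proof -
 have "N j k a (pmul (bas (i, p)) y)\<in>{0}"
 proof (rule pcar_memI[OF fl_comp[OF fl_mulL N_linear] fs.subspace_single_0 assms(2)])
  fix i' p' show "N j k a (pmul (bas (i, p)) (bas (i', p')))\<in>{0}"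
  unfolding pm_basis using N_other[OF assms(1)] N_0 by auto
 qed
 thus ?thesis by simp
qed

lemma N_mult_alpha:
 assumes y: "y\<in>pc"
 shows "N j k a (pmul (bas (j, epow j m @ Alpha j k' # p)) y) =
  (if k' = k & m mod cc C j k = a then pmul (bas (k, epow k (cc C k j * (m div cc C j k)) @ p)) y else 0)"
proof (cases "k' = k & m mod cc C j k = a")
 case True
 have "N j k a (pmul (bas (j, epow j m @ Alpha j k' # p)) y) = pmul (bas (k, epow k (cc C k j * (m div cc C j k)) @ p)) y"
 proof (rule pcar_eqI[OF fl_comp[OF fl_mulL N_linear] fl_mulL y])
  fix i' p'
  show "N j k a (pmul (bas (j, epow j m @ Alpha j k' # p)) (bas (i', p')))
  = pmul (bas (k, epow k (cc C k j * (m div cc C j k)) @ p)) (bas (i', p'))"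
  using True N_0 by (simp add: pm_basis psrc_app N_alpha)
 qed
 thus ?thesis using True by simp
next
 case False
 have "N j k a (pmul (bas (j, epow j m @ Alpha j k' # p)) y)\<in>{0}"
 proof (rule pcar_memI[OF fl_comp[OF fl_mulL N_linear] fs.subspace_single_0 y])
  fix i' p'
  show "N j k a (pmul (bas (j, epow j m @ Alpha j k' # p)) (bas (i', p')))\<in>{0}"
  using False N_0 by (auto simp: pm_basis psrc_app N_alpha)
 qed
 thus ?thesis using False by (simp only: if_False singletonD)
qed

definition outP :: "'i => 'i => nat => ('i, 'k) pelem => ('i, 'k) pelem" where
 "outP j k a u = fsc (om j k) (pmul (bas (k, Alpha k j # epow j (cc C j k - 1 - a))) u)"

lemma outP_linear: "flinear (outP j k a)"
 unfolding outP_def by (rule fl_fscale[OF fl_mulL])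

text \<open>Elements whose coefficients \<open>N\<close> form, modulo \<open>I\<close>, the image of
  one \<open>u\<close> under the mesh map \<open>outP\<close>. That \<open>I\<close> is contained in
  this space is the exactness of the mesh sequence.\<close>

definition Q :: "'i => ('i, 'k) pelem set" where
 "Q j = {x. \<exists>u\<in>pc. \<forall>(k, a)\<in>J j. N j k a x - outP j k a u\<in>I}"

lemma I_0: "0\<in>I"
 by (rule fs.subspace_0[OF I_sub])

lemma I_add: "x\<in>I ==> y\<in>I ==> x + y\<in>I"
 by (rule fs.subspace_add[OF I_sub])

lemma Q_sub: "module.subspace fsc (Q j)"
 unfolding fs.subspace_def
proof (intro conjI ballI allI)
 have "N j k a 0 - outP j k a 0 = 0" for k a
  by (simp only: N_0 fl_0[OF outP_linear] diff_self)
 thus "0\<in>Q j" unfolding Q_def using I_0 pc_diff(4) by (auto intro!: bexI[of _ 0])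
next
 fix x y assume "x\<in>Q j" "y\<in>Q j"
 then obtain u v where uv: "u\<in>pc" "v\<in>pc" "\<forall>(k, a)\<in>J j. N j k a x - outP j k a u\<in>I" "\<forall>(k, a)\<in>J j. N j k a y - outP j k a v\<in>I"
  unfolding Q_def by blast
 have "N j k a (x + y) - outP j k a (u + v) = (N j k a x - outP j k a u) + (N j k a y - outP j k a v)" for k a
  using N_linear[of j k a] outP_linear[of j k a] by (simp only: fl_iff) (simp only: add_diff_add)
 hence "\<forall>(k, a)\<in>J j. N j k a (x + y) - outP j k a (u + v)\<in>I"
  using uv(3,4) I_add by (metis (mono_tags, lifting) case_prod_beta)
 thus "x + y\<in>Q j" unfolding Q_def using pc_diff(1)[OF uv(1,2)] by blast
next
 fix c x assume "x\<in>Q j"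
 then obtain u where u: "u\<in>pc" "\<forall>(k, a)\<in>J j. N j k a x - outP j k a u\<in>I" unfolding Q_def by blast
 have "N j k a (fsc c x) - outP j k a (fsc c u) = fsc c (N j k a x - outP j k a u)" for k a
  using N_linear[of j k a] outP_linear[of j k a] by (simp only: fl_iff fs.scale_right_diff_distrib)
 hence "\<forall>(k, a)\<in>J j. N j k a (fsc c x) - outP j k a (fsc c u)\<in>I"
  using u(2) fs.subspace_scale[OF I_sub] by (metis (mono_tags, lifting) case_prod_beta)
 thus "fsc c x\<in>Q j" unfolding Q_def using pc_diff(3)[OF u(1)] by blast
qed

lemma Q_triv: assumes "!!k a. (k, a)\<in>J j ==> N j k a x\<in>I" shows "x\<in>Q j"
proof -
 have "N j k a x - outP j k a 0 = N j k a x" for k a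
  by (simp only: fl_0[OF outP_linear] diff_zero)
 thus ?thesis unfolding Q_def using assms pc_diff(4) by (auto intro!: bexI[of _ 0])
qed

lemma mod_add_left_inj:
 fixes b c m :: nat assumes e: "(m + b) mod c = (m + b') mod c" and b: "b < c" "b' < c"
 shows "b = b'"
proof -
 have "int c dvd int (m + b) - int (m + b')" using e by (metis mod_eq_dvd_iff of_nat_mod)
 hence "int c dvd int b - int b'" by simp
 thus ?thesis using b zdvd_not_zless[of "int b - int b'" "int c"] zdvd_not_zless[of "int b' - int b" "int c"]
  by (cases b b' rule: linorder_cases) (auto simp: dvd_diff_commute)
qed

lemma mod_unique:
 fixes a c m :: nat assumes "a < c"
 obtains b0 where "b0 < c" "!!b. b < c ==> (m + b) mod c = a \<longleftrightarrow> b = b0"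
proof
 let ?b0 = "(a + (c - m mod c)) mod c"
 show "?b0 < c" using assms by simp
 have c: "m mod c < c" using assms by simp
 have 1: "(m + ?b0) mod c = a"
 proof -
  have "(m + ?b0) mod c = (m mod c + (a + (c - m mod c))) mod c" by (metis mod_add_left_eq mod_add_right_eq)
  also have "m mod c + (a + (c - m mod c)) = a + c" using c by simp
  finally show ?thesis using assms by simp
 qed
 show "(m + b) mod c = a \<longleftrightarrow> b = ?b0" if "b < c" for b
 proof
  assume "(m + b) mod c = a"
  hence e: "(m + b) mod c = (m + ?b0) mod c" using 1 by simp
  show "b = ?b0" by (rule mod_add_left_inj[OF e that \<open>?b0 < c\<close>])
 qed (use 1 in simp)
qed

text \<open>Checked on the generators of \<open>I\<close>. If the left factor contains an \<alpha>,
  stripping it leaves a multiple of the relation. If it is a power of the loop, \<open>N\<close>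
  does not see a commutation relation, and takes a mesh relation to the image of a path under
  \<open>outP\<close>.\<close>

lemma N_I: assumes x: "x\<in>I" shows "x\<in>Q j"
proof -
 have "x\<in>Q j" if xg: "x\<in>Igens" for x
 proof -
  obtain i p i' q rh where x: "x = pmul (pmul (bas (i, p)) rh) (bas (i', q))"
  and ip: "is_path C i p" and iq: "is_path C i' q" and r: "rh\<in>rels"
  using xg unfolding Igens_def by blast
  let ?y = "pmul rh (bas (i', q))"
  have x': "x = pmul (bas (i, p)) ?y" by (simp only: x pm_assoc)
  have y: "?y\<in>I" by (rule I_right[OF pcar_basis[OF iq] rels_I[OF r]])
  hence ypc: "?y\<in>pc" by (rule I_pc)
  show ?thesis
  proof (cases "i = j")
  case False
  show ?thesis unfolding x' by (rule Q_triv) (simp only: N_mult_other[OF False ypc] I_0)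
  next
  case True
  hence jp: "is_path C j p" using ip by simp
  show ?thesis
  proof (cases rule: path_cases[OF jp])
  case (2 m k0 p')
  have "pmul (bas (k, epow k (cc C k j * (m div cc C j k)) @ p')) ?y\<in>I" if "k0 = k" for k
  by (rule I_left[OF pcar_basis y]) (use 2 that in \<open>simp add: path_app\<close>)
  thus ?thesis unfolding x' True 2(1) by (intro Q_triv) (auto simp: N_mult_alpha[OF ypc] I_0)
  next
  case (1 m)
  have p: "(i, p) = (j, epow j m)" using True 1 by simp
  consider i1 j1 where "adj C i1 j1" "rh = rel_commute C i1 j1" | i1 where "rh = rel_mesh C \<omega> i1"
  using r unfolding rels_def by blast
  thus ?thesis
  proof cases
  case c: 1
  show ?thesis
  proof (cases "i1 = j & j1 = i'")
  case False
  hence "x = 0"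
  unfolding x p c(2) commute_eq[OF c(1)]
  by (auto simp: pm_diff_left pm_diff_right pm_basis psrc_app)
  thus ?thesis using fs.subspace_0[OF Q_sub] by simp
  next
  case t: True
  hence a: "adj C j i'" using c(1) by simp
  have "x = bas (j, epow j (m + cc C j i') @ Alpha j i' # q)
  - bas (j, epow j m @ Alpha j i' # (epow i' (cc C i' j) @ q))"
  unfolding x p c(2) commute_eq[OF c(1)] using t
  by (simp add: pm_diff_left pm_diff_right pm_basis psrc_app replicate_add)
  hence Nx: "N j k b x = N j k b (bas (j, epow j (m + cc C j i') @ Alpha j i' # q))
  - N j k b (bas (j, epow j m @ Alpha j i' # (epow i' (cc C i' j) @ q)))" for k b
  by (simp only: fl_minus[OF N_linear])
  have "N j k b x = 0" for k b
  proof (cases "i' = k")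
  case True
  have "epow k (cc C k j * (m div cc C j k)) @ epow k (cc C k j) = epow k (cc C k j * ((m + cc C j k) div cc C j k))"
  using cc_pos[OF a] True by (simp add: replicate_add[symmetric] add.commute)
  hence "epow k (cc C k j * (m div cc C j k)) @ epow k (cc C k j) @ q = epow k (cc C k j * ((m + cc C j k) div cc C j k)) @ q"
  by (metis append_assoc)
  thus ?thesis unfolding Nx N_alpha True by (simp only: mod_add_self2) simp
  next
  case False
  thus ?thesis unfolding Nx N_alpha by simp
  qed
  thus ?thesis by (intro Q_triv) (simp add: I_0)
  qed
  next
  case c: 2
  show ?thesis
  proof (cases "i1 = j & i' = j")
  case False
  hence "x = 0"
  unfolding x p c mesh_eq pm_sum_left pm_sum_right pm_scale_left pm_scale_right
  by (intro sum.neutral ballI) (cases "i1 = j"; simp add: pm_basis psrc_app)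
  thus ?thesis using fs.subspace_0[OF Q_sub] by simp
  next
  case t: True
  let ?t = "%k b. bas (j, epow j (m + b) @ Alpha j k # Alpha k j # (epow j (cc C j k - 1 - b) @ q)) :: ('i, 'k) pelem"
  have xe: "x = (\<Sum>k\<in>nbs C j. \<Sum>b<cc C j k. fsc (om j k) (?t k b))"
  unfolding x p c mesh_eq om_def using t
  by (simp add: pm_sum_left pm_sum_right pm_scale_left pm_scale_right pm_basis psrc_app replicate_add)
  have "N j k a x - outP j k a (bas (j, epow j m @ q))\<in>I" if "(k, a)\<in>J j" for k a
  proof -
  have k: "adj C j k" "a < cc C j k" using that by (auto simp: J_iff)
  let ?c = "cc C j k"
  \<comment> \<open>Of the terms of the mesh relation at \<open>k\<close> exactly one,
    \<open>b0\<close>, has the right exponent modulo \<open>cc C j k\<close>.\<close>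
  obtain b0 where b0: "b0 < ?c" "!!b. b < ?c ==> (m + b) mod ?c = a \<longleftrightarrow> b = b0" by (rule mod_unique[OF k(2), of m]) blast
  define e where "e = (m + b0) div ?c"
  have e: "m + b0 = ?c * e + a" using b0 by (metis e_def mult_div_mod_eq)
  let ?s = "bas (k, epow k (cc C k j * e) @ Alpha k j # (epow j (?c - 1 - b0) @ q)) :: ('i, 'k) pelem"
  have tb: "N j k a (?t k' b) = (if k' = k & b = b0 then ?s else 0)" if "b < cc C j k'" for k' b
  unfolding N_alpha using b0(2)[of b] that by (auto simp: e_def)
  have "N j k a x = (\<Sum>k'\<in>nbs C j. \<Sum>b<cc C j k'. fsc (om j k') (N j k a (?t k' b)))"
  unfolding xe fl_of_sum[OF N_linear] fl_of_scale[OF N_linear] ..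
  also have "\<dots> = (\<Sum>k'\<in>nbs C j. \<Sum>b<cc C j k'. if k' = k & b = b0 then fsc (om j k) ?s else 0)"
  proof (intro sum.cong refl)
  fix k' b assume "b\<in>{..<cc C j k'}"
  thus "fsc (om j k') (N j k a (?t k' b)) = (if k' = k & b = b0 then fsc (om j k) ?s else 0)"
  by (subst tb) (auto simp only: lessThan_iff fs.scale_zero_right split: if_split)
  qed
  also have "\<dots> = (\<Sum>k'\<in>nbs C j. if k' = k then fsc (om j k) ?s else 0)"
  using b0(1) by (intro sum.cong refl) (auto simp: sum.delta)
  also have "\<dots> = fsc (om j k) ?s" using k by simp
  finally have Nx: "N j k a x = fsc (om j k) ?s" .
  \<comment> \<open>By the choice of \<open>e\<close> both words have
    \<open>m + cc C j k - 1 - a\<close> loops, so they agree once the surplus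
    \<open>cc C j k * e\<close> has passed through the arrow.\<close>
  have le: "epow j (?c * e) @ epow j (?c - 1 - b0) = epow j (?c - 1 - a) @ epow j m"
  proof -
  have "?c * e + (?c - 1 - b0) = ?c - 1 - a + m" using e b0(1) k(2) by linarith
  thus ?thesis by (simp only: replicate_add[symmetric])
  qed
  have "outP j k a (bas (j, epow j m @ q)) = fsc (om j k) (bas (k, Alpha k j # (epow j (?c - 1 - a) @ epow j m @ q)))"
  by (simp add: outP_def pm_basis)
  also have "epow j (?c - 1 - a) @ epow j m @ q = epow j (?c * e) @ (epow j (?c - 1 - b0) @ q)"
  using le by (metis append_assoc)
  finally have o: "outP j k a (bas (j, epow j m @ q)) = fsc (om j k) (bas (k, Alpha k j # epow j (?c * e) @ (epow j (?c - 1 - b0) @ q)))" .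
  have "is_path C j (epow j (?c - 1 - b0) @ q)" using iq t by (simp add: path_app)
  from commute_I[OF adj_sym[OF k(1)] this, of e]
  have "fsc (om j k) (?s - bas (k, Alpha k j # epow j (?c * e) @ (epow j (?c - 1 - b0) @ q)))\<in>I"
  by (rule fs.subspace_scale[OF I_sub])
  thus ?thesis unfolding Nx o fs.scale_right_diff_distrib .
  qed
  moreover have "bas (j, epow j m @ q)\<in>pc" using iq t by (intro pcar_basis) (simp add: path_app)
  ultimately show ?thesis unfolding Q_def by blast
  qed
  qed
  qed
  qed
 qed
 hence "fspan Igens \<subseteq> Q j" by (intro fs.span_minimal Q_sub) blast
 thus ?thesis using x I_span by blast
qed

text \<open>\<open>N\<close> reads the entries \<open>w\<close> off the sum, since exponents below
  \<open>cc C j k\<close> need no reduction; then \<open>N_I\<close> supplies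
  \<open>u\<close>.\<close>

lemma mesh_exact:
 assumes w: "!!k a. (k, a)\<in>J j ==> w (k, a)\<in>pc" "!!k a. (k, a)\<in>J j ==> pmul (idem k) (w (k, a)) = w (k, a)"
  and 0: "(\<Sum>(k, a)\<in>J j. pmul (bas (j, epow j a @ [Alpha j k])) (w (k, a)))\<in>I"
 obtains u where "u\<in>pc" "!!k a. (k, a)\<in>J j ==> w (k, a) - outP j k a u\<in>I"
proof -
 let ?x = "\<Sum>(k, a)\<in>J j. pmul (bas (j, epow j a @ [Alpha j k])) (w (k, a))"
 have Nx: "N j k a ?x = w (k, a)" if ka: "(k, a)\<in>J j" for k a
 proof -
  have "N j k a ?x = (\<Sum>p\<in>J j. N j k a (case p of (k', a') => pmul (bas (j, epow j a' @ [Alpha j k'])) (w (k', a'))))"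
  by (rule fl_of_sum[OF N_linear])
  also have "\<dots> = (\<Sum>p\<in>J j. if p = (k, a) then w (k, a) else 0)"
  proof (intro sum.cong refl)
  fix p assume p: "p\<in>J j"
  obtain k' a' where pk: "p = (k', a')" by (cases p)
  have a': "a' < cc C j k'" using p pk by (simp add: J_iff)
  have "N j k a (pmul (bas (j, epow j a' @ [Alpha j k'])) (w (k', a')))
  = (if k' = k & a' mod cc C j k = a then pmul (bas (k, epow k (cc C k j * (a' div cc C j k)) @ [])) (w (k', a')) else 0)"
  by (rule N_mult_alpha[OF w(1)]) (use p pk in simp)
  also have "\<dots> = (if p = (k, a) then w (k, a) else 0)" using a' w(2)[OF ka] pk by auto
  finally show "N j k a (case p of (k', a') => pmul (bas (j, epow j a' @ [Alpha j k'])) (w (k', a'))) = (if p = (k, a) then w (k, a) else 0)"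
  by (simp only: pk prod.case)
  qed
  also have "\<dots> = w (k, a)" using ka finite_J by simp
  finally show ?thesis .
 qed
 have "?x\<in>Q j" by (rule N_I[OF 0])
 then obtain u where u: "u\<in>pc" "\<forall>(k, a)\<in>J j. N j k a ?x - outP j k a u\<in>I" unfolding Q_def by blast
 show ?thesis
 proof (rule that[OF u(1)])
  fix k a assume "(k, a)\<in>J j"
  thus "w (k, a) - outP j k a u\<in>I" using u(2) Nx by fastforce
 qed
qed

lemma mesh_zero:
 assumes f: "f\<in>pc"
 shows "(\<Sum>(k, a)\<in>J j. pmul (bas (j, epow j a @ [Alpha j k])) (outP j k a f))\<in>I"
proof -
 have "(\<Sum>(k, a)\<in>J j. pmul (bas (j, epow j a @ [Alpha j k])) (outP j k a f)) = pmul (rel_mesh C \<omega> j) f"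
  unfolding mesh_eq pm_sum_left J_def
  by (subst sum_Sigma) (auto simp: outP_def om_def pm_scale_left pm_scale_right pm_assoc[symmetric] pm_basis psrc_app)
 also have "\<dots>\<in>I" by (rule I_right[OF f rels_I]) (simp add: rels_def)
 finally show ?thesis .
qed

text \<open>Moving the surplus powers of the loop through the first \<alpha> brings a path into the
  form whose coefficient is \<open>N\<close>.\<close>

lemma generation_basis:
 assumes l: "is_path C j l" "wt is_alpha (j, l) > 0"
 shows "bas (j, l) - (\<Sum>(k, a)\<in>J j. pmul (bas (j, epow j a @ [Alpha j k])) (N j k a (bas (j, l))))\<in>I"
proof (cases rule: path_cases[OF l(1)])
 case (1 m)
 hence "wt is_alpha (j, l) = 0" by (simp add: sum_list_replicate)
 thus ?thesis using l(2) by simp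
next
 case (2 m k0 q)
 let ?c = "cc C j k0"
 let ?a = "m mod ?c" and ?e = "m div ?c"
 have ka: "(k0, ?a)\<in>J j" using 2(2) cc_pos[OF 2(2)] by (simp add: J_iff)
 let ?z = "bas (k0, epow k0 (cc C k0 j * ?e) @ q) :: ('i, 'k) pelem"
 have "(\<Sum>(k, a)\<in>J j. pmul (bas (j, epow j a @ [Alpha j k])) (N j k a (bas (j, l))))
  = (\<Sum>p\<in>J j. if p = (k0, ?a) then pmul (bas (j, epow j ?a @ [Alpha j k0])) ?z else 0)"
 proof (intro sum.cong refl)
  fix p assume p: "p\<in>J j"
  obtain k a where pk: "p = (k, a)" by (cases p)
  have "pmul (bas (j, epow j a @ [Alpha j k])) (N j k a (bas (j, l))) = (if p = (k0, ?a) then pmul (bas (j, epow j ?a @ [Alpha j k0])) ?z else 0)"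
  unfolding 2(1) N_alpha pk by (cases "k0 = k & m mod cc C j k = a") (auto simp only: if_True if_False pm_0_right prod.inject split: if_split)
  thus "(case p of (k, a) => pmul (bas (j, epow j a @ [Alpha j k])) (N j k a (bas (j, l))))
  = (if p = (k0, ?a) then pmul (bas (j, epow j ?a @ [Alpha j k0])) ?z else 0)" by (simp only: pk prod.case)
 qed
 also have "\<dots> = pmul (bas (j, epow j ?a @ [Alpha j k0])) ?z" using ka finite_J by simp
 also have "\<dots> = pmul (bas (j, epow j ?a)) (bas (j, Alpha j k0 # epow k0 (cc C k0 j * ?e) @ q))"
  by (simp add: pm_basis psrc_app)
 finally have s: "(\<Sum>(k, a)\<in>J j. pmul (bas (j, epow j a @ [Alpha j k])) (N j k a (bas (j, l))))
  = pmul (bas (j, epow j ?a)) (bas (j, Alpha j k0 # epow k0 (cc C k0 j * ?e) @ q))" .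
 have "epow j ?a @ epow j (?c * ?e) = epow j m"
  unfolding replicate_add[symmetric] by (simp add: add.commute[of "m mod _"])
 hence b: "(bas (j, l) :: ('i, 'k) pelem) = pmul (bas (j, epow j ?a)) (bas (j, epow j (?c * ?e) @ Alpha j k0 # q))"
  unfolding 2(1) by (simp add: pm_basis append_assoc[symmetric] del: append_assoc)
 show ?thesis unfolding s unfolding b pm_diff_right[symmetric]
  by (rule I_left[OF pcar_basis commute_I[OF 2(2,3)]]) simp
qed

end

section \<open>The pieces of the algebra as an instance of knitting\<close>

lemma cut_cut: "cut P (cut Q f) = cut (%x. P x & Q x) f"
 by (auto simp: cut_def)

locale knit_gpp = gpp C d \<omega> Rt I
 for C :: "'i::finite => 'i => int" and d \<omega> Rt and I :: "('i, 'k::field) pelem set" +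
 fixes pos :: "'i => nat" and i0 :: 'i and n :: nat
 assumes n: "n = card (UNIV :: 'i set)" and pos: "bij_betw pos UNIV {..<n}"
begin

definition vt :: "nat => 'i" where "vt t = inv_into UNIV pos (t mod n)"

text \<open>An arrow from \<open>l\<close> to \<open>k\<close> with \<open>pos k < pos l\<close>
  cannot stay within the current cycle of \<open>n\<close> times, so it raises the cycle number by
  one.\<close>

definition dw :: "'i arrow => int" where
 "dw a = (case a of Alpha k l => if pos k < pos l then 1 else 0 | Eps k => 0)"

text \<open>The \<open>+ 1\<close> puts the idempotent at \<open>i0\<close> at time
  \<open>n + pos i0\<close>, so that a whole cycle of zero pieces precedes it.\<close>

definition PQ :: "nat => 'i path => bool" where
 "PQ t = (%(k, p). k = vt t & psrc k p = i0 & wt dw (k, p) + 1 = int (t div n))"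

definition PX :: "nat => ('i, 'k) pelem set" where
 "PX t = {f\<in>pc. cut (PQ t) f = f}"

text \<open>Its range models the quotient by \<open>I\<close> inside the type of path algebra
  elements, as the typed knitting requires.\<close>

definition proj :: "('i, 'k) pelem => ('i, 'k) pelem" where
 "proj = (SOME p. flinear p & (\<forall>x. p x = 0 \<longleftrightarrow> x\<in>I) & (\<forall>x. p x - x\<in>I))"

lemma proj_lin: "flinear proj" and proj_zero_iff: "proj x = 0 \<longleftrightarrow> x\<in>I" and proj_diff: "proj x - x\<in>I"
proof -
 have "\<exists>p. flinear p & (\<forall>x. p x = 0 \<longleftrightarrow> x\<in>I) & (\<forall>x. p x - x\<in>I)"
  by (rule fs.projection_along[OF I_sub]) blast
 from someI_ex[OF this] show "flinear proj" "proj x = 0 \<longleftrightarrow> x\<in>I" "proj x - x\<in>I"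
  unfolding proj_def by blast+
qed

lemma proj_eqI: "x - y\<in>I ==> proj x = proj y"
 using fl_minus[OF proj_lin, of x y] proj_zero_iff[of "x - y"] by simp

definition X :: "nat => ('i, 'k) pelem set" where "X t = proj ` PX t"

definition E :: "'i => ('i, 'k) pelem => ('i, 'k) pelem" where
 "E j x = proj (pmul (bas (j, [Eps j])) x)"

definition Al :: "'i => 'i => ('i, 'k) pelem => ('i, 'k) pelem" where
 "Al k l x = proj (if adj C k l then pmul (bas (k, [Alpha k l])) x else 0)"

definition pr :: "int => ('i, 'k) pelem => ('i, 'k) pelem" where
 "pr u x = proj (cut (%(k, p). wt (arrow_deg d) (k, p) = u) x)"

lemma n_pos: "n > 0"
 by (simp add: n finite_UNIV_card_ge_0)

lemma pos_less: "pos k < n"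
 using pos by (auto simp: bij_betw_def)

lemma pos_inj: "pos k = pos l ==> k = l"
 using pos by (auto simp: bij_betw_def dest: injD)

lemma pos_vt: "pos (vt t) = t mod n"
 unfolding vt_def using pos n_pos by (intro f_inv_into_f) (auto simp: bij_betw_def)

lemma vt_eqI: "t mod n = pos k ==> vt t = k"
 using pos_vt pos_inj by metis

lemma homog_dw: "homog_weight dw"
 unfolding homog_weight_def
proof (intro conjI allI impI exI)
 fix i j assume a: "adj C i j"
 hence "pos i ~= pos j" using pos_inj adj_neq by blast
 thus "dw (Alpha i j) + dw (Alpha j i) + (int (cc C i j) - 1) * dw (Eps i) = 1"
  by (auto simp: dw_def)
qed (simp add: dw_def)

lemma PX_sub: "module.subspace fsc (PX t)"
proof -
 have "cut (PQ t) (x + y) = cut (PQ t) x + cut (PQ t) y" "cut (PQ t) (fsc c x) = fsc c (cut (PQ t) x)"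
  for x y :: "('i, 'k) pelem" and c
  using fl_cut[of "PQ t", unfolded fl_iff] by blast+
 note lin = this
 show ?thesis unfolding PX_def fs.subspace_def
 proof (intro conjI ballI allI)
  show "0\<in>{f\<in>pc. cut (PQ t) f = f}"
  by (simp only: mem_Collect_eq pc_diff fl_0[OF fl_cut])
  show "x + y\<in>{f\<in>pc. cut (PQ t) f = f}" if "x\<in>{f\<in>pc. cut (PQ t) f = f}" "y\<in>{f\<in>pc. cut (PQ t) f = f}" for x y
  using that by (simp only: mem_Collect_eq lin pc_diff)
  show "fsc c x\<in>{f\<in>pc. cut (PQ t) f = f}" if "x\<in>{f\<in>pc. cut (PQ t) f = f}" for c x
  using that by (simp only: mem_Collect_eq lin pc_diff)
 qed
qed

lemma PX_pc: "y\<in>PX t ==> y\<in>pc"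
 by (simp add: PX_def)

lemma PX_basis: "is_path C k p ==> PQ t (k, p) ==> bas (k, p)\<in>PX t"
 unfolding PX_def by (simp only: mem_Collect_eq cut_basis if_True pcar_basis)

lemma cut_PX: "y\<in>pc ==> cut (PQ t) y\<in>PX t"
 unfolding PX_def by (simp only: mem_Collect_eq cut_cut pcar_cut conj_absorb)

lemma PX_linear_mem:
 assumes f: "flinear f" and T: "module.subspace fsc T" and y: "y\<in>PX t"
  and b: "!!k p. is_path C k p ==> PQ t (k, p) ==> f (bas (k, p))\<in>T"
 shows "f y\<in>T"
proof -
 have "f (cut (PQ t) y)\<in>T"
 proof (rule pcar_memI[OF fl_comp[OF fl_cut f] T PX_pc[OF y]])
  fix i p assume "is_path C i p"
  thus "f (cut (PQ t) (bas (i, p)))\<in>T"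
  using b fl_0[OF f] fs.subspace_0[OF T] by (cases "PQ t (i, p)") (simp_all only: cut_basis if_True if_False)
 qed
 thus ?thesis using y by (simp add: PX_def)
qed

lemma PX_linear_eq:
 assumes f: "flinear f" and g: "flinear g" and y: "y\<in>PX t"
  and b: "!!k p. is_path C k p ==> PQ t (k, p) ==> f (bas (k, p)) = g (bas (k, p))"
 shows "f y = g y"
proof -
 have "f y - g y\<in>{0}"
  by (rule PX_linear_mem[OF fl_diff[OF f g] _ y]) (simp_all only: fs.subspace_single_0 b diff_self singletonI)
 thus ?thesis by simp
qed

lemma PX_idem: assumes "y\<in>PX t" shows "pmul (idem (vt t)) y = y"
 by (rule PX_linear_eq[OF fl_mulL fs.linear_ident assms]) (auto simp: pm_basis PQ_def)

lemma PX_mult: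
 assumes l: "is_path C (vt t) l" "psrc (vt t) l = vt s" "wt dw (vt t, l) = int (t div n) - int (s div n)"
  and y: "y\<in>PX s"
 shows "pmul (bas (vt t, l)) y\<in>PX t"
proof (rule PX_linear_mem[OF fl_mulL PX_sub y])
 fix k p assume p: "is_path C k p" "PQ s (k, p)"
 hence "bas (vt t, l @ p)\<in>PX t" using l by (intro PX_basis) (auto simp: PQ_def psrc_app path_app)
 thus "pmul (bas (vt t, l)) (bas (k, p))\<in>PX t" using p l by (simp add: pm_basis PQ_def)
qed

text \<open>Inside a window the cycle number \<open>t div n\<close> goes up exactly when the
  position goes down, which is what \<open>dw\<close> counts along an arrow.\<close>

lemma div_window:
 assumes "s < t" "t < s + n"
 shows "int (t div n) - int (s div n) = (if t mod n < s mod n then 1 else 0)"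
proof -
 note t = mult_div_mod_eq[of n t] and s = mult_div_mod_eq[of n s]
 have "s div n <= t div n" using assms by (simp add: div_le_mono)
 moreover have "t div n <= Suc (s div n)"
 proof -
  have "t div n <= (s + n) div n" using assms by (intro div_le_mono) simp
  thus ?thesis using n_pos by simp
 qed
 ultimately consider "t div n = s div n" | "t div n = Suc (s div n)" by linarith
 thus ?thesis
 proof cases
  case 1
  hence "n * (t div n) = n * (s div n)" by simp
  hence "s mod n < t mod n" using assms(1) t s by linarith
  thus ?thesis using 1 by simp
 next
  case 2
  hence "n * (t div n) = n * (s div n) + n" by simp
  hence "t mod n < s mod n" using assms(2) t s by linarith
  thus ?thesis using 2 by simp
 qed
qed

lemma dw_alpha: "dw (Alpha (vt t) (vt s)) = (if t mod n < s mod n then 1 else 0)"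
 by (simp add: dw_def pos_vt)

lemma PX_alpha:
 assumes "adj C (vt t) (vt s)" "s < t" "t < s + n" "y\<in>PX s"
 shows "pmul (bas (vt t, [Alpha (vt t) (vt s)])) y\<in>PX t"
 using assms by (intro PX_mult[where s = s]) (auto simp: dw_alpha div_window)

lemma PX_eps: "y\<in>PX t ==> pmul (bas (vt t, [Eps (vt t)])) y\<in>PX t"
 by (intro PX_mult[where s = t]) (auto simp: dw_def)

lemma E_linear: "flinear (E j)"
 unfolding E_def by (rule fl_comp[OF fl_mulL proj_lin])

lemma zero_linear: "flinear (%x. 0)"
 by (simp only: fl_iff add_0 fs.scale_zero_right simp_thms)

lemma Al_linear: "flinear (Al k l)"
 unfolding Al_def using fl_comp[OF fl_mulL proj_lin] fl_comp[OF zero_linear proj_lin]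
 by (cases "adj C k l") (simp_all only: if_True if_False)

lemma pr_linear: "flinear (pr u)"
 unfolding pr_def by (rule fl_comp[OF fl_cut proj_lin])

lemma E_proj: "E j (proj x) = proj (pmul (bas (j, [Eps j])) x)"
 unfolding E_def by (rule proj_eqI) (simp only: pm_diff_right[symmetric] I_left pcar_basis proj_diff is_path.simps is_arrow.simps tgt.simps simp_thms)

lemma Al_proj: "adj C k l ==> Al k l (proj x) = proj (pmul (bas (k, [Alpha k l])) x)"
 unfolding Al_def by (simp only: if_True, rule proj_eqI)
  (simp only: pm_diff_right[symmetric] I_left pcar_basis proj_diff is_path.simps is_arrow.simps tgt.simps simp_thms)

lemma pr_proj: "pr u (proj x) = proj (cut (%(k, p). wt (arrow_deg d) (k, p) = u) x)"
 unfolding pr_def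
proof (rule proj_eqI)
 show "cut (%(k, p). wt (arrow_deg d) (k, p) = u) (proj x) - cut (%(k, p). wt (arrow_deg d) (k, p) = u) x\<in>I"
  using I_cut[OF homog_deg proj_diff, of "%_ _ w. w = u" x]
  by (simp only: fl_minus[OF fl_cut])
qed

lemma EAl_proj:
 assumes "adj C j k"
 shows "(E j ^^ a) (Al j k (proj z)) = proj (pmul (bas (j, epow j a @ [Alpha j k])) z)"
proof (induction a)
 case 0 thus ?case using Al_proj[OF assms] by simp
next
 case (Suc a)
 have "(E j ^^ Suc a) (Al j k (proj z)) = proj (pmul (pmul (bas (j, [Eps j])) (bas (j, epow j a @ [Alpha j k]))) z)"
  by (simp add: Suc E_proj pm_assoc)
 thus ?case by (simp add: pm_basis)
qed

lemma AlE_proj: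
 assumes "adj C k j"
 shows "Al k j ((E j ^^ m) (proj u)) = proj (pmul (bas (k, Alpha k j # epow j m)) u)"
proof (induction m arbitrary: u)
 case 0 thus ?case using Al_proj[OF assms] by simp
next
 case (Suc m)
 have "Al k j ((E j ^^ Suc m) (proj u)) = Al k j ((E j ^^ m) (E j (proj u)))" by (metis comp_apply funpow_Suc_right)
 also have "\<dots> = proj (pmul (pmul (bas (k, Alpha k j # epow j m)) (bas (j, [Eps j]))) u)"
  by (simp only: E_proj Suc pm_assoc)
 finally show ?case by (simp add: pm_basis replicate_append_same)
qed

lemma E_pow_idem: "(E j ^^ m) (proj (idem j)) = proj (bas (j, epow j m))"
 by (induction m) (simp_all add: E_proj pm_basis)

text \<open>Each \<alpha> advances the time, which is \<open>n\<close> times the cycle number plus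
  the position, by at least one. So the time of a path bounds its number of arrows \<alpha>, and the
  vanishing of late pieces becomes nilpotency.\<close>

lemma path_pos:
 "is_path C k p ==> int (pos (psrc k p)) + wt is_alpha (k, p) <= int (pos k) + int n * wt dw (k, p)"
proof (induction p arbitrary: k)
 case (Cons a p)
 show ?case
 proof (cases a)
  case (Alpha i l)
  hence il: "i = k" "adj C k l" "is_path C l p" using Cons.prems by auto
  have "pos k ~= pos l" using il(2) pos_inj adj_neq by blast
  hence "int (pos l) + 1 <= int (pos k) + int n * dw a" using pos_less[of l] Alpha il(1) by (auto simp: dw_def)
  thus ?thesis using Cons.IH[OF il(3)] Alpha by (simp add: algebra_simps)
 next
  case (Eps i)
  thus ?thesis using Cons by (auto simp: dw_def)
 qed
qed simp

lemma weight_nonneg: "0 <= wt dw (k, p)" "0 <= wt is_alpha (k, p)"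
proof -
 have "0 <= dw a" "0 <= is_alpha a" for a by (cases a; auto simp: dw_def)+
 thus "0 <= wt dw (k, p)" "0 <= wt is_alpha (k, p)" by (auto intro!: sum_list_nonneg)
qed

lemma PQ_time: assumes "is_path C k p" "PQ t (k, p)"
 shows "int n + int (pos i0) + wt is_alpha (k, p) <= int t"
proof -
 have "int t = int n * int (t div n) + int (t mod n)" by (metis mult_div_mod_eq of_nat_add of_nat_mult)
 moreover have "int (t div n) = wt dw (k, p) + 1" "int (t mod n) = int (pos k)" "psrc k p = i0"
  using assms(2) by (auto simp: PQ_def pos_vt)
 ultimately show ?thesis using path_pos[OF assms(1)] by (simp add: algebra_simps)
qed

lemma no_alpha: assumes "is_path C k p" "wt is_alpha (k, p) = 0" obtains m where "p = epow k m"
proof (cases rule: path_cases[OF assms(1)])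
 case (2 m l q)
 thus ?thesis using assms(2) weight_nonneg(2)[of l q] by (simp add: sum_list_replicate)
qed (use that in blast)

lemma X_early: assumes "s < n + pos i0" shows "X s = {0}"
proof -
 have "y = 0" if y: "y\<in>PX s" for y
 proof
  fix x show "y x = 0 x"
  proof (cases x)
  case (Pair k p)
  show ?thesis
  proof (rule ccontr)
  assume "\<not> ?thesis"
  hence nz: "y (k, p) ~= 0" by (simp add: Pair)
  hence "is_path C k p" using PX_pc[OF y] by (auto simp: pcar_def)
  moreover have "cut (PQ s) y (k, p) ~= 0" using nz y by (simp add: PX_def)
  hence "PQ s (k, p)" by (simp add: cut_def split: if_splits)
  ultimately show False using PQ_time[of k p s] assms weight_nonneg(2)[of k p] by simp
  qed
  qed
 qed
 hence "PX s \<subseteq> {0}" by blast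
 hence "PX s = {0}" using fs.subspace_0[OF PX_sub] by blast
 thus ?thesis unfolding X_def using fl_0[OF proj_lin] by simp
qed

text \<open>At the starting time only the powers of the loop at \<open>i0\<close> are left; they are
  independent modulo \<open>I\<close> by \<open>I_has_alpha\<close>.\<close>

lemma X_start: "fs.hbasis (E i0) {proj (idem i0)} (X (n + pos i0))"
 unfolding fs.hbasis_def
proof (intro conjI allI impI ballI)
 let ?t = "n + pos i0"
 have vt: "vt ?t = i0" using pos_less[of i0] by (intro vt_eqI) simp
 have td: "?t div n = 1" using pos_less[of i0] n_pos by (simp add: div_add_self1)
 have eps_PX: "bas (i0, epow i0 m)\<in>PX ?t" for m
  by (rule PX_basis) (auto simp: PQ_def vt td sum_list_replicate dw_def)
 show "finite {proj (idem i0)}" by simp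
 show "X ?t = fspan {(E i0 ^^ a) b | a b. b\<in>{proj (idem i0)}}" (is "_ = ?S")
 proof
  show "?S \<subseteq> X ?t"
  proof (rule fs.span_minimal)
  show "{(E i0 ^^ a) b | a b. b\<in>{proj (idem i0)}} \<subseteq> X ?t"
  using eps_PX by (auto simp: E_pow_idem X_def)
  show "module.subspace fsc (X ?t)" unfolding X_def
  proof -
  interpret p: Vector_Spaces.linear fsc fsc proj by (rule proj_lin)
  show "module.subspace fsc (proj ` PX ?t)" by (rule p.subspace_image[OF PX_sub])
  qed
  qed
  show "X ?t \<subseteq> ?S"
  proof
  fix x assume "x\<in>X ?t"
  then obtain y where y: "y\<in>PX ?t" "x = proj y" by (auto simp: X_def)
  have "proj y\<in>?S"
  proof (rule PX_linear_mem[OF proj_lin fs.subspace_span y(1)])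
  fix k p assume p: "is_path C k p" "PQ ?t (k, p)"
  have "wt is_alpha (k, p) = 0" using PQ_time[OF p] weight_nonneg(2)[of k p] by simp
  then obtain m where "p = epow k m" by (rule no_alpha[OF p(1)])
  hence "proj (bas (k, p)) = (E i0 ^^ m) (proj (idem i0))" using p(2) by (simp add: PQ_def vt E_pow_idem)
  thus "proj (bas (k, p))\<in>?S" by (simp only:) (rule fs.span_base, blast)
  qed
  thus "x\<in>?S" using y(2) by simp
  qed
 qed
 fix m and kp :: "nat => ('i, 'k) pelem => 'k" and a b
 assume s: "(\<Sum>a\<le>m. \<Sum>b\<in>{proj (idem i0)}. fsc (kp a b) ((E i0 ^^ a) b)) = 0" and a: "a <= m" and b: "b\<in>{proj (idem i0)}"
 let ?k = "%a. kp a (proj (idem i0))"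
 let ?z = "\<Sum>a\<le>m. fsc (?k a) (bas (i0, epow i0 a)) :: ('i, 'k) pelem"
 have "proj ?z = 0" using s by (simp add: fl_of_sum[OF proj_lin] fl_of_scale[OF proj_lin] E_pow_idem)
 hence z: "?z\<in>I" using proj_zero_iff by blast
 have "?z (i0, epow i0 a) = (\<Sum>a'\<le>m. if a' = a then ?k a else 0)"
  unfolding sum_apply by (intro sum.cong refl) (auto simp: path_basis_def)
 hence za: "?z (i0, epow i0 a) = ?k a" using a by simp
 show "kp a b = 0"
 proof (rule ccontr)
  assume "kp a b ~= 0"
  hence "?k a ~= 0" using b by simp
  hence "wt is_alpha (i0, epow i0 a) > 0" by (intro I_has_alpha[OF z]) (simp only: za not_False_eq_True)
  thus False by (simp add: sum_list_replicate)
 qed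
qed

lemma pr_eps_pcar: assumes "y\<in>pc"
 shows "cut (%(k, p). wt (arrow_deg d) (k, p) = u) (pmul (bas (j, [Eps j])) y)
  = pmul (bas (j, [Eps j])) (cut (%(k, p). wt (arrow_deg d) (k, p) = u - 2 * d j) y)"
 by (rule pcar_eqI[OF fl_comp[OF fl_mulL fl_cut] fl_comp[OF fl_cut fl_mulL] assms])
  (auto simp: pm_basis cut_basis fl_0[OF fl_cut])

lemma pr_alpha_pcar: assumes "y\<in>pc"
 shows "cut (%(k, p). wt (arrow_deg d) (k, p) = u) (pmul (bas (j, [Alpha j l])) y)
  = pmul (bas (j, [Alpha j l])) (cut (%(k, p). wt (arrow_deg d) (k, p) = u + max (d j) (d l)) y)"
 by (rule pcar_eqI[OF fl_comp[OF fl_mulL fl_cut] fl_comp[OF fl_cut fl_mulL] assms])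
  (auto simp: pm_basis cut_basis fl_0[OF fl_cut])

lemma PX_cut: "y\<in>PX t ==> cut P y\<in>PX t"
proof -
 assume y: "y\<in>PX t"
 have "cut (PQ t) (cut P y) = cut P (cut (PQ t) y)" by (auto simp: cut_def)
 thus ?thesis using y unfolding PX_def by (simp only: mem_Collect_eq pcar_cut simp_thms)
qed

lemma degree_bound: "wt (arrow_deg d) (k, p) >= - Max (range d) * wt is_alpha (k, p)"
proof (induction p arbitrary: k)
 case (Cons a p k)
 have M: "d i <= Max (range d)" for i by simp
 have "arrow_deg d a >= - Max (range d) * is_alpha a"
  using M d_pos by (cases a) (auto simp: max_def less_imp_le)
 thus ?case using Cons.IH[of k] by (simp add: algebra_simps)
qed simp

text \<open>Stripping the first \<alpha> leads from time \<open>t + n\<close> back to the time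
  \<open>s\<close> of its source \<open>k\<close> in the window.\<close>

lemma N_PX:
 assumes t: "t < s" "s < t + n" "vt s = k" and f: "f\<in>PX (t + n)" and k: "adj C (vt t) k"
 shows "N (vt t) k a f\<in>PX s"
proof (rule PX_linear_mem[OF N_linear PX_sub f])
 fix k' p assume p: "is_path C k' p" "PQ (t + n) (k', p)"
 have vtn: "vt (t + n) = vt t" by (simp add: vt_def)
 have k': "k' = vt t" "psrc k' p = i0" "wt dw (k', p) + 1 = int ((t + n) div n)" using p(2) by (auto simp: PQ_def vtn)
 show "N (vt t) k a (bas (k', p))\<in>PX s"
 proof (cases rule: path_cases[OF p(1)])
  case (1 m)
  thus ?thesis using fs.subspace_0[OF PX_sub] unfolding k'(1) by (simp only: N_eps)
 next
  case (2 m k0 q)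
  show ?thesis
  proof (cases "k0 = k & m mod cc C (vt t) k = a")
  case True
  have "int ((t + n) div n) - int (s div n) = (if (t + n) mod n < s mod n then 1 else 0)"
  using t by (intro div_window) auto
  moreover have "dw (Alpha (vt t) k) = (if (t + n) mod n < s mod n then 1 else 0)"
  using dw_alpha[of "t + n" s] t(3) vtn by simp
  moreover have "wt dw (k', p) = dw (Alpha (vt t) k) + wt dw (k, q)"
  using 2 k'(1) True by (simp add: sum_list_replicate dw_def)
  ultimately have "PQ s (k, epow k (cc C k (vt t) * (m div cc C (vt t) k)) @ q)"
  using k' 2 True t(3) by (auto simp: PQ_def psrc_app sum_list_replicate dw_def)
  moreover have "is_path C k (epow k (cc C k (vt t) * (m div cc C (vt t) k)) @ q)" using 2 True by (simp add: path_app)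
  ultimately have "bas (k, epow k (cc C k (vt t) * (m div cc C (vt t) k)) @ q)\<in>PX s" by (rule PX_basis[rotated])
  thus ?thesis using True unfolding k'(1) 2(1)[unfolded k'(1)] N_alpha by simp
  next
  case False
  thus ?thesis using fs.subspace_0[OF PX_sub] unfolding k'(1) 2(1)[unfolded k'(1)] N_alpha by (simp only: if_False)
  qed
 qed
qed

lemma outP_cut:
 assumes t: "t < s" "s < t + n" "vt s = k" and k: "adj C (vt t) k" and u: "u\<in>pc"
 shows "cut (PQ s) (outP (vt t) k a u) = outP (vt t) k a (cut (PQ t) u)"
proof (rule pcar_eqI[OF fl_comp[OF outP_linear fl_cut] fl_comp[OF fl_cut outP_linear] u])
 fix k' p assume p: "is_path C k' p"
 show "cut (PQ s) (outP (vt t) k a (bas (k', p))) = outP (vt t) k a (cut (PQ t) (bas (k', p)))"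
 proof (cases "k' = vt t")
  case False
  hence 1: "outP (vt t) k a (bas (k', p)) = 0"
  by (simp add: outP_def pm_basis)
  have "\<not> PQ t (k', p)" using False by (simp add: PQ_def)
  thus ?thesis by (simp only: 1 cut_basis if_False fl_0[OF fl_cut] fl_0[OF outP_linear])
 next
  case True
  let ?l = "Alpha k (vt t) # epow (vt t) (cc C (vt t) k - 1 - a) @ p"
  have o: "outP (vt t) k a (bas (k', p)) = fsc (om (vt t) k) (bas (k, ?l))"
  using True by (simp add: outP_def pm_basis)
  have "dw (Alpha k (vt t)) = int (s div n) - int (t div n)"
  using dw_alpha[of s t] div_window[of t s] t by simp
  hence "PQ s (k, ?l) \<longleftrightarrow> PQ t (k', p)"
  using True t(3) by (auto simp: PQ_def psrc_app sum_list_replicate dw_def)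
  thus ?thesis
  by (cases "PQ t (k', p)") (simp_all only: o cut_basis if_True if_False fl_of_scale[OF fl_cut] fl_0[OF outP_linear] fs.scale_zero_right)
 qed
qed

end

context knit_gpp
begin

lemma om_nonzero: "adj C j k ==> om j k ~= 0"
 using signs unfolding sign_choice_def om_def by fastforce

lemma X_subspace: "module.subspace fsc (X t)"
proof -
 interpret p: Vector_Spaces.linear fsc fsc proj by (rule proj_lin)
 show ?thesis unfolding X_def by (rule p.subspace_image[OF PX_sub])
qed

lemma X_E: assumes "x\<in>X t" shows "E (vt t) x\<in>X t"
proof -
 obtain y where "y\<in>PX t" "x = proj y" using assms by (auto simp: X_def)
 thus ?thesis using PX_eps by (auto simp: X_def E_proj)
qed

lemma X_Al: assumes "adj C (vt t) (vt s)" "s < t" "t < s + n" "x\<in>X s" shows "Al (vt t) (vt s) x\<in>X t"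
proof -
 obtain y where "y\<in>PX s" "x = proj y" using assms by (auto simp: X_def)
 thus ?thesis using PX_alpha[OF assms(1-3)] by (auto simp: X_def Al_proj[OF assms(1)])
qed

lemma X_rel: assumes a: "adj C (vt t) (vt s)" and x: "x\<in>X s"
 shows "Al (vt t) (vt s) ((E (vt s) ^^ cc C (vt s) (vt t)) x) = (E (vt t) ^^ cc C (vt t) (vt s)) (Al (vt t) (vt s) x)"
proof -
 obtain y where y: "y\<in>PX s" "x = proj y" using x by (auto simp: X_def)
 let ?i = "vt t" and ?j = "vt s"
 have "rel_commute C ?i ?j\<in>I" using a by (intro rels_I) (auto simp: rels_def)
 hence "pmul (rel_commute C ?i ?j) y\<in>I" by (rule I_right[OF PX_pc[OF y(1)]])
 hence "proj (pmul (bas (?i, epow ?i (cc C ?i ?j) @ [Alpha ?i ?j])) y)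
  = proj (pmul (bas (?i, Alpha ?i ?j # epow ?j (cc C ?j ?i))) y)"
  by (intro proj_eqI) (simp only: commute_eq[OF a] pm_diff_left)
 thus ?thesis unfolding y(2) EAl_proj[OF a] AlE_proj[OF a] by simp
qed

lemma X_gen:
 assumes t: "t > pos i0" and tm: "!!k. k ~= vt t ==> t < tm k & tm k < t + n & vt (tm k) = k" and x: "x\<in>X (t + n)"
 shows "\<exists>w. (\<forall>k a. if adj C (vt t) k & a < cc C (vt t) k then w (k, a)\<in>X (tm k) else w (k, a) = 0) &
  x = (\<Sum>(k, a)\<in>(SIGMA k : {k. adj C (vt t) k}. {..<cc C (vt t) k}). (E (vt t) ^^ a) (Al (vt t) k (w (k, a))))"
proof -
 let ?j = "vt t"
 obtain f where f: "f\<in>PX (t + n)" "x = proj f" using x by (auto simp: X_def)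
 have vtn: "vt (t + n) = ?j" by (simp add: vt_def)
 define w where "w = (%(k, a). if adj C ?j k & a < cc C ?j k then proj (N ?j k a f) else 0)"
 have w1: "if adj C ?j k & a < cc C ?j k then w (k, a)\<in>X (tm k) else w (k, a) = 0" for k a
 proof (cases "adj C ?j k & a < cc C ?j k")
  case True
  hence "k ~= ?j" using adj_neq by blast
  hence "N ?j k a f\<in>PX (tm k)" using tm[of k] True f(1) by (intro N_PX) auto
  thus ?thesis using True by (simp add: w_def X_def)
 qed (auto simp only: w_def prod.case if_False)
 have "f - (\<Sum>(k, a)\<in>J ?j. pmul (bas (?j, epow ?j a @ [Alpha ?j k])) (N ?j k a f))\<in>I"
 proof (rule PX_linear_mem[OF fl_diff[OF fs.linear_ident fl_sum] I_sub f(1)])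
  show "flinear (%f. case p of (k, a) => pmul (bas (?j, epow ?j a @ [Alpha ?j k])) (N ?j k a f))" for p
  by (cases p) (simp only: prod.case fl_comp[OF N_linear fl_mulL])
  fix k p assume p: "is_path C k p" "PQ (t + n) (k, p)"
  have k: "k = ?j" using p(2) by (simp add: PQ_def vtn)
  have "wt is_alpha (k, p) > 0"
  proof (rule ccontr)
  assume "\<not> ?thesis"
  hence "wt is_alpha (k, p) = 0" using weight_nonneg(2)[of k p] by simp
  then obtain m where m: "p = epow k m" by (rule no_alpha[OF p(1)])
  \<comment> \<open>A path without \<alpha> at time \<open>t + n\<close> is a power of the loop at
    \<open>i0\<close> in the first nonzero cycle, so \<open>t = pos i0\<close>, which is
    excluded.\<close>
  hence "k = i0" "int ((t + n) div n) = 1" using p(2) by (auto simp: PQ_def sum_list_replicate dw_def)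
  hence "t div n = 0" "t mod n = pos i0" using n_pos k pos_vt[of t] by auto
  thus False using t mult_div_mod_eq[of n t] by simp
  qed
  from generation_basis[OF p(1) this]
  show "bas (k, p) - (\<Sum>(k', a)\<in>J ?j. pmul (bas (?j, epow ?j a @ [Alpha ?j k'])) (N ?j k' a (bas (k, p))))\<in>I"
  unfolding k .
 qed
 hence "x = proj (\<Sum>(k, a)\<in>J ?j. pmul (bas (?j, epow ?j a @ [Alpha ?j k])) (N ?j k a f))"
  unfolding f(2) by (rule proj_eqI)
 also have "\<dots> = (\<Sum>(k, a)\<in>J ?j. (E ?j ^^ a) (Al ?j k (w (k, a))))"
  unfolding fl_of_sum[OF proj_lin]
  by (intro sum.cong refl) (auto simp: J_iff w_def EAl_proj)
 finally show ?thesis using w1 unfolding J_def by blast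
qed

lemma X_mesh:
 assumes x: "x\<in>X t"
 shows "(\<Sum>(k, a)\<in>(SIGMA k : {k. adj C (vt t) k}. {..<cc C (vt t) k}).
  (E (vt t) ^^ a) (Al (vt t) k (fsc (om (vt t) k) (Al k (vt t) ((E (vt t) ^^ (cc C (vt t) k - 1 - a)) x))))) = 0"
proof -
 let ?j = "vt t"
 obtain f where f: "f\<in>PX t" "x = proj f" using x by (auto simp: X_def)
 have "(\<Sum>(k, a)\<in>J ?j. (E ?j ^^ a) (Al ?j k (fsc (om ?j k) (Al k ?j ((E ?j ^^ (cc C ?j k - 1 - a)) x)))))
  = (\<Sum>(k, a)\<in>J ?j. proj (pmul (bas (?j, epow ?j a @ [Alpha ?j k])) (outP ?j k a f)))"
 proof (intro sum.cong refl)
  fix p assume p: "p\<in>J ?j"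
  obtain k a where pk: "p = (k, a)" by (cases p)
  have a: "adj C ?j k" "adj C k ?j" using p pk adj_sym by (auto simp: J_iff)
  show "(case p of (k, a) => (E ?j ^^ a) (Al ?j k (fsc (om ?j k) (Al k ?j ((E ?j ^^ (cc C ?j k - 1 - a)) x)))))
  = (case p of (k, a) => proj (pmul (bas (?j, epow ?j a @ [Alpha ?j k])) (outP ?j k a f)))"
  by (simp only: pk prod.case f(2) AlE_proj[OF a(2)] fl_of_scale[OF proj_lin, symmetric] EAl_proj[OF a(1)] outP_def)
 qed
 also have "\<dots> = proj (\<Sum>(k, a)\<in>J ?j. pmul (bas (?j, epow ?j a @ [Alpha ?j k])) (outP ?j k a f))"
  unfolding fl_of_sum[OF proj_lin] by (intro sum.cong refl) auto
 also have "\<dots> = 0" using mesh_zero[OF PX_pc[OF f(1)]] proj_zero_iff by blast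
 finally show ?thesis unfolding J_def .
qed

lemma X_exact:
 assumes tm: "!!k. k ~= vt t ==> t < tm k & tm k < t + n & vt (tm k) = k"
  and w: "!!k a. adj C (vt t) k ==> a < cc C (vt t) k ==> w (k, a)\<in>X (tm k)"
  and 0: "(\<Sum>(k, a)\<in>(SIGMA k : {k. adj C (vt t) k}. {..<cc C (vt t) k}). (E (vt t) ^^ a) (Al (vt t) k (w (k, a)))) = 0"
 shows "\<exists>x\<in>X t. \<forall>k a. adj C (vt t) k --> a < cc C (vt t) k -->
  w (k, a) = fsc (om (vt t) k) (Al k (vt t) ((E (vt t) ^^ (cc C (vt t) k - 1 - a)) x))"
proof -
 let ?j = "vt t"
 have "\<forall>p. \<exists>y. p\<in>J ?j --> y\<in>PX (tm (fst p)) & w p = proj y"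
  using w by (auto simp: J_iff X_def)
 then obtain y where y0: "\<forall>p. p\<in>J ?j --> y p\<in>PX (tm (fst p)) & w p = proj (y p)" by metis
 have y: "y (k, a)\<in>PX (tm k)" "w (k, a) = proj (y (k, a))" if "(k, a)\<in>J ?j" for k a
  using y0 that by fastforce+
 have window: "t < tm k" "tm k < t + n" "vt (tm k) = k" "adj C ?j k" "adj C k ?j" if "(k, a)\<in>J ?j" for k a
  using that tm[of k] adj_neq[of ?j k] adj_sym by (auto simp: J_iff)
 have "(\<Sum>(k, a)\<in>J ?j. (E ?j ^^ a) (Al ?j k (w (k, a)))) = (\<Sum>(k, a)\<in>J ?j. proj (pmul (bas (?j, epow ?j a @ [Alpha ?j k])) (y (k, a))))"
  using y(2) window(4) by (intro sum.cong refl) (auto simp: EAl_proj)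
 also have "\<dots> = proj (\<Sum>(k, a)\<in>J ?j. pmul (bas (?j, epow ?j a @ [Alpha ?j k])) (y (k, a)))"
  unfolding fl_of_sum[OF proj_lin] by (intro sum.cong refl) auto
 finally have "proj (\<Sum>(k, a)\<in>J ?j. pmul (bas (?j, epow ?j a @ [Alpha ?j k])) (y (k, a))) = 0"
  using 0 unfolding J_def by simp
 hence yI: "(\<Sum>(k, a)\<in>J ?j. pmul (bas (?j, epow ?j a @ [Alpha ?j k])) (y (k, a)))\<in>I"
  using proj_zero_iff by blast
 have yi: "pmul (idem k) (y (k, a)) = y (k, a)" if "(k, a)\<in>J ?j" for k a
  using PX_idem[OF y(1)[OF that]] window(3)[OF that] by simp
 obtain u where u: "u\<in>pc" "!!k a. (k, a)\<in>J ?j ==> y (k, a) - outP ?j k a u\<in>I"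
  by (rule mesh_exact[OF PX_pc[OF y(1)] yi yI]) (assumption | rule that)+
 \<comment> \<open>\<open>mesh_exact\<close> gives no control over the paths in \<open>u\<close>.
   Its part at time \<open>t\<close> does as well, as \<open>outP\<close> commutes with cutting and
   \<open>I\<close> is stable under it.\<close>
 define u' where "u' = cut (PQ t) u"
 have u': "u'\<in>PX t" unfolding u'_def by (rule cut_PX[OF u(1)])
 have "w (k, a) = fsc (om ?j k) (Al k ?j ((E ?j ^^ (cc C ?j k - 1 - a)) (proj u')))" if ka: "(k, a)\<in>J ?j" for k a
 proof -
  note wd = window[OF ka]
  have cI: "cut (PQ (tm k)) z\<in>I" if "z\<in>I" for z
  using I_cut[OF homog_dw that, of "%k' s w. k' = vt (tm k) & s = i0 & w + 1 = int (tm k div n)"] by (simp add: PQ_def)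
  have "cut (PQ (tm k)) (y (k, a) - outP ?j k a u) = y (k, a) - outP ?j k a u'"
  unfolding fl_minus[OF fl_cut] outP_cut[OF wd(1-4) u(1)] u'_def
  using y(1)[OF ka] by (simp only: PX_def mem_Collect_eq)
  hence "y (k, a) - outP ?j k a u'\<in>I" using cI[OF u(2)[OF ka]] by simp
  hence "w (k, a) = proj (outP ?j k a u')" using y(2)[OF ka] proj_eqI by metis
  thus ?thesis by (simp only: AlE_proj[OF wd(5)] outP_def fl_of_scale[OF proj_lin])
 qed
 thus ?thesis using u' by (intro bexI[of _ "proj u'"]) (auto simp: J_iff X_def)
qed

lemma pr_X: assumes "x\<in>X t" shows "pr u x\<in>X t"
proof -
 obtain y where "y\<in>PX t" "x = proj y" using assms by (auto simp: X_def)
 thus ?thesis using PX_cut by (auto simp: X_def pr_proj)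
qed

lemma pr_idem: assumes "x\<in>X t" shows "pr u (pr u x) = pr u x"
proof -
 obtain y where "x = proj y" using assms by (auto simp: X_def)
 thus ?thesis by (simp only: pr_proj cut_cut conj_absorb)
qed

lemma pr_E: assumes "x\<in>X t" shows "pr u (E (vt t) x) = E (vt t) (pr (u - 2 * d (vt t)) x)"
proof -
 obtain y where "y\<in>PX t" "x = proj y" using assms by (auto simp: X_def)
 thus ?thesis using pr_eps_pcar[OF PX_pc] by (simp only: pr_proj E_proj)
qed

lemma pr_Al: assumes "adj C (vt t) (vt s)" "x\<in>X s"
 shows "pr u (Al (vt t) (vt s) x) = Al (vt t) (vt s) (pr (u + max (d (vt t)) (d (vt s))) x)"
proof -
 obtain y where "y\<in>PX s" "x = proj y" using assms by (auto simp: X_def)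
 thus ?thesis using pr_alpha_pcar[OF PX_pc] by (simp only: pr_proj Al_proj[OF assms(1)])
qed

lemma pr_low: "\<exists>L. \<forall>u<L. \<forall>x\<in>X t. pr u x = 0"
proof -
 obtain M where MM: "M = Max (range d)" by blast
 have M: "0 < M" unfolding MM using d_pos Max_ge[of "range d" "d undefined"] by (meson finite finite_imageI less_le_trans rangeI)
 \<comment> \<open>At time \<open>t\<close> a path has at most \<open>t\<close> arrows \<alpha>,
   each lowering the degree by at most \<open>M\<close>.\<close>
 have "pr u x = 0" if u: "u < - (M * int t)" and x: "x\<in>X t" for u x
proof -
 obtain y where y: "y\<in>PX t" "x = proj y" using x by (auto simp: X_def)
 have "cut (%(k, p). wt (arrow_deg d) (k, p) = u) y\<in>{0}"
 proof (rule PX_linear_mem[OF fl_cut fs.subspace_single_0 y(1)])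
  fix k p assume p: "is_path C k p" "PQ t (k, p)"
  have "wt is_alpha (k, p) <= int t" using PQ_time[OF p] by simp
  hence "M * wt is_alpha (k, p) <= M * int t" using M by (intro mult_left_mono) auto
  moreover have "wt (arrow_deg d) (k, p) >= - (M * wt is_alpha (k, p))"
  using degree_bound[of k p] unfolding MM mult_minus_left .
  ultimately have "wt (arrow_deg d) (k, p) ~= u" using u by linarith
  thus "cut (%(k, p). wt (arrow_deg d) (k, p) = u) (bas (k, p))\<in>{0}"
  by (simp only: cut_basis prod.case if_False singletonI)
 qed
 hence "cut (%(k, p). wt (arrow_deg d) (k, p) = u) y = 0" by blast
 thus "pr u x = 0" by (simp only: y(2) pr_proj fl_0[OF proj_lin])
qed
 thus ?thesis by blast
qed

lemma sum_cut:
 assumes f: "finite {x. f x ~= 0}" and S: "finite S" "!!x. f x ~= 0 ==> g x\<in>S"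
 shows "f = (\<Sum>s\<in>S. cut (%x. g x = s) f)"
proof
 fix x
 have "(\<Sum>s\<in>S. cut (%x. g x = s) f x) = (\<Sum>s\<in>S. if s = g x then f x else 0)"
  by (intro sum.cong refl) (auto simp: cut_def)
 also have "\<dots> = f x" using S by auto
 finally show "f x = (\<Sum>s\<in>S. cut (%x. g x = s) f) x" by (simp add: sum_apply)
qed

lemma pr_zero: assumes "x\<in>X t" "!!u. pr u x = 0" shows "x = 0"
proof -
 obtain y where y: "y\<in>PX t" "x = proj y" using assms by (auto simp: X_def)
 have fin: "finite {x. y x ~= 0}" using PX_pc[OF y(1)] by (simp add: pcar_def)
 have "y = (\<Sum>s\<in>wt (arrow_deg d) ` {x. y x ~= 0}. cut (%x. wt (arrow_deg d) x = s) y)"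
  using fin by (intro sum_cut) auto
 also have "\<dots>\<in>I"
 proof (rule fs.subspace_sum[OF I_sub])
  fix s
  have "proj (cut (%(k, p). wt (arrow_deg d) (k, p) = s) y) = 0" using assms(2)[of s] by (simp only: y(2) pr_proj)
  hence "cut (%(k, p). wt (arrow_deg d) (k, p) = s) y\<in>I" using proj_zero_iff by blast
  thus "cut (%x. wt (arrow_deg d) x = s) y\<in>I" by (simp only: case_prod_unfold prod.collapse)
 qed
 finally show ?thesis using y(2) proj_zero_iff by blast
qed

lemma hom_start: "\<exists>u. pr u (proj (idem i0)) = proj (idem i0) & (\<forall>u'. u' ~= u --> pr u' (proj (idem i0)) = 0)"
 by (intro exI[of _ 0]) (auto simp: pr_proj cut_basis fl_0[OF proj_lin])

lemma is_knitting: "knitting fsc C d Rt pos X E Al om pr i0 (proj (idem i0)) vt n"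
 apply (rule knitting.intro[OF vspace_fscale knitting_axioms.intro])
 apply (rule n)
 apply (rule roots)
 apply (rule pos)
 apply (rule vt_def)
 apply (rule d_pos)
 apply (rule d_sym)
 apply (erule om_nonzero)
 apply (rule E_linear)
 apply (rule Al_linear)
 apply (rule pr_linear)
 apply (rule X_subspace)
 apply (erule X_E)
 apply (erule (3) X_Al)
 apply (erule (1) X_rel)
 apply (erule X_early)
 apply (rule X_start)
 apply (rule hom_start)
 apply (rule X_gen, assumption, assumption, assumption)
 apply (erule X_mesh)
 apply (rule X_exact, assumption, assumption, assumption)
 apply (erule pr_X)
 apply (erule pr_idem)
 apply (erule pr_E)
 apply (erule (1) pr_Al)
 apply (rule pr_low)
 apply (erule pr_zero, blast)
 done

lemma vanishing: "\<exists>T. \<forall>s\<ge>T. X s = {0}" and torsion_free: "x\<in>X s ==> E (vt s) x = 0 ==> x = 0"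
proof -
 interpret knitting fsc C d Rt pos X E Al om pr i0 "proj (idem i0)" vt n by (rule is_knitting)
 obtain T where T: "!!s. s >= T ==> X s = {0}" "!!s x. x\<in>X s ==> E (vt s) x = 0 ==> x = 0"
  by (rule main) blast
 show "\<exists>T. \<forall>s\<ge>T. X s = {0}" using T(1) by blast
 show "x\<in>X s ==> E (vt s) x = 0 ==> x = 0" by (rule T(2))
qed

lemma PX_of_path:
 assumes p: "is_path C k p" "psrc k p = i0"
 shows "bas (k, p)\<in>PX (n * (nat (wt dw (k, p)) + 1) + pos k)"
proof (rule PX_basis[OF p(1)])
 let ?t = "n * (nat (wt dw (k, p)) + 1) + pos k"
 have "?t mod n = pos k" using pos_less[of k] by (simp only: mod_mult_self4 mod_less)
 hence "vt ?t = k" by (rule vt_eqI)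
 moreover have "?t div n = nat (wt dw (k, p)) + 1"
  using pos_less[of k] n_pos by (metis add.right_neutral div_less div_mult_self4 less_numeral_extra(3))
 ultimately show "PQ ?t (k, p)" using p(2) weight_nonneg(1)[of k p] by (simp only: PQ_def prod.case) simp
qed

end

section \<open>Torsion-freeness and nilpotency of the algebra\<close>

context gpp
begin

lemma exists_pos: obtains pos :: "'i => nat" where "bij_betw pos UNIV {..<card (UNIV :: 'i set)}"
 using ex_bij_betw_finite_nat[of "UNIV :: 'i set"] by (auto simp: atLeast0LessThan)

text \<open>Torsion-freeness and nilpotency are the two properties of the algebra on which the
 computation of the extension groups rests.\<close>

lemma eps_torsion_free:
 assumes f: "f\<in>pc" "pmul (idem j) f = f" and ef: "pmul (bas (j, [Eps j])) f\<in>I"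
 shows "f\<in>I"
proof -
 obtain pos :: "'i => nat" where pos: "bij_betw pos UNIV {..<card (UNIV :: 'i set)}" by (rule exists_pos)
 \<comment> \<open>Each source \<open>i0\<close> has its own knitting; with \<open>n\<close>
   vertices, the component of \<open>f\<close> with source \<open>i0\<close> and weight
   \<open>w\<close> lies in its piece at time \<open>n (w + 1) + pos j\<close>.\<close>
 have cutI: "cut (%(k, p). k = j & psrc k p = i0 & wt (knit_gpp.dw pos) (k, p) = w) f\<in>I" for i0 w
 proof -
  interpret knit_gpp C d \<omega> Rt I pos i0 "card (UNIV :: 'i set)" by unfold_locales (simp_all add: pos)
  let ?t = "card (UNIV :: 'i set) * (nat w + 1) + pos j"
  let ?P = "%(k, p). k = j & psrc k p = i0 & wt dw (k, p) = w"
  show ?thesis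
  proof (cases "w >= 0")
  case True
  have 1: "vt ?t = j" using pos_less[of j] by (intro vt_eqI) (simp only: mod_mult_self4 mod_less)
  have 2: "?t div card (UNIV :: 'i set) = nat w + 1"
  using pos_less[of j] n_pos by (subst div_mult_self4) simp_all
  have PQ: "PQ ?t = ?P" unfolding PQ_def 1 2 using True by (auto simp: fun_eq_iff)
  let ?y = "cut ?P f"
  have y: "?y\<in>PX ?t" unfolding PQ[symmetric] by (rule cut_PX[OF f(1)])
  have "pmul (bas (j, [Eps j])) ?y = cut ?P (pmul (bas (j, [Eps j])) f)"
  by (rule pcar_eqI[OF fl_comp[OF fl_cut fl_mulL] fl_comp[OF fl_mulL fl_cut] f(1)])
  (auto simp: cut_basis pm_basis dw_def fl_0[OF fl_cut])
  also have "\<dots>\<in>I" by (rule I_cut[OF homog_dw ef])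
  finally have "E (vt ?t) (proj ?y) = 0" by (simp only: 1 E_proj proj_zero_iff)
  moreover have "proj ?y\<in>X ?t" unfolding X_def by (rule imageI[OF y])
  ultimately have "proj ?y = 0" using torsion_free by blast
  thus ?thesis using proj_zero_iff by blast
  next
  case False
  hence "\<not> ?P x" for x using weight_nonneg(1)[of j "snd x"] by (cases x) auto
  hence "cut ?P f = 0" by (simp add: cut_def fun_eq_iff)
  thus ?thesis using I_0 by simp
  qed
 qed
 let ?g = "%x. (psrc (fst x) (snd x), wt (knit_gpp.dw pos) x)"
 have fin: "finite {x. f x ~= 0}" using f(1) by (simp add: pcar_def)
 have tgt: "k = j" if "f (k, p) ~= 0" for k p
 proof (rule ccontr)
  assume "k ~= j"
  hence "pmul (idem j) f (k, p) = 0" by (auto simp: path_mult_def path_basis_def intro!: sum.neutral)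
  thus False using that f(2) by simp
 qed
 interpret k0: knit_gpp C d \<omega> Rt I pos j "card (UNIV :: 'i set)" by unfold_locales (simp_all add: pos)
 have "f = (\<Sum>s\<in>?g ` {x. f x ~= 0}. cut (%x. ?g x = s) f)"
  using fin by (intro k0.sum_cut) auto
 also have "\<dots>\<in>I"
 proof (rule fs.subspace_sum[OF I_sub])
  fix s
  have "cut (%x. ?g x = s) f = cut (%(k, p). k = j & psrc k p = fst s & wt (knit_gpp.dw pos) (k, p) = snd s) f"
  using tgt by (cases s) (auto simp: cut_def fun_eq_iff)
  thus "cut (%x. ?g x = s) f\<in>I" using cutI by simp
 qed
 finally show ?thesis .
qed

text \<open>A path with at least \<open>T\<close> arrows \<alpha> belongs to a time of at least
  \<open>T\<close> by \<open>PQ_time\<close>, where the pieces vanish. The maximum over the finitely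
  many sources makes the bound uniform.\<close>

lemma alpha_nilpotent:
 obtains M where "!!k p. is_path C k p ==> wt is_alpha (k, p) >= M ==> bas (k, p)\<in>I"
proof -
 obtain pos :: "'i => nat" where pos: "bij_betw pos UNIV {..<card (UNIV :: 'i set)}" by (rule exists_pos)
 have "\<exists>T. \<forall>k p. is_path C k p --> psrc k p = i0 --> wt is_alpha (k, p) >= int T --> bas (k, p)\<in>I" for i0
 proof -
  interpret knit_gpp C d \<omega> Rt I pos i0 "card (UNIV :: 'i set)" by unfold_locales (simp_all add: pos)
  obtain T where T: "!!s. s >= T ==> X s = {0}" using vanishing by blast
  have "bas (k, p)\<in>I" if p: "is_path C k p" "psrc k p = i0" and w: "wt is_alpha (k, p) >= int T" for k p
  proof -
  let ?t = "card (UNIV :: 'i set) * (nat (wt dw (k, p)) + 1) + pos k"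
  have b: "bas (k, p)\<in>PX ?t" by (rule PX_of_path[OF p])
  have "PQ ?t (k, p)"
  proof (rule ccontr)
  assume "\<not> ?thesis"
  hence "cut (PQ ?t) (bas (k, p)) (k, p) = (0 :: 'k)" by (simp add: cut_def)
  moreover have "cut (PQ ?t) (bas (k, p)) = (bas (k, p) :: ('i, 'k) pelem)" using b by (simp add: PX_def)
  ultimately show False by (simp add: path_basis_def)
  qed
  from PQ_time[OF p(1) this] have "T <= ?t" using w by linarith
  hence "X ?t = {0}" by (rule T)
  hence "proj (bas (k, p)) = 0" using b unfolding X_def by blast
  thus ?thesis using proj_zero_iff by blast
  qed
  thus ?thesis by blast
 qed
 then obtain T where T: "!!i0 k p. is_path C k p ==> psrc k p = i0 ==> wt is_alpha (k, p) >= int (T i0) ==> bas (k, p)\<in>I"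
  by metis
 have "bas (k, p)\<in>I" if "is_path C k p" "wt is_alpha (k, p) >= int (Max (range T))" for k p
 proof (rule T[OF that(1) refl])
  have "T (psrc k p) <= Max (range T)" by simp
  thus "int (T (psrc k p)) <= wt is_alpha (k, p)" using that(2) by linarith
 qed
 thus ?thesis using that by blast
qed

end

section \<open>Extensions of graded modules\<close>

abbreviation kspace :: "('k::field, 'v, 'z) module_scheme => bool" where
 "kspace V \<equiv> module ground V"

lemma ground_simps [simp]:
 "carrier ground = UNIV" "a \<otimes>\<^bsub>ground\<^esub> b = a * b" "\<one>\<^bsub>ground\<^esub> = 1" "\<zero>\<^bsub>ground\<^esub> = 0" "a \<oplus>\<^bsub>ground\<^esub> b = a + b"
 "a \<odot>\<^bsub>ground\<^esub> b = a * b"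
 by (simp_all add: ground_def)

lemma ground_cring: "cring (ground :: ('k::field, 'k) module)"
proof (rule cringI)
 show "abelian_group (ground :: ('k, 'k) module)"
 proof (rule abelian_groupI)
  fix x :: 'k
  have "- x + x = 0" by simp
  thus "\<exists>y\<in>carrier ground. y \<oplus>\<^bsub>ground\<^esub> x = \<zero>\<^bsub>ground\<^esub>" unfolding ground_simps by blast
 qed (simp_all add: algebra_simps)
 show "Group.comm_monoid (ground :: ('k, 'k) module)"
  by (rule comm_monoidI) (simp_all add: algebra_simps)
qed (simp_all add: algebra_simps)

lemma kspaceI:
 fixes V :: "('k::field, 'v, 'z) module_scheme" (structure)
 assumes closed: "\<zero>\<in>carrier V" "!!x y. x\<in>carrier V ==> y\<in>carrier V ==> x\<oplus>y\<in>carrier V"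
  "!!c x. x\<in>carrier V ==> c \<odot> x\<in>carrier V"
  and grp: "!!x y z. x\<in>carrier V ==> y\<in>carrier V ==> z\<in>carrier V ==> (x\<oplus>y)\<oplus>z = x\<oplus>(y\<oplus>z)"
  "!!x y. x\<in>carrier V ==> y\<in>carrier V ==> x\<oplus>y = y\<oplus>x"
  "!!x. x\<in>carrier V ==> \<zero>\<oplus>x = x"
  and smult: "!!a b x. x\<in>carrier V ==> (a + b) \<odot> x = a \<odot> x\<oplus>b \<odot> x"
  "!!a x y. x\<in>carrier V ==> y\<in>carrier V ==> a \<odot> (x\<oplus>y) = a \<odot> x\<oplus>a \<odot> y"
  "!!a b x. x\<in>carrier V ==> (a * b) \<odot> x = a \<odot> (b \<odot> x)"
  "!!x. x\<in>carrier V ==> 1 \<odot> x = x"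
  "!!x. x\<in>carrier V ==> 0 \<odot> x = \<zero>"
 shows "kspace V"
proof (rule moduleI)
 show "abelian_group V"
 proof (rule abelian_groupI)
  fix x assume x: "x\<in>carrier V"
  have "(- 1) \<odot> x\<oplus>x = \<zero>"
  using smult(1)[OF x, of "- 1" 1] smult(4,5)[OF x] by simp
  thus "\<exists>y\<in>carrier V. y\<oplus>x = \<zero>" using closed(3)[OF x] by blast
 qed (fact closed grp)+
qed (simp_all add: ground_cring closed smult)

lemma kspace_ground: "kspace (ground :: ('k::field, 'k) module)"
 by (rule kspaceI) (simp_all add: algebra_simps)

lemma kspaceD:
 fixes V :: "('k::field, 'v, 'z) module_scheme" (structure)
 assumes "kspace V"
 shows "\<zero>\<in>carrier V"
  and "x\<in>carrier V ==> y\<in>carrier V ==> x\<oplus>y\<in>carrier V"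
  and "x\<in>carrier V ==> c \<odot> x\<in>carrier V"
  and "x\<in>carrier V ==> (a + b) \<odot> x = a \<odot> x\<oplus>b \<odot> x"
  and "x\<in>carrier V ==> y\<in>carrier V ==> c \<odot> (x\<oplus>y) = c \<odot> x\<oplus>c \<odot> y"
  and "x\<in>carrier V ==> (a * b) \<odot> x = a \<odot> (b \<odot> x)"
  and "x\<in>carrier V ==> 1 \<odot> x = x"
  and "x\<in>carrier V ==> 0 \<odot> x = \<zero>"
  and "c \<odot> \<zero> = \<zero>"
  and "x\<in>carrier V ==> \<ominus> x = (- 1) \<odot> x"
proof -
 interpret V: module ground V by fact
 show "\<zero>\<in>carrier V" "x\<in>carrier V ==> y\<in>carrier V ==> x\<oplus>y\<in>carrier V"
  "x\<in>carrier V ==> c \<odot> x\<in>carrier V" by simp_all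
 show l: "x\<in>carrier V ==> (a + b) \<odot> x = a \<odot> x\<oplus>b \<odot> x" for a b
  using V.smult_l_distr[of a b x] by simp
 show "x\<in>carrier V ==> y\<in>carrier V ==> c \<odot> (x\<oplus>y) = c \<odot> x\<oplus>c \<odot> y"
  using V.smult_r_distr[of c x y] by simp
 show "x\<in>carrier V ==> (a * b) \<odot> x = a \<odot> (b \<odot> x)"
  using V.smult_assoc1[of a b x] by simp
 show o: "x\<in>carrier V ==> 1 \<odot> x = x" using V.smult_one[of x] by simp
 show z: "x\<in>carrier V ==> 0 \<odot> x = \<zero>" using V.smult_l_null[of x] by simp
 show "c \<odot> \<zero> = \<zero>" by simp
 assume x: "x\<in>carrier V"
 have "(- 1) \<odot> x\<oplus>x = \<zero>" using l[OF x, of "- 1" 1] o[OF x] z[OF x] by simp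
 thus "\<ominus> x = (- 1) \<odot> x" using V.minus_equality x by simp
qed

lemma lin_mapsI:
 assumes "!!x. x\<in>carrier V ==> f x\<in>carrier W" "f\<in>extensional (carrier V)"
  "!!x y. x\<in>carrier V ==> y\<in>carrier V ==> f (x \<oplus>\<^bsub>V\<^esub> y) = f x \<oplus>\<^bsub>W\<^esub> f y"
  "!!c x. x\<in>carrier V ==> f (c \<odot>\<^bsub>V\<^esub> x) = c \<odot>\<^bsub>W\<^esub> f x"
 shows "f\<in>lin_maps V W"
 using assms by (auto simp: lin_maps_def PiE_def)

lemma lm_restrict:
 assumes "kspace V" "!!x. x\<in>carrier V ==> f x\<in>carrier W"
  "!!x y. x\<in>carrier V ==> y\<in>carrier V ==> f (x \<oplus>\<^bsub>V\<^esub> y) = f x \<oplus>\<^bsub>W\<^esub> f y"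
  "!!c x. x\<in>carrier V ==> f (c \<odot>\<^bsub>V\<^esub> x) = c \<odot>\<^bsub>W\<^esub> f x"
 shows "restrict f (carrier V)\<in>lin_maps V W"
proof -
 interpret module ground V by fact
 show ?thesis by (rule lin_mapsI) (simp_all add: assms(2-))
qed

lemma lm_simps:
 assumes "f\<in>lin_maps V W"
 shows "x\<in>carrier V ==> f x\<in>carrier W"
  and "x\<in>carrier V ==> y\<in>carrier V ==> f (x \<oplus>\<^bsub>V\<^esub> y) = f x \<oplus>\<^bsub>W\<^esub> f y"
  and "x\<in>carrier V ==> f (c \<odot>\<^bsub>V\<^esub> x) = c \<odot>\<^bsub>W\<^esub> f x"
  and "f\<in>extensional (carrier V)"
 using assms by (auto simp: lin_maps_def PiE_def)

lemma lin_maps_ext: "f\<in>lin_maps V W ==> g\<in>lin_maps V W ==> (!!x. x\<in>carrier V ==> f x = g x) ==> f = g"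
 using extensionalityI lm_simps(4) by blast

lemma lin_maps_zero:
 assumes "kspace V" "kspace W" "f\<in>lin_maps V W" shows "f \<zero>\<^bsub>V\<^esub> = \<zero>\<^bsub>W\<^esub>"
proof -
 show ?thesis using lm_simps(1,3)[OF assms(3) kspaceD(1)[OF assms(1)]] kspaceD(8)[OF assms(1), of "\<zero>\<^bsub>V\<^esub>"]
  kspaceD(8)[OF assms(2)] kspaceD(1)[OF assms(1)] by metis
qed

lemma hom_simps [simp]:
 "carrier (hom_space V W) = lin_maps V W" "\<zero>\<^bsub>hom_space V W\<^esub> = (\<lambda>x\<in>carrier V. \<zero>\<^bsub>W\<^esub>)"
 "f \<oplus>\<^bsub>hom_space V W\<^esub> g = (\<lambda>x\<in>carrier V. f x \<oplus>\<^bsub>W\<^esub> g x)" "c \<odot>\<^bsub>hom_space V W\<^esub> f = (\<lambda>x\<in>carrier V. c \<odot>\<^bsub>W\<^esub> f x)"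
 by (simp_all add: hom_space_def)

lemma kspace_hom_space:
 assumes V: "kspace V" and W: "kspace W"
 shows "kspace (hom_space V W)"
proof -
 interpret V: module ground V by fact
 interpret W: module ground W by fact
 note l = lm_simps
 show ?thesis
 proof (rule kspaceI)
  show "\<zero>\<^bsub>hom_space V W\<^esub>\<in>carrier (hom_space V W)"
  unfolding hom_simps by (rule lm_restrict[OF V]) (simp_all add: kspaceD[OF W])
  show "f \<oplus>\<^bsub>hom_space V W\<^esub> g\<in>carrier (hom_space V W)"
  if "f\<in>carrier (hom_space V W)" "g\<in>carrier (hom_space V W)" for f g
  unfolding hom_simps by (rule lm_restrict[OF V])
  (use that in \<open>simp_all add: l[of f] l[of g] kspaceD(5)[OF W] W.a_ac\<close>)
  show "c \<odot>\<^bsub>hom_space V W\<^esub> f\<in>carrier (hom_space V W)" if "f\<in>carrier (hom_space V W)" for c f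
  unfolding hom_simps by (rule lm_restrict[OF V])
  (use that in \<open>simp_all add: l[of f] kspaceD(3,5)[OF W] kspaceD(6)[OF W, symmetric] mult.commute\<close>)
  show "\<zero>\<^bsub>hom_space V W\<^esub> \<oplus>\<^bsub>hom_space V W\<^esub> f = f" if "f\<in>carrier (hom_space V W)" for f
  by (rule ext) (use that in \<open>simp add: restrict_def l(1)[of f] extensional_arb[OF l(4)[of f]]\<close>)
  show "1 \<odot>\<^bsub>hom_space V W\<^esub> f = f" if "f\<in>carrier (hom_space V W)" for f
  by (rule ext) (use that in \<open>simp add: restrict_def l(1)[of f] extensional_arb[OF l(4)[of f]] kspaceD(7)[OF W]\<close>)
 qed (simp_all add: l(1) W.a_ac kspaceD(4-8)[OF W] cong: restrict_cong)
qed

definition lin_iso :: "('k, 'v) module => ('k, 'w) module => bool" where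
 "lin_iso V W \<longleftrightarrow> (\<exists>f\<in>lin_maps V W. bij_betw f (carrier V) (carrier W))"

lemma lin_iso_trans:
 assumes V: "kspace V" and f: "lin_iso V U" and g: "lin_iso U W"
 shows "lin_iso V W"
proof -
 obtain f g where f: "f\<in>lin_maps V U" "bij_betw f (carrier V) (carrier U)"
  and g: "g\<in>lin_maps U W" "bij_betw g (carrier U) (carrier W)"
  using f g by (auto simp: lin_iso_def)
 have "restrict (g \<circ> f) (carrier V)\<in>lin_maps V W"
  by (rule lm_restrict[OF V]) (simp_all add: lm_simps[OF f(1)] lm_simps[OF g(1)])
 moreover have "bij_betw (restrict (g \<circ> f) (carrier V)) (carrier V) (carrier W)"
  using bij_betw_trans[OF f(2) g(2)] by simp
 ultimately show ?thesis unfolding lin_iso_def by blast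
qed

lemma lin_iso_sym:
 assumes V: "kspace V" and f: "lin_iso V W" shows "lin_iso W V"
proof -
 obtain f where f: "f\<in>lin_maps V W" "bij_betw f (carrier V) (carrier W)" using f by (auto simp: lin_iso_def)
 note l = lm_simps[OF f(1)] and VD = kspaceD[OF V]
 define g where "g = restrict (the_inv_into (carrier V) f) (carrier W)"
 have g: "g (f x) = x" if "x\<in>carrier V" for x
  using f(2) that l(1) by (simp add: g_def bij_betw_def the_inv_into_f_f)
 have W: "\<exists>x\<in>carrier V. y = f x" if "y\<in>carrier W" for y using f(2) that by (auto simp: bij_betw_def)
 have "g\<in>lin_maps W V"
 proof (rule lin_mapsI)
  show "g\<in>extensional (carrier W)" by (simp add: g_def)
  fix y assume "y\<in>carrier W"
  then obtain x where x: "x\<in>carrier V" "y = f x" using W by blast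
  show "g y\<in>carrier V" "g (c \<odot>\<^bsub>W\<^esub> y) = c \<odot>\<^bsub>V\<^esub> g y" for c
  using x g VD(3) l(3)[OF x(1), symmetric] by simp_all
  fix y' assume "y'\<in>carrier W"
  then obtain x' where x': "x'\<in>carrier V" "y' = f x'" using W by blast
  show "g (y \<oplus>\<^bsub>W\<^esub> y') = g y \<oplus>\<^bsub>V\<^esub> g y'" using x x' g VD(2) l(2)[OF x(1) x'(1), symmetric] by simp
 qed
 moreover have "bij_betw g (carrier W) (carrier V)"
  by (rule bij_betw_byWitness[of _ f]) (use g W l(1) in force)+
 ultimately show ?thesis unfolding lin_iso_def by blast
qed

definition ksub :: "('k, 'v, 'z) module_scheme => 'v set => bool" where
 "ksub V W \<longleftrightarrow> W \<subseteq> carrier V & \<zero>\<^bsub>V\<^esub>\<in>W & (\<forall>x\<in>W. \<forall>y\<in>W. x \<oplus>\<^bsub>V\<^esub> y\<in>W) & (\<forall>c. \<forall>x\<in>W. c \<odot>\<^bsub>V\<^esub> x\<in>W)"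

lemma kspace_ksub:
 fixes V :: "('k::field, 'v) module"
 assumes V: "kspace V" and W: "ksub V W"
 shows "kspace (V\<lparr>carrier := W\<rparr>)"
proof -
 interpret V: module ground V by fact
 have "!!x. x\<in>W ==> x\<in>carrier V" using W by (auto simp: ksub_def)
 thus ?thesis using W
  by (intro kspaceI) (auto simp: ksub_def V.a_ac kspaceD(4-)[OF V])
qed

lemma ksub_carrier: "kspace V ==> ksub V (carrier V)"
 by (simp add: ksub_def kspaceD)

lemma ksub_set_add:
 fixes V (structure)
 assumes V: "kspace V" and S: "ksub V S" and T: "ksub V T" shows "ksub V (S <+>\<^bsub>V\<^esub> T)"
proof -
 interpret V: module ground V by fact
 have mem: "x\<in>S <+>\<^bsub>V\<^esub> T \<longleftrightarrow> (\<exists>y\<in>S. \<exists>z\<in>T. x = y\<oplus>z)" for x unfolding set_add_def' by blast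
 note D = S[unfolded ksub_def] T[unfolded ksub_def]
 have c: "x\<in>S ==> x\<in>carrier V" "x\<in>T ==> x\<in>carrier V" for x using D by auto
 show ?thesis unfolding ksub_def
 proof (intro conjI ballI allI)
  show "\<zero>\<in>S <+>\<^bsub>V\<^esub> T" unfolding mem using D by (intro bexI[of _ "\<zero>"]) auto
  fix x assume "x\<in>S <+>\<^bsub>V\<^esub> T"
  then obtain y z where x: "y\<in>S" "z\<in>T" "x = y\<oplus>z" unfolding mem by blast
  show "k \<odot> x\<in>S <+>\<^bsub>V\<^esub> T" for k unfolding mem x(3) kspaceD(5)[OF V c(1)[OF x(1)] c(2)[OF x(2)]] using D x by blast
  fix x' assume "x'\<in>S <+>\<^bsub>V\<^esub> T"
  then obtain y' z' where x': "y'\<in>S" "z'\<in>T" "x' = y'\<oplus>z'" unfolding mem by blast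
  have "x\<oplus>x' = (y\<oplus>y')\<oplus>(z\<oplus>z')" using x x' c by (simp add: V.a_ac)
  thus "x\<oplus>x'\<in>S <+>\<^bsub>V\<^esub> T" unfolding mem using D x x' by blast
 qed (use c mem in auto)
qed

locale kquot = V: module ground V for V :: "('k::field, 'v, 'z) module_scheme" (structure) +
 fixes W :: "'v set"
 assumes W: "ksub V W"
begin

lemma W_carrier: "w\<in>W ==> w\<in>carrier V" and W_zero: "\<zero>\<in>W"
 and W_add: "x\<in>W ==> y\<in>W ==> x\<oplus>y\<in>W" and W_smult: "x\<in>W ==> c \<odot>\<^bsub>V\<^esub> x\<in>W"
 using W by (auto simp: ksub_def)

lemmas kD = kspaceD[OF V.module_axioms]

sublocale S: abelian_subgroup W V
proof (rule abelian_subgroupI3)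
 show "additive_subgroup W V"
 proof (rule additive_subgroup.intro, unfold_locales)
  show "W \<subseteq> carrier (add_monoid V)" using W_carrier by auto
  show "inv\<^bsub>add_monoid V\<^esub> x\<in>W" if "x\<in>W" for x
  using kD(10)[OF W_carrier[OF that]] W_smult[OF that] by (simp add: a_inv_def)
 qed (use W_zero W_add in simp_all)
qed (rule V.abelian_group_axioms)

lemma coset_eq_iff: assumes "x\<in>carrier V" "y\<in>carrier V"
 shows "W +>\<^bsub>V\<^esub> x = W +>\<^bsub>V\<^esub> y \<longleftrightarrow> (\<exists>w\<in>W. x = w\<oplus>y)"
proof
 assume "W +>\<^bsub>V\<^esub> x = W +>\<^bsub>V\<^esub> y"
 hence "x\<in>W +>\<^bsub>V\<^esub> y" using S.a_rcos_self assms by blast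
 thus "\<exists>w\<in>W. x = w\<oplus>y" by (auto simp: a_r_coset_def')
next
 assume "\<exists>w\<in>W. x = w\<oplus>y"
 hence "x\<in>W +>\<^bsub>V\<^esub> y" by (auto simp: a_r_coset_def')
 thus "W +>\<^bsub>V\<^esub> x = W +>\<^bsub>V\<^esub> y" using S.a_repr_independence' assms by metis
qed

lemma coset_zero_iff: "x\<in>carrier V ==> W +>\<^bsub>V\<^esub> x = W \<longleftrightarrow> x\<in>W"
 using coset_eq_iff[of x \<zero>] S.a_rcos_const[OF W_zero] by auto

lemma coset_self: "x\<in>carrier V ==> x\<in>W +>\<^bsub>V\<^esub> x"
 by (rule S.a_rcos_self)

lemma coset_memD: "y\<in>W +>\<^bsub>V\<^esub> x ==> \<exists>w\<in>W. y = w\<oplus>x"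
 by (auto simp: a_r_coset_def')

text \<open>Multiplication maps on cosets are written as unions over representatives.\<close>

lemma coset_lift:
 assumes U: "kquot U W'" and x: "x\<in>carrier V" and f: "!!x. x\<in>carrier V ==> f x\<in>carrier U"
  and add: "!!x y. x\<in>carrier V ==> y\<in>carrier V ==> f (x\<oplus>y) = f x \<oplus>\<^bsub>U\<^esub> f y" and W': "f ` W \<subseteq> W'"
 shows "(\<Union>z\<in>W +>\<^bsub>V\<^esub> x. W' +>\<^bsub>U\<^esub> f z) = W' +>\<^bsub>U\<^esub> f x"
proof -
 interpret U: kquot U W' by (rule U)
 have "W' +>\<^bsub>U\<^esub> f z = W' +>\<^bsub>U\<^esub> f x" if "z\<in>W +>\<^bsub>V\<^esub> x" for z
 proof -
  obtain w where w: "w\<in>W" "z = w\<oplus>x" using coset_memD[OF \<open>z\<in>_\<close>] by blast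
  hence "f z = f w \<oplus>\<^bsub>U\<^esub> f x" using add x by simp
  moreover have "f w\<in>W'" using w W' by blast
  ultimately show ?thesis using U.coset_eq_iff f x W_carrier w V.a_closed by metis
 qed
 thus ?thesis using coset_self[OF x] by blast
qed

lemma cs_simps:
 "carrier (coset_space V W S) = (%x. W +>\<^bsub>V\<^esub> x) ` S" "\<zero>\<^bsub>coset_space V W S\<^esub> = W"
 "x\<in>carrier V ==> y\<in>carrier V ==> (W +>\<^bsub>V\<^esub> x) \<oplus>\<^bsub>coset_space V W S\<^esub> (W +>\<^bsub>V\<^esub> y) = W +>\<^bsub>V\<^esub> (x\<oplus>y)"
 "x\<in>carrier V ==> c \<odot>\<^bsub>coset_space V W S\<^esub> (W +>\<^bsub>V\<^esub> x) = W +>\<^bsub>V\<^esub> (c \<odot>\<^bsub>V\<^esub> x)"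
proof -
 show "(W +>\<^bsub>V\<^esub> x) \<oplus>\<^bsub>coset_space V W S\<^esub> (W +>\<^bsub>V\<^esub> y) = W +>\<^bsub>V\<^esub> (x\<oplus>y)" if "x\<in>carrier V" "y\<in>carrier V"
  using S.a_rcos_sum[OF that] by (simp add: coset_space_def)
 have Q: "kquot V W" by unfold_locales
 show "c \<odot>\<^bsub>coset_space V W S\<^esub> (W +>\<^bsub>V\<^esub> x) = W +>\<^bsub>V\<^esub> (c \<odot>\<^bsub>V\<^esub> x)" if "x\<in>carrier V"
  using coset_lift[OF Q that, of "%x. c \<odot>\<^bsub>V\<^esub> x"] W_smult
  by (auto simp: coset_space_def kD(5))
qed (simp_all add: coset_space_def)

lemma kspace_cs:
 assumes S: "ksub V S" shows "kspace (coset_space V W S)"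
proof -
 have c: "!!x. x\<in>S ==> x\<in>carrier V" "\<zero>\<in>S" "!!x y. x\<in>S ==> y\<in>S ==> x\<oplus>y\<in>S" "!!c x. x\<in>S ==> c \<odot>\<^bsub>V\<^esub> x\<in>S"
  using S by (auto simp: ksub_def)
 have z: "\<zero>\<^bsub>coset_space V W S\<^esub> = W +>\<^bsub>V\<^esub> \<zero>"
  unfolding cs_simps(2) using coset_zero_iff[of "\<zero>"] W_zero by simp
 note s = cs_simps(1,3,4) c
 show ?thesis
 proof (rule kspaceI)
  show "\<zero>\<^bsub>coset_space V W S\<^esub>\<in>carrier (coset_space V W S)" unfolding z s(1) using c(2) by blast
  show "0 \<odot>\<^bsub>coset_space V W S\<^esub> x = \<zero>\<^bsub>coset_space V W S\<^esub>" if "x\<in>carrier (coset_space V W S)" for x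
  using that unfolding z by (auto simp: s kD(8))
  show "\<zero>\<^bsub>coset_space V W S\<^esub> \<oplus>\<^bsub>coset_space V W S\<^esub> x = x" if "x\<in>carrier (coset_space V W S)" for x
  using that unfolding z by (auto simp: s)
 qed (auto simp: s V.a_ac kD(4-7))
qed

text \<open>The isomorphism theorem for the image of \<open>S\<close> in the quotient by
  \<open>W\<close>. As \<open>W\<close> may reach outside \<open>S\<close>, the kernel of
  \<open>T\<close> is compared with it on \<open>S\<close> only.\<close>

lemma coset_iso:
 assumes S: "ksub V S" and U: "kspace U"
  and T: "!!x. x\<in>S ==> T x\<in>carrier U" "!!x y. x\<in>S ==> y\<in>S ==> T (x\<oplus>y) = T x \<oplus>\<^bsub>U\<^esub> T y"
  "!!c x. x\<in>S ==> T (c \<odot>\<^bsub>V\<^esub> x) = c \<odot>\<^bsub>U\<^esub> T x"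
  and surj: "!!y. y\<in>carrier U ==> \<exists>x\<in>S. T x = y"
  and ker: "!!x. x\<in>S ==> T x = \<zero>\<^bsub>U\<^esub> \<longleftrightarrow> x\<in>W"
 shows "lin_iso (coset_space V W S) U"
proof -
 interpret U: module ground U by fact
 let ?Q = "coset_space V W S"
 have c: "!!x. x\<in>S ==> x\<in>carrier V" "\<zero>\<in>S" "!!x y. x\<in>S ==> y\<in>S ==> x\<oplus>y\<in>S" "!!c x. x\<in>S ==> c \<odot>\<^bsub>V\<^esub> x\<in>S"
  using S by (auto simp: ksub_def)
 have eq: "T x = T y \<longleftrightarrow> W +>\<^bsub>V\<^esub> x = W +>\<^bsub>V\<^esub> y" if x: "x\<in>S" and y: "y\<in>S" for x y
 proof -
  let ?w = "x\<oplus>(- 1) \<odot>\<^bsub>V\<^esub> y"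
  have w: "?w\<in>S" using x y c by blast
  have x': "x = ?w\<oplus>y" using x y c(1)
  by (simp add: kD(10)[symmetric] V.a_assoc V.l_neg)
  have "T x = T ?w \<oplus>\<^bsub>U\<^esub> T y" using T(2)[OF w y] x' by metis
  hence "T x = T y \<longleftrightarrow> ?w\<in>W"
  unfolding ker[OF w, symmetric] using T(1)[OF w] T(1)[OF y] by simp
  also have "\<dots> \<longleftrightarrow> W +>\<^bsub>V\<^esub> x = W +>\<^bsub>V\<^esub> y"
  proof
  assume "?w\<in>W"
  thus "W +>\<^bsub>V\<^esub> x = W +>\<^bsub>V\<^esub> y" using coset_eq_iff[OF c(1)[OF x] c(1)[OF y]] x' by blast
  next
  assume "W +>\<^bsub>V\<^esub> x = W +>\<^bsub>V\<^esub> y"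
  then obtain v where v: "v\<in>W" "x = v\<oplus>y" using coset_eq_iff[OF c(1)[OF x] c(1)[OF y]] by blast
  hence "v = ?w" using x' V.add.right_cancel[of y v ?w] W_carrier c(1) w y by metis
  thus "?w\<in>W" using v by simp
  qed
  finally show ?thesis .
 qed
 define f where "f = (%X. T (SOME x. x\<in>S & X = W +>\<^bsub>V\<^esub> x))"
 have f: "f (W +>\<^bsub>V\<^esub> x) = T x" if "x\<in>S" for x
 proof -
  let ?y = "SOME y. y\<in>S & W +>\<^bsub>V\<^esub> x = W +>\<^bsub>V\<^esub> y"
  have "?y\<in>S & W +>\<^bsub>V\<^esub> x = W +>\<^bsub>V\<^esub> ?y" by (rule someI_ex) (use that in blast)
  thus ?thesis using eq that unfolding f_def by metis
 qed
 have "restrict f (carrier ?Q)\<in>lin_maps ?Q U"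
  by (rule lm_restrict[OF kspace_cs[OF S]]) (auto simp: cs_simps f T c)
 moreover have "bij_betw f (carrier ?Q) (carrier U)"
 proof -
  have "T ` S = carrier U" using surj T(1) by blast
  thus ?thesis by (auto simp: bij_betw_def inj_on_def cs_simps(1) image_image f eq cong: image_cong)
 qed
 ultimately show ?thesis unfolding lin_iso_def by (intro bexI[of _ "restrict f (carrier ?Q)"]) simp_all
qed

end

lemma ksub_image:
 assumes V: "kspace V" and P: "ksub V P" and U: "kspace U" and g: "!!x. x\<in>P ==> g x\<in>carrier U"
  "!!x y. x\<in>P ==> y\<in>P ==> g (x \<oplus>\<^bsub>V\<^esub> y) = g x \<oplus>\<^bsub>U\<^esub> g y" "!!c x. x\<in>P ==> g (c \<odot>\<^bsub>V\<^esub> x) = c \<odot>\<^bsub>U\<^esub> g x"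
 shows "ksub U (g ` P)"
proof -
 have P': "\<zero>\<^bsub>V\<^esub>\<in>P" "!!x y. x\<in>P ==> y\<in>P ==> x \<oplus>\<^bsub>V\<^esub> y\<in>P" "!!c x. x\<in>P ==> c \<odot>\<^bsub>V\<^esub> x\<in>P"
  using P by (auto simp: ksub_def)
 have "g \<zero>\<^bsub>V\<^esub> = \<zero>\<^bsub>U\<^esub>" using g(3)[OF P'(1), of 0] kspaceD(8)[OF U g(1)[OF P'(1)]] kspaceD(9)[OF V] by simp
 thus ?thesis unfolding ksub_def using P' g(1) by (auto simp: g(2,3)[symmetric] intro: image_eqI[OF sym])
qed

text \<open>A functional prescribed on the image of \<open>g\<close> and on the subspace \<open>N\<close> extends to \<open>V\<close>. Bases are only
 available for type-based vector spaces, whence the coordinate map \<open>R\<close>.\<close>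

lemma extend_functional:
 fixes V :: "('k::field, 'v, 'z) module_scheme" and V' :: "('k, 'w, 'y) module_scheme" and R :: "'v => 'x => 'k"
 assumes V: "kspace V" and R: "inj_on R (carrier V)"
  "!!x y. x\<in>carrier V ==> y\<in>carrier V ==> R (x \<oplus>\<^bsub>V\<^esub> y) = R x + R y"
  "!!c x. x\<in>carrier V ==> R (c \<odot>\<^bsub>V\<^esub> x) = fsc c (R x)"
  and N: "ksub V N" and V': "kspace V'" and P: "ksub V' P"
  and g: "!!p. p\<in>P ==> g p\<in>carrier V" "!!p p'. p\<in>P ==> p'\<in>P ==> g (p \<oplus>\<^bsub>V'\<^esub> p') = g p \<oplus>\<^bsub>V\<^esub> g p'"
  "!!c p. p\<in>P ==> g (c \<odot>\<^bsub>V'\<^esub> p) = c \<odot>\<^bsub>V\<^esub> g p"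
  and h: "!!p p'. p\<in>P ==> p'\<in>P ==> h (p \<oplus>\<^bsub>V'\<^esub> p') = h p + h p'" "!!c p. p\<in>P ==> h (c \<odot>\<^bsub>V'\<^esub> p) = c * h p"
  and compat: "!!p. p\<in>P ==> g p\<in>N ==> h p = 0"
 obtains f where "!!x y. x\<in>carrier V ==> y\<in>carrier V ==> f (x \<oplus>\<^bsub>V\<^esub> y) = f x + f y"
  "!!c x. x\<in>carrier V ==> f (c \<odot>\<^bsub>V\<^esub> x) = c * f x" "!!p. p\<in>P ==> f (g p) = h p" "!!x. x\<in>N ==> f x = 0"
proof -
 have sub: "module.subspace fsc (Q ` S)"
  if S: "ksub U S" and U: "kspace U" and Q: "!!x y. x\<in>S ==> y\<in>S ==> Q (x \<oplus>\<^bsub>U\<^esub> y) = Q x + Q y"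
  "!!c x. x\<in>S ==> Q (c \<odot>\<^bsub>U\<^esub> x) = fsc c (Q x)" for U :: "('k, 'b, 'c) module_scheme" and S and Q :: "'b => 'x => 'k"
 proof -
  have S': "\<zero>\<^bsub>U\<^esub>\<in>S" "!!x y. x\<in>S ==> y\<in>S ==> x \<oplus>\<^bsub>U\<^esub> y\<in>S" "!!c x. x\<in>S ==> c \<odot>\<^bsub>U\<^esub> x\<in>S"
  using S by (auto simp: ksub_def)
  have "Q \<zero>\<^bsub>U\<^esub> = 0" using Q(2)[OF S'(1), of 0] kspaceD(9)[OF U] by (simp add: fs.scale_zero_left)
  thus ?thesis unfolding fs.subspace_def using S' by (auto simp: Q[symmetric] intro: image_eqI[OF sym])
 qed
 have P': "\<zero>\<^bsub>V'\<^esub>\<in>P" "!!p p'. p\<in>P ==> p'\<in>P ==> p \<oplus>\<^bsub>V'\<^esub> p'\<in>P" "!!c p. p\<in>P ==> c \<odot>\<^bsub>V'\<^esub> p\<in>P"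
  and N': "!!x. x\<in>N ==> x\<in>carrier V" using P N by (auto simp: ksub_def)
 have "module.subspace fsc (R ` N)" by (rule sub[OF N V]) (simp_all add: R(2,3) N')
 \<comment> \<open>\<open>p1\<close> models the quotient by \<open>N\<close>, and \<open>p2\<close>
   then splits off the image of \<open>g\<close> in it.\<close>
 then obtain p1 :: "('x => 'k) => 'x => 'k" where p1: "flinear p1" "!!x. p1 x = 0 \<longleftrightarrow> x\<in>R ` N" by (rule fs.projection_along) blast
 define Q where "Q x = p1 (R x)" for x
 have Q: "y\<in>carrier V ==> Q (x \<oplus>\<^bsub>V\<^esub> y) = Q x + Q y" "Q (c \<odot>\<^bsub>V\<^esub> x) = fsc c (Q x)" if "x\<in>carrier V" for x y c
  using p1(1) R that by (simp_all add: Q_def fl_iff)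
 have Q0: "Q x = 0 \<longleftrightarrow> x\<in>N" if "x\<in>carrier V" for x
  unfolding Q_def p1(2) using R(1) that N' by (auto simp: inj_on_def)
 let ?D = "(%p. Q (g p)) ` P"
 have "module.subspace fsc ?D" by (rule sub[OF P V']) (simp_all add: g Q)
 then obtain p2 :: "('x => 'k) => 'x => 'k" where p2: "flinear p2" "!!x. p2 x = 0 \<longleftrightarrow> x\<in>?D" "!!x. p2 x - x\<in>?D" "module.subspace fsc ?D"
  using fs.projection_along by metis
 have wd: "h p = h p'" if p: "p\<in>P" and p': "p'\<in>P" and "Q (g p) = Q (g p')" for p p'
 proof -
  have q: "p \<oplus>\<^bsub>V'\<^esub> (- 1) \<odot>\<^bsub>V'\<^esub> p'\<in>P" using P' p p' by blast
  have "Q (g (p \<oplus>\<^bsub>V'\<^esub> (- 1) \<odot>\<^bsub>V'\<^esub> p')) = 0"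
  using that Q kspaceD(3)[OF V] by (simp add: g P' )
  hence "h (p \<oplus>\<^bsub>V'\<^esub> (- 1) \<odot>\<^bsub>V'\<^esub> p') = 0" using compat[OF q] Q0[OF g(1)[OF q]] by blast
  thus ?thesis using h P' p p' by simp
 qed
 \<comment> \<open>\<open>Q v - p2 (Q v)\<close> is the component of \<open>v\<close> modulo
   \<open>N\<close> along the image of \<open>g\<close>; by \<open>wd\<close> the choice of a
   preimage does not matter.\<close>
 define f where "f v = h (SOME p. p\<in>P & Q (g p) = Q v - p2 (Q v))" for v
 have ex: "\<exists>p. p\<in>P & Q (g p) = Q v - p2 (Q v)" for v
  using fs.subspace_neg[OF p2(4,3), of "Q v"] by force
 have key: "f v = h p" if "p\<in>P" "Q (g p) = Q v - p2 (Q v)" for v p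
  unfolding f_def using someI_ex[OF ex[of v]] wd that by metis
 show thesis
 proof (rule that[of f])
  show "f (g p) = h p" if "p\<in>P" for p using key[OF that, of "g p"] p2(2) that by auto
  have z: "Q (g \<zero>\<^bsub>V'\<^esub>) = 0" "h \<zero>\<^bsub>V'\<^esub> = 0"
  using g(3)[OF P'(1), of 0] h(2)[OF P'(1), of 0] Q(2)[OF g(1)[OF P'(1)], of 0] kspaceD(9)[OF V']
  by (simp_all add: fs.scale_zero_left)
  show "f x = 0" if "x\<in>N" for x using key[OF P'(1), of x] z Q0[OF N'[OF that]] that fl_0[OF p2(1)] by simp
  fix x assume x: "x\<in>carrier V"
  obtain p where p: "p\<in>P" "Q (g p) = Q x - p2 (Q x)" using ex by blast
  show "f (c \<odot>\<^bsub>V\<^esub> x) = c * f x" for c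
  using key[OF P'(3)[OF p(1)], of c "c \<odot>\<^bsub>V\<^esub> x"] key[OF p]
  by (simp add: p g h Q x fl_of_scale[OF p2(1)] fs.scale_right_diff_distrib)
  fix y assume y: "y\<in>carrier V"
  obtain p' where p': "p'\<in>P" "Q (g p') = Q y - p2 (Q y)" using ex by blast
  have "p2 (Q x + Q y) = p2 (Q x) + p2 (Q y)" using p2(1) fl_iff by blast
  thus "f (x \<oplus>\<^bsub>V\<^esub> y) = f x + f y"
  using key[OF P'(2)[OF p(1) p'(1)], of "x \<oplus>\<^bsub>V\<^esub> y"] key[OF p] key[OF p'] by (simp add: p p' g h Q x y)
 qed
qed

text \<open>A functional vanishing on the common kernel of finitely many functionals is a
  combination of them, by induction through the kernel of one. In \<open>soc_dual_iso\<close> the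
  set \<open>E\<close> consists of evaluations, and this is how finite dimension enters the double
  dual.\<close>

lemma functional_in_span:
 fixes V (structure)
 assumes V: "kspace V" and Z: "ksub V Z" and B: "finite B" "B \<subseteq> E"
  and lin: "!!f x y. f\<in>insert tht E ==> x\<in>Z ==> y\<in>Z ==> f (x\<oplus>y) = f x + (f y :: 'k::field)"
  "!!f c x. f\<in>insert tht E ==> x\<in>Z ==> f (c \<odot> x) = c * f x"
  and E: "(%x. 0)\<in>E" "!!f g c. f\<in>E ==> g\<in>E ==> (%x. f x + c * g x)\<in>E"
  and ker: "!!x. x\<in>Z ==> (!!f. f\<in>B ==> f x = 0) ==> tht x = 0"
 shows "\<exists>f\<in>E. \<forall>x\<in>Z. tht x = f x"
 using B Z lin ker
proof (induction B arbitrary: Z rule: finite_induct)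
 case empty
 thus ?case using E(1) by auto
next
 case (insert g B)
 interpret V: module ground V by fact
 note Z = insert.prems(2) and lin = insert.prems(3,4)
 have ZV: "x\<in>carrier V" if "x\<in>Z" for x using Z that by (auto simp: ksub_def)
 have Z': "x\<oplus>y\<in>Z" "c \<odot> x\<in>Z" if "x\<in>Z" "y\<in>Z" for x y c using Z that by (auto simp: ksub_def)
 have gE: "g\<in>E" using insert.prems(1) by blast
 let ?Z = "{x\<in>Z. g x = 0}"
 have "g \<zero> = 0" using lin(2)[of g "\<zero>" 0] kspaceD(9)[OF V] gE Z by (simp add: ksub_def)
 moreover have "g (x\<oplus>y) = g x + g y" "g (c \<odot> x) = c * g x" if "x\<in>Z" "y\<in>Z" for x y c
  using lin(1)[of g x y] lin(2)[of g x c] gE that by blast+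
 ultimately have sub: "ksub V ?Z" using Z by (auto simp: ksub_def)
 have "\<exists>f\<in>E. \<forall>x\<in>?Z. tht x = f x"
 proof (rule insert.IH[OF _ sub])
  show "B \<subseteq> E" using insert.prems(1) by blast
  show "tht x = 0" if "x\<in>?Z" "!!f. f\<in>B ==> f x = 0" for x
  using insert.prems(5)[of x] that by blast
 qed (use lin in blast)+
 then obtain f where f: "f\<in>E" "!!x. x\<in>Z ==> g x = 0 ==> tht x = f x" by blast
 show ?case
 proof (cases "\<exists>z\<in>Z. g z ~= 0")
  case False
  thus ?thesis using f by blast
 next
  case True
  then obtain z where z: "z\<in>Z" "g z ~= 0" by blast
  \<comment> \<open>The coefficient is fixed by comparing \<open>tht\<close> and \<open>f\<close> at
    one vector outside the kernel of \<open>g\<close>; every \<open>x\<close> differs from a vector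
    in that kernel by a multiple of \<open>z\<close>.\<close>
  let ?c = "(tht z - f z) / g z"
  have "tht x = f x + ?c * g x" if x: "x\<in>Z" for x
  proof -
  let ?a = "- (g x / g z)"
  let ?y = "x\<oplus>?a \<odot> z"
  have y: "h ?y = h x + ?a * h z" if "h\<in>insert tht E" for h
  using lin(1)[OF that x Z'(2)[OF z(1) z(1)]] lin(2)[OF that z(1)] by simp
  have "g ?y = 0" using y[of g] gE z(2) by simp
  hence "tht ?y = f ?y" using f(2) Z'(1)[OF x Z'(2)[OF z(1) z(1)]] by blast
  thus ?thesis using y[of tht] y[of f] f(1) z(2) by (simp add: field_simps)
  qed
  thus ?thesis by (intro bexI[OF _ E(2)[OF f(1) gE, of ?c]] ballI)
 qed
qed

section \<open>Graded algebras, graded modules and their free covers\<close>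

abbreviation cg :: "('k, 'a, 'm) gmodule => int => 'm set" where
 "cg M u \<equiv> carrier (gr M u)"

lemma kspace_finsum_hom:
 assumes V: "kspace V" and U: "kspace U" and h: "!!x. x\<in>carrier V ==> h x\<in>carrier U"
  "!!x y. x\<in>carrier V ==> y\<in>carrier V ==> h (x \<oplus>\<^bsub>V\<^esub> y) = h x \<oplus>\<^bsub>U\<^esub> h y"
  and S: "finite S" "f\<in>S \<rightarrow> carrier V"
 shows "h (finsum V f S) = finsum U (%x. h (f x)) S"
proof -
 interpret V: module ground V by fact
 interpret U: module ground U by fact
 have "h \<zero>\<^bsub>V\<^esub> \<oplus>\<^bsub>U\<^esub> h \<zero>\<^bsub>V\<^esub> = h \<zero>\<^bsub>V\<^esub>" using h(2)[of "\<zero>\<^bsub>V\<^esub>" "\<zero>\<^bsub>V\<^esub>"] by simp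
 hence 0: "h \<zero>\<^bsub>V\<^esub> = \<zero>\<^bsub>U\<^esub>" using U.add.r_cancel_one[of "h \<zero>\<^bsub>V\<^esub>" "h \<zero>\<^bsub>V\<^esub>"] h(1)[of "\<zero>\<^bsub>V\<^esub>"] by simp
 show ?thesis using S by (induction S rule: finite_induct) (auto simp: 0 h Pi_iff)
qed

text \<open>The map \<open>tau\<close> is an anti-involution, \<open>hp v\<close> the projection to the component of degree
 \<open>v\<close>, and \<open>rh\<close> a coordinate map.\<close>

locale graded_algebra =
 fixes A :: "('k::field, 'a) galgebra" (structure) and tau :: "'a => 'a" and hp :: "int => 'a => 'a" and rh :: "'a => 'x => 'k"
 assumes A_ring: "ring A" and A_kspace: "kspace A"
  and smult_mult: "x\<in>carrier A ==> y\<in>carrier A ==> (c \<odot> x)\<otimes>y = c \<odot> (x\<otimes>y)"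
  "x\<in>carrier A ==> y\<in>carrier A ==> x\<otimes>(c \<odot> y) = c \<odot> (x\<otimes>y)"
  and hcomp: "ksub A (hcomp A v)"
  and hcomp_mult: "a\<in>hcomp A v ==> b\<in>hcomp A w ==> a\<otimes>b\<in>hcomp A (v + w)"
  and hcomp_one: "\<one>\<in>hcomp A 0"
  and hcomp_fin: "\<exists>B. finite B & B \<subseteq> hcomp A v & (\<forall>S. B \<subseteq> S --> ksub A S --> hcomp A v \<subseteq> S)"
  and tau: "a\<in>hcomp A v ==> tau a\<in>hcomp A v" "x\<in>carrier A ==> tau x\<in>carrier A"
  "x\<in>carrier A ==> y\<in>carrier A ==> tau (x\<oplus>y) = tau x\<oplus>tau y"
  "x\<in>carrier A ==> tau (c \<odot> x) = c \<odot> tau x"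
  "x\<in>carrier A ==> y\<in>carrier A ==> tau (x\<otimes>y) = tau y\<otimes>tau x"
  "x\<in>carrier A ==> tau (tau x) = x" "tau \<one> = \<one>"
  and hp: "x\<in>carrier A ==> hp v x\<in>hcomp A v" "x\<in>hcomp A v ==> hp v x = x"
  "x\<in>carrier A ==> y\<in>carrier A ==> hp v (x\<oplus>y) = hp v x\<oplus>hp v y"
  "x\<in>carrier A ==> b\<in>hcomp A w ==> hp v (x\<otimes>b) = hp (v - w) x\<otimes>b"
  "x\<in>carrier A ==> b\<in>hcomp A w ==> hp v (b\<otimes>x) = b\<otimes>hp (v - w) x"
  and rh: "x\<in>carrier A ==> y\<in>carrier A ==> rh (x\<oplus>y) = rh x + rh y"
  "x\<in>carrier A ==> rh (c \<odot> x) = fsc c (rh x)" "inj_on rh (carrier A)"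
begin

abbreviation "hA \<equiv> hcomp A"
abbreviation "Fr M \<equiv> free_cover A M"
abbreviation "Sy M \<equiv> syzygy A M"

sublocale A: ring A by (rule A_ring)

lemmas AD = kspaceD[OF A_kspace]

lemma hcompD:
 "a\<in>hA v ==> a\<in>carrier A" "\<zero>\<in>hA v"
 "a\<in>hA v ==> b\<in>hA v ==> a\<oplus>b\<in>hA v" "a\<in>hA v ==> c \<odot> a\<in>hA v"
 using hcomp[of v] by (auto simp: ksub_def)

lemma hcomp_mult': "a\<in>hA v ==> b\<in>hA w ==> u = v + w ==> a\<otimes>b\<in>hA u"
 using hcomp_mult by simp

end

locale gmod_over = graded_algebra A tau hp rh
 for A :: "('k::field, 'a) galgebra" (structure) and tau and hp and rh :: "'a => 'x => 'k" +
 fixes M :: "('k, 'a, 'm) gmodule"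
 assumes space: "kspace (gr M u)"
  and closed: "a\<in>hA v ==> x\<in>cg M u ==> act M v u a x\<in>cg M (v + u)"
  and add: "a\<in>hA v ==> x\<in>cg M u ==> y\<in>cg M u ==>
  act M v u a (x \<oplus>\<^bsub>gr M u\<^esub> y) = act M v u a x \<oplus>\<^bsub>gr M (v + u)\<^esub> act M v u a y"
  and addl: "a\<in>hA v ==> b\<in>hA v ==> x\<in>cg M u ==>
  act M v u (a\<oplus>b) x = act M v u a x \<oplus>\<^bsub>gr M (v + u)\<^esub> act M v u b x"
  and smultl: "a\<in>hA v ==> x\<in>cg M u ==> act M v u (c \<odot> a) x = c \<odot>\<^bsub>gr M (v + u)\<^esub> act M v u a x"
  and assoc: "a\<in>hA v ==> b\<in>hA w ==> x\<in>cg M u ==>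
  act M (w + v) u (b\<otimes>a) x = act M w (v + u) b (act M v u a x)"
  and one: "x\<in>cg M u ==> act M 0 u \<one> x = x"
begin

text \<open>Scalars act through multiples of the unit, so their compatibility with the action
  follows from associativity.\<close>

lemma smult:
 assumes a: "a\<in>hA v" and x: "x\<in>cg M u"
 shows "act M v u a (c \<odot>\<^bsub>gr M u\<^esub> x) = c \<odot>\<^bsub>gr M (v + u)\<^esub> act M v u a x"
proof -
 have "c \<odot>\<^bsub>gr M u\<^esub> x = act M 0 u (c \<odot> \<one>) x" using smultl[OF hcomp_one x] one[OF x] by simp
 moreover have "act M v u a (act M 0 u (c \<odot> \<one>) x) = act M v u (a\<otimes>(c \<odot> \<one>)) x"
  using assoc[OF hcompD(4)[OF hcomp_one] a x] by simp
 moreover have "a\<otimes>(c \<odot> \<one>) = c \<odot> a" using smult_mult(2) hcompD(1)[OF a] by simp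
 ultimately show ?thesis using smultl[OF a x] by simp
qed

end

context graded_algebra
begin

abbreviation gmod :: "('k, 'a, 'm) gmodule => bool" where
 "gmod M \<equiv> gmod_over A tau hp rh M"

lemmas gmodI = gmod_over.intro[OF graded_algebra_axioms gmod_over_axioms.intro]
lemmas gmodD = gmod_over.space gmod_over.closed gmod_over.add gmod_over.smult gmod_over.addl gmod_over.smultl
 gmod_over.assoc gmod_over.one

lemma act_zero: assumes M: "gmod M" and a: "a\<in>hA v" shows "act M v u a \<zero>\<^bsub>gr M u\<^esub> = \<zero>\<^bsub>gr M (v + u)\<^esub>"
 using gmodD(4)[OF M a kspaceD(1)[OF gmodD(1)[OF M]], where c = 0] gmodD(2)[OF M a kspaceD(1)[OF gmodD(1)[OF M]]]
  kspaceD(8,9)[OF gmodD(1)[OF M]] by metis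

lemma act_zero_left: assumes M: "gmod M" and x: "x\<in>cg M u" shows "act M v u \<zero> x = \<zero>\<^bsub>gr M (v + u)\<^esub>"
 using gmodD(6)[OF M hcompD(2) x, where c = 0] gmodD(2)[OF M hcompD(2) x]
  kspaceD(8)[OF gmodD(1)[OF M]] AD(9) by metis

lemma shift_simps [simp]: "gr (shift s M) u = gr M (u - s)" "act (shift s M) v u = act M v (u - s)"
 by (simp_all add: shift_def gvec_shift_def)

lemma gmod_shift: assumes M: "gmod M" shows "gmod (shift s M)"
proof -
 have e: "!!v u. v + u - s = v + (u - s)" by simp
 show ?thesis by (rule gmodI) (simp_all only: shift_simps e gmodD[OF M])
qed

lemma dual_simps [simp]:
 "gr (restricted_dual tau M) u = hom_space (gr M (- u)) ground"
 "act (restricted_dual tau M) v u a ph = (\<lambda>x\<in>carrier (gr M (- (v + u))). ph (act M v (- (v + u)) (tau a) x))"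
 by (simp_all add: restricted_dual_def)

lemma gmod_restricted_dual: assumes M: "gmod M" shows "gmod (restricted_dual tau M)"
proof (rule gmodI)
 note D = gmodD[OF M] and l = lm_simps
 show "kspace (gr (restricted_dual tau M) u)" for u
  by (simp only: dual_simps kspace_hom_space[OF D(1) kspace_ground])
 have c: "act M v (- (v + u)) (tau a) x\<in>cg M (- u)"
  if "a\<in>hA v" "x\<in>carrier (gr M (- (v + u)))" for v u a x
  using D(2)[OF tau(1)[OF that(1)] that(2)] by simp
 fix v u a ph assume a: "a\<in>hA v" and "ph\<in>cg (restricted_dual tau M) u"
 hence p: "ph\<in>lin_maps (gr M (- u)) ground" by simp
 have e: "v + - (v + u) = - u" by simp
 show "act (restricted_dual tau M) v u a ph\<in>cg (restricted_dual tau M) (v + u)"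
  unfolding dual_simps hom_simps
  by (rule lm_restrict[OF D(1)]) (simp_all only: D(3,4)[OF tau(1)[OF a]] e l[OF p] c[OF a] ground_simps UNIV_I)
 show "act (restricted_dual tau M) v u (k \<odot> a) ph = k \<odot>\<^bsub>gr (restricted_dual tau M) (v + u)\<^esub> act (restricted_dual tau M) v u a ph" for k
  unfolding dual_simps hom_simps
  by (rule restrict_ext) (simp only: tau(4)[OF hcompD(1)[OF a]] D(6)[OF tau(1)[OF a]] e l(3)[OF p c[OF a]] restrict_apply if_True)
 show "act (restricted_dual tau M) v u a (ph \<oplus>\<^bsub>gr (restricted_dual tau M) u\<^esub> ps)
  = act (restricted_dual tau M) v u a ph \<oplus>\<^bsub>gr (restricted_dual tau M) (v + u)\<^esub> act (restricted_dual tau M) v u a ps" for ps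
  unfolding dual_simps hom_simps by (rule restrict_ext) (simp only: restrict_apply c[OF a] if_True)
 show "act (restricted_dual tau M) v u (a\<oplus>b) ph
  = act (restricted_dual tau M) v u a ph \<oplus>\<^bsub>gr (restricted_dual tau M) (v + u)\<^esub> act (restricted_dual tau M) v u b ph"
  if b: "b\<in>hA v" for b
  unfolding dual_simps hom_simps
  by (rule restrict_ext) (simp only: tau(3)[OF hcompD(1)[OF a] hcompD(1)[OF b]] D(5)[OF tau(1)[OF a] tau(1)[OF b]] e
  l(2)[OF p c[OF a] c[OF b]] restrict_apply if_True)
 show "act (restricted_dual tau M) (w + v) u (b\<otimes>a) ph = act (restricted_dual tau M) w (v + u) b (act (restricted_dual tau M) v u a ph)"
  if b: "b\<in>hA w" for w b
  unfolding dual_simps hom_simps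
 proof (rule ext)
  fix x
  have t: "tau (b\<otimes>a) = tau a\<otimes>tau b" by (rule tau(5)[OF hcompD(1)[OF b] hcompD(1)[OF a]])
  have e: "- (w + v + u) = - (w + (v + u))" "w + v = v + w" "w + - (w + (v + u)) = - (v + u)" by simp_all
  show "(\<lambda>x\<in>carrier (gr M (- (w + v + u))). ph (act M (w + v) (- (w + v + u)) (tau (b\<otimes>a)) x)) x
  = (\<lambda>x\<in>carrier (gr M (- (w + (v + u)))). (\<lambda>x\<in>carrier (gr M (- (v + u))). ph (act M v (- (v + u)) (tau a) x))
  (act M w (- (w + (v + u))) (tau b) x)) x"
  using c[OF b, of x "v + u"] D(7)[OF tau(1)[OF b] tau(1)[OF a], of x "- (w + (v + u))"]
  by (simp only: e(1) t restrict_apply if_True e(3)) (simp add: e(2))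
 qed
next
 fix u ph assume "ph\<in>cg (restricted_dual tau M) u"
 hence p: "ph\<in>lin_maps (gr M (- u)) ground" by simp
 show "act (restricted_dual tau M) 0 u \<one> ph = ph"
  by (rule ext) (simp add: tau(7) gmodD(8)[OF M] restrict_def extensional_arb[OF lm_simps(4)[OF p]])
qed

text \<open>The abstract form of \<open>eps_quotient\<close>: \<open>e\<close> stands for the
  idempotent at a vertex and \<open>s\<close> for the power of its loop.\<close>

definition quo :: "'a => 'a => ('k, 'a, 'a set) gmodule" where
 "quo e s = \<lparr>gr = (%u. coset_space A (left_gen A s) ((%x. x\<otimes>e) ` hA u)),
  act = (%v u a X. \<Union>x\<in>X. left_gen A s +> (a\<otimes>x))\<rparr>"

lemma ksub_left_gen: "s\<in>carrier A ==> ksub A (left_gen A s)"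
 unfolding left_gen_def by (rule ksub_image[OF A_kspace ksub_carrier[OF A_kspace] A_kspace]) (simp_all add: smult_mult A.l_distr)

lemma kquot_left_gen: "s\<in>carrier A ==> kquot A (left_gen A s)"
 by (intro kquot.intro kquot_axioms.intro A_kspace ksub_left_gen)

lemma left_gen_left: "s\<in>carrier A ==> a\<in>carrier A ==> x\<in>left_gen A s ==> a\<otimes>x\<in>left_gen A s"
 unfolding left_gen_def by (auto simp: A.m_assoc[symmetric])

lemma ksub_right_mult: "e\<in>carrier A ==> ksub A ((%x. x\<otimes>e) ` hA u)"
 by (rule ksub_image[OF A_kspace hcomp A_kspace]) (auto simp: smult_mult A.l_distr dest!: hcompD(1))

lemma quo_simps:
 assumes s: "s\<in>carrier A"
 shows "cg (quo e s) u = (%x. left_gen A s +> (x\<otimes>e)) ` hA u"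
  and "\<zero>\<^bsub>gr (quo e s) u\<^esub> = left_gen A s"
  and "x\<in>carrier A ==> y\<in>carrier A ==>
  (left_gen A s +> x) \<oplus>\<^bsub>gr (quo e s) u\<^esub> (left_gen A s +> y) = left_gen A s +> (x\<oplus>y)"
  and "x\<in>carrier A ==> c \<odot>\<^bsub>gr (quo e s) u\<^esub> (left_gen A s +> x) = left_gen A s +> (c \<odot> x)"
  and "a\<in>carrier A ==> x\<in>carrier A ==> act (quo e s) v u a (left_gen A s +> x) = left_gen A s +> (a\<otimes>x)"
proof -
 interpret L: kquot A "left_gen A s" by (rule kquot_left_gen[OF s])
 note c = L.cs_simps
 show "cg (quo e s) u = (%x. left_gen A s +> (x\<otimes>e)) ` hA u"
  by (simp add: quo_def c(1) image_image)
 show "\<zero>\<^bsub>gr (quo e s) u\<^esub> = left_gen A s"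
  "x\<in>carrier A ==> y\<in>carrier A ==>
  (left_gen A s +> x) \<oplus>\<^bsub>gr (quo e s) u\<^esub> (left_gen A s +> y) = left_gen A s +> (x\<oplus>y)"
  "x\<in>carrier A ==> c \<odot>\<^bsub>gr (quo e s) u\<^esub> (left_gen A s +> x) = left_gen A s +> (c \<odot> x)"
  by (simp_all add: quo_def c)
 show "act (quo e s) v u a (left_gen A s +> x) = left_gen A s +> (a\<otimes>x)" if "a\<in>carrier A" "x\<in>carrier A"
  using L.coset_lift[OF kquot_left_gen[OF s] that(2), of "%x. a\<otimes>x"] that left_gen_left[OF s that(1)]
  by (auto simp: quo_def A.r_distr)
qed

lemma gmod_quo: assumes s: "s\<in>carrier A" and e: "e\<in>carrier A" shows "gmod (quo e s)"
proof (rule gmodI)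
 interpret L: kquot A "left_gen A s" by (rule kquot_left_gen[OF s])
 note q = quo_simps[OF s]
 show "kspace (gr (quo e s) u)" for u
  using L.kspace_cs[OF ksub_right_mult[OF e]] by (simp add: quo_def)
 note h = hcompD hcomp_mult
 fix v u a X assume a: "a\<in>hA v" and "X\<in>cg (quo e s) u"
 then obtain x where x: "x\<in>hA u" and X: "X = left_gen A s +> (x\<otimes>e)" by (auto simp: q)
 note c = hcompD(1)[OF a] hcompD(1)[OF x] e
 show "act (quo e s) v u a X\<in>cg (quo e s) (v + u)"
  unfolding X by (simp add: q c A.m_assoc[symmetric]) (use hcomp_mult[OF a x] in blast)
 show "act (quo e s) v u (k \<odot> a) X = k \<odot>\<^bsub>gr (quo e s) (v + u)\<^esub> act (quo e s) v u a X" for k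
  unfolding X by (simp add: q c smult_mult)
 show "act (quo e s) v u (a\<oplus>b) X = act (quo e s) v u a X \<oplus>\<^bsub>gr (quo e s) (v + u)\<^esub> act (quo e s) v u b X"
  if b: "b\<in>hA v" for b
  unfolding X by (simp add: q c hcompD(1)[OF b] A.l_distr)
 show "act (quo e s) (w + v) u (b\<otimes>a) X = act (quo e s) w (v + u) b (act (quo e s) v u a X)"
  if b: "b\<in>hA w" for w b
  unfolding X by (simp add: q c hcompD(1)[OF b] A.m_assoc)
 fix Y assume "Y\<in>cg (quo e s) u"
 then obtain y where y: "y\<in>hA u" and Y: "Y = left_gen A s +> (y\<otimes>e)" by (auto simp: q)
 show "act (quo e s) v u a (X \<oplus>\<^bsub>gr (quo e s) u\<^esub> Y) = act (quo e s) v u a X \<oplus>\<^bsub>gr (quo e s) (v + u)\<^esub> act (quo e s) v u a Y"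
  unfolding X Y by (simp add: q c hcompD(1)[OF y] A.r_distr)
next
 fix u X assume "X\<in>cg (quo e s) u"
 thus "act (quo e s) 0 u \<one> X = X" using hcompD(1) e by (auto simp: quo_simps[OF s])
qed

lemma cover_simps:
 "cg (Fr M) u = {f. finite {x. f x ~= \<zero>} &
  (\<forall>w m. if m\<in>cg M w then f (w, m)\<in>hA (u - w) else f (w, m) = \<zero>)}"
 "\<zero>\<^bsub>gr (Fr M) u\<^esub> = (%x. \<zero>)"
 "f \<oplus>\<^bsub>gr (Fr M) u\<^esub> g = (%x. f x\<oplus>g x)" "c \<odot>\<^bsub>gr (Fr M) u\<^esub> f = (%x. c \<odot> f x)"
 "act (Fr M) v u a f = (%x. a\<otimes>f x)"
 by (simp_all add: free_cover_def)

lemma coverD: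
 assumes "f\<in>cg (Fr M) u"
 shows "finite {x. f x ~= \<zero>}" "m\<in>cg M w ==> f (w, m)\<in>hA (u - w)"
  "m \<notin> cg M w ==> f (w, m) = \<zero>" "f p\<in>carrier A"
proof -
 show m: "finite {x. f x ~= \<zero>}" "m\<in>cg M w ==> f (w, m)\<in>hA (u - w)"
  "m \<notin> cg M w ==> f (w, m) = \<zero>" for m w
  using assms by (auto simp: cover_simps split: if_splits)
 show "f p\<in>carrier A" using m(2,3)[of "snd p" "fst p"] hcompD(1) by (cases "snd p\<in>cg M (fst p)") auto
qed

lemma free_coverI:
 assumes "finite {x. f x ~= \<zero>}" "!!w m. m\<in>cg M w ==> f (w, m)\<in>hA (u - w)"
  "!!w m. m \<notin> cg M w ==> f (w, m) = \<zero>"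
 shows "f\<in>cg (Fr M) u"
 using assms by (simp add: cover_simps)

lemma gmod_Fr: "gmod (Fr M)"
proof (rule gmodI)
 note s = cover_simps(2-)
 show "kspace (gr (Fr M) u)" for u
 proof (rule kspaceI)
  show "\<zero>\<^bsub>gr (Fr M) u\<^esub>\<in>cg (Fr M) u" by (rule free_coverI) (simp_all add: s hcompD)
  fix f assume f: "f\<in>cg (Fr M) u"
  note F = coverD[OF f]
  show "c \<odot>\<^bsub>gr (Fr M) u\<^esub> f\<in>cg (Fr M) u" for c
  unfolding s by (rule free_coverI, rule finite_subset[OF _ F(1)]) (auto simp: F hcompD AD(9))
  show "\<zero>\<^bsub>gr (Fr M) u\<^esub> \<oplus>\<^bsub>gr (Fr M) u\<^esub> f = f" "1 \<odot>\<^bsub>gr (Fr M) u\<^esub> f = f"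
  "0 \<odot>\<^bsub>gr (Fr M) u\<^esub> f = \<zero>\<^bsub>gr (Fr M) u\<^esub>"
  "(a + b) \<odot>\<^bsub>gr (Fr M) u\<^esub> f = a \<odot>\<^bsub>gr (Fr M) u\<^esub> f \<oplus>\<^bsub>gr (Fr M) u\<^esub> b \<odot>\<^bsub>gr (Fr M) u\<^esub> f"
  "(a * b) \<odot>\<^bsub>gr (Fr M) u\<^esub> f = a \<odot>\<^bsub>gr (Fr M) u\<^esub> (b \<odot>\<^bsub>gr (Fr M) u\<^esub> f)" for a b
  by (simp_all add: s F AD(4-8))
  fix g assume g: "g\<in>cg (Fr M) u"
  note G = coverD[OF g]
  show "f \<oplus>\<^bsub>gr (Fr M) u\<^esub> g\<in>cg (Fr M) u"
  unfolding s by (rule free_coverI, rule finite_subset[OF _ finite_UnI[OF F(1) G(1)]]) (auto simp: F G hcompD)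
  show "f \<oplus>\<^bsub>gr (Fr M) u\<^esub> g = g \<oplus>\<^bsub>gr (Fr M) u\<^esub> f"
  "a \<odot>\<^bsub>gr (Fr M) u\<^esub> (f \<oplus>\<^bsub>gr (Fr M) u\<^esub> g)
  = a \<odot>\<^bsub>gr (Fr M) u\<^esub> f \<oplus>\<^bsub>gr (Fr M) u\<^esub> a \<odot>\<^bsub>gr (Fr M) u\<^esub> g" for a
  by (simp_all add: s F G A.a_comm AD(5))
  fix h assume h: "h\<in>cg (Fr M) u"
  show "f \<oplus>\<^bsub>gr (Fr M) u\<^esub> g \<oplus>\<^bsub>gr (Fr M) u\<^esub> h = f \<oplus>\<^bsub>gr (Fr M) u\<^esub> (g \<oplus>\<^bsub>gr (Fr M) u\<^esub> h)"
  by (simp add: s F G coverD(4)[OF h] A.a_assoc)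
 qed
 fix v u a f assume a: "a\<in>hA v" and f: "f\<in>cg (Fr M) u"
 note F = coverD[OF f] and a' = hcompD(1)[OF a]
 show "act (Fr M) v u a f\<in>cg (Fr M) (v + u)"
  unfolding s by (rule free_coverI, rule finite_subset[OF _ F(1)])
  (auto simp: F a' intro!: hcomp_mult'[OF a F(2)])
 show "act (Fr M) v u (c \<odot> a) f = c \<odot>\<^bsub>gr (Fr M) (v + u)\<^esub> act (Fr M) v u a f" for c
  by (simp_all add: s F a' smult_mult)
 show "act (Fr M) v u (a\<oplus>b) f = act (Fr M) v u a f \<oplus>\<^bsub>gr (Fr M) (v + u)\<^esub> act (Fr M) v u b f"
  if "b\<in>hA v" for b
  by (simp add: s F a' hcompD(1)[OF that] A.l_distr)
 show "act (Fr M) (w + v) u (b\<otimes>a) f = act (Fr M) w (v + u) b (act (Fr M) v u a f)"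
  if "b\<in>hA w" for w b
  by (simp add: s F a' hcompD(1)[OF that] A.m_assoc)
 fix g assume "g\<in>cg (Fr M) u"
 thus "act (Fr M) v u a (f \<oplus>\<^bsub>gr (Fr M) u\<^esub> g)
  = act (Fr M) v u a f \<oplus>\<^bsub>gr (Fr M) (v + u)\<^esub> act (Fr M) v u a g"
  by (simp add: s F coverD(4) a' A.r_distr)
next
 fix u f assume "f\<in>cg (Fr M) u"
 thus "act (Fr M) 0 u \<one> f = f" by (simp add: cover_simps(5) coverD(4))
qed

text \<open>The uncurried coordinates embed a component of the free cover in a space of functions,
  as \<open>extend_functional\<close> requires.\<close>

lemma free_cover_coord:
 defines "R \<equiv> %f (p, y). rh (f p) y"
 shows "inj_on R (cg (Fr M) u)"
  and "x\<in>cg (Fr M) u ==> y\<in>cg (Fr M) u ==> R (x \<oplus>\<^bsub>gr (Fr M) u\<^esub> y) = R x + R y"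
  and "x\<in>cg (Fr M) u ==> R (c \<odot>\<^bsub>gr (Fr M) u\<^esub> x) = fsc c (R x)"
proof (rule inj_onI)
 fix f g assume f: "f\<in>cg (Fr M) u" and g: "g\<in>cg (Fr M) u" and eq: "R f = R g"
 have "rh (f p) y = rh (g p) y" for p y using fun_cong[OF eq, of "(p, y)"] by (simp add: R_def)
 hence "rh (f p) = rh (g p)" for p by blast
 thus "f = g" using inj_onD[OF rh(3) _ coverD(4)[OF f] coverD(4)[OF g]] by blast
next
 show "R (x \<oplus>\<^bsub>gr (Fr M) u\<^esub> y) = R x + R y" if "x\<in>cg (Fr M) u" "y\<in>cg (Fr M) u"
  using that[THEN coverD(4)] by (auto simp: R_def cover_simps(3) fun_eq_iff rh(1))
 show "R (c \<odot>\<^bsub>gr (Fr M) u\<^esub> x) = fsc c (R x)" if "x\<in>cg (Fr M) u"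
  using coverD(4)[OF that] by (auto simp: R_def cover_simps(4) fun_eq_iff rh(2) fsc_def)
qed

lemma cm_eq:
 assumes M: "gmod M" and f: "f\<in>cg (Fr M) u" and S: "finite S" "{x. f x ~= \<zero>} \<subseteq> S"
  "S \<subseteq> {(w, m). m\<in>cg M w}"
 shows "cover_map A M u f = finsum (gr M u) (%(w, m). act M (u - w) w (f (w, m)) m) S"
  and "(%(w, m). act M (u - w) w (f (w, m)) m)\<in>S \<rightarrow> cg M u"
proof -
 interpret V: module ground "gr M u" by (rule gmodD(1)[OF M])
 show c: "(%(w, m). act M (u - w) w (f (w, m)) m)\<in>S \<rightarrow> cg M u"
 proof
  fix p assume "p\<in>S"
  then obtain w m where p: "p = (w, m)" "m\<in>cg M w" using S(3) by auto
  show "(case p of (w, m) => act M (u - w) w (f (w, m)) m)\<in>cg M u"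
  using gmodD(2)[OF M coverD(2)[OF f p(2)] p(2)] p(1) by simp
 qed
 show "cover_map A M u f = finsum (gr M u) (%(w, m). act M (u - w) w (f (w, m)) m) S"
  unfolding cover_map_def
 proof (rule V.add.finprod_mono_neutral_cong_left[OF S(1,2) _ _ c])
  fix p assume p: "p\<in>S - {x. f x ~= \<zero>}"
  then obtain w m where p': "p = (w, m)" "m\<in>cg M w" "f (w, m) = \<zero>" using S(3) by auto
  thus "(case p of (w, m) => act M (u - w) w (f (w, m)) m) = \<zero>\<^bsub>gr M u\<^esub>"
  using act_zero_left[OF M p'(2), of "u - w"] by simp
 qed simp
qed

lemma support_idx: "f\<in>cg (Fr M) u ==> {x. f x ~= \<zero>} \<subseteq> {(w, m). m\<in>cg M w}"
 using coverD(3) by fastforce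

lemma cm_closed:
 assumes M: "gmod M" and f: "f\<in>cg (Fr M) u"
 shows "cover_map A M u f\<in>cg M u"
proof -
 interpret V: module ground "gr M u" by (rule gmodD(1)[OF M])
 note S = coverD(1)[OF f] order_refl support_idx[OF f]
 show ?thesis unfolding cm_eq(1)[OF M f S] by (rule V.finsum_closed[OF cm_eq(2)[OF M f S]])
qed

lemma cover_map_add:
 assumes M: "gmod M" and f: "f\<in>cg (Fr M) u" and g: "g\<in>cg (Fr M) u"
 shows "cover_map A M u (f \<oplus>\<^bsub>gr (Fr M) u\<^esub> g) = cover_map A M u f \<oplus>\<^bsub>gr M u\<^esub> cover_map A M u g"
proof -
 interpret V: module ground "gr M u" by (rule gmodD(1)[OF M])
 let ?S = "{x. f x ~= \<zero>} \<union> {x. g x ~= \<zero>}"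
 let ?h = "f \<oplus>\<^bsub>gr (Fr M) u\<^esub> g"
 have h: "?h\<in>cg (Fr M) u" by (rule kspaceD(2)[OF gmodD(1)[OF gmod_Fr] f g])
 have S: "finite ?S" "?S \<subseteq> {(w, m). m\<in>cg M w}"
  using coverD(1)[OF f] coverD(1)[OF g] support_idx[OF f] support_idx[OF g] by auto
 have hS: "{x. ?h x ~= \<zero>} \<subseteq> ?S" by (auto simp: cover_simps)
 have fS: "{x. f x ~= \<zero>} \<subseteq> ?S" and gS: "{x. g x ~= \<zero>} \<subseteq> ?S" by blast+
 show ?thesis
  unfolding cm_eq(1)[OF M h S(1) hS S(2)] cm_eq(1)[OF M f S(1) fS S(2)] cm_eq(1)[OF M g S(1) gS S(2)]
  V.finsum_addf[OF cm_eq(2)[OF M f S(1) fS S(2)] cm_eq(2)[OF M g S(1) gS S(2)], symmetric]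
 proof (rule V.finsum_cong'[OF refl])
  show "(%x. (case x of (w, m) => act M (u - w) w (f (w, m)) m) \<oplus>\<^bsub>gr M u\<^esub> (case x of (w, m) => act M (u - w) w (g (w, m)) m))
  \<in>?S \<rightarrow> cg M u"
  by (intro Pi_I V.a_closed Pi_mem[OF cm_eq(2)[OF M f S(1) fS S(2)]] Pi_mem[OF cm_eq(2)[OF M g S(1) gS S(2)]])
  fix p assume "p\<in>?S"
  then obtain w m where p: "p = (w, m)" "m\<in>cg M w" using S(2) by auto
  show "(case p of (w, m) => act M (u - w) w (?h (w, m)) m)
  = (case p of (w, m) => act M (u - w) w (f (w, m)) m) \<oplus>\<^bsub>gr M u\<^esub> (case p of (w, m) => act M (u - w) w (g (w, m)) m)"
  using gmodD(5)[OF M coverD(2)[OF f p(2)] coverD(2)[OF g p(2)] p(2)] p(1) by (simp add: cover_simps)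
 qed
qed

lemma cm_act:
 assumes M: "gmod M" and f: "f\<in>cg (Fr M) u" and a: "a\<in>hA v"
 shows "cover_map A M (v + u) (act (Fr M) v u a f) = act M v u a (cover_map A M u f)"
proof -
 interpret V: module ground "gr M (v + u)" by (rule gmodD(1)[OF M])
 let ?S = "{x. f x ~= \<zero>}" and ?h = "act (Fr M) v u a f"
 have h: "?h\<in>cg (Fr M) (v + u)" by (rule gmodD(2)[OF gmod_Fr a f])
 note S = coverD(1)[OF f] order_refl support_idx[OF f]
 have hS: "{x. ?h x ~= \<zero>} \<subseteq> ?S" using hcompD(1)[OF a] by (auto simp: cover_simps)
 have "act M v u a (cover_map A M u f) = finsum (gr M (v + u)) (%p. act M v u a (case p of (w, m) => act M (u - w) w (f (w, m)) m)) ?S"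
  unfolding cm_eq(1)[OF M f S]
  by (rule kspace_finsum_hom[OF gmodD(1)[OF M] gmodD(1)[OF M] gmodD(2)[OF M a] gmodD(3)[OF M a] S(1) cm_eq(2)[OF M f S]])
 also have "\<dots> = cover_map A M (v + u) ?h"
  unfolding cm_eq(1)[OF M h S(1) hS S(3)]
 proof (rule V.finsum_cong'[OF refl cm_eq(2)[OF M h S(1) hS S(3)]])
  fix p assume "p\<in>?S"
  then obtain w m where p: "p = (w, m)" "m\<in>cg M w" using S(3) by auto
  have e: "v + u - w = v + (u - w)" "u - w + w = u" by simp_all
  show "act M v u a (case p of (w, m) => act M (u - w) w (f (w, m)) m) = (case p of (w, m) => act M (v + u - w) w (?h (w, m)) m)"
  unfolding p(1) prod.case e(1) cover_simps gmodD(7)[OF M coverD(2)[OF f p(2)] a p(2)] e(2) ..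
 qed
 finally show ?thesis by simp
qed

lemma cm_smult:
 assumes M: "gmod M" and f: "f\<in>cg (Fr M) u"
 shows "cover_map A M u (c \<odot>\<^bsub>gr (Fr M) u\<^esub> f) = c \<odot>\<^bsub>gr M u\<^esub> cover_map A M u f"
proof -
 have "c \<odot>\<^bsub>gr (Fr M) u\<^esub> f = act (Fr M) 0 u (c \<odot> \<one>) f"
  using gmodD(6)[OF gmod_Fr hcomp_one f, of c] gmodD(8)[OF gmod_Fr f] by simp
 hence "cover_map A M u (c \<odot>\<^bsub>gr (Fr M) u\<^esub> f) = act M 0 u (c \<odot> \<one>) (cover_map A M u f)"
  using cm_act[OF M f hcompD(4)[OF hcomp_one], of c] by simp
 also have "\<dots> = c \<odot>\<^bsub>gr M u\<^esub> cover_map A M u f"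
  using gmodD(6)[OF M hcomp_one cm_closed[OF M f], of c] gmodD(8)[OF M cm_closed[OF M f]] by simp
 finally show ?thesis .
qed

definition gen :: "int => 'm => int \<times> 'm => 'a" where
 "gen w m = (%p. if p = (w, m) then \<one> else \<zero>)"

lemma gen_closed: "m\<in>cg M w ==> gen w m\<in>cg (Fr M) w"
 by (rule free_coverI, rule finite_subset[of _ "{(w, m)}"]) (auto simp: gen_def hcompD(2) hcomp_one)

lemma cm_gen:
 assumes M: "gmod M" and m: "m\<in>cg M w" shows "cover_map A M w (gen w m) = m"
proof -
 interpret V: module ground "gr M w" by (rule gmodD(1)[OF M])
 have S: "finite {(w, m)}" "{x. gen w m x ~= \<zero>} \<subseteq> {(w, m)}" "{(w, m)} \<subseteq> {(w, m). m\<in>cg M w}"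
  using m by (auto simp: gen_def)
 show ?thesis
  unfolding cm_eq(1)[OF M gen_closed[OF m] S] by (simp add: gen_def gmodD(8)[OF M m] m)
qed

lemma syzygy_simps:
 "cg (Sy M) u = {f\<in>cg (Fr M) u. cover_map A M u f = \<zero>\<^bsub>gr M u\<^esub>}"
 "f \<oplus>\<^bsub>gr (Sy M) u\<^esub> g = f \<oplus>\<^bsub>gr (Fr M) u\<^esub> g" "c \<odot>\<^bsub>gr (Sy M) u\<^esub> f = c \<odot>\<^bsub>gr (Fr M) u\<^esub> f"
 "\<zero>\<^bsub>gr (Sy M) u\<^esub> = \<zero>\<^bsub>gr (Fr M) u\<^esub>" "act (Sy M) = act (Fr M)"
 by (simp_all add: syzygy_def)

lemma ksub_syzygy: assumes M: "gmod M" shows "ksub (gr (Fr M) u) (cg (Sy M) u)"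
proof -
 interpret V: module ground "gr M u" by (rule gmodD(1)[OF M])
 note F = kspaceD[OF gmodD(1)[OF gmod_Fr[of M]]] and MD = kspaceD[OF gmodD(1)[OF M]]
 have "cover_map A M u (0 \<odot>\<^bsub>gr (Fr M) u\<^esub> \<zero>\<^bsub>gr (Fr M) u\<^esub>) = \<zero>\<^bsub>gr M u\<^esub>"
  by (simp only: cm_smult[OF M F(1)] MD(8)[OF cm_closed[OF M F(1)]])
 thus ?thesis
  by (auto simp: ksub_def syzygy_simps F(1-3,9) cm_smult[OF M] cover_map_add[OF M])
qed

lemma gmod_syzygy: assumes M: "gmod M" shows "gmod (Sy M)"
proof -
 note F = gmodD[OF gmod_Fr[of M]]
 have "gr (Sy M) u = (gr (Fr M) u)\<lparr>carrier := cg (Sy M) u\<rparr>" for u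
  by (simp add: syzygy_def)
 hence "kspace (gr (Sy M) u)" for u
  using kspace_ksub[OF F(1) ksub_syzygy[OF M]] by metis
 thus ?thesis
  by (intro gmodI)
  (simp_all add: syzygy_simps F(2-8) cm_act[OF M] act_zero[OF M] del: dual_simps)
qed

end

section \<open>Homomorphisms into generic kernels\<close>

context graded_algebra
begin

lemma ghom_simps:
 "carrier (ghom A M N) = {ph. (\<forall>u. ph u\<in>lin_maps (gr M u) (gr N u)) &
  (\<forall>v u. \<forall>a\<in>hA v. \<forall>x\<in>cg M u. ph (v + u) (act M v u a x) = act N v u a (ph u x))}"
 "\<zero>\<^bsub>ghom A M N\<^esub> = (%u. \<zero>\<^bsub>hom_space (gr M u) (gr N u)\<^esub>)"
 "ph \<oplus>\<^bsub>ghom A M N\<^esub> ps = (%u. ph u \<oplus>\<^bsub>hom_space (gr M u) (gr N u)\<^esub> ps u)"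
 "c \<odot>\<^bsub>ghom A M N\<^esub> ph = (%u. c \<odot>\<^bsub>hom_space (gr M u) (gr N u)\<^esub> ph u)"
 by (simp_all add: ghom_def)

lemma ghomD:
 assumes "ph\<in>carrier (ghom A M N)"
 shows "ph u\<in>lin_maps (gr M u) (gr N u)"
  and "a\<in>hA v ==> x\<in>cg M u ==> ph (v + u) (act M v u a x) = act N v u a (ph u x)"
 using assms by (auto simp: ghom_simps)

lemma kspace_ghom:
 assumes M: "gmod M" and N: "gmod N" shows "kspace (ghom A M N)"
proof -
 let ?H = "%u. hom_space (gr M u) (gr N u)" and ?G = "ghom A M N"
 have H: "kspace (?H u)" for u by (rule kspace_hom_space[OF gmodD(1)[OF M] gmodD(1)[OF N]])
 note HD = kspaceD[OF H]
 have c: "ph u\<in>carrier (?H u)" if "ph\<in>carrier ?G" for ph u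
  unfolding hom_simps by (rule ghomD(1)[OF that])
 interpret H: module ground "?H u" for u by (rule H)
 note val = lm_simps(1)[OF ghomD(1)] and ND = gmodD[OF N] and MD = gmodD[OF M]
 show ?thesis
 proof (rule kspaceI)
  show "\<zero>\<^bsub>?G\<^esub>\<in>carrier ?G"
  using HD(1) by (simp add: ghom_simps MD(2) act_zero[OF N])
  show "ph \<oplus>\<^bsub>?G\<^esub> ps\<in>carrier ?G" if p: "ph\<in>carrier ?G" and q: "ps\<in>carrier ?G" for ph ps
  unfolding ghom_simps(1,3) mem_Collect_eq
  proof (intro conjI allI ballI)
  show "ph u \<oplus>\<^bsub>?H u\<^esub> ps u\<in>lin_maps (gr M u) (gr N u)" for u using HD(2)[OF c[OF p] c[OF q]] unfolding hom_simps(1) .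
  fix v u a x assume a: "a\<in>hA v" and x: "x\<in>cg M u"
  show "(ph (v + u) \<oplus>\<^bsub>?H (v + u)\<^esub> ps (v + u)) (act M v u a x) = act N v u a ((ph u \<oplus>\<^bsub>?H u\<^esub> ps u) x)"
  by (simp add: MD(2)[OF a x] x ghomD(2)[OF p a x] ghomD(2)[OF q a x] ND(3)[OF a val[OF p x] val[OF q x]])
  qed
  show "k \<odot>\<^bsub>?G\<^esub> ph\<in>carrier ?G" if p: "ph\<in>carrier ?G" for ph k
  unfolding ghom_simps(1,4) mem_Collect_eq
  proof (intro conjI allI ballI)
  show "k \<odot>\<^bsub>?H u\<^esub> ph u\<in>lin_maps (gr M u) (gr N u)" for u using HD(3)[OF c[OF p]] unfolding hom_simps(1) .
  fix v u a x assume a: "a\<in>hA v" and x: "x\<in>cg M u"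
  show "(k \<odot>\<^bsub>?H (v + u)\<^esub> ph (v + u)) (act M v u a x) = act N v u a ((k \<odot>\<^bsub>?H u\<^esub> ph u) x)"
  by (simp add: MD(2)[OF a x] x ghomD(2)[OF p a x] ND(4)[OF a val[OF p x]])
  qed
 qed (simp_all only: ghom_simps(2-4) H.a_assoc[OF c c c] H.l_zero[OF c] HD(4-8)[OF c] HD(5)[OF c c], rule ext, rule H.a_comm[OF c c])
qed

text \<open>An abstraction of the idempotent and the \<open>k\<close>-th power of the loop at
  \<open>i\<close>, with \<open>m = k d i\<close>; the degree \<open>2 * m\<close> makes the shift
  by \<open>m\<close> symmetric around 0. The last clause is torsion-freeness.\<close>

definition vertex :: "'a => 'a => int => bool" where
 "vertex e s m \<longleftrightarrow> e\<in>hA 0 & s\<in>hA (2 * m) & e\<otimes>e = e & e\<otimes>s = s & s\<otimes>e = s &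
  tau e = e & tau s = s & (\<forall>x\<in>carrier A. s\<otimes>x = \<zero> --> e\<otimes>x = \<zero>)"

definition gker :: "'a => 'a => int => ('k, 'a, 'a set => 'k) gmodule" where
 "gker e s m = shift m (restricted_dual tau (quo e s))"

end

locale graded_vertex = graded_algebra A tau hp rh
 for A :: "('k::field, 'a) galgebra" (structure) and tau and hp and rh :: "'a => 'x => 'k" +
 fixes e s :: 'a and m :: int
 assumes vertex: "vertex e s m"
begin

lemma e: "e\<in>hA 0" "e\<otimes>e = e" "tau e = e"
 and s: "s\<in>hA (2 * m)" "e\<otimes>s = s" "s\<otimes>e = s" "tau s = s"
 and torsion: "x\<in>carrier A ==> s\<otimes>x = \<zero> ==> e\<otimes>x = \<zero>"
 using vertex by (auto simp: vertex_def)

lemmas ec = hcompD(1)[OF e(1)] and sc = hcompD(1)[OF s(1)]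

abbreviation "L \<equiv> left_gen A s"
abbreviation "cls x \<equiv> L +> x"
abbreviation "K \<equiv> gker e s m"

sublocale L: kquot A L by (rule kquot_left_gen[OF sc])

lemmas q = quo_simps[OF sc]

lemma gmod_quo': "gmod (quo e s)" by (rule gmod_quo[OF sc ec])

lemma gmod_K: "gmod K"
 unfolding gker_def by (intro gmod_shift gmod_restricted_dual gmod_quo')

lemma cls_mem: "a\<in>hA u ==> a\<otimes>e = a ==> cls a\<in>cg (quo e s) u"
 unfolding q by force

lemma quoE:
 assumes "X\<in>cg (quo e s) u"
 obtains a where "a\<in>hA u" "a\<otimes>e = a" "X = cls a"
proof -
 obtain a where a: "a\<in>hA u" "X = cls (a\<otimes>e)" using assms unfolding q by blast
 have "a\<otimes>e\<otimes>e = a\<otimes>e" using A.m_assoc[OF hcompD(1)[OF a(1)] ec ec] e(2) by simp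
 thus thesis using that hcomp_mult'[OF a(1) e(1)] a(2) by simp
qed

lemma left_gen_homog:
 assumes "w\<in>L" "w\<in>hA v" obtains b where "b\<in>hA (v - 2 * m)" "w = b\<otimes>s"
proof -
 obtain b where b: "b\<in>carrier A" "w = b\<otimes>s" using assms(1) by (auto simp: left_gen_def)
 have "w = hp v (b\<otimes>s)" using hp(2)[OF assms(2)] b(2) by simp
 thus thesis using that[of "hp (v - 2 * m) b"] hp(1)[OF b(1)] hp(4)[OF b(1) s(1)] by simp
qed

lemma cls_s: "cls s = L"
proof -
 have "s\<in>L" unfolding left_gen_def using A.l_one[OF sc] A.one_closed by (metis image_eqI)
 thus ?thesis using L.coset_zero_iff[OF sc] by simp
qed

lemma K_simps:
 "gr K u = hom_space (gr (quo e s) (m - u)) ground"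
 "act K v u a ph = (\<lambda>x\<in>cg (quo e s) (m - u - v). ph (act (quo e s) v (m - u - v) (tau a) x))"
proof -
 have "- (u - m) = m - u" "- (v + (u - m)) = m - u - v" by simp_all
 thus "gr K u = hom_space (gr (quo e s) (m - u)) ground"
  "act K v u a ph = (\<lambda>x\<in>cg (quo e s) (m - u - v). ph (act (quo e s) v (m - u - v) (tau a) x))"
  by (simp_all only: gker_def shift_simps dual_simps)
qed

lemma cls_e: "cls e\<in>cg (quo e s) 0" by (rule cls_mem[OF e(1,2)])

text \<open>Homomorphisms to \<open>K\<close> correspond to the functionals on the component of degree \<open>m\<close> that
 are invariant under \<open>e\<close> and vanish on multiples of \<open>s\<close>, by evaluation at the class of \<open>e\<close>.\<close>

lemma eval_hom:
 assumes F: "gmod F" and ph: "ph\<in>carrier (ghom A F K)" and r: "r\<in>cg F u"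
  and a: "a\<in>hA (m - u)" "a\<otimes>e = a"
 shows "ph m (act F (m - u) u (tau a) r) (cls e) = ph u r (cls a)"
proof -
 have "ph (m - u + u) (act F (m - u) u (tau a) r) (cls e) = act K (m - u) u (tau a) (ph u r) (cls e)"
  using ghomD(2)[OF ph tau(1)[OF a(1)] r] by simp
 also have "\<dots> = ph u r (cls a)"
 proof -
  have "m - u - (m - u) = 0" by simp
  thus ?thesis
  by (simp only: K_simps(2) tau(6)[OF hcompD(1)[OF a(1)]] restrict_apply cls_e if_True q(5)[OF hcompD(1)[OF a(1)] ec] a(2))
 qed
 finally show ?thesis by simp
qed

lemma eval_linear:
 assumes F: "gmod F" and ph: "ph\<in>carrier (ghom A F K)"
 shows "x\<in>cg F m ==> y\<in>cg F m ==> ph m (x \<oplus>\<^bsub>gr F m\<^esub> y) (cls e) = ph m x (cls e) + ph m y (cls e)"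
  and "x\<in>cg F m ==> ph m (c \<odot>\<^bsub>gr F m\<^esub> x) (cls e) = c * ph m x (cls e)"
 using lm_simps(2,3)[OF ghomD(1)[OF ph, of m]] cls_e by (simp_all add: K_simps(1))

lemma eval_e:
 assumes F: "gmod F" and ph: "ph\<in>carrier (ghom A F K)" and r: "r\<in>cg F m"
 shows "ph m (act F 0 m e r) (cls e) = ph m r (cls e)"
 using eval_hom[OF F ph r, of e] e by simp

lemma eval_s:
 assumes F: "gmod F" and ph: "ph\<in>carrier (ghom A F K)" and r: "r\<in>cg F (- m)"
 shows "ph m (act F (2 * m) (- m) s r) (cls e) = 0"
proof -
 have m2: "m - - m = 2 * m" by simp
 have "ph m (act F (2 * m) (- m) s r) (cls e) = ph (- m) r (cls s)"
  using eval_hom[OF F ph r, of s, unfolded m2] s by simp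
 also have "\<dots> = 0"
 proof -
  have "ph (- m) r\<in>lin_maps (gr (quo e s) (2 * m)) ground"
  using lm_simps(1)[OF ghomD(1)[OF ph] r] unfolding K_simps(1) m2 hom_simps .
  from lin_maps_zero[OF gmodD(1)[OF gmod_quo'] kspace_ground this] show ?thesis
  unfolding cls_s q(2) by simp
 qed
 finally show ?thesis .
qed

text \<open>By \<open>eval_hom\<close> the value of \<open>ph u r\<close> at the class of
  \<open>a\<close> must be \<open>l\<close> at \<open>tau a\<close> applied to \<open>r\<close>. Two
  representatives differ by some \<open>c\<close> times \<open>s\<close>, which \<open>tau\<close>
  turns into \<open>s\<close> times \<open>tau c\<close>, and \<open>l\<close> kills multiples of
  \<open>s\<close>; so the value is well defined.\<close>

lemma hom_of_functional:
 assumes F: "gmod F"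
  and l: "!!x y. x\<in>cg F m ==> y\<in>cg F m ==> l (x \<oplus>\<^bsub>gr F m\<^esub> y) = l x + l y"
  "!!c x. x\<in>cg F m ==> l (c \<odot>\<^bsub>gr F m\<^esub> x) = c * l x"
  and le: "!!r. r\<in>cg F m ==> l (act F 0 m e r) = l r"
  and ls: "!!r. r\<in>cg F (- m) ==> l (act F (2 * m) (- m) s r) = 0"
 obtains ph where "ph\<in>carrier (ghom A F K)" "!!r. r\<in>cg F m ==> ph m r (cls e) = l r"
proof -
 note FD = gmodD[OF F]
 define f where "f = (%u r X. l (act F (m - u) u (tau (SOME a. a\<in>hA (m - u) & a\<otimes>e = a & X = cls a)) r))"
 have act: "act F (m - u) u (tau a) r\<in>cg F m" if "a\<in>hA (m - u)" "r\<in>cg F u" for u a r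
  using FD(2)[OF tau(1)[OF that(1)] that(2)] by simp
 have f: "f u r (cls a) = l (act F (m - u) u (tau a) r)"
  if a: "a\<in>hA (m - u)" "a\<otimes>e = a" and r: "r\<in>cg F u" for u r a
 proof -
  define b where "b = (SOME b. b\<in>hA (m - u) & b\<otimes>e = b & cls a = cls b)"
  have b: "b\<in>hA (m - u)" "cls a = cls b"
  using someI_ex[of "%b. b\<in>hA (m - u) & b\<otimes>e = b & cls a = cls b"] a unfolding b_def by blast+
  note ac = hcompD(1)[OF a(1)] and bc = hcompD(1)[OF b(1)]
  obtain w where w: "w\<in>L" "b = w\<oplus>a" using L.coset_eq_iff[OF bc ac] b(2) by metis
  note wc = L.W_carrier[OF w(1)]
  have "w = b\<oplus>(- 1) \<odot> a" unfolding w(2) AD(10)[OF ac, symmetric] using wc ac by (simp add: A.a_assoc A.r_neg)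
  hence wh: "w\<in>hA (m - u)" using hcompD(3)[OF b(1) hcompD(4)[OF a(1)]] by simp
  obtain c where c: "c\<in>hA (m - u - 2 * m)" "w = c\<otimes>s" by (rule left_gen_homog[OF w(1) wh])
  have e1: "m - u = 2 * m + (m - u - 2 * m)" "m - u - 2 * m + u = - m" by simp_all
  have "act F (m - u) u (tau w) r = act F (2 * m + (m - u - 2 * m)) u (s\<otimes>tau c) r"
  unfolding c(2) tau(5)[OF hcompD(1)[OF c(1)] sc] s(4) by (simp only: e1(1)[symmetric])
  also have "\<dots> = act F (2 * m) (- m) s (act F (m - u - 2 * m) u (tau c) r)"
  using FD(7)[OF tau(1)[OF c(1)] s(1) r] unfolding e1(2) .
  finally have "l (act F (m - u) u (tau w) r) = 0"
  using ls[of "act F (m - u - 2 * m) u (tau c) r"] FD(2)[OF tau(1)[OF c(1)] r] by simp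
  moreover have "act F (m - u) u (tau b) r = act F (m - u) u (tau w) r \<oplus>\<^bsub>gr F m\<^esub> act F (m - u) u (tau a) r"
  unfolding w(2) tau(3)[OF wc ac] using FD(5)[OF tau(1)[OF wh] tau(1)[OF a(1)] r] by simp
  ultimately show ?thesis unfolding f_def b_def[symmetric] using l(1)[OF act[OF wh r] act[OF a(1) r]] by simp
 qed
 let ?Q = "%u. gr (quo e s) (m - u)"
 define ph where "ph = (%u. \<lambda>r\<in>cg F u. restrict (f u r) (carrier (?Q u)))"
 have fl: "restrict (f u r) (carrier (?Q u))\<in>lin_maps (?Q u) ground" if r: "r\<in>cg F u" for u r
 proof (rule lm_restrict[OF gmodD(1)[OF gmod_quo']])
  fix X assume "X\<in>carrier (?Q u)"
  then obtain a where a: "a\<in>hA (m - u)" "a\<otimes>e = a" "X = cls a" by (rule quoE)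
  note ac = hcompD(1)[OF a(1)]
  show "f u r X\<in>carrier ground" by simp
  show "f u r (k \<odot>\<^bsub>?Q u\<^esub> X) = k \<odot>\<^bsub>ground\<^esub> f u r X" for k
  proof -
  have "(k \<odot> a)\<otimes>e = k \<odot> a" using smult_mult(1)[OF ac ec] a(2) by simp
  thus ?thesis
  unfolding a(3) q(4)[OF ac] using f[OF hcompD(4)[OF a(1)] _ r] f[OF a(1,2) r] tau(4)[OF ac]
  FD(6)[OF tau(1)[OF a(1)] r] l(2)[OF act[OF a(1) r]] by simp
  qed
  fix Y assume "Y\<in>carrier (?Q u)"
  then obtain b where b: "b\<in>hA (m - u)" "b\<otimes>e = b" "Y = cls b" by (rule quoE)
  note bc = hcompD(1)[OF b(1)]
  have "(a\<oplus>b)\<otimes>e = a\<oplus>b" using A.l_distr[OF ac bc ec] a(2) b(2) by simp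
  thus "f u r (X \<oplus>\<^bsub>?Q u\<^esub> Y) = f u r X \<oplus>\<^bsub>ground\<^esub> f u r Y"
  unfolding a(3) b(3) q(3)[OF ac bc] using f[OF hcompD(3)[OF a(1) b(1)] _ r] f[OF a(1,2) r] f[OF b(1,2) r] tau(3)[OF ac bc]
  FD(5)[OF tau(1)[OF a(1)] tau(1)[OF b(1)] r] l(1)[OF act[OF a(1) r] act[OF b(1) r]] by simp
 qed
 have "ph\<in>carrier (ghom A F K)"
  unfolding ghom_simps(1) mem_Collect_eq
 proof (intro conjI allI ballI)
  show "ph u\<in>lin_maps (gr F u) (gr K u)" for u
  unfolding K_simps(1) ph_def
  proof (rule lm_restrict[OF FD(1)])
  fix r assume r: "r\<in>cg F u"
  show "restrict (f u r) (carrier (?Q u))\<in>carrier (hom_space (?Q u) ground)" using fl[OF r] by simp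
  show "restrict (f u (k \<odot>\<^bsub>gr F u\<^esub> r)) (carrier (?Q u)) = k \<odot>\<^bsub>hom_space (?Q u) ground\<^esub> restrict (f u r) (carrier (?Q u))" for k
  unfolding hom_simps
  proof (rule restrict_ext)
  fix X assume X: "X\<in>carrier (?Q u)"
  then obtain a where a: "a\<in>hA (m - u)" "a\<otimes>e = a" "X = cls a" by (rule quoE)
  show "f u (k \<odot>\<^bsub>gr F u\<^esub> r) X = k \<odot>\<^bsub>ground\<^esub> restrict (f u r) (carrier (?Q u)) X"
  unfolding a(3) using X a(3) f[OF a(1,2) r] f[OF a(1,2) kspaceD(3)[OF FD(1) r]] FD(4)[OF tau(1)[OF a(1)] r] l(2)[OF act[OF a(1) r]] by simp
  qed
  fix r' assume r': "r'\<in>cg F u"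
  show "restrict (f u (r \<oplus>\<^bsub>gr F u\<^esub> r')) (carrier (?Q u))
  = restrict (f u r) (carrier (?Q u)) \<oplus>\<^bsub>hom_space (?Q u) ground\<^esub> restrict (f u r') (carrier (?Q u))"
  unfolding hom_simps
  proof (rule restrict_ext)
  fix X assume X: "X\<in>carrier (?Q u)"
  then obtain a where a: "a\<in>hA (m - u)" "a\<otimes>e = a" "X = cls a" by (rule quoE)
  show "f u (r \<oplus>\<^bsub>gr F u\<^esub> r') X = restrict (f u r) (carrier (?Q u)) X \<oplus>\<^bsub>ground\<^esub> restrict (f u r') (carrier (?Q u)) X"
  unfolding a(3) using X a(3) f[OF a(1,2) r] f[OF a(1,2) r'] f[OF a(1,2) kspaceD(2)[OF FD(1) r r']]
  FD(3)[OF tau(1)[OF a(1)] r r'] l(1)[OF act[OF a(1) r] act[OF a(1) r']] by simp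
  qed
  qed
  fix v u b r assume b: "b\<in>hA v" and r: "r\<in>cg F u"
  have eq: "m - (v + u) = m - u - v" by simp
  have "ph (v + u) (act F v u b r) = restrict (f (v + u) (act F v u b r)) (cg (quo e s) (m - u - v))"
  using FD(2)[OF b r] by (simp only: ph_def restrict_apply if_True eq)
  also have "\<dots> = act K v u b (ph u r)"
  unfolding K_simps(2)
  proof (rule restrict_ext)
  fix X assume "X\<in>cg (quo e s) (m - u - v)"
  then obtain a where a: "a\<in>hA (m - u - v)" "a\<otimes>e = a" "X = cls a" by (rule quoE)
  note ac = hcompD(1)[OF a(1)] and bc = hcompD(1)[OF b] and tb = tau(1)[OF b]
  have ba: "tau b\<otimes>a\<in>hA (m - u)" "tau b\<otimes>a\<otimes>e = tau b\<otimes>a"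
  using hcomp_mult[OF tb a(1)] A.m_assoc[OF hcompD(1)[OF tb] ac ec] a(2) by simp_all
  have "f (v + u) (act F v u b r) X = l (act F (m - u - v) (v + u) (tau a) (act F v u b r))"
  unfolding a(3) using f[of a "v + u" "act F v u b r"] a(1,2) FD(2)[OF b r] by (simp only: eq)
  also have "act F (m - u - v) (v + u) (tau a) (act F v u b r) = act F (m - u - v + v) u (tau a\<otimes>b) r"
  using FD(7)[OF b tau(1)[OF a(1)] r] by simp
  also have "\<dots> = act F (m - u) u (tau (tau b\<otimes>a)) r"
  using tau(5)[OF hcompD(1)[OF tb] ac] tau(6)[OF bc] by simp
  also have "l \<dots> = f u r (cls (tau b\<otimes>a))" using f[OF ba r] by simp
  also have "\<dots> = ph u r (act (quo e s) v (m - u - v) (tau b) X)"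
  unfolding a(3) q(5)[OF hcompD(1)[OF tb] ac] using cls_mem[OF ba] r by (simp add: ph_def)
  finally show "f (v + u) (act F v u b r) X = ph u r (act (quo e s) v (m - u - v) (tau b) X)" .
  qed
  finally show "ph (v + u) (act F v u b r) = act K v u b (ph u r)" .
 qed
 moreover have "ph m r (cls e) = l r" if r: "r\<in>cg F m" for r
  using f[of e m r] e r cls_e le[OF r] by (simp add: ph_def)
 ultimately show ?thesis by (rule that)
qed

lemma hom_eqI:
 assumes F: "gmod F" and ph: "ph\<in>carrier (ghom A F K)" and ps: "ps\<in>carrier (ghom A F K)"
  and eq: "!!r. r\<in>cg F m ==> ph m r (cls e) = ps m r (cls e)"
 shows "ph = ps"
proof
 fix u show "ph u = ps u"
 proof (rule lin_maps_ext[OF ghomD(1)[OF ph] ghomD(1)[OF ps]])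
  fix r assume r: "r\<in>cg F u"
  have l: "ph u r\<in>lin_maps (gr (quo e s) (m - u)) ground" "ps u r\<in>lin_maps (gr (quo e s) (m - u)) ground"
  using lm_simps(1)[OF ghomD(1)[OF ph] r] lm_simps(1)[OF ghomD(1)[OF ps] r] by (simp_all add: K_simps(1))
  show "ph u r = ps u r"
  proof (rule lin_maps_ext[OF l])
  fix X assume "X\<in>cg (quo e s) (m - u)"
  then obtain a where a: "a\<in>hA (m - u)" "a\<otimes>e = a" "X = cls a" by (rule quoE)
  have "act F (m - u) u (tau a) r\<in>cg F m" using gmodD(2)[OF F tau(1)[OF a(1)] r] by simp
  thus "ph u r X = ps u r X"
  unfolding a(3) using eval_hom[OF F ph r a(1,2)] eval_hom[OF F ps r a(1,2)] eq by simp
  qed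
 qed
qed

end

section \<open>Extensions of a graded module by a generic kernel\<close>

context graded_vertex
begin

text \<open>The space \<open>soc X\<close> of elements of \<open>eX\<close> of degree \<open>-m\<close> killed by \<open>s\<close>; it is dual to the
 extensions of \<open>X\<close> by \<open>K\<close>.\<close>

definition soc :: "('k, 'a, 'm) gmodule => 'm set" where
 "soc X = {x\<in>cg X (- m). act X 0 (- m) e x = x & act X (2 * m) (- m) s x = \<zero>\<^bsub>gr X m\<^esub>}"

lemma act_e_s:
 assumes F: "gmod F" and f: "f\<in>cg F (- m)"
 shows "act F 0 m e (act F (2 * m) (- m) s f) = act F (2 * m) (- m) s f"
  and "act F (2 * m) (- m) s (act F 0 (- m) e f) = act F (2 * m) (- m) s f"
  and "act F (2 * m) (- m) s f\<in>cg F m"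
proof -
 have m2: "2 * m + - m = m" by simp
 show "act F 0 m e (act F (2 * m) (- m) s f) = act F (2 * m) (- m) s f"
  using gmodD(7)[OF F s(1) e(1) f, unfolded m2 add_0_left s(2)] by simp
 show "act F (2 * m) (- m) s (act F 0 (- m) e f) = act F (2 * m) (- m) s f"
  using gmodD(7)[OF F e(1) s(1) f, unfolded add_0_left add_0_right s(3)] by simp
 show "act F (2 * m) (- m) s f\<in>cg F m"
  using gmodD(2)[OF F s(1) f, unfolded m2] .
qed

lemma act_e_e:
 assumes F: "gmod F" and f: "f\<in>cg F u"
 shows "act F 0 u e (act F 0 u e f) = act F 0 u e f" "act F 0 u e f\<in>cg F u"
 using gmodD(7)[OF F e(1) e(1) f, unfolded add_0_left e(2)] gmodD(2)[OF F e(1) f, unfolded add_0_left] by simp_all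

lemma ksub_soc:
 assumes X: "gmod X" shows "ksub (gr X (- m)) (soc X)"
proof -
 note D = gmodD[OF X] and k = kspaceD[OF gmodD(1)[OF X]]
 have m2: "2 * m + - m = m" by simp
 note se = D(3,4)[OF s(1), where u = "- m", unfolded m2] D(3,4)[OF e(1), where u = "- m", unfolded add_0_left]
  act_zero[OF X s(1), where u = "- m", unfolded m2] act_zero[OF X e(1), where u = "- m", unfolded add_0_left]
 have "x \<oplus>\<^bsub>gr X u\<^esub> \<zero>\<^bsub>gr X u\<^esub> = x" if "x\<in>cg X u" for x u
 proof -
  interpret module ground "gr X u" by (rule D(1))
  show ?thesis using that by simp
 qed
 thus ?thesis unfolding ksub_def soc_def by (auto simp: se k)
qed

lemma kspace_soc: "gmod X ==> kspace ((gr X (- m))\<lparr>carrier := soc X\<rparr>)"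
 by (rule kspace_ksub[OF gmodD(1) ksub_soc])

text \<open>Extend first and compose with \<open>e\<close> afterwards: idempotency makes the result
  invariant, and the conditions \<open>inv\<close> ensure that the prescribed values
  survive.\<close>

lemma extend_invariant:
 fixes X :: "('k, 'a, 'm) gmodule" and V' :: "('k, 'w, 'y) module_scheme" and h :: "'w => 'k"
 defines "F \<equiv> Fr X"
 assumes N: "ksub (gr F m) N" and V': "kspace V'" "ksub V' P"
  and g: "!!p. p\<in>P ==> g p\<in>cg F m" "!!p p'. p\<in>P ==> p'\<in>P ==> g (p \<oplus>\<^bsub>V'\<^esub> p') = g p \<oplus>\<^bsub>gr F m\<^esub> g p'"
  "!!c p. p\<in>P ==> g (c \<odot>\<^bsub>V'\<^esub> p) = c \<odot>\<^bsub>gr F m\<^esub> g p"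
  and h: "!!p p'. p\<in>P ==> p'\<in>P ==> h (p \<oplus>\<^bsub>V'\<^esub> p') = h p + h p'" "!!c p. p\<in>P ==> h (c \<odot>\<^bsub>V'\<^esub> p) = c * h p"
  and compat: "!!p. p\<in>P ==> g p\<in>N ==> h p = 0"
  and inv: "!!x. x\<in>N ==> act F 0 m e x\<in>N" "!!p. p\<in>P ==> \<exists>p'\<in>P. act F 0 m e (g p) = g p' & h p' = h p"
 obtains l where "!!x y. x\<in>cg F m ==> y\<in>cg F m ==> l (x \<oplus>\<^bsub>gr F m\<^esub> y) = l x + l y"
  "!!c x. x\<in>cg F m ==> l (c \<odot>\<^bsub>gr F m\<^esub> x) = c * l x"
  "!!r. r\<in>cg F m ==> l (act F 0 m e r) = l r"
  "!!p. p\<in>P ==> l (g p) = h p" "!!x. x\<in>N ==> l x = 0"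
proof -
 have F: "gmod F" unfolding F_def by (rule gmod_Fr)
 note FD = gmodD[OF F] and ee = act_e_e[OF F]
 obtain l where l: "!!x y. x\<in>cg F m ==> y\<in>cg F m ==> l (x \<oplus>\<^bsub>gr F m\<^esub> y) = l x + l y"
  "!!c x. x\<in>cg F m ==> l (c \<odot>\<^bsub>gr F m\<^esub> x) = c * l x" "!!p. p\<in>P ==> l (g p) = h p" "!!x. x\<in>N ==> l x = 0"
  by (rule extend_functional[OF FD(1) free_cover_coord[where M = X and u = m, folded F_def] N V' g h compat]) (assumption | blast)+
 show thesis
 proof (rule that[of "%x. l (act F 0 m e x)"])
  show "l (act F 0 m e (g p)) = h p" if "p\<in>P" for p using inv(2)[OF that] l(3) by auto
 qed (use l(4) inv(1) ee in \<open>simp_all add: l(1,2) FD(3,4)[OF e(1), of _ m, unfolded add_0_left]\<close>)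
qed

text \<open>A map from the syzygies to \<open>K\<close> amounts to a functional on their component
  of degree \<open>m\<close>. It extends to the free cover exactly when it vanishes on those
  syzygies that are multiples by \<open>s\<close> of elements of the cover, and modulo
  \<open>s\<close> times syzygies these are given by \<open>soc X\<close>. That every functional on
  \<open>soc X\<close> occurs rests on torsion-freeness, by which \<open>s f\<close> determines
  \<open>e f\<close> in the free cover.\<close>

lemma Ext1_iso_dual:
 fixes X :: "('k, 'a, 'm) gmodule"
 assumes X: "gmod X"
 defines "U \<equiv> hom_space ((gr X (- m))\<lparr>carrier := soc X\<rparr>) ground"
 shows "lin_iso (Ext1 A X K) U" "kspace (Ext1 A X K)" "kspace U"
proof -
 let ?F = "Fr X" and ?R = "Sy X" and ?Z = "(gr X (- m))\<lparr>carrier := soc X\<rparr>"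
 let ?s = "act ?F (2 * m) (- m) s" and ?e = "act ?F 0 (- m) e"
 define W where "W = (%ph u. restrict (ph u) (cg ?R u)) ` carrier (ghom A ?F K)"
 \<comment> \<open>The connecting map: lift \<open>x\<close> to its generator in the free cover and
   multiply by \<open>s\<close>; the result is a syzygy because \<open>s\<close> kills
   \<open>x\<close>.\<close>
 define T where "T = (%ph. \<lambda>x\<in>soc X. ph m (?s (gen (- m) x)) (cls e) :: 'k)"
 note gF = gmod_Fr[of X] and gR = gmod_syzygy[OF X]
 note FD = gmodD[OF gF] and RD = gmodD[OF gR] and XD = gmodD[OF X]
 note Fk = kspaceD[OF gmodD(1)[OF gF]] and Xk = kspaceD[OF gmodD(1)[OF X]]
 note R = syzygy_simps[where M = X]
 have m2: "2 * m + - m = m" by simp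
 interpret Fm: module ground "gr ?F m" by (rule FD(1))
 interpret Xm: module ground "gr X (- m)" by (rule XD(1))
 have V: "kspace (ghom A ?R K)" by (rule kspace_ghom[OF gR gmod_K])
 interpret V: module ground "ghom A ?R K" by (rule V)
 show U: "kspace U" unfolding U_def by (rule kspace_hom_space[OF kspace_soc[OF X] kspace_ground])
 have sF: "?s f\<in>cg ?F m" if "f\<in>cg ?F (- m)" for f
  by (rule act_e_s(3)[OF gF that])
 have cov_s: "cover_map A X m (?s f) = act X (2 * m) (- m) s (cover_map A X (- m) f)" if "f\<in>cg ?F (- m)" for f
  using cm_act[OF X that s(1), unfolded m2] .
 have s_lin: "?s (f \<oplus>\<^bsub>gr ?F (- m)\<^esub> g) = ?s f \<oplus>\<^bsub>gr ?F m\<^esub> ?s g" "?s (c \<odot>\<^bsub>gr ?F (- m)\<^esub> f) = c \<odot>\<^bsub>gr ?F m\<^esub> ?s f"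
  if "f\<in>cg ?F (- m)" "g\<in>cg ?F (- m)" for f g c
  using FD(3)[OF s(1) that, unfolded m2] FD(4)[OF s(1) that(1), where c = c, unfolded m2] by simp_all
 have socD: "x\<in>cg X (- m)" "act X 0 (- m) e x = x" "act X (2 * m) (- m) s x = \<zero>\<^bsub>gr X m\<^esub>" if "x\<in>soc X" for x
  using that by (auto simp: soc_def)
 have gen: "gen (- m) x\<in>cg ?F (- m)" if "x\<in>soc X" for x
  by (rule gen_closed[OF socD(1)[OF that]])
 have sgen: "?s (gen (- m) x)\<in>cg ?R m" if "x\<in>soc X" for x
  unfolding R(1) using sF[OF gen[OF that]] cov_s[OF gen[OF that]] cm_gen[OF X socD(1)[OF that]] socD(3)[OF that] by simp
 have RF: "f\<in>cg ?R u ==> f\<in>cg ?F u" for f u by (simp add: R(1))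
 have ev: "x\<in>cg ?R m ==> y\<in>cg ?R m ==> ph m (x \<oplus>\<^bsub>gr ?F m\<^esub> y) (cls e) = ph m x (cls e) + ph m y (cls e)"
  "x\<in>cg ?R m ==> ph m (c \<odot>\<^bsub>gr ?F m\<^esub> x) (cls e) = c * ph m x (cls e)"
  if "ph\<in>carrier (ghom A ?R K)" for ph x y c
  using eval_linear[OF gR that] unfolding R(2,3) by blast+
 have ev_s: "ph m (?s r) (cls e) = 0" if "ph\<in>carrier (ghom A ?R K)" "r\<in>cg ?R (- m)" for ph r
  using eval_s[OF gR that] unfolding R(5) .
 have diff: "f \<oplus>\<^bsub>gr ?F (- m)\<^esub> (- 1) \<odot>\<^bsub>gr ?F (- m)\<^esub> g\<in>cg ?R (- m)"
  if "f\<in>cg ?F (- m)" "g\<in>cg ?F (- m)" "cover_map A X (- m) f = cover_map A X (- m) g" for f g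
 proof -
  have "cover_map A X (- m) (f \<oplus>\<^bsub>gr ?F (- m)\<^esub> (- 1) \<odot>\<^bsub>gr ?F (- m)\<^esub> g)
  = cover_map A X (- m) g \<oplus>\<^bsub>gr X (- m)\<^esub> (- 1) \<odot>\<^bsub>gr X (- m)\<^esub> cover_map A X (- m) g"
  using cover_map_add[OF X that(1) Fk(3)[OF that(2)]] cm_smult[OF X that(2)] that(3) by simp
  also have "\<dots> = \<zero>\<^bsub>gr X (- m)\<^esub>"
  using Xk(10)[OF cm_closed[OF X that(2)]] Xm.r_neg[OF cm_closed[OF X that(2)]] by simp
  finally show ?thesis unfolding R(1) using Fk(2)[OF that(1) Fk(3)[OF that(2)]] by simp
 qed
 \<comment> \<open>Two lifts of the same element differ by a syzygy, and functionals that come from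
   maps to \<open>K\<close> vanish on \<open>s\<close> times syzygies.\<close>
 have ev_diff: "ph m (?s f) (cls e) = ph m (?s g) (cls e)"
  if p: "ph\<in>carrier (ghom A ?R K)" and fg: "f\<in>cg ?F (- m)" "g\<in>cg ?F (- m)"
  "cover_map A X (- m) f = cover_map A X (- m) g" "?s f\<in>cg ?R m" for ph f g
 proof -
  have sg: "?s g\<in>cg ?R m" using fg(4) sF[OF fg(2)] cov_s[OF fg(1)] cov_s[OF fg(2)] fg(3) by (simp add: R(1))
  have sg': "(- 1) \<odot>\<^bsub>gr ?F m\<^esub> ?s g\<in>cg ?R m"
  using ksub_syzygy[OF X, of m] sg by (auto simp: ksub_def)
  have "0 = ph m (?s (f \<oplus>\<^bsub>gr ?F (- m)\<^esub> (- 1) \<odot>\<^bsub>gr ?F (- m)\<^esub> g)) (cls e)" using ev_s[OF p diff[OF fg(1-3)]] by simp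
  also have "\<dots> = ph m (?s f) (cls e) - ph m (?s g) (cls e)"
  unfolding s_lin(1)[OF fg(1) Fk(3)[OF fg(2)]] s_lin(2)[OF fg(2) fg(2)] using ev(1)[OF p fg(4) sg'] ev(2)[OF p sg] by simp
  finally show ?thesis by simp
 qed
 have T1: "T ph\<in>carrier U" if p: "ph\<in>carrier (ghom A ?R K)" for ph
 proof -
  have "T ph\<in>lin_maps ?Z ground"
  proof -
  have "restrict (%x. ph m (?s (gen (- m) x)) (cls e)) (carrier ?Z)\<in>lin_maps ?Z ground"
  proof (rule lm_restrict[OF kspace_soc[OF X]])
  fix x assume "x\<in>carrier ?Z" hence x: "x\<in>soc X" by simp
  show "ph m (?s (gen (- m) (c \<odot>\<^bsub>?Z\<^esub> x))) (cls e) = c \<odot>\<^bsub>ground\<^esub> ph m (?s (gen (- m) x)) (cls e)" for c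
  proof -
  have cx: "c \<odot>\<^bsub>gr X (- m)\<^esub> x\<in>soc X" using ksub_soc[OF X] x by (auto simp: ksub_def)
  have "ph m (?s (gen (- m) (c \<odot>\<^bsub>gr X (- m)\<^esub> x))) (cls e) = ph m (?s (c \<odot>\<^bsub>gr ?F (- m)\<^esub> gen (- m) x)) (cls e)"
  by (rule ev_diff[OF p gen[OF cx] Fk(3)[OF gen[OF x]] _ sgen[OF cx]])
  (simp only: cm_smult[OF X gen[OF x]] cm_gen[OF X socD(1)[OF cx]] cm_gen[OF X socD(1)[OF x]])
  thus ?thesis unfolding s_lin(2)[OF gen[OF x] gen[OF x]] using ev(2)[OF p sgen[OF x]] by simp
  qed
  fix y assume "y\<in>carrier ?Z" hence y: "y\<in>soc X" by simp
  have xy: "x \<oplus>\<^bsub>gr X (- m)\<^esub> y\<in>soc X" using ksub_soc[OF X] x y by (auto simp: ksub_def)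
  have "ph m (?s (gen (- m) (x \<oplus>\<^bsub>gr X (- m)\<^esub> y))) (cls e) = ph m (?s (gen (- m) x \<oplus>\<^bsub>gr ?F (- m)\<^esub> gen (- m) y)) (cls e)"
  by (rule ev_diff[OF p gen[OF xy] Fk(2)[OF gen[OF x] gen[OF y]] _ sgen[OF xy]])
  (simp only: cover_map_add[OF X gen[OF x] gen[OF y]] cm_gen[OF X socD(1)[OF xy]]
  cm_gen[OF X socD(1)[OF x]] cm_gen[OF X socD(1)[OF y]])
  thus "ph m (?s (gen (- m) (x \<oplus>\<^bsub>?Z\<^esub> y))) (cls e) = ph m (?s (gen (- m) x)) (cls e) \<oplus>\<^bsub>ground\<^esub> ph m (?s (gen (- m) y)) (cls e)"
  unfolding s_lin(1)[OF gen[OF x] gen[OF y]] using ev(1)[OF p sgen[OF x] sgen[OF y]] by simp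
  qed simp
  thus ?thesis by (simp add: T_def)
  qed
  thus ?thesis by (simp add: U_def)
 qed
 have T2: "T (ph \<oplus>\<^bsub>ghom A ?R K\<^esub> ps) = T ph \<oplus>\<^bsub>U\<^esub> T ps" "T (c \<odot>\<^bsub>ghom A ?R K\<^esub> ph) = c \<odot>\<^bsub>U\<^esub> T ph"
  if "ph\<in>carrier (ghom A ?R K)" for ph ps c
 proof -
  have add: "(ph \<oplus>\<^bsub>ghom A ?R K\<^esub> ps) m r (cls e) = ph m r (cls e) + ps m r (cls e)"
  "(c \<odot>\<^bsub>ghom A ?R K\<^esub> ph) m r (cls e) = c * ph m r (cls e)" if "r\<in>cg ?R m" for r
  using that cls_e by (simp_all add: ghom_simps K_simps(1))
  show "T (ph \<oplus>\<^bsub>ghom A ?R K\<^esub> ps) = T ph \<oplus>\<^bsub>U\<^esub> T ps" "T (c \<odot>\<^bsub>ghom A ?R K\<^esub> ph) = c \<odot>\<^bsub>U\<^esub> T ph"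
  by (rule ext; simp add: T_def U_def restrict_def add sgen)+
 qed
 have surj: "\<exists>ph\<in>carrier (ghom A ?R K). T ph = tht" if "tht\<in>carrier U" for tht
 proof -
  have th: "tht\<in>lin_maps ?Z ground" using that by (simp add: U_def)
  note tl = lm_simps(2,3)[OF th, simplified]
  have t0: "tht \<zero>\<^bsub>gr X (- m)\<^esub> = 0" using lin_maps_zero[OF kspace_soc[OF X] kspace_ground th] by simp
  \<comment> \<open>The functional is prescribed on the multiples \<open>s f\<close> that are
    syzygies: there it is \<open>tht\<close> at the image of \<open>e f\<close> in
    \<open>X\<close>.\<close>
  let ?P = "{f\<in>cg ?F (- m). ?s f\<in>cg ?R m}"
  let ?c = "%f. cover_map A X (- m) (?e f)"
  note eF = act_e_e[OF gF, where u = "- m"]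
  have cP: "?c f\<in>soc X" if "f\<in>?P" for f
  proof -
  have f: "f\<in>cg ?F (- m)" "?s f\<in>cg ?R m" using that by auto
  have "act X (2 * m) (- m) s (?c f) = \<zero>\<^bsub>gr X m\<^esub>"
  using f(2) unfolding cov_s[OF eF(2)[OF f(1)], symmetric] act_e_s(2)[OF gF f(1)] R(1) by simp
  moreover have "act X 0 (- m) e (?c f) = ?c f"
  using cm_act[OF X eF(2)[OF f(1)] e(1), unfolded add_0_left eF(1)[OF f(1)]] by simp
  ultimately show ?thesis using cm_closed[OF X eF(2)[OF f(1)]] by (simp add: soc_def)
  qed
  have e_lin: "?c (f \<oplus>\<^bsub>gr ?F (- m)\<^esub> g) = ?c f \<oplus>\<^bsub>gr X (- m)\<^esub> ?c g" "?c (k \<odot>\<^bsub>gr ?F (- m)\<^esub> f) = k \<odot>\<^bsub>gr X (- m)\<^esub> ?c f"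
  if f: "f\<in>cg ?F (- m)" and g: "g\<in>cg ?F (- m)" for f g k
  using FD(3)[OF e(1) f g, unfolded add_0_left] FD(4)[OF e(1) f, where c = k, unfolded add_0_left]
  cover_map_add[OF X eF(2)[OF f] eF(2)[OF g]] cm_smult[OF X eF(2)[OF f], of k] by simp_all
  have kR: "x \<oplus>\<^bsub>gr ?F m\<^esub> y\<in>cg ?R m" "k \<odot>\<^bsub>gr ?F m\<^esub> x\<in>cg ?R m"
  if "x\<in>cg ?R m" "y\<in>cg ?R m" for x y k
  using ksub_syzygy[OF X, of m] that by (auto simp: ksub_def)
  \<comment> \<open>Torsion-freeness, entry by entry: \<open>s f = 0\<close> implies
    \<open>e f = 0\<close>, so the prescription depends on \<open>s f\<close> only.\<close>
  have c0: "?c f = \<zero>\<^bsub>gr X (- m)\<^esub>" if f: "f\<in>cg ?F (- m)" and "?s f = \<zero>\<^bsub>gr ?F m\<^esub>" for f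
  proof -
  have "s\<otimes>f p = \<zero>" for p using \<open>?s f = _\<close> unfolding cover_simps by metis
  hence "?e f = \<zero>\<^bsub>gr ?F (- m)\<^esub>" using torsion[OF coverD(4)[OF f]] by (simp add: cover_simps)
  thus ?thesis using cm_smult[OF X Fk(1), where c = 0] Xk(8) Fk(9) cm_closed[OF X Fk(1)] by metis
  qed
  have kP: "ksub (gr ?F (- m)) ?P"
  proof -
  have "?s \<zero>\<^bsub>gr ?F (- m)\<^esub> = \<zero>\<^bsub>gr ?F m\<^esub>" using act_zero[OF gF s(1), of "- m"] unfolding m2 .
  hence "?s \<zero>\<^bsub>gr ?F (- m)\<^esub>\<in>cg ?R m" using ksub_syzygy[OF X, of m] by (simp add: ksub_def)
  thus ?thesis unfolding ksub_def using Fk(1-3) kR s_lin by auto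
  qed
  have kN: "ksub (gr ?F m) {\<zero>\<^bsub>gr ?F m\<^esub>}" by (auto simp: ksub_def)
  have Pg: "?s p\<in>cg ?F m" "p'\<in>?P ==> ?s (p \<oplus>\<^bsub>gr ?F (- m)\<^esub> p') = ?s p \<oplus>\<^bsub>gr ?F m\<^esub> ?s p'"
  "?s (k \<odot>\<^bsub>gr ?F (- m)\<^esub> p) = k \<odot>\<^bsub>gr ?F m\<^esub> ?s p"
  "p'\<in>?P ==> tht (?c (p \<oplus>\<^bsub>gr ?F (- m)\<^esub> p')) = tht (?c p) + tht (?c p')" "tht (?c (k \<odot>\<^bsub>gr ?F (- m)\<^esub> p)) = k * tht (?c p)"
  "?s p\<in>{\<zero>\<^bsub>gr ?F m\<^esub>} ==> tht (?c p) = 0" "\<exists>p'\<in>?P. act ?F 0 m e (?s p) = ?s p' & tht (?c p') = tht (?c p)" if p: "p\<in>?P" for p p' k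
  proof -
  have f: "p\<in>cg ?F (- m)" using p by simp
  show "?s p\<in>cg ?F m" by (rule sF[OF f])
  show "?s (k \<odot>\<^bsub>gr ?F (- m)\<^esub> p) = k \<odot>\<^bsub>gr ?F m\<^esub> ?s p" by (rule s_lin(2)[OF f f])
  show "tht (?c (k \<odot>\<^bsub>gr ?F (- m)\<^esub> p)) = k * tht (?c p)" unfolding e_lin(2)[OF f f] tl(2)[OF cP[OF p]] ..
  show "\<exists>p'\<in>?P. act ?F 0 m e (?s p) = ?s p' & tht (?c p') = tht (?c p)" using p act_e_s(1)[OF gF f] by blast
  show "tht (?c p) = 0" if "?s p\<in>{\<zero>\<^bsub>gr ?F m\<^esub>}" using c0[OF f] that t0 by simp
  assume p': "p'\<in>?P"
  hence f': "p'\<in>cg ?F (- m)" by simp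
  show "?s (p \<oplus>\<^bsub>gr ?F (- m)\<^esub> p') = ?s p \<oplus>\<^bsub>gr ?F m\<^esub> ?s p'" by (rule s_lin(1)[OF f f'])
  show "tht (?c (p \<oplus>\<^bsub>gr ?F (- m)\<^esub> p')) = tht (?c p) + tht (?c p')" unfolding e_lin(1)[OF f f'] tl(1)[OF cP[OF p] cP[OF p']] ..
  qed
  have eN: "act ?F 0 m e x\<in>{\<zero>\<^bsub>gr ?F m\<^esub>}" if "x\<in>{\<zero>\<^bsub>gr ?F m\<^esub>}" for x using that act_zero[OF gF e(1), of m] by simp
  obtain l where l: "!!x y. x\<in>cg ?F m ==> y\<in>cg ?F m ==> l (x \<oplus>\<^bsub>gr ?F m\<^esub> y) = l x + (l y :: 'k)"
  "!!c x. x\<in>cg ?F m ==> l (c \<odot>\<^bsub>gr ?F m\<^esub> x) = c * l x"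
  "!!r. r\<in>cg ?F m ==> l (act ?F 0 m e r) = l r" "!!p. p\<in>?P ==> l (?s p) = tht (?c p)"
  by (rule extend_invariant[OF kN FD(1) kP Pg(1-6) eN Pg(7)]) (assumption | blast)+
  have ls: "l (act ?R (2 * m) (- m) s r) = 0" if r: "r\<in>cg ?R (- m)" for r
  proof -
  have rF: "r\<in>cg ?F (- m)" by (rule RF[OF r])
  have "?s r\<in>cg ?R m" using act_e_s(3)[OF gR r] unfolding R(5) .
  hence P: "r\<in>?P" using rF by simp
  have "?c r = \<zero>\<^bsub>gr X (- m)\<^esub>"
  using cm_act[OF X rF e(1), unfolded add_0_left] r act_zero[OF X e(1), of "- m"] by (simp add: R(1))
  thus ?thesis using l(4)[OF P] t0 unfolding R(5) by simp
  qed
  have lR: "l (x \<oplus>\<^bsub>gr ?R m\<^esub> y) = l x + l y" "l (k \<odot>\<^bsub>gr ?R m\<^esub> x) = k * l x" "l (act ?R 0 m e x) = l x"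
  if "x\<in>cg ?R m" "y\<in>cg ?R m" for x y k
  unfolding R(2,3,5) using l(1)[OF RF[OF that(1)] RF[OF that(2)]] l(2,3)[OF RF[OF that(1)]] by simp_all
  obtain ph where ph: "ph\<in>carrier (ghom A ?R K)" "!!r. r\<in>cg ?R m ==> ph m r (cls e) = l r"
  by (rule hom_of_functional[OF gR, of l, OF lR(1) lR(2) lR(3) ls]) (assumption | blast)+
  have "T ph = tht"
  proof (rule lin_maps_ext[OF _ th])
  show "T ph\<in>lin_maps ?Z ground" using T1[OF ph(1)] by (simp add: U_def)
  fix x assume "x\<in>carrier ?Z" hence x: "x\<in>soc X" by simp
  have "gen (- m) x\<in>?P" using gen[OF x] sgen[OF x] by simp
  from l(4)[OF this]
  have "l (?s (gen (- m) x)) = tht (?c (gen (- m) x))" .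
  also have "?c (gen (- m) x) = x"
  using cm_act[OF X gen[OF x] e(1), unfolded add_0_left] cm_gen[OF X socD(1)[OF x]] socD(2)[OF x] by simp
  finally show "T ph x = tht x" using x ph(2)[OF sgen[OF x]] by (simp add: T_def)
  qed
  thus ?thesis using ph(1) by blast
 qed
 have restr: "restrict (ps u) (cg ?R u) f = ps u f" if "f\<in>cg ?R u" for ps :: "int => (int \<times> 'm => 'a) => 'a set => 'k" and u f
  using that by simp
 have Wsub: "W \<subseteq> {ph\<in>carrier (ghom A ?R K). T ph = \<zero>\<^bsub>U\<^esub>}"
 proof
  fix ph assume "ph\<in>W"
  then obtain ps where p: "ps\<in>carrier (ghom A ?F K)" "ph = (%u. restrict (ps u) (cg ?R u))" by (auto simp: W_def)
  have "ph\<in>carrier (ghom A ?R K)"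
  unfolding ghom_simps(1) mem_Collect_eq
  proof (intro conjI allI ballI)
  show "ph u\<in>lin_maps (gr ?R u) (gr K u)" for u
  unfolding p(2) by (rule lm_restrict[OF RD(1)]) (simp_all add: R(2,3) lm_simps[OF ghomD(1)[OF p(1)]] RF)
  show "ph (v + u) (act ?R v u a x) = act K v u a (ph u x)" if "a\<in>hA v" "x\<in>cg ?R u" for v u a x
  using RD(2)[OF that] ghomD(2)[OF p(1) that(1) RF[OF that(2)]] that(2) unfolding p(2) R(5) by simp
  qed
  moreover have "T ph = \<zero>\<^bsub>U\<^esub>"
  unfolding T_def U_def p(2) by (rule ext) (simp add: restrict_def sgen eval_s[OF gF p(1) gen])
  ultimately show "ph\<in>{ph\<in>carrier (ghom A ?R K). T ph = \<zero>\<^bsub>U\<^esub>}" by blast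
 qed
 have ker: "ph\<in>W" if p: "ph\<in>carrier (ghom A ?R K)" and T0: "T ph = \<zero>\<^bsub>U\<^esub>" for ph
 proof -
  have gen0: "ph m (?s (gen (- m) x)) (cls e) = 0" if "x\<in>soc X" for x
  proof -
  have "T ph x = 0" unfolding T0 using that by (simp add: U_def)
  thus ?thesis using that by (simp add: T_def)
  qed
  note eF = act_e_e[OF gF, where u = "- m"]
  have s0: "ph m (?s f) (cls e) = 0" if f: "f\<in>cg ?F (- m)" and sf: "?s f\<in>cg ?R m" for f
  proof -
  let ?x = "cover_map A X (- m) (?e f)"
  have "act X (2 * m) (- m) s ?x = \<zero>\<^bsub>gr X m\<^esub>"
  using sf unfolding cov_s[OF eF(2)[OF f], symmetric] act_e_s(2)[OF gF f] R(1) by simp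
  moreover have "act X 0 (- m) e ?x = ?x"
  using cm_act[OF X eF(2)[OF f] e(1), unfolded add_0_left eF(1)[OF f]] by simp
  ultimately have x: "?x\<in>soc X" using cm_closed[OF X eF(2)[OF f]] by (simp add: soc_def)
  have "ph m (?s (?e f)) (cls e) = ph m (?s (gen (- m) ?x)) (cls e)"
  by (rule ev_diff[OF p eF(2)[OF f] gen[OF x]]) (simp_all only: cm_gen[OF X socD(1)[OF x]] act_e_s(2)[OF gF f] sf)
  thus ?thesis using gen0[OF x] act_e_s(2)[OF gF f] by simp
  qed
  \<comment> \<open>Extending by zero on the multiples of \<open>s\<close> is consistent because of
    \<open>s0\<close>, and vanishing there is what makes the extension a map to \<open>K\<close> on
    the whole cover.\<close>
  let ?N = "?s ` cg ?F (- m)"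
  have kN: "ksub (gr ?F m) ?N" by (rule ksub_image[OF FD(1) ksub_carrier[OF FD(1)] FD(1)]) (rule sF s_lin; assumption)+
  have eN: "act ?F 0 m e x\<in>?N" if "x\<in>?N" for x using that act_e_s(1)[OF gF] by auto
  have eR: "\<exists>r'\<in>cg ?R m. act ?F 0 m e r = r' & ph m r' (cls e) = ph m r (cls e)" if "r\<in>cg ?R m" for r
  using act_e_e(2)[OF gR that] eval_e[OF gR p that] unfolding R(5) by blast
  have rN: "ph m r (cls e) = 0" if "r\<in>cg ?R m" "r\<in>?N" for r using that s0 by auto
  obtain l where l: "!!x y. x\<in>cg ?F m ==> y\<in>cg ?F m ==> l (x \<oplus>\<^bsub>gr ?F m\<^esub> y) = l x + (l y :: 'k)"
  "!!c x. x\<in>cg ?F m ==> l (c \<odot>\<^bsub>gr ?F m\<^esub> x) = c * l x"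
  "!!r. r\<in>cg ?F m ==> l (act ?F 0 m e r) = l r"
  "!!r. r\<in>cg ?R m ==> l r = ph m r (cls e)" "!!x. x\<in>?N ==> l x = 0"
  by (rule extend_invariant[OF kN FD(1) ksub_syzygy[OF X] RF HOL.refl HOL.refl ev(1)[OF p] ev(2)[OF p] rN eN eR]) (assumption | blast)+
  note lR = l(4)
  have ls: "l (?s r) = 0" if "r\<in>cg ?F (- m)" for r
  using l(5) that by blast
  obtain ps where q: "ps\<in>carrier (ghom A ?F K)" "!!r. r\<in>cg ?F m ==> ps m r (cls e) = l r"
  by (rule hom_of_functional[OF gF, of l, OF l(1-3) ls]) (assumption | blast)+
  have w: "(%u. restrict (ps u) (cg ?R u))\<in>W" using q(1) by (simp add: W_def)
  have "ph = (%u. restrict (ps u) (cg ?R u))"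
  by (rule hom_eqI[OF gR p]) (use w Wsub lR q(2) RF in auto)
  thus ?thesis using w by simp
 qed
 have Wker: "W = {ph\<in>carrier (ghom A ?R K). T ph = \<zero>\<^bsub>U\<^esub>}" using Wsub ker by blast
 interpret U: module ground U by (rule U)
 note Vk = kspaceD[OF V] and Uk = kspaceD[OF U]
 have T0: "T \<zero>\<^bsub>ghom A ?R K\<^esub> = \<zero>\<^bsub>U\<^esub>" using T2(2)[OF Vk(1), of 0] Uk(8)[OF T1[OF Vk(1)]] unfolding Vk(9) by simp
 have "ksub (ghom A ?R K) W"
  unfolding ksub_def Wker using T2 T0 Vk(1-3) Uk(9) by auto
 then interpret Q: kquot "ghom A ?R K" W by unfold_locales
 have S: "ksub (ghom A ?R K) (carrier (ghom A ?R K))" by (auto simp: ksub_def)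
 have kW: "T ph = \<zero>\<^bsub>U\<^esub> \<longleftrightarrow> ph\<in>W" if "ph\<in>carrier (ghom A ?R K)" for ph
  unfolding Wker using that by blast
 have add: "T (ph \<oplus>\<^bsub>ghom A ?R K\<^esub> ps) = T ph \<oplus>\<^bsub>U\<^esub> T ps"
  if "ph\<in>carrier (ghom A ?R K)" "ps\<in>carrier (ghom A ?R K)" for ph ps
  by (fact T2(1)[OF that(1)])
 have E: "Ext1 A X K = coset_space (ghom A ?R K) W (carrier (ghom A ?R K))" by (simp add: Ext1_def W_def)
 show "kspace (Ext1 A X K)" unfolding E by (rule Q.kspace_cs[OF S])
 show "lin_iso (Ext1 A X K) U" unfolding E
  by (rule Q.coset_iso[OF S U, of T]) (erule T1, erule (1) add, erule T2(2), erule surj, erule kW)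
qed

end

section \<open>The two-sided quotient and the symmetry of extensions\<close>

context graded_algebra
begin

definition biquo :: "'a => 'a => 'a => 'a => ('k, 'a set) gvec" where
 "biquo e s e' s' = (%u. coset_space A (right_gen A s <+>\<^bsub>A\<^esub> left_gen A s') ((%x. e\<otimes>x\<otimes>e') ` hA u))"

end

locale vertex_pair = graded_vertex A tau hp rh e s m
 for A :: "('k::field, 'a) galgebra" (structure) and tau and hp and rh :: "'a => 'x => 'k" and e s :: 'a and m :: int +
 fixes e' s' :: 'a and m' :: int
 assumes vertex': "vertex e' s' m'"
begin

sublocale Q: graded_vertex A tau hp rh e' s' m' by unfold_locales (rule vertex')

definition W :: "'a set" where "W = right_gen A s <+>\<^bsub>A\<^esub> left_gen A s'"
definition S :: "int => 'a set" where "S g = {b\<in>hA g. e\<otimes>b = b & b\<otimes>e' = b}"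

lemma S_eq: "(%x. e\<otimes>x\<otimes>e') ` hA g = S g"
proof (intro equalityI subsetI)
 fix b assume "b\<in>(%x. e\<otimes>x\<otimes>e') ` hA g"
 then obtain x where x: "x\<in>hA g" "b = e\<otimes>x\<otimes>e'" by blast
 note xc = hcompD(1)[OF x(1)]
 have "b\<in>hA g" unfolding x(2) by (rule hcomp_mult'[OF hcomp_mult[OF e(1) x(1)] Q.e(1)]) simp
 moreover have "e\<otimes>b = b" "b\<otimes>e' = b"
  unfolding x(2) using e(2) Q.e(2) xc ec Q.ec A.m_assoc[symmetric, of e e x] A.m_assoc[symmetric, of e "e\<otimes>x" e']
  A.m_assoc[of "e\<otimes>x" e' e'] by simp_all
 ultimately show "b\<in>S g" by (simp add: S_def)
next
 fix b assume "b\<in>S g"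
 thus "b\<in>(%x. e\<otimes>x\<otimes>e') ` hA g" unfolding S_def by (intro image_eqI[of _ _ b]) auto
qed

lemma ksub_S: "ksub A (S g)"
 unfolding S_eq[symmetric]
 by (rule ksub_image[OF A_kspace hcomp A_kspace]) (auto simp: smult_mult A.l_distr A.r_distr ec Q.ec dest!: hcompD(1))

lemma W_iff: "w\<in>W \<longleftrightarrow> (\<exists>y\<in>carrier A. \<exists>z\<in>carrier A. w = s\<otimes>y\<oplus>z\<otimes>s')"
 unfolding W_def set_add_def' right_gen_def left_gen_def by blast

lemma W_I: "y\<in>carrier A ==> s\<otimes>y\<in>W" "z\<in>carrier A ==> z\<otimes>s'\<in>W"
proof -
 show "s\<otimes>y\<in>W" if "y\<in>carrier A"
  unfolding W_iff using that sc Q.sc by (intro bexI[of _ y] bexI[of _ "\<zero>"]) simp_all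
 show "z\<otimes>s'\<in>W" if "z\<in>carrier A"
  unfolding W_iff using that sc Q.sc by (intro bexI[of _ "\<zero>"] bexI[of _ z]) simp_all
qed

lemma ksub_W: "ksub A W"
proof -
 have "ksub A (right_gen A s)" unfolding right_gen_def
  by (rule ksub_image[OF A_kspace ksub_carrier[OF A_kspace] A_kspace]) (simp_all add: smult_mult A.r_distr sc)
 thus ?thesis unfolding W_def by (rule ksub_set_add[OF A_kspace _ ksub_left_gen[OF Q.sc]])
qed

sublocale W: kquot A W by unfold_locales (rule ksub_W)

lemma biquo_eq: "biquo e s e' s' g = coset_space A W (S g)"
 unfolding biquo_def W_def S_eq ..

lemma kspace_biquo: "kspace (biquo e s e' s' g)"
 unfolding biquo_eq by (rule W.kspace_cs[OF ksub_S])

abbreviation "X u \<equiv> shift u Q.K"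

lemma gmod_X: "gmod (X u)" by (rule gmod_shift[OF Q.gmod_K])

text \<open>The component of degree \<open>- m\<close> of the shifted kernel is the dual of the
  component of degree \<open>m' - (- m - u) = u + m + m'\<close>; this is where the total shift of
  the statement appears.\<close>

lemma soc_iff:
 fixes u defines "g \<equiv> u + m + m'"
 shows "x\<in>soc (X u) \<longleftrightarrow> x\<in>lin_maps (gr (quo e' s') g) ground &
  (\<forall>b\<in>hA g. b\<otimes>e' = b --> x (Q.cls (e\<otimes>b)) = x (Q.cls b)) &
  (\<forall>b\<in>hA (g - 2 * m). b\<otimes>e' = b --> x (Q.cls (s\<otimes>b)) = 0)"
proof -
 let ?M = "quo e' s'"
 have g: "m' - (- m - u) = g" "m' - (m - u) = g - 2 * m" by (simp_all add: g_def)
 have 1: "act (X u) 0 (- m) e x = x \<longleftrightarrow> (\<forall>b\<in>hA g. b\<otimes>e' = b --> x (Q.cls (e\<otimes>b)) = x (Q.cls b))"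
  if x: "x\<in>lin_maps (gr ?M g) ground"
 proof -
  have "act (X u) 0 (- m) e x = (\<lambda>y\<in>cg ?M g. x (act ?M 0 g e y))"
  by (simp only: shift_simps Q.K_simps(2) g diff_0_right e(3))
  hence "act (X u) 0 (- m) e x = x \<longleftrightarrow> (\<forall>y\<in>cg ?M g. x (act ?M 0 g e y) = x y)"
  using lm_simps(4)[OF x] by (auto simp: fun_eq_iff restrict_def extensional_def)
  also have "\<dots> \<longleftrightarrow> (\<forall>b\<in>hA g. b\<otimes>e' = b --> x (Q.cls (e\<otimes>b)) = x (Q.cls b))"
  proof (intro iffI ballI impI)
  fix b assume h: "\<forall>y\<in>cg ?M g. x (act ?M 0 g e y) = x y" and b: "b\<in>hA g" "b\<otimes>e' = b"
  show "x (Q.cls (e\<otimes>b)) = x (Q.cls b)"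
  using bspec[OF h Q.cls_mem[OF b]] unfolding Q.q(5)[OF ec hcompD(1)[OF b(1)]] .
  next
  fix y assume h: "\<forall>b\<in>hA g. b\<otimes>e' = b --> x (Q.cls (e\<otimes>b)) = x (Q.cls b)" and y: "y\<in>cg ?M g"
  obtain b where b: "b\<in>hA g" "b\<otimes>e' = b" "y = Q.cls b" by (rule Q.quoE[OF y])
  show "x (act ?M 0 g e y) = x y" unfolding b(3) Q.q(5)[OF ec hcompD(1)[OF b(1)]] using h b by blast
  qed
  finally show ?thesis .
 qed
 have 2: "act (X u) (2 * m) (- m) s x = \<zero>\<^bsub>gr (X u) m\<^esub> \<longleftrightarrow> (\<forall>b\<in>hA (g - 2 * m). b\<otimes>e' = b --> x (Q.cls (s\<otimes>b)) = 0)"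
 proof -
  have "act (X u) (2 * m) (- m) s x = (\<lambda>y\<in>cg ?M (g - 2 * m). x (act ?M (2 * m) (g - 2 * m) s y))"
  by (simp only: shift_simps Q.K_simps(2) g s(4))
  moreover have "\<zero>\<^bsub>gr (X u) m\<^esub> = (\<lambda>y\<in>cg ?M (g - 2 * m). 0)"
  by (simp only: shift_simps Q.K_simps(1) g hom_simps ground_simps)
  ultimately have "act (X u) (2 * m) (- m) s x = \<zero>\<^bsub>gr (X u) m\<^esub> \<longleftrightarrow>
  (\<forall>y\<in>cg ?M (g - 2 * m). x (act ?M (2 * m) (g - 2 * m) s y) = 0)"
  by (auto simp: fun_eq_iff)
  also have "\<dots> \<longleftrightarrow> (\<forall>b\<in>hA (g - 2 * m). b\<otimes>e' = b --> x (Q.cls (s\<otimes>b)) = 0)"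
  proof (intro iffI ballI impI)
  fix b assume h: "\<forall>y\<in>cg ?M (g - 2 * m). x (act ?M (2 * m) (g - 2 * m) s y) = 0"
  and b: "b\<in>hA (g - 2 * m)" "b\<otimes>e' = b"
  show "x (Q.cls (s\<otimes>b)) = 0"
  using bspec[OF h Q.cls_mem[OF b]] unfolding Q.q(5)[OF sc hcompD(1)[OF b(1)]] .
  next
  fix y assume h: "\<forall>b\<in>hA (g - 2 * m). b\<otimes>e' = b --> x (Q.cls (s\<otimes>b)) = 0"
  and y: "y\<in>cg ?M (g - 2 * m)"
  obtain b where b: "b\<in>hA (g - 2 * m)" "b\<otimes>e' = b" "y = Q.cls b" by (rule Q.quoE[OF y])
  show "x (act ?M (2 * m) (g - 2 * m) s y) = 0" unfolding b(3) Q.q(5)[OF sc hcompD(1)[OF b(1)]] using h b by blast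
  qed
  finally show ?thesis .
 qed
 have 3: "cg (X u) (- m) = lin_maps (gr ?M g) ground"
  by (simp only: shift_simps Q.K_simps(1) g hom_simps)
 show ?thesis unfolding soc_def mem_Collect_eq 3 2 using 1 by blast
qed

text \<open>Evaluation at classes pairs the two-sided quotient with \<open>soc (X u)\<close>. It is
  onto the dual because the components of the algebra are finite dimensional, and its kernel comes
  from \<open>W\<close> because elements outside \<open>W\<close> are separated from it by a
  functional.\<close>

lemma soc_dual_iso:
 fixes u defines "g \<equiv> u + m + m'"
 defines "U \<equiv> hom_space ((gr (X u) (- m))\<lparr>carrier := soc (X u)\<rparr>) ground"
 shows "lin_iso (biquo e s e' s' g) U"
proof -
 let ?M = "gr (quo e' s') g" and ?Z = "(gr (X u) (- m))\<lparr>carrier := soc (X u)\<rparr>"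
 note soc = soc_iff[of _ u, folded g_def]
 have H: "gr (X u) (- m) = hom_space ?M ground"
 proof -
  have "m' - (- m - u) = g" by (simp add: g_def)
  thus ?thesis by (simp only: shift_simps Q.K_simps(1))
 qed
 have kM: "kspace ?M" by (rule gmodD(1)[OF Q.gmod_quo'])
 have kZ: "kspace ?Z" by (rule kspace_soc[OF gmod_X])
 have U: "kspace U" unfolding U_def by (rule kspace_hom_space[OF kZ kspace_ground])
 note sub = ksub_soc[OF gmod_X, of u]
 have lin: "x\<in>lin_maps ?M ground" if "x\<in>soc (X u)" for x using that soc by blast
 have Sc: "a\<in>carrier A" "a\<in>hA g" "e\<otimes>a = a" "a\<otimes>e' = a" if "a\<in>S g" for a
  using that hcompD(1) by (auto simp: S_def)
 have cm: "Q.cls a\<in>carrier ?M" if "a\<in>S g" for a by (rule Q.cls_mem[OF Sc(2,4)[OF that]])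
 have ev: "x (Q.cls (a\<oplus>b)) = x (Q.cls a) + x (Q.cls b)" "x (Q.cls (c \<odot> a)) = c * x (Q.cls a)"
  if "x\<in>lin_maps ?M ground" "Q.cls a\<in>carrier ?M" "Q.cls b\<in>carrier ?M" "a\<in>carrier A" "b\<in>carrier A" for x a b c
  using lm_simps(2,3)[OF that(1)] that(2,3) Q.q(3)[OF that(4,5)] Q.q(4)[OF that(4)] by (metis ground_simps(5,6))+
 define T where "T = (%a. \<lambda>x\<in>soc (X u). x (Q.cls a))"
 have T1: "T a\<in>carrier U" if a: "a\<in>S g" for a
 proof -
  have "restrict (%x. x (Q.cls a)) (carrier ?Z)\<in>lin_maps ?Z ground"
  by (rule lm_restrict[OF kZ]) (simp_all add: H cm[OF a] del: shift_simps)
  thus ?thesis by (simp add: T_def U_def)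
 qed
 have T2: "T (a\<oplus>b) = T a \<oplus>\<^bsub>U\<^esub> T b" if a: "a\<in>S g" and b: "b\<in>S g" for a b
  unfolding T_def U_def by (rule ext) (simp add: restrict_def ev(1)[OF lin cm[OF a] cm[OF b] Sc(1)[OF a] Sc(1)[OF b]])
 have T3: "T (c \<odot> a) = c \<odot>\<^bsub>U\<^esub> T a" if a: "a\<in>S g" for a c
  unfolding T_def U_def by (rule ext) (simp add: restrict_def ev(2)[OF lin cm[OF a] cm[OF a] Sc(1)[OF a] Sc(1)[OF a]])
 have surj: "\<exists>a\<in>S g. T a = tht" if "tht\<in>carrier U" for tht
 proof -
  have th: "tht\<in>lin_maps ?Z ground" using that by (simp add: U_def)
  obtain B where B: "finite B" "B \<subseteq> hA g" "!!S. B \<subseteq> S ==> ksub A S ==> hA g \<subseteq> S"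
  using hcomp_fin[of g] by blast
  let ?E = "{f. \<exists>a\<in>S g. \<forall>x\<in>soc (X u). f x = x (Q.cls a)}"
  have mid: "e\<otimes>b\<otimes>e'\<in>S g" if "b\<in>hA g" for b using that S_eq[of g] by blast
  \<comment> \<open>A functional on \<open>soc (X u)\<close> is a combination of the evaluations at
    the images of the spanning set \<open>B\<close>, since an \<open>x\<close> killed by all of
    these is zero.\<close>
  have "\<exists>f\<in>?E. \<forall>x\<in>soc (X u). tht x = f x"
  proof (rule functional_in_span[OF gmodD(1)[OF gmod_X] sub])
  show "finite ((%b x. x (Q.cls (e\<otimes>b\<otimes>e'))) ` B)" using B(1) by simp
  show "(%b x. x (Q.cls (e\<otimes>b\<otimes>e'))) ` B \<subseteq> ?E" using mid B(2) by blast
  have cl: "x \<oplus>\<^bsub>hom_space ?M ground\<^esub> y\<in>soc (X u)" "c \<odot>\<^bsub>hom_space ?M ground\<^esub> x\<in>soc (X u)"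
  if "x\<in>soc (X u)" "y\<in>soc (X u)" for x y c
  using sub that unfolding ksub_def H by blast+
  have th': "tht (x \<oplus>\<^bsub>hom_space ?M ground\<^esub> y) = tht x + tht y" "tht (c \<odot>\<^bsub>hom_space ?M ground\<^esub> x) = c * tht x"
  if "x\<in>soc (X u)" "y\<in>soc (X u)" for x y c
  using lm_simps(2,3)[OF th] that unfolding H by (simp_all del: shift_simps)
  have fE: "f (x \<oplus>\<^bsub>hom_space ?M ground\<^esub> y) = f x + f y" "f (c \<odot>\<^bsub>hom_space ?M ground\<^esub> x) = c * f x"
  if f: "f\<in>?E" and x: "x\<in>soc (X u)" and y: "y\<in>soc (X u)" for f x y c
  proof -
  obtain a where a: "a\<in>S g" "\<forall>x\<in>soc (X u). f x = x (Q.cls a)" using f by blast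
  show "f (x \<oplus>\<^bsub>hom_space ?M ground\<^esub> y) = f x + f y" "f (c \<odot>\<^bsub>hom_space ?M ground\<^esub> x) = c * f x"
  unfolding a(2)[rule_format, OF cl(1)[OF x y]] a(2)[rule_format, OF cl(2)[OF x y]] a(2)[rule_format, OF x] a(2)[rule_format, OF y]
  using cm[OF a(1)] by simp_all
  qed
  show "f (x \<oplus>\<^bsub>gr (X u) (- m)\<^esub> y) = f x + f y" if "f\<in>insert tht ?E" "x\<in>soc (X u)" "y\<in>soc (X u)" for f x y
  using that(1) th'(1)[OF that(2,3)] fE(1)[OF _ that(2,3)] unfolding H by blast
  show "f (c \<odot>\<^bsub>gr (X u) (- m)\<^esub> x) = c * f x" if "f\<in>insert tht ?E" "x\<in>soc (X u)" for f x c
  using that(1) th'(2)[OF that(2,2)] fE(2)[OF _ that(2,2)] unfolding H by blast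
  show "tht x = 0" if x: "x\<in>soc (X u)" and x0: "!!f. f\<in>(%b x. x (Q.cls (e\<otimes>b\<otimes>e'))) ` B ==> f x = 0" for x
  proof -
  have x0: "x (Q.cls (e\<otimes>b\<otimes>e')) = 0" if "b\<in>B" for b using x0 that by blast
  let ?S = "{a\<in>hA g. x (Q.cls (e\<otimes>a\<otimes>e')) = 0}"
  have ml: "e\<otimes>(a\<oplus>b)\<otimes>e' = e\<otimes>a\<otimes>e'\<oplus>e\<otimes>b\<otimes>e'"
  "e\<otimes>(c \<odot> a)\<otimes>e' = c \<odot> (e\<otimes>a\<otimes>e')"
  if "a\<in>carrier A" "b\<in>carrier A" for a b c
  using that ec Q.ec by (simp_all add: A.r_distr A.l_distr smult_mult)
  have "ksub A ?S"
  proof -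
  have z: "e\<otimes>\<zero>\<otimes>e' = \<zero>" using ec Q.ec by simp
  have "Q.cls \<zero> = \<zero>\<^bsub>?M\<^esub>" unfolding Q.q(2) using Q.L.coset_zero_iff Q.L.W_zero by simp
  hence "x (Q.cls \<zero>) = 0" using lin_maps_zero[OF kM kspace_ground lin[OF x]] by simp
  moreover have "x (Q.cls (e\<otimes>(a\<oplus>b)\<otimes>e')) = 0" "x (Q.cls (e\<otimes>(c \<odot> a)\<otimes>e')) = 0"
  if "a\<in>?S" "b\<in>?S" for a b c
  proof -
  have h: "a\<in>hA g" "b\<in>hA g" using that by auto
  show "x (Q.cls (e\<otimes>(a\<oplus>b)\<otimes>e')) = 0" "x (Q.cls (e\<otimes>(c \<odot> a)\<otimes>e')) = 0"
  unfolding ml[OF hcompD(1)[OF h(1)] hcompD(1)[OF h(2)]]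
  using ev[OF lin[OF x] cm[OF mid[OF h(1)]] cm[OF mid[OF h(2)]] Sc(1)[OF mid[OF h(1)]] Sc(1)[OF mid[OF h(2)]]] that by simp_all
  qed
  ultimately show ?thesis unfolding ksub_def subset_iff using hcompD(1)[of _ g] hcompD(2)[of g] hcompD(3)[of _ g] hcompD(4)[of _ g] z by simp
  qed
  hence all: "hA g \<subseteq> ?S" using B(2) B(3)[of ?S] x0 by blast
  have "x = \<zero>\<^bsub>gr (X u) (- m)\<^esub>"
  proof (rule lin_maps_ext[OF lin[OF x]])
  show "\<zero>\<^bsub>gr (X u) (- m)\<^esub>\<in>lin_maps ?M ground" using kspaceD(1)[OF gmodD(1)[OF gmod_X[of u], of "- m"]] unfolding H by simp
  fix y assume y: "y\<in>carrier ?M"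
  obtain b where b: "b\<in>hA g" "b\<otimes>e' = b" "y = Q.cls b" by (rule Q.quoE[OF y])
  have "x y = x (Q.cls (e\<otimes>b))" using x b soc by metis
  also have "\<dots> = x (Q.cls (e\<otimes>b\<otimes>e'))" using A.m_assoc[OF ec hcompD(1)[OF b(1)] Q.ec] b(2) by simp
  also have "\<dots> = 0" using all b(1) by blast
  finally show "x y = \<zero>\<^bsub>gr (X u) (- m)\<^esub> y" unfolding H using y by simp
  qed
  thus ?thesis using lin_maps_zero[OF kZ kspace_ground th] by simp
  qed
  show "(%x. f x + c * h x)\<in>?E" if f: "f\<in>?E" and h: "h\<in>?E" for f h c
  proof -
  obtain a where a: "a\<in>S g" "\<forall>x\<in>soc (X u). f x = x (Q.cls a)" using f by blast
  obtain b where b: "b\<in>S g" "\<forall>x\<in>soc (X u). h x = x (Q.cls b)" using h by blast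
  have cb: "c \<odot> b\<in>S g" "a\<oplus>c \<odot> b\<in>S g" using ksub_S[of g] a(1) b(1) by (auto simp: ksub_def)
  have "f x + c * h x = x (Q.cls (a\<oplus>c \<odot> b))" if x: "x\<in>soc (X u)" for x
  using ev(1)[OF lin[OF x] cm[OF a(1)] cm[OF cb(1)] Sc(1)[OF a(1)] Sc(1)[OF cb(1)]]
  ev(2)[OF lin[OF x] cm[OF b(1)] cm[OF b(1)] Sc(1)[OF b(1)] Sc(1)[OF b(1)]] a(2) b(2) x by simp
  thus ?thesis using cb(2) by blast
  qed
  show "(%x. 0)\<in>?E"
  proof -
  have z: "\<zero>\<in>S g" using ksub_S[of g] by (auto simp: ksub_def)
  have "x (Q.cls \<zero>) = 0" if "x\<in>soc (X u)" for x
  using ev(2)[OF lin[OF that] cm[OF z] cm[OF z] Sc(1)[OF z] Sc(1)[OF z], of 0] AD(9) by simp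
  thus ?thesis using z by force
  qed
  qed
  then obtain f where f: "f\<in>?E" "!!x. x\<in>soc (X u) ==> tht x = f x" by blast
  then obtain a where a: "a\<in>S g" "!!x. x\<in>soc (X u) ==> tht x = x (Q.cls a)" by auto
  have "T a = tht"
  by (rule lin_maps_ext[OF _ th]) (use T1[OF a(1)] a(2) in \<open>simp_all add: U_def T_def\<close>)
  thus ?thesis using a(1) by blast
 qed
 have Z0: "T a = \<zero>\<^bsub>U\<^esub> \<longleftrightarrow> (\<forall>x\<in>soc (X u). x (Q.cls a) = 0)" for a
  unfolding T_def U_def by (auto simp: fun_eq_iff)
 have ker1: "x (Q.cls a) = 0" if aW: "a\<in>W" and a: "a\<in>S g" and x: "x\<in>soc (X u)" for a x
 proof -
  obtain y z where yz: "y\<in>carrier A" "z\<in>carrier A" "a = s\<otimes>y\<oplus>z\<otimes>s'" using aW W_iff by blast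
  \<comment> \<open>Projection to degree \<open>g\<close> replaces the factors \<open>y\<close> and
    \<open>z\<close> by homogeneous ones, and multiplication by \<open>e'\<close> on the right gives
    \<open>y\<close> the form that \<open>soc_iff\<close> refers to.\<close>
  define b where "b = hp (g - 2 * m) y\<otimes>e'"
  define c where "c = hp (g - 2 * m') z"
  have yh: "hp (g - 2 * m) y\<in>hA (g - 2 * m)" and c: "c\<in>carrier A"
  using hp(1) yz hcompD(1) by (auto simp: c_def)
  note yc = hcompD(1)[OF yh]
  have b: "b\<in>hA (g - 2 * m)" "b\<otimes>e' = b"
  unfolding b_def using hcomp_mult'[OF yh Q.e(1)] A.m_assoc[OF yc Q.ec Q.ec] Q.e(2) by simp_all
  note bc = hcompD(1)[OF b(1)]
  have "a = hp g a" using hp(2)[OF Sc(2)[OF a]] by simp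
  also have "\<dots> = s\<otimes>hp (g - 2 * m) y\<oplus>c\<otimes>s'"
  unfolding yz(3) c_def using hp(3) hp(5)[OF yz(1) s(1)] hp(4)[OF yz(2) Q.s(1)] yz sc Q.sc by simp
  finally have "a\<otimes>e' = (s\<otimes>hp (g - 2 * m) y\<oplus>c\<otimes>s')\<otimes>e'" by (rule arg_cong)
  hence "a = s\<otimes>b\<oplus>c\<otimes>s'"
  unfolding Sc(4)[OF a] b_def using yc c sc Q.sc Q.ec Q.s(3) by (simp add: A.l_distr A.m_assoc)
  hence "a = c\<otimes>s'\<oplus>s\<otimes>b" using bc c sc Q.sc by (simp add: A.a_comm)
  moreover have "c\<otimes>s'\<in>Q.L" unfolding left_gen_def using c by (rule imageI)
  ultimately have "Q.cls a = Q.cls (s\<otimes>b)"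
  unfolding Q.L.coset_eq_iff[OF Sc(1)[OF a] A.m_closed[OF sc bc]] by blast
  thus ?thesis using x b soc by simp
 qed
 have ker2: "\<exists>x\<in>soc (X u). x (Q.cls a) ~= 0" if aW: "a \<notin> W" and a: "a\<in>S g" for a
 proof -
  note ac = Sc(1)[OF a]
  have compat: "c = 0" if "c \<odot> a\<in>W" for c
  proof (rule ccontr)
  assume "c ~= 0"
  moreover have "inverse c \<odot> (c \<odot> a)\<in>W" by (rule W.W_smult[OF that])
  ultimately show False using aW AD(6)[OF ac, of "inverse c" c] AD(7)[OF ac] by simp
  qed
  have ga: "c \<odot> a\<in>carrier A" "(c \<oplus>\<^bsub>ground\<^esub> c') \<odot> a = c \<odot> a\<oplus>c' \<odot> a"
  "(c \<odot>\<^bsub>ground\<^esub> c') \<odot> a = c \<odot> (c' \<odot> a)" for c c'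
  by (simp_all add: AD ac)
  have gU: "ksub ground (UNIV :: 'k set)" by (simp add: ksub_def)
  obtain mu where mu: "!!x y. x\<in>carrier A ==> y\<in>carrier A ==> mu (x\<oplus>y) = mu x + (mu y :: 'k)"
  "!!c x. x\<in>carrier A ==> mu (c \<odot> x) = c * mu x" "!!c. mu (c \<odot> a) = c" "!!w. w\<in>W ==> mu w = 0"
  by (rule extend_functional[where V = A and R = rh and g = "%c. c \<odot> a" and h = "%c. c" and V' = ground and P = UNIV,
  OF A_kspace rh(3,1,2) ksub_W kspace_ground gU ga ground_simps(5,6) compat]) (assumption | rule UNIV_I | blast)+
  note muW = mu(4)
  have mua: "mu a = 1" using mu(3)[of 1] AD(7)[OF ac] by simp
  \<comment> \<open>As \<open>mu\<close> kills \<open>W\<close>, the value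
    \<open>mu (e\<otimes>b)\<close> depends only on the class of \<open>b\<close> and vanishes at
    multiples of \<open>s\<close>; the factor \<open>e\<close> makes it invariant.\<close>
  define x0 where "x0 = (\<lambda>Y\<in>carrier ?M. mu (e\<otimes>(SOME b. b\<in>hA g & Y = Q.cls b)))"
  have x0: "x0 (Q.cls b) = mu (e\<otimes>b)" if b: "b\<in>hA g" "b\<otimes>e' = b" for b
  proof -
  define c where "c = (SOME c. c\<in>hA g & Q.cls b = Q.cls c)"
  have c: "c\<in>hA g" "Q.cls b = Q.cls c"
  using someI[of "%c. c\<in>hA g & Q.cls b = Q.cls c" b] b(1) unfolding c_def by blast+
  note bc = hcompD(1)[OF b(1)] and cc = hcompD(1)[OF c(1)]
  obtain w where w: "w\<in>Q.L" "b = w\<oplus>c" using c(2) Q.L.coset_eq_iff[OF bc cc] by blast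
  obtain z where z: "z\<in>carrier A" "w = z\<otimes>s'" using w(1) unfolding left_gen_def by blast
  have "e\<otimes>w = (e\<otimes>z)\<otimes>s'" unfolding z(2) using A.m_assoc[OF ec z(1) Q.sc] by simp
  hence eW: "e\<otimes>w\<in>W" using W_I(2)[of "e\<otimes>z"] ec z(1) by simp
  have "mu (e\<otimes>b) = mu (e\<otimes>w\<oplus>e\<otimes>c)"
  using A.r_distr[OF Q.L.W_carrier[OF w(1)] cc ec] w(2) by simp
  also have "\<dots> = mu (e\<otimes>c)" using mu(1)[OF W.W_carrier[OF eW], of "e\<otimes>c"] muW[OF eW] ec cc by simp
  finally show ?thesis unfolding x0_def c_def using Q.cls_mem[OF b] by simp
  qed
  have "x0\<in>lin_maps ?M ground"
  proof (rule lin_mapsI)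
  show "x0\<in>extensional (carrier ?M)" by (simp add: x0_def)
  fix Y assume Y: "Y\<in>carrier ?M"
  obtain b where b: "b\<in>hA g" "b\<otimes>e' = b" "Y = Q.cls b" by (rule Q.quoE[OF Y])
  note bc = hcompD(1)[OF b(1)]
  show "x0 (k \<odot>\<^bsub>?M\<^esub> Y) = k \<odot>\<^bsub>ground\<^esub> x0 Y" for k
  unfolding b(3) Q.q(4)[OF bc]
  using x0[OF b(1,2)] x0[OF hcompD(4)[OF b(1), of k]] smult_mult(1)[OF bc Q.ec, of k] smult_mult(2)[OF ec bc, of k] b(2)
  mu(2)[of "e\<otimes>b" k] ec bc by simp
  fix Y' assume Y': "Y'\<in>carrier ?M"
  obtain b' where b': "b'\<in>hA g" "b'\<otimes>e' = b'" "Y' = Q.cls b'" by (rule Q.quoE[OF Y'])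
  note bc' = hcompD(1)[OF b'(1)]
  show "x0 (Y \<oplus>\<^bsub>?M\<^esub> Y') = x0 Y \<oplus>\<^bsub>ground\<^esub> x0 Y'"
  unfolding b(3) b'(3) Q.q(3)[OF bc bc']
  using x0[OF b(1,2)] x0[OF b'(1,2)] x0[OF hcompD(3)[OF b(1) b'(1)]] A.l_distr[OF bc bc' Q.ec] A.r_distr[OF bc bc' ec] b(2) b'(2)
  mu(1)[of "e\<otimes>b" "e\<otimes>b'"] ec bc bc' by simp
  qed simp
  moreover have "x0 (Q.cls (e\<otimes>b)) = x0 (Q.cls b)" if b: "b\<in>hA g" "b\<otimes>e' = b" for b
  proof -
  note bc = hcompD(1)[OF b(1)]
  have "e\<otimes>b\<in>hA g" "e\<otimes>b\<otimes>e' = e\<otimes>b" "e\<otimes>(e\<otimes>b) = e\<otimes>b"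
  using hcomp_mult[OF e(1) b(1)] A.m_assoc[OF ec bc Q.ec] A.m_assoc[OF ec ec bc] b(2) e(2) by simp_all
  thus ?thesis using x0[OF b] x0[of "e\<otimes>b"] by simp
  qed
  moreover have "x0 (Q.cls (s\<otimes>b)) = 0" if b: "b\<in>hA (g - 2 * m)" "b\<otimes>e' = b" for b
  proof -
  note bc = hcompD(1)[OF b(1)]
  have "s\<otimes>b\<in>hA g" "s\<otimes>b\<otimes>e' = s\<otimes>b" "e\<otimes>(s\<otimes>b) = s\<otimes>b"
  using hcomp_mult'[OF s(1) b(1), of g] A.m_assoc[OF sc bc Q.ec] A.m_assoc[OF ec sc bc] b(2) s(2) by simp_all
  thus ?thesis using x0[of "s\<otimes>b"] muW[OF W_I(1)[OF bc]] by simp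
  qed
  ultimately have "x0\<in>soc (X u)" using soc by blast
  moreover have "x0 (Q.cls a) ~= 0" using x0[OF Sc(2,4)[OF a]] Sc(3)[OF a] mua by simp
  ultimately show ?thesis by blast
 qed
 have ker: "T a = \<zero>\<^bsub>U\<^esub> \<longleftrightarrow> a\<in>W" if "a\<in>S g" for a
  unfolding Z0 using ker1[OF _ that] ker2[OF _ that] by blast
 show ?thesis unfolding biquo_eq
  by (rule W.coset_iso[OF ksub_S U, of _ T]) (erule T1, erule (1) T2, erule T3, erule surj, erule ker)
qed

lemma kspace_graded_ext1: "kspace (graded_ext1 A Q.K K u)"
 unfolding graded_ext1_def by (rule Ext1_iso_dual(2)[OF gmod_X])

lemma graded_ext1_biquo: "lin_iso (biquo e s e' s' (u + m + m')) (graded_ext1 A Q.K K u)"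
proof -
 note E = Ext1_iso_dual[OF gmod_X[of u]]
 show ?thesis
  unfolding graded_ext1_def by (rule lin_iso_trans[OF kspace_biquo soc_dual_iso lin_iso_sym[OF E(2,1)]])
qed

end

context graded_algebra
begin

text \<open>The anti-involution takes the \<open>e\<close>, \<open>e'\<close> corner of the algebra
  to the \<open>e'\<close>, \<open>e\<close> corner and exchanges the right ideal of one vertex with
  its left ideal.\<close>

lemma biquo_swap:
 assumes v: "vertex e s m" and v': "vertex e' s' m'"
 shows "lin_iso (biquo e s e' s' g) (biquo e' s' e s g)"
proof -
 interpret P: vertex_pair A tau hp rh e s m e' s' m' by unfold_locales (fact v v')+
 interpret P': vertex_pair A tau hp rh e' s' m' e s m by unfold_locales (fact v v')+
 have tS: "tau a\<in>P'.S g" if "a\<in>P.S g" for a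
 proof -
  have a: "a\<in>hA g" "e\<otimes>a = a" "a\<otimes>e' = a" using that by (auto simp: P.S_def)
  have "tau a\<otimes>e = tau a" "e'\<otimes>tau a = tau a"
  using tau(5)[OF P.ec hcompD(1)[OF a(1)]] tau(5)[OF hcompD(1)[OF a(1)] P.Q.ec] a P.e(3) P.Q.e(3) by simp_all
  thus ?thesis using tau(1)[OF a(1)] by (simp add: P'.S_def)
 qed
 have tS': "tau a\<in>P.S g" if "a\<in>P'.S g" for a
 proof -
  have a: "a\<in>hA g" "e'\<otimes>a = a" "a\<otimes>e = a" using that by (auto simp: P'.S_def)
  have "tau a\<otimes>e' = tau a" "e\<otimes>tau a = tau a"
  using tau(5)[OF P.Q.ec hcompD(1)[OF a(1)]] tau(5)[OF hcompD(1)[OF a(1)] P.ec] a P.e(3) P.Q.e(3) by simp_all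
  thus ?thesis using tau(1)[OF a(1)] by (simp add: P.S_def)
 qed
 have tW: "tau a\<in>P'.W" if a: "a\<in>P.W" for a
 proof -
  obtain y z where yz: "y\<in>carrier A" "z\<in>carrier A" "a = s\<otimes>y\<oplus>z\<otimes>s'" using a P.W_iff by blast
  have "tau a = s'\<otimes>tau z\<oplus>tau y\<otimes>s"
  unfolding yz(3) using yz(1,2) P.sc P.Q.sc P.s(4) P.Q.s(4) tau(2) by (simp add: tau(3,5) A.a_comm)
  thus ?thesis unfolding P'.W_iff using tau(2) yz(1,2) by blast
 qed
 have tW': "tau a\<in>P.W" if a: "a\<in>P'.W" for a
 proof -
  obtain y z where yz: "y\<in>carrier A" "z\<in>carrier A" "a = s'\<otimes>y\<oplus>z\<otimes>s" using a P'.W_iff by blast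
  have "tau a = s\<otimes>tau z\<oplus>tau y\<otimes>s'"
  unfolding yz(3) using yz(1,2) P.sc P.Q.sc P.s(4) P.Q.s(4) tau(2) by (simp add: tau(3,5) A.a_comm)
  thus ?thesis unfolding P.W_iff using tau(2) yz(1,2) by blast
 qed
 have c: "a\<in>carrier A" if "a\<in>P.S g" for a using that hcompD(1) by (auto simp: P.S_def)
 have c': "a\<in>carrier A" if "a\<in>P'.S g" for a using that hcompD(1) by (auto simp: P'.S_def)
 define T where "T = (%a. P'.W +> tau a)"
 note cs = P'.W.cs_simps
 have T1: "T a\<in>carrier (coset_space A P'.W (P'.S g))" if "a\<in>P.S g" for a
  unfolding T_def cs(1) using tS[OF that] by blast
 have T2: "T (a\<oplus>b) = T a \<oplus>\<^bsub>coset_space A P'.W (P'.S g)\<^esub> T b" if "a\<in>P.S g" "b\<in>P.S g" for a b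
  unfolding T_def tau(3)[OF c[OF that(1)] c[OF that(2)]] by (rule cs(3)[symmetric]) (use that c tau(2) in auto)
 have T3: "T (k \<odot> a) = k \<odot>\<^bsub>coset_space A P'.W (P'.S g)\<^esub> T a" if "a\<in>P.S g" for a k
  unfolding T_def tau(4)[OF c[OF that(1)]] by (rule cs(4)[symmetric]) (use that c tau(2) in auto)
 have surj: "\<exists>a\<in>P.S g. T a = Y" if Y: "Y\<in>carrier (coset_space A P'.W (P'.S g))" for Y
 proof -
  obtain b where b: "b\<in>P'.S g" "Y = P'.W +> b" using Y unfolding cs(1) by blast
  thus ?thesis using tS'[OF b(1)] tau(6)[OF c'[OF b(1)]] by (intro bexI[of _ "tau b"]) (simp_all add: T_def)
 qed
 have ker: "T a = \<zero>\<^bsub>coset_space A P'.W (P'.S g)\<^esub> \<longleftrightarrow> a\<in>P.W" if "a\<in>P.S g" for a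
  unfolding T_def cs(2) using P'.W.coset_zero_iff[OF tau(2)[OF c[OF that]]] tW[of a] tW'[of "tau a"] tau(6)[OF c[OF that]] by auto
 show ?thesis unfolding P.biquo_eq P'.biquo_eq
  by (rule P.W.coset_iso[OF P.ksub_S, of _ _ T])
  (rule P'.W.kspace_cs[OF P'.ksub_S], erule T1, erule (1) T2, erule T3, erule surj, erule ker)
qed

lemma ext_symmetry:
 assumes v: "vertex e s m" and v': "vertex e' s' m'"
 shows "lin_iso (graded_ext1 A (gker e' s' m') (gker e s m) u) (graded_ext1 A (gker e s m) (gker e' s' m') u)"
  and "lin_iso (graded_ext1 A (gker e s m) (gker e' s' m') u) (biquo e' s' e s (u + m + m'))"
proof -
 interpret P: vertex_pair A tau hp rh e s m e' s' m' by unfold_locales (fact v v')+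
 interpret P': vertex_pair A tau hp rh e' s' m' e s m by unfold_locales (fact v v')+
 have c: "u + m' + m = u + m + m'" by simp
 note i = P'.graded_ext1_biquo[of u, unfolded c] and j = P.graded_ext1_biquo[of u]
 show "lin_iso (graded_ext1 A P.K P.Q.K u) (biquo e' s' e s (u + m + m'))"
  by (rule lin_iso_sym[OF P'.kspace_biquo i])
 show "lin_iso (graded_ext1 A P.Q.K P.K u) (graded_ext1 A P.K P.Q.K u)"
  by (rule lin_iso_sym[OF _ lin_iso_trans[OF _ lin_iso_sym[OF P'.kspace_biquo i] lin_iso_trans[OF P'.kspace_biquo biquo_swap[OF v' v] j]]])
  (rule P'.kspace_graded_ext1)+
qed

end

section \<open>The anti-involution and the graded structure of the quotient algebra\<close>

lemma opp_simps [simp]: "opp (opp a) = a" "tgt (opp a) = src a" "src (opp a) = tgt a"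
 by (cases a; simp)+

lemma opp_comp_opp: "map opp (map opp p) = p"
 by (induction p) auto

context gpp
begin

lemma is_arrow_opp: "is_arrow C a ==> is_arrow C (opp a)"
 by (cases a) (auto intro: adj_sym)

lemma is_path_rev: "is_path C i p ==> is_path C (psrc i p) (rev (map opp p)) & psrc (psrc i p) (rev (map opp p)) = i"
 by (induction p arbitrary: i) (auto simp: path_app psrc_app intro: is_arrow_opp)

lemma fl_anti: "flinear (anti C)"
 by (auto simp: fl_iff path_anti_def)

lemma anti_basis:
 assumes "is_path C i p" shows "anti C (bas (i, p)) = (bas (psrc i p, rev (map opp p)) :: ('i, 'k) pelem)"
proof
 fix y :: "'i path"
 obtain j q where y: "y = (j, q)" by (cases y)
 have "is_path C j q & (psrc j q, rev (map opp q)) = (i, p) \<longleftrightarrow> (j, q) = (psrc i p, rev (map opp p))"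
 proof
  assume h: "is_path C j q & (psrc j q, rev (map opp q)) = (i, p)"
  hence i: "i = psrc j q" "p = rev (map opp q)" by auto
  show "(j, q) = (psrc i p, rev (map opp p))"
  using is_path_rev[of j q] h unfolding i by (simp add: rev_map opp_comp_opp del: map_map)
 next
  assume h: "(j, q) = (psrc i p, rev (map opp p))"
  hence j: "j = psrc i p" "q = rev (map opp p)" by auto
  show "is_path C j q & (psrc j q, rev (map opp q)) = (i, p)"
  using is_path_rev[OF assms] unfolding j by (simp add: rev_map opp_comp_opp del: map_map)
 qed
 thus "anti C (bas (i, p)) y = (bas (psrc i p, rev (map opp p)) :: ('i, 'k) pelem) y"
  unfolding y path_anti_def path_basis_def by auto
qed

lemma anti_pc: "f\<in>pc ==> anti C f\<in>pc"
 by (rule pcar_memI[OF fl_anti pcar_sub]) (auto simp: anti_basis is_path_rev intro!: pcar_basis)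

lemma anti_anti: "f\<in>pc ==> anti C (anti C f) = f"
proof (rule pcar_eqI[OF fl_comp[OF fl_anti fl_anti] fs.linear_ident])
 fix i p assume p: "is_path C i p"
 show "anti C (anti C (bas (i, p))) = (bas (i, p) :: ('i, 'k) pelem)"
  unfolding anti_basis[OF p] anti_basis[OF conjunct1[OF is_path_rev[OF p]]]
  using is_path_rev[OF p] by (simp add: rev_map opp_comp_opp del: map_map)
qed

lemma anti_mult:
 assumes f: "f\<in>pc" and g: "g\<in>pc"
 shows "anti C (pmul f g) = pmul (anti C g) (anti C f)"
proof (rule pcar_eqI[OF fl_comp[OF fl_mulR fl_anti] fl_comp[OF fl_anti fl_mulL] f])
 fix i p assume p: "is_path C i p"
 show "anti C (pmul (bas (i, p)) g) = pmul (anti C g) (anti C (bas (i, p)))"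
 proof (rule pcar_eqI[OF fl_comp[OF fl_mulL fl_anti] fl_comp[OF fl_anti fl_mulR] g])
  fix j q assume q: "is_path C j q"
  show "anti C (pmul (bas (i, p)) (bas (j, q))) = pmul (anti C (bas (j, q))) (anti C (bas (i, p)) :: ('i, 'k) pelem)"
  proof (cases "psrc i p = j")
  case True
  hence "is_path C i (p @ q)" using p q by (simp add: path_app)
  thus ?thesis using True is_path_rev[OF q] by (simp add: pm_basis anti_basis p q psrc_app)
  next
  case False
  hence "psrc (psrc j q) (rev (map opp q)) ~= psrc i p" using is_path_rev[OF q] by auto
  thus ?thesis using False by (simp only: pm_basis anti_basis[OF p] anti_basis[OF q] if_False fl_0[OF fl_anti])
  qed
 qed
qed

text \<open>Reversal turns the commutation relation for \<open>i\<close>, \<open>j\<close> into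
  minus the one for \<open>j\<close>, \<open>i\<close>. It fixes the product of an arrow with its
  opposite, hence permutes the terms of a mesh relation belonging to the same \<open>j\<close>, and
  the signs are undisturbed.\<close>

lemma anti_rels: assumes r: "r\<in>rels" shows "anti C r\<in>I"
proof -
 consider i j where "adj C i j" "r = rel_commute C i j" | i where "r = rel_mesh C \<omega> i"
  using r unfolding rels_def by blast
 thus ?thesis
 proof cases
  case 1
  note a = 1(1) and a' = adj_sym[OF 1(1)]
  have p: "is_path C i (epow i (cc C i j) @ [Alpha i j])" "is_path C i (Alpha i j # epow j (cc C j i))"
  using a by (simp_all add: path_app)
  have "anti C r = - rel_commute C j i"
  unfolding 1(2) commute_eq[OF a] commute_eq[OF a'] fl_minus[OF fl_anti] anti_basis[OF p(1)] anti_basis[OF p(2)]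
  by (simp only: minus_diff_eq) (simp add: psrc_app)
  moreover have "rel_commute C j i\<in>I" using a' by (intro rels_I) (auto simp: rels_def)
  ultimately show ?thesis using fs.subspace_neg[OF I_sub] by simp
 next
  case 2
  have "anti C r = r"
  unfolding 2 mesh_eq fl_of_sum[OF fl_anti] fl_of_scale[OF fl_anti]
  proof (rule sum.cong[OF refl])
  fix j assume "j\<in>{j. adj C i j}"
  hence a: "adj C i j" "adj C j i" using adj_sym by auto
  let ?b = "%k. bas (i, epow i k @ [Alpha i j, Alpha j i] @ epow i (cc C i j - 1 - k)) :: ('i, 'k) pelem"
  have "anti C (?b k) = ?b (cc C i j - 1 - k)" if "k < cc C i j" for k
  proof -
  have "is_path C i (epow i k @ [Alpha i j, Alpha j i] @ epow i (cc C i j - 1 - k))" using a by (simp add: path_app)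
  from anti_basis[OF this] show ?thesis using that by (simp add: psrc_app)
  qed
  hence "(\<Sum>k<cc C i j. fsc (of_int (\<omega> i j)) (anti C (?b k))) = (\<Sum>k<cc C i j. fsc (of_int (\<omega> i j)) (?b (cc C i j - Suc k)))"
  by (intro sum.cong refl) simp
  also have "\<dots> = (\<Sum>k<cc C i j. fsc (of_int (\<omega> i j)) (?b k))"
  by (rule sum.nat_diff_reindex)
  finally show "(\<Sum>k<cc C i j. fsc (of_int (\<omega> i j)) (anti C (?b k))) = (\<Sum>k<cc C i j. fsc (of_int (\<omega> i j)) (?b k))" .
  qed
  thus ?thesis using rels_I[OF r] by simp
 qed
qed

lemma anti_I: "x\<in>I ==> anti C x\<in>I"
proof (rule fl_span_sub[OF fl_anti _ I_sub])
 show "x\<in>I ==> x\<in>fspan Igens" using I_span by blast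
 fix x assume "x\<in>Igens"
 then obtain i p j q r where x: "x = pmul (pmul (bas (i, p)) r) (bas (j, q))"
  "is_path C i p" "is_path C j q" "r\<in>rels"
  unfolding Igens_def by blast
 note b = pcar_basis[OF x(2)] pcar_basis[OF x(3)]
 show "anti C x\<in>I"
  unfolding x(1) anti_mult[OF pcar_mult[OF b(1) rels_pc[OF x(4)]] b(2)] anti_mult[OF b(1) rels_pc[OF x(4)]]
  by (intro I_left I_right anti_rels x(4) anti_pc b)
qed

abbreviation degcut :: "int => ('i, 'k) pelem => ('i, 'k) pelem" where
 "degcut v \<equiv> cut (%(k, p). wt (arrow_deg d) (k, p) = v)"

lemma arrow_deg_opp: "arrow_deg d (opp a) = arrow_deg d a"
 by (cases a) (auto simp: max.commute)

lemma anti_degcut: "f\<in>pc ==> anti C (degcut v f) = degcut v (anti C f)"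
proof (rule pcar_eqI[OF fl_comp[OF fl_cut fl_anti] fl_comp[OF fl_anti fl_cut]])
 fix i p assume p: "is_path C i p"
 have "wt (arrow_deg d) (psrc i p, rev (map opp p)) = wt (arrow_deg d) (i, p)"
  by (simp add: rev_map[symmetric] arrow_deg_opp comp_def)
 thus "anti C (degcut v (bas (i, p))) = degcut v (anti C (bas (i, p)))"
  unfolding anti_basis[OF p] cut_basis prod.case by (simp only: anti_basis[OF p] fl_0[OF fl_anti] split: if_split) simp
qed

lemma degcut_mult:
 assumes f: "f\<in>pc" and g: "g\<in>pc"
 shows "degcut v (pmul f (degcut w g)) = pmul (degcut (v - w) f) (degcut w g)"
  and "degcut v (pmul (degcut w g) f) = pmul (degcut w g) (degcut (v - w) f)"
proof -
 have "degcut v (pmul (bas (i, p)) (degcut w g)) = pmul (degcut (v - w) (bas (i, p))) (degcut w g)" for i p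
  by (rule pcar_eqI[OF fl_comp[OF fl_comp[OF fl_cut fl_mulL] fl_cut] fl_comp[OF fl_cut fl_mulL] g])
  (auto simp: cut_basis pm_basis fl_0[OF fl_cut])
 thus "degcut v (pmul f (degcut w g)) = pmul (degcut (v - w) f) (degcut w g)"
  by (intro pcar_eqI[OF fl_comp[OF fl_mulR fl_cut] fl_comp[OF fl_cut fl_mulR] f])
 have "degcut v (pmul (degcut w g) (bas (i, p))) = pmul (degcut w g) (degcut (v - w) (bas (i, p)))" for i p
  by (rule pcar_eqI[OF fl_comp[OF fl_comp[OF fl_cut fl_mulR] fl_cut] fl_comp[OF fl_cut fl_mulR] g])
  (auto simp: cut_basis pm_basis fl_0[OF fl_cut])
 thus "degcut v (pmul (degcut w g) f) = pmul (degcut w g) (degcut (v - w) f)"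
  by (intro pcar_eqI[OF fl_comp[OF fl_mulL fl_cut] fl_comp[OF fl_cut fl_mulL] f])
qed

lemma comp_iff: "f\<in>path_comp C d v \<longleftrightarrow> f\<in>pc & degcut v f = f"
 by (auto simp: path_comp_def cut_def fun_eq_iff)

lemma degcut_path_comp: "f\<in>pc ==> degcut v f\<in>path_comp C d v"
 by (simp add: comp_iff pcar_cut) (auto simp: cut_def fun_eq_iff)

lemma degcut_I: "x\<in>I ==> degcut v x\<in>I"
 using I_cut[OF homog_deg, of x "%_ _ w. w = v"] by simp

text \<open>Loops have degree at least 1 and an \<alpha> lowers the degree by at most
  \<open>D\<close>, so degree and number of arrows \<alpha> together bound the length.\<close>

lemma finite_degree_paths: "finite {(k, p). is_path C k p & wt (arrow_deg d) (k, p) = v & wt is_alpha (k, p) < M}"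
proof -
 define D where "D = Max (range d)"
 have D: "d i <= D" for i by (simp add: D_def)
 have D0: "D > 0" using D[of undefined] d_pos[of undefined] by linarith
 have len: "int (length p) <= wt (arrow_deg d) (k, p) + (D + 1) * wt is_alpha (k, p)" for k p
 proof (induction p)
  case (Cons a p)
  have "1 <= arrow_deg d a + (D + 1) * is_alpha a"
  proof (cases a)
  case (Alpha i j)
  thus ?thesis using D[of i] D[of j] by simp
  next
  case (Eps i)
  thus ?thesis using d_pos[of i] by simp
  qed
  thus ?case using Cons by (simp add: algebra_simps)
 qed simp
 have "(UNIV :: 'i arrow set) \<subseteq> range (%(i, j). Alpha i j) \<union> range Eps"
 proof
  fix a :: "'i arrow" show "a\<in>range (%(i, j). Alpha i j) \<union> range Eps" by (cases a) auto
 qed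
 hence "finite (UNIV :: 'i arrow set)" by (rule finite_subset) simp
 hence "finite {p :: 'i arrow list. set p \<subseteq> UNIV & length p <= nat (v + (D + 1) * M)}"
  by (rule finite_lists_length_le)
 hence fin: "finite ((UNIV :: 'i set) \<times> {p :: 'i arrow list. set p \<subseteq> UNIV & length p <= nat (v + (D + 1) * M)})"
  by (intro finite_cartesian_product) auto
 show ?thesis
 proof (rule finite_subset[OF _ fin], rule subsetI)
  fix x assume x: "x\<in>{(k, p). is_path C k p & wt (arrow_deg d) (k, p) = v & wt is_alpha (k, p) < M}"
  obtain k p where kp: "x = (k, p)" by (cases x)
  from x have w: "wt (arrow_deg d) (k, p) = v" "wt is_alpha (k, p) < M" unfolding kp by auto
  have "(D + 1) * wt is_alpha (k, p) <= (D + 1) * M" using w(2) D0 by (intro mult_left_mono) auto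
  hence "int (length p) <= v + (D + 1) * M" using len[of p k] w(1) by linarith
  thus "x\<in>UNIV \<times> {p. set p \<subseteq> UNIV & length p <= nat (v + (D + 1) * M)}" unfolding kp by simp
 qed
qed

abbreviation "A \<equiv> Pi_alg C d \<omega> :: ('k, ('i, 'k) pelem set) galgebra"
abbreviation "R \<equiv> path_algebra C :: ('k, ('i, 'k) pelem) module"
abbreviation "q \<equiv> Pi_proj C \<omega> :: ('i, 'k) pelem => ('i, 'k) pelem set"

lemma q_def: "q f = I +>\<^bsub>R\<^esub> f"
 by (simp add: Pi_proj_def I_def)

lemma kspace_R: "kspace R"
 by (rule kspaceI) (simp_all add: pc_diff fs.scale_left_distrib fs.scale_right_distrib add.assoc add.commute)

lemma ksub_I: "ksub R I"
 using I_pc fs.subspace_0[OF I_sub] fs.subspace_add[OF I_sub] fs.subspace_scale[OF I_sub] by (auto simp: ksub_def)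

sublocale kq: kquot R I
 by (intro kquot.intro kspace_R kquot_axioms.intro ksub_I)

lemma q_eq_iff: "f\<in>pc ==> g\<in>pc ==> q f = q g \<longleftrightarrow> f - g\<in>I"
proof -
 assume f: "f\<in>pc" "g\<in>pc"
 have "(\<exists>w\<in>I. f = w + g) \<longleftrightarrow> f - g\<in>I"
 proof
  show "\<exists>w\<in>I. f = w + g ==> f - g\<in>I" by (metis add_diff_cancel)
  show "f - g\<in>I ==> \<exists>w\<in>I. f = w + g" by (metis diff_add_cancel)
 qed
 thus "q f = q g \<longleftrightarrow> f - g\<in>I" unfolding q_def using kq.coset_eq_iff[of f g] f by (simp only: pa_simps)
qed

lemma ideal_I: "ideal I R"
proof -
 interpret ring R by (rule pa_ring)
 have "rels \<subseteq> carrier R" using rels_pc by auto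
 moreover have "I = genideal R rels" by (simp add: I_def rel_ideal_def rels_def)
 ultimately show ?thesis using genideal_ideal by simp
qed

lemma A_simps:
 "carrier A = q ` pc" "\<zero>\<^bsub>A\<^esub> = q 0" "\<one>\<^bsub>A\<^esub> = q path_one" "hcomp A v = q ` path_comp C d v"
 "f\<in>pc ==> g\<in>pc ==> q f \<oplus>\<^bsub>A\<^esub> q g = q (f + g)"
 "f\<in>pc ==> g\<in>pc ==> q f \<otimes>\<^bsub>A\<^esub> q g = q (pmul f g)"
 "f\<in>pc ==> c \<odot>\<^bsub>A\<^esub> q f = q (fsc c f)"
proof -
 interpret I: ideal I R by (rule ideal_I)
 show "carrier A = q ` pc"
  by (auto simp: Pi_alg_def Let_def FactRing_def A_RCOSETS_def' I_def[symmetric] q_def)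
 show "\<zero>\<^bsub>A\<^esub> = q 0"
 proof -
  have "q 0 = I" unfolding q_def using kq.coset_zero_iff[of 0] fs.subspace_0[OF I_sub] pc_diff(4) by simp
  thus ?thesis by (simp add: Pi_alg_def Let_def FactRing_def I_def[symmetric])
 qed
 show "\<one>\<^bsub>A\<^esub> = q path_one" by (simp add: Pi_alg_def Let_def FactRing_def I_def[symmetric] q_def)
 show "hcomp A v = q ` path_comp C d v" by (simp add: Pi_alg_def Let_def)
 show "q f \<oplus>\<^bsub>A\<^esub> q g = q (f + g)" if "f\<in>pc" "g\<in>pc"
  using kq.S.a_rcos_sum[of f g] that by (simp add: Pi_alg_def Let_def FactRing_def q_def)
 show "q f \<otimes>\<^bsub>A\<^esub> q g = q (pmul f g)" if "f\<in>pc" "g\<in>pc"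
  using I.rcoset_mult_add[of f g] that by (simp add: Pi_alg_def Let_def FactRing_def I_def[symmetric] q_def)
 show "c \<odot>\<^bsub>A\<^esub> q f = q (fsc c f)" if f: "f\<in>pc"
  using kq.coset_lift[OF kq.kquot_axioms, of f "%x. c \<odot>\<^bsub>R\<^esub> x"] f fs.subspace_scale[OF I_sub]
  by (auto simp: Pi_alg_def Let_def q_def pc_diff fs.scale_right_distrib)
qed

definition rep :: "('i, 'k) pelem set => ('i, 'k) pelem" where
 "rep X = (SOME f. f\<in>pc & X = q f)"

lemma rep: "f\<in>pc ==> rep (q f)\<in>pc & rep (q f) - f\<in>I"
proof -
 assume f: "f\<in>pc"
 have "rep (q f)\<in>pc & q f = q (rep (q f))" unfolding rep_def using someI[of "%g. g\<in>pc & q f = q g" f] f by blast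
 thus ?thesis using q_eq_iff[of "rep (q f)" f] f by auto
qed

definition hp :: "int => ('i, 'k) pelem set => ('i, 'k) pelem set" where
 "hp v X = q (degcut v (rep X))"

lemma hp_q: "f\<in>pc ==> hp v (q f) = q (degcut v f)"
 unfolding hp_def using rep[of f] degcut_I[of "rep (q f) - f" v]
 by (subst q_eq_iff) (auto simp: pcar_cut fl_minus[OF fl_cut])

lemma anti_q: assumes f: "f\<in>pc" shows "anti C ` q f = q (anti C f)"
proof -
 have q: "q g = (%w. w + g) ` I" if "g\<in>pc" for g by (auto simp: q_def a_r_coset_def')
 have "anti C ` I = I"
 proof
  show "anti C ` I \<subseteq> I" using anti_I by blast
  show "I \<subseteq> anti C ` I"
  proof
  fix x assume x: "x\<in>I"
  thus "x\<in>anti C ` I" using anti_anti[OF I_pc[OF x]] anti_I[OF x] by (metis image_eqI)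
  qed
 qed
 moreover have "anti C ` q f = (%w. w + anti C f) ` anti C ` I"
 proof -
  have "anti C (w + f) = anti C w + anti C f" for w using fl_anti fl_iff by blast
  thus ?thesis unfolding q[OF f] image_image by (rule image_cong[OF refl])
 qed
 ultimately show ?thesis using q[OF anti_pc[OF f]] by simp
qed

text \<open>Finite dimension of the components: paths with \<open>M\<close> or more arrows \<alpha>
  vanish in the quotient, and only finitely many paths of a given degree have fewer.\<close>

lemma A_fin: "\<exists>B. finite B & B \<subseteq> hcomp A v & (\<forall>S. B \<subseteq> S --> ksub A S --> hcomp A v \<subseteq> S)"
proof -
 obtain M where M: "!!k p. is_path C k p ==> wt is_alpha (k, p) >= M ==> bas (k, p)\<in>I" using alpha_nilpotent by blast
 let ?Q = "{(k, p). is_path C k p & wt (arrow_deg d) (k, p) = v & wt is_alpha (k, p) < M}"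
 let ?B = "(%x. q (bas x)) ` ?Q"
 have "finite ?B" using finite_degree_paths by blast
 moreover have "?B \<subseteq> hcomp A v" unfolding A_simps(4) by (auto simp: comp_iff pcar_basis cut_basis)
 moreover have "hcomp A v \<subseteq> S" if B: "?B \<subseteq> S" and S: "ksub A S" for S
 proof
  fix X assume "X\<in>hcomp A v"
  then obtain f where f: "f\<in>pc" "degcut v f = f" "X = q f" unfolding A_simps(4) by (auto simp: comp_iff)
  have S0: "q 0\<in>S" "!!X Y. X\<in>S ==> Y\<in>S ==> X \<oplus>\<^bsub>A\<^esub> Y\<in>S" "!!X c. X\<in>S ==> c \<odot>\<^bsub>A\<^esub> X\<in>S"
  using S by (auto simp: ksub_def A_simps(2))
  let ?T = "{f\<in>pc. q f\<in>S}"
  have "module.subspace fsc ?T"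
  unfolding fs.subspace_def
  proof (intro conjI ballI allI)
  show "0\<in>?T" using S0(1) pc_diff(4) by blast
  fix x assume x: "x\<in>?T"
  show "fsc c x\<in>?T" for c using x S0(3)[of "q x" c] A_simps(7)[of x c] pc_diff(3)[of x c] by auto
  fix y assume y: "y\<in>?T"
  show "x + y\<in>?T" using x y S0(2)[of "q x" "q y"] A_simps(5)[of x y] pc_diff(1)[of x y] by auto
  qed
  hence "degcut v f\<in>?T"
  proof (rule pcar_memI[OF fl_cut _ f(1)])
  fix k p assume p: "is_path C k p"
  show "degcut v (bas (k, p))\<in>?T"
  proof (cases "wt (arrow_deg d) (k, p) = v")
  case True
  have "q (bas (k, p))\<in>S"
  proof (cases "wt is_alpha (k, p) < M")
  case True
  thus ?thesis using B p \<open>wt (arrow_deg d) (k, p) = v\<close> by blast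
  next
  case False
  hence "q (bas (k, p)) = q 0" using M[OF p] q_eq_iff[OF pcar_basis[OF p] pc_diff(4)] by simp
  thus ?thesis using S0(1) by simp
  qed
  thus ?thesis using True pcar_basis[OF p] by (simp add: cut_basis)
  next
  case False
  thus ?thesis using S0(1) pc_diff(4) by (simp add: cut_basis)
  qed
  qed
  thus "X\<in>S" using f by simp
 qed
 ultimately show ?thesis by blast
qed

lemma graded_algebra_Pi: obtains rh where "graded_algebra A (image (anti C)) hp (rh :: ('i, 'k) pelem set => 'i path => 'k)"
proof -
 obtain pr where pr: "flinear pr" "!!x. pr x = 0 \<longleftrightarrow> x\<in>I" "!!x. pr x - x\<in>I" by (rule fs.projection_along[OF I_sub]) blast
 \<comment> \<open>The projection with kernel \<open>I\<close>, applied to any representative,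
   embeds the quotient in a space of functions.\<close>
 define rh where "rh = (%X. pr (rep X))"
 have rh: "rh (q f) = pr f" if "f\<in>pc" for f
  using pr(2)[of "rep (q f) - f"] rep[OF that] fl_minus[OF pr(1)] by (simp add: rh_def)
 have kA: "kspace A"
 proof (rule kspaceI)
  show "\<zero>\<^bsub>A\<^esub>\<in>carrier A" by (simp add: A_simps pc_diff)
 qed (auto simp: A_simps pc_diff fs.scale_left_distrib fs.scale_right_distrib add.assoc add.commute add.left_commute)
 have ringA: "ring A"
 proof (rule ringI)
  show "abelian_group A"
  proof -
  interpret module ground A by (rule kA)
  show ?thesis by (rule abelian_group_axioms)
  qed
  show "monoid A"
  by (rule monoidI) (auto simp: A_simps pcar_mult pcar_one pm_assoc)
 qed (auto simp: A_simps pcar_mult pc_diff pm_add_left pm_add_right)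
 have pcomp: "f\<in>pc" "degcut v f = f" if "f\<in>path_comp C d v" for f :: "('i, 'k) pelem" and v using that by (simp_all only: comp_iff)
 have "graded_algebra A (image (anti C)) hp rh"
 proof (rule graded_algebra.intro)
  show "ring A" "kspace A" by (fact ringA kA)+
  show "\<exists>B. finite B & B \<subseteq> hcomp A v & (\<forall>S. B \<subseteq> S --> ksub A S --> hcomp A v \<subseteq> S)" for v by (rule A_fin)
  show "(c \<odot>\<^bsub>A\<^esub> x) \<otimes>\<^bsub>A\<^esub> y = c \<odot>\<^bsub>A\<^esub> (x \<otimes>\<^bsub>A\<^esub> y)" "x \<otimes>\<^bsub>A\<^esub> (c \<odot>\<^bsub>A\<^esub> y) = c \<odot>\<^bsub>A\<^esub> (x \<otimes>\<^bsub>A\<^esub> y)"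
  if "x\<in>carrier A" "y\<in>carrier A" for x y c
  using that by (auto simp: A_simps pcar_mult pc_diff pm_scale_left pm_scale_right)
  show "ksub A (hcomp A v)" for v
  proof -
  have "f + g\<in>path_comp C d v" "fsc c f\<in>path_comp C d v" if fg: "f\<in>path_comp C d v" "g\<in>path_comp C d v" for f g :: "('i, 'k) pelem" and c
  proof -
  have "degcut v (f + g) = degcut v f + degcut v g" "degcut v (fsc c f) = fsc c (degcut v f)" using fl_cut fl_iff by blast+
  thus "f + g\<in>path_comp C d v" "fsc c f\<in>path_comp C d v"
  using pcomp[OF fg(1)] pcomp[OF fg(2)] pc_diff unfolding comp_iff by simp_all
  qed
  moreover have "(0 :: ('i, 'k) pelem)\<in>path_comp C d v" using pc_diff(4) by (simp add: comp_iff fl_0[OF fl_cut])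
  ultimately show ?thesis using pcomp(1)[of _ v] by (auto simp: ksub_def A_simps)
  qed
  show "a \<otimes>\<^bsub>A\<^esub> b\<in>hcomp A (v + w)" if a: "a\<in>hcomp A v" and b: "b\<in>hcomp A w" for a b v w
  proof -
  obtain f g where f: "f\<in>path_comp C d v" "a = q f" and g: "g\<in>path_comp C d w" "b = q g" using a b unfolding A_simps(4) by blast
  have "pmul f g\<in>path_comp C d (v + w)"
  using degcut_mult(1)[OF pcomp(1)[OF f(1)] pcomp(1)[OF g(1)], of "v + w" w] pcar_mult[OF pcomp(1)[OF f(1)] pcomp(1)[OF g(1)]]
  pcomp(2)[OF f(1)] pcomp(2)[OF g(1)] by (simp add: comp_iff)
  thus ?thesis unfolding f(2) g(2) A_simps(6)[OF pcomp(1)[OF f(1)] pcomp(1)[OF g(1)]] A_simps(4) by blast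
  qed
  show "\<one>\<^bsub>A\<^esub>\<in>hcomp A 0"
  proof -
  have "degcut 0 path_one = path_one" by (auto simp: path_one_def cut_def)
  hence "(path_one :: ('i, 'k) pelem)\<in>path_comp C d 0" unfolding comp_iff using pcar_one by simp
  thus ?thesis unfolding A_simps(3,4) by blast
  qed
  show "anti C ` a\<in>hcomp A v" if a: "a\<in>hcomp A v" for a v
  proof -
  obtain f where f: "f\<in>path_comp C d v" "a = q f" using a unfolding A_simps(4) by blast
  have "anti C f\<in>path_comp C d v"
  using anti_degcut[OF pcomp(1)[OF f(1)], of v] pcomp(2)[OF f(1)] anti_pc[OF pcomp(1)[OF f(1)]] by (simp add: comp_iff)
  thus ?thesis unfolding f(2) anti_q[OF pcomp(1)[OF f(1)]] A_simps(4) by blast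
  qed
  show "anti C ` x\<in>carrier A" "anti C ` (c \<odot>\<^bsub>A\<^esub> x) = c \<odot>\<^bsub>A\<^esub> anti C ` x" "anti C ` anti C ` x = x"
  if x: "x\<in>carrier A" for x c
  proof -
  obtain f where f: "f\<in>pc" "x = q f" using x unfolding A_simps(1) by blast
  note af = anti_pc[OF f(1)]
  show "anti C ` x\<in>carrier A" unfolding f(2) anti_q[OF f(1)] A_simps(1) using af by blast
  show "anti C ` (c \<odot>\<^bsub>A\<^esub> x) = c \<odot>\<^bsub>A\<^esub> anti C ` x"
  unfolding f(2) anti_q[OF f(1)] A_simps(7)[OF f(1)] A_simps(7)[OF af] anti_q[OF pc_diff(3)[OF f(1)]] fl_of_scale[OF fl_anti] ..
  show "anti C ` anti C ` x = x" unfolding f(2) anti_q[OF f(1)] anti_q[OF af] anti_anti[OF f(1)] ..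
  qed
  show "anti C ` (x \<oplus>\<^bsub>A\<^esub> y) = anti C ` x \<oplus>\<^bsub>A\<^esub> anti C ` y" "anti C ` (x \<otimes>\<^bsub>A\<^esub> y) = anti C ` y \<otimes>\<^bsub>A\<^esub> anti C ` x"
  if xy: "x\<in>carrier A" "y\<in>carrier A" for x y
  proof -
  obtain f g where f: "f\<in>pc" "x = q f" and g: "g\<in>pc" "y = q g" using xy unfolding A_simps(1) by blast
  have "anti C (f + g) = anti C f + anti C g" using fl_anti fl_iff by blast
  thus "anti C ` (x \<oplus>\<^bsub>A\<^esub> y) = anti C ` x \<oplus>\<^bsub>A\<^esub> anti C ` y" "anti C ` (x \<otimes>\<^bsub>A\<^esub> y) = anti C ` y \<otimes>\<^bsub>A\<^esub> anti C ` x"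
  unfolding f(2) g(2) by (simp_all only: A_simps(5,6) f(1) g(1) anti_q anti_pc pc_diff pcar_mult anti_mult)
  qed
  show "anti C ` \<one>\<^bsub>A\<^esub> = \<one>\<^bsub>A\<^esub>"
  proof -
  have "anti C path_one = (path_one :: ('i, 'k) pelem)"
  unfolding path_one_eq fl_of_sum[OF fl_anti] by (intro sum.cong refl) (simp add: anti_basis)
  thus ?thesis unfolding A_simps(3) anti_q[OF pcar_one] by simp
  qed
  show "hp v x\<in>hcomp A v" if x: "x\<in>carrier A" for x v
  proof -
  obtain f where f: "f\<in>pc" "x = q f" using x unfolding A_simps(1) by blast
  thus ?thesis using degcut_path_comp[OF f(1), of v] by (simp add: hp_q A_simps(4))
  qed
  show "hp v x = x" if x: "x\<in>hcomp A v" for x v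
  using x pcomp[of _ v] by (auto simp: A_simps(4) hp_q)
  show "hp v (x \<oplus>\<^bsub>A\<^esub> y) = hp v x \<oplus>\<^bsub>A\<^esub> hp v y" if xy: "x\<in>carrier A" "y\<in>carrier A" for x y v
  proof -
  obtain f g where f: "f\<in>pc" "x = q f" and g: "g\<in>pc" "y = q g" using xy unfolding A_simps(1) by blast
  have "degcut v (f + g) = degcut v f + degcut v g" using fl_cut[of "%(k, p). wt (arrow_deg d) (k, p) = v"] fl_iff by blast
  thus ?thesis unfolding f(2) g(2) by (simp only: A_simps(5) f(1) g(1) hp_q pcar_cut pc_diff)
  qed
  show "hp v (x \<otimes>\<^bsub>A\<^esub> b) = hp (v - w) x \<otimes>\<^bsub>A\<^esub> b" "hp v (b \<otimes>\<^bsub>A\<^esub> x) = b \<otimes>\<^bsub>A\<^esub> hp (v - w) x"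
  if x: "x\<in>carrier A" and b: "b\<in>hcomp A w" for x b v w
  proof -
  obtain f where f: "f\<in>pc" "x = q f" using x unfolding A_simps(1) by blast
  obtain g where g: "g\<in>path_comp C d w" "b = q g" using b unfolding A_simps(4) by blast
  note gp = pcomp[OF g(1)]
  show "hp v (x \<otimes>\<^bsub>A\<^esub> b) = hp (v - w) x \<otimes>\<^bsub>A\<^esub> b" "hp v (b \<otimes>\<^bsub>A\<^esub> x) = b \<otimes>\<^bsub>A\<^esub> hp (v - w) x"
  unfolding f(2) g(2) using degcut_mult[OF f(1) gp(1), of v w] gp(2)
  by (simp_all only: A_simps(6) f(1) gp(1) hp_q pcar_cut pcar_mult)
  qed
  show "rh (x \<oplus>\<^bsub>A\<^esub> y) = rh x + rh y" if xy: "x\<in>carrier A" "y\<in>carrier A" for x y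
  proof -
  obtain f g where f: "f\<in>pc" "x = q f" and g: "g\<in>pc" "y = q g" using xy unfolding A_simps(1) by blast
  have "pr (f + g) = pr f + pr g" using pr(1) fl_iff by blast
  thus ?thesis unfolding f(2) g(2) by (simp only: A_simps(5) f(1) g(1) rh pc_diff)
  qed
  show "rh (c \<odot>\<^bsub>A\<^esub> x) = fsc c (rh x)" if x: "x\<in>carrier A" for x c
  proof -
  obtain f where f: "f\<in>pc" "x = q f" using x unfolding A_simps(1) by blast
  show ?thesis unfolding f(2) A_simps(7)[OF f(1)] rh[OF f(1)] rh[OF pc_diff(3)[OF f(1)]] fl_of_scale[OF pr(1)] ..
  qed
  show "inj_on rh (carrier A)"
  proof (rule inj_onI)
  fix x y assume xy: "x\<in>carrier A" "y\<in>carrier A" "rh x = rh y"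
  obtain f g where f: "f\<in>pc" "x = q f" and g: "g\<in>pc" "y = q g" using xy unfolding A_simps(1) by blast
  hence "f - g\<in>I" using xy(3) rh pr(2)[of "f - g"] fl_minus[OF pr(1)] by simp
  thus "x = y" unfolding f(2) g(2) using q_eq_iff[OF f(1) g(1)] by simp
  qed
 qed
 thus ?thesis by (rule that)
qed

text \<open>For \<open>k = 0\<close> the power would be the unit of the algebra instead of the
  idempotent at \<open>i\<close>.\<close>

lemma Pi_epow: "0 < k ==> Pi_eps C \<omega> i [^]\<^bsub>A\<^esub> k = q (bas (i, epow i k))"
proof (induction k)
 case (Suc k)
 have p: "bas (i, epow i m)\<in>pc" for m by (rule pcar_basis) simp
 have 1: "Pi_eps C \<omega> i = q (bas (i, epow i 1))" by simp
 show ?case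
 proof (cases "k = 0")
  case True
  thus ?thesis using A_simps(6)[OF pcar_one p[of 1]] by (simp add: A_simps(3))
 next
  case False
  have "Pi_eps C \<omega> i [^]\<^bsub>A\<^esub> Suc k = q (bas (i, epow i k)) \<otimes>\<^bsub>A\<^esub> q (bas (i, epow i 1))"
  using Suc False by (simp add: nat_pow_def)
  also have "\<dots> = q (bas (i, epow i (Suc k)))"
  unfolding A_simps(6)[OF p p] pm_basis by (simp add: replicate_append_same)
  finally show ?thesis .
 qed
qed simp

lemma epow_torsion_free:
 assumes f: "f\<in>pc" "pmul (bas (i, epow i k)) f\<in>I" shows "pmul (idem i) f\<in>I"
 using f(2)
proof (induction k)
 case (Suc k)
 let ?g = "pmul (bas (i, epow i k)) f"
 have p: "bas (i, epow i k)\<in>pc" by (rule pcar_basis) simp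
 have "?g\<in>I"
 proof (rule eps_torsion_free[of _ i])
  show "?g\<in>pc" by (rule pcar_mult[OF p f(1)])
  show "pmul (idem i) ?g = ?g" unfolding pm_assoc[symmetric] pm_basis by simp
  show "pmul (bas (i, [Eps i])) ?g\<in>I" unfolding pm_assoc[symmetric] pm_basis using Suc.prems by simp
 qed
 thus ?case by (rule Suc.IH)
qed simp

lemma vertex_Pi:
 assumes g: "graded_algebra A (image (anti C)) hp rh" and k: "0 < k"
 shows "graded_algebra.vertex A (image (anti C)) (Pi_idem C \<omega> i) (Pi_eps C \<omega> i [^]\<^bsub>A\<^esub> k) (int k * d i)"
proof -
 interpret graded_algebra A "image (anti C)" hp rh by (rule g)
 have p: "bas (i, epow i m)\<in>pc" for m by (rule pcar_basis) simp
 have p0: "idem i\<in>pc" using p[of 0] by simp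
 have an: "anti C (bas (i, epow i m)) = (bas (i, epow i m) :: ('i, 'k) pelem)" for m
  by (simp add: anti_basis)
 have co: "(bas (i, epow i m) :: ('i, 'k) pelem)\<in>path_comp C d (2 * (int m * d i))" for m
 proof -
  have "wt (arrow_deg d) (i, epow i m) = 2 * (int m * d i)" by (simp add: sum_list_replicate)
  thus ?thesis unfolding comp_iff cut_basis prod.case using p[of m] by simp
 qed
 show ?thesis
  unfolding vertex_def Pi_epow[OF k]
 proof (intro conjI ballI impI)
  show "q (idem i)\<in>hcomp A 0" using co[of 0] by (simp add: A_simps(4))
  show "q (bas (i, epow i k))\<in>hcomp A (2 * (int k * d i))" using co[of k] unfolding A_simps(4) by blast
  show "anti C ` q (idem i) = q (idem i)" using anti_q[OF p0] an[of 0] by simp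
  show "anti C ` q (bas (i, epow i k)) = q (bas (i, epow i k))" using anti_q[OF p] an by simp
  show "q (idem i) \<otimes>\<^bsub>A\<^esub> q (idem i) = q (idem i)" "q (idem i) \<otimes>\<^bsub>A\<^esub> q (bas (i, epow i k)) = q (bas (i, epow i k))"
  "q (bas (i, epow i k)) \<otimes>\<^bsub>A\<^esub> q (idem i) = q (bas (i, epow i k))"
  by (simp_all only: A_simps(6)[OF p0 p0] A_simps(6)[OF p0 p] A_simps(6)[OF p p0]) (simp_all add: pm_basis)
  fix x assume x: "x\<in>carrier A" "q (bas (i, epow i k)) \<otimes>\<^bsub>A\<^esub> x = \<zero>\<^bsub>A\<^esub>"
  obtain f where f: "f\<in>pc" "x = q f" using x(1) unfolding A_simps(1) by blast
  have "pmul (bas (i, epow i k)) f\<in>I"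
  using x(2) q_eq_iff[OF pcar_mult[OF p f(1)] pc_diff(4)] unfolding f(2) A_simps(2) A_simps(6)[OF p f(1)] by simp
  from epow_torsion_free[OF f(1) this]
  show "q (idem i) \<otimes>\<^bsub>A\<^esub> x = \<zero>\<^bsub>A\<^esub>"
  using q_eq_iff[OF pcar_mult[OF p0 f(1)] pc_diff(4)] unfolding f(2) A_simps(2) A_simps(6)[OF p0 f(1)] by simp
 qed
qed

section \<open>The extension groups of generic kernels\<close>

lemma ext_generic_kernels:
 assumes kl: "0 < k" "0 < l"
 shows "lin_iso (graded_ext1 A (generic_kernel C d \<omega> i k) (generic_kernel C d \<omega> j l) u)
  (graded_ext1 A (generic_kernel C d \<omega> j l) (generic_kernel C d \<omega> i k) u)"
  and "lin_iso (graded_ext1 A (generic_kernel C d \<omega> j l) (generic_kernel C d \<omega> i k) u)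
  (eps_biquotient C d \<omega> i k j l (u + int l * d j + int k * d i))"
proof -
 obtain rh where g: "graded_algebra A (image (anti C)) hp (rh :: ('i, 'k) pelem set => 'i path => 'k)" by (rule graded_algebra_Pi)
 interpret graded_algebra A "image (anti C)" hp rh by (rule g)
 have K: "generic_kernel C d \<omega> i k = gker (Pi_idem C \<omega> i) (Pi_eps C \<omega> i [^]\<^bsub>A\<^esub> k) (int k * d i)" for i k
  by (simp add: generic_kernel_def gker_def eps_quotient_def quo_def Let_def)
 have B: "eps_biquotient C d \<omega> i k j l = biquo (Pi_idem C \<omega> i) (Pi_eps C \<omega> i [^]\<^bsub>A\<^esub> k) (Pi_idem C \<omega> j) (Pi_eps C \<omega> j [^]\<^bsub>A\<^esub> l)"
  by (simp add: eps_biquotient_def biquo_def Let_def)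
 \<comment> \<open>The vertex \<open>j\<close> comes first, because the second part of
   \<open>ext_symmetry\<close> has the two vertices of the quotient in the opposite order.\<close>
 note s = ext_symmetry[OF vertex_Pi[OF g kl(2), of j] vertex_Pi[OF g kl(1), of i]]
 show "lin_iso (graded_ext1 A (generic_kernel C d \<omega> i k) (generic_kernel C d \<omega> j l) u)
  (graded_ext1 A (generic_kernel C d \<omega> j l) (generic_kernel C d \<omega> i k) u)"
  unfolding K by (rule s(1))
 show "lin_iso (graded_ext1 A (generic_kernel C d \<omega> j l) (generic_kernel C d \<omega> i k) u)
  (eps_biquotient C d \<omega> i k j l (u + int l * d j + int k * d i))"
  unfolding K B by (rule s(2))
qed

end

lemma gvec_iso_iff: "gvec_iso V W \<longleftrightarrow> (\<forall>u. lin_iso (V u) (W u))"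
 by (simp add: gvec_iso_def lin_iso_def)

theorem proposition5p4:
  fixes scale :: "complex \<Rightarrow> 'g::ab_group_add \<Rightarrow> 'g" and br :: "'g \<Rightarrow> 'g \<Rightarrow> 'g"
    and C :: "'i::finite \<Rightarrow> 'i \<Rightarrow> int" and d :: "'i \<Rightarrow> int" and \<omega> :: "'i \<Rightarrow> 'i \<Rightarrow> int"
    and A :: "('k::field, ('i, 'k) pelem set) galgebra"
    and K :: "'i \<Rightarrow> nat \<Rightarrow> ('k, ('i, 'k) pelem set, ('i, 'k) pelem set set \<Rightarrow> 'k) gmodule"
    and i j :: 'i and k l :: nat
  assumes "simple_lie_algebra scale br"
    and "complex_lie_algebra.has_cartan_matrix scale br C"
    and "symmetrizer C d"
    and "sign_choice C \<omega>"
    and "A = Pi_alg C d \<omega>"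
    and "K = generic_kernel C d \<omega>"
    and "k > 0" and "l > 0"
  shows "gvec_iso (graded_ext1 A (K i k) (K j l)) (graded_ext1 A (K j l) (K i k))
    \<and> gvec_iso (graded_ext1 A (K j l) (K i k))
        (gvec_shift (- int k * d i - int l * d j) (eps_biquotient C d \<omega> i k j l))"
proof -
  interpret simple_lie_algebra scale br by fact
  obtain Bs where "finite Bs" "span Bs = UNIV" using fin_dim by blast
  then obtain Rt where Rt: "finite_roots C Rt"
    using cartan_matrix_finite_roots assms(2) by blast
  interpret gpp C d \<omega> Rt "rel_ideal C \<omega> :: ('i, 'k) pelem set"
    by (rule gpp.intro[OF Rt assms(3,4)]) (rule HOL.refl)
  note E = ext_generic_kernels[OF \<open>k > 0\<close> \<open>l > 0\<close>, where i = i and j = j]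
  \<comment> \<open>A shift by a negative amount reads the component \<open>u\<close> off at a
    larger degree, which is the sum of \<open>u\<close> and the two kernel shifts.\<close>
  have "u - (- int k * d i - int l * d j) = u + int l * d j + int k * d i" for u by simp
  then show ?thesis
    unfolding \<open>A = _\<close> \<open>K = _\<close> gvec_iso_iff graded_ext1_def[symmetric] gvec_shift_def
    using E by (auto simp only:)
qed

end
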